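(* Let $k$ be a positive integer, let $\{f(n)\}$, $\{f^{\ast}(n)\}$ be $k$-periodic sequences of complex numbers, $A=\{f(n)\}$, $B=\{f^{\ast}(n)\}$, and for an integer $\alpha$ let $A_\alpha=\{f(\alpha n)\}$, $B_\alpha=\{f^*(\alpha n)\}$. Let $a,b,c,d$ be integers with $ad-bc=1$ and $c>0$, and $Vz=(az+b)/(cz+d)$. Let $r_1,r_2$ be arbitrary real numbers, put $R_{1}=ar_{1}+cr_{2}$, $R_{2}=br_{1}+dr_{2}$ and $\rho=\{R_{2}\}c-\{R_{1}\}d$. For integers $j,\mu,v$ put \[ I_{j,\mu,v}(z,s)=\int_{C}u^{s-1}\frac{\exp\!\left(-\frac{c\mu+j-\{R_{1}\}}{ck}(cz+d)ku\right)}{\exp(-ku(cz+d))-1}\,\frac{\exp\!\left(\frac{v+\{(dj+\rho)/c\}}{k}ku\right)}{\exp(ku)-1}\,du, \] where the branch of $u^{s}$ has $0<\arg u<2\pi$, and $C$ is a loop beginning at $+\infty$, proceeding in the upper half-plane, encircling the origin in the positive direction so that $u=0$ is the only zero of $(\exp(-ku(cz+d))-1)(\exp(ku)-1)$ lying inside the loop, and returning to $+\infty$ in the lower half-plane. (i) If $a\equiv d\equiv 0\pmod k$, then for $z\in\mathbb{K}$ and all $s$, \begin{align*} &(cz+d)^{-s}\Gamma(s)G(Vz,s;A,B;r_{1},r_{2})\\ &=\Gamma(s)G(z,s;B_{-b},A_{-c};R_{1},R_{2})-2i\Gamma(s)\sin(\pi s)L(s;A_{c};-R_{2})f^{\ast}(bR_{1})\lambda_{R_{1}}\\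 &\quad+e(-s/2)\sum_{j=1}^{c}\sum_{\mu=0}^{k-1}\sum_{v=0}^{k-1}f\big(c([R_{2}+d(j-\{R_{1}\})/c]-v)\big)f^{\ast}\big(b(\mu c+j+[R_{1}])\big)\,I_{j,\mu,v}(z,s). \end{align*} (ii) If $b\equiv c\equiv 0\pmod k$, then for $z\in\mathbb{K}$ and all $s$, \begin{align*} &(cz+d)^{-s}\Gamma(s)G(Vz,s;A,B;r_{1},r_{2})\\ &=\Gamma(s)G(z,s;A_{d},B_{a};R_{1},R_{2})-2i\Gamma(s)\sin(\pi s)L(s;B_{-a};-R_{2})f(-dR_{1})\lambda_{R_{1}}\\ &\quad+e(-s/2)\sum_{j=1}^{c}\sum_{\mu=0}^{k-1}\sum_{v=0}^{k-1}f^{\ast}\big(-a([R_{2}+d(j-\{R_{1}\})/c]-v+d\mu)\big)f\big(-d(j+[R_{1}])\big)\,I_{j,\mu,v}(z,s). \end{align*} Both identities are identities of functions of $s$ understood via analytic continuation.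
   Context: For $k$-periodic sequences $C=\{g(n)\}$, $D=\{h(n)\}$, real $r_1,r_2$, $z\in\mathbb{H}$ (upper half-plane) and $\operatorname{Re}(s)>2$: $G(z,s;C,D;r_1,r_2)=\sum'_{m,n\in\mathbb{Z}} g(m)h(n)((m+r_1)z+n+r_2)^{-s}$, the prime meaning the pair $(m,n)=(-r_1,-r_2)$ is omitted if it is an integer pair; this is continued analytically in $s$. Thus e.g. $G(z,s;B_{-b},A_{-c};R_1,R_2)=\sum' f^*(-bm)f(-cn)((m+R_1)z+n+R_2)^{-s}$. For a $k$-periodic sequence $C=\{g(n)\}$ and real $\theta$, $L(s;C;\theta)=\sum_{n>-\theta}g(n)(n+\theta)^{-s}$ for $\operatorname{Re}(s)>1$, continued analytically in $s$ (e.g. $L(s;A_c;\theta)=\sum_{n>-\theta}f(cn)(n+\theta)^{-s}$). Complex powers $w^{-s}$ (other than $u^{s-1}$ in the integral) use the branch $-\pi\le\arg w<\pi$. $\lambda_x=1$ if $x\in\mathbb{Z}$ and $0$ otherwise (a product like $f^*(bR_1)\lambda_{R_1}$ is taken to be $0$ when $R_1\notin\mathbb{Z}$). $[x]$ is the floor of $x$, $\{x\}=x-[x]$, $e(z)=e^{2\pi i z}$, and $\mathbb{K}=\{x+iy: x>-d/c,\ y>0\}$. *)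

theory Defs
  imports "HOL-Complex_Analysis.Complex_Analysis" "HOL-Number_Theory.Cong"
    "HOL-Real_Asymp.Real_Asymp"
begin

definition periodic_seq :: "int \<Rightarrow> (int \<Rightarrow> complex) \<Rightarrow> bool" where
  "periodic_seq k f \<longleftrightarrow> (\<forall>n. f (n + k) = f n)"

text \<open>
  Two branches of the complex power occur. \<open>arg_low\<close> takes values in \<open>[-pi, pi)\<close>, whereas the
  library's \<^const>\<open>Arg\<close> takes values in \<open>(-pi, pi]\<close>, so they differ exactly on the negative reals.
  The integrand of the loop integral uses \<^const>\<open>Arg2pi\<close>, with values in \<open>[0, 2*pi)\<close>.
\<close>

definition arg_low :: "complex \<Rightarrow> real" where
  "arg_low w = (if Arg w = pi then - pi else Arg w)"

definition cpow_low :: "complex \<Rightarrow> complex \<Rightarrow> complex" where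
  "cpow_low w s = exp (s * Complex (ln (cmod w)) (arg_low w))"

definition cpow_2pi :: "complex \<Rightarrow> complex \<Rightarrow> complex" where
  "cpow_2pi u s = exp (s * Complex (ln (cmod u)) (Arg2pi u))"

text \<open>
  The continuation to the whole plane of a function given on the half-plane \<open>Re s > \<sigma>\<close>.
  It is unique when it exists, because \<^const>\<open>nicely_meromorphic_on\<close> fixes the values:
  removable singularities are filled in and poles get the value 0.
\<close>

definition meromorphic_continuation :: "real \<Rightarrow> (complex \<Rightarrow> complex) \<Rightarrow> complex \<Rightarrow> complex" where
  "meromorphic_continuation \<sigma> \<phi> =
     (THE F. F nicely_meromorphic_on UNIV \<and> (\<forall>s. Re s > \<sigma> \<longrightarrow> F s = \<phi> s))"

lemma meromorphic_continuation_eqI: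
  assumes F: "F nicely_meromorphic_on UNIV" "\<And>s. Re s > \<sigma> \<Longrightarrow> F s = \<phi> s"
  shows "meromorphic_continuation \<sigma> \<phi> = F"
  unfolding meromorphic_continuation_def
proof (rule the_equality)
  fix G assume G: "G nicely_meromorphic_on UNIV \<and> (\<forall>s. Re s > \<sigma> \<longrightarrow> G s = \<phi> s)"
  define s0 where "s0 = complex_of_real (\<sigma> + 1)"
  have "eventually (\<lambda>s. s \<in> {s. Re s > \<sigma>}) (at s0)"
    by (rule eventually_at_in_open') (auto simp: s0_def open_halfspace_Re_gt)
  then have ev: "eventually (\<lambda>s. G s = F s) (at s0)"
    by eventually_elim (use G F in auto)
  define D where "D = (\<lambda>s. G s - F s)"
  have D: "D meromorphic_on UNIV"
    using F G by (auto simp: D_def nicely_meromorphic_on_def intro!: meromorphic_intros)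
  have "remove_sings D s0 = 0"
    using ev by (intro remove_sings_eqI tendsto_eventually) (auto simp: D_def elim: eventually_mono)
  have "eventually (\<lambda>s. remove_sings D s = 0) (at s0)"
  proof -
    from ev have "eventually (\<lambda>s. D s = 0) (at s0)" by (auto simp: D_def elim: eventually_mono)
    moreover have "eventually (\<lambda>s. remove_sings D s = D s) (at s0)"
      using D by (intro eventually_remove_sings_eq_at)
        (meson UNIV_I meromorphic_onE)
    ultimately show ?thesis by eventually_elim auto
  qed
  then have "frequently (\<lambda>s. remove_sings D s = 0) (at s0)"
    by (intro eventually_frequently) auto
  then have 0: "remove_sings D s = 0" for s
    by (rule frequently_eq_meromorphic_imp_constant[where A = UNIV])
       (use D in \<open>auto intro: remove_sings_nicely_meromorphic\<close>)
  have "eventually (\<lambda>w. G w = F w) (at s)" for s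
  proof -
    have "eventually (\<lambda>w. remove_sings D w = D w) (at s)"
      using D by (intro eventually_remove_sings_eq_at)
        (meson UNIV_I meromorphic_onE)
    then show ?thesis by eventually_elim (metis 0 D_def eq_iff_diff_eq_0)
  qed
  then have eq: "remove_sings G s = remove_sings F s" for s
    by (intro remove_sings_cong) auto
  have "remove_sings H s = H s" if "H nicely_meromorphic_on UNIV" for H s
  proof -
    from that consider "is_pole H s" "H s = 0" | "H \<midarrow>s\<rightarrow> H s"
      by (auto simp: nicely_meromorphic_on_def)
    then show ?thesis
      by cases (simp_all add: remove_sings_at_pole remove_sings_eqI)
  qed
  then show "G = F"
    using eq F(1) G by (intro ext) metis
qed (use F in auto)

definition G_series ::
  "complex \<Rightarrow> (int \<Rightarrow> complex) \<Rightarrow> (int \<Rightarrow> complex) \<Rightarrow> real \<Rightarrow> real \<Rightarrow> complex \<Rightarrow> complex" where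
  "G_series z g h r1 r2 s =
     (\<Sum>\<^sub>\<infinity>(m, n) \<in> {(m, n). \<not> (real_of_int m = - r1 \<and> real_of_int n = - r2)}.
        g m * h n * cpow_low ((of_int m + of_real r1) * z + of_int n + of_real r2) (- s))"

definition G_fun ::
  "complex \<Rightarrow> complex \<Rightarrow> (int \<Rightarrow> complex) \<Rightarrow> (int \<Rightarrow> complex) \<Rightarrow> real \<Rightarrow> real \<Rightarrow> complex" where
  "G_fun z s g h r1 r2 = meromorphic_continuation 2 (G_series z g h r1 r2) s"

definition L_series :: "(int \<Rightarrow> complex) \<Rightarrow> real \<Rightarrow> complex \<Rightarrow> complex" where
  "L_series g \<theta> s =
     (\<Sum>\<^sub>\<infinity>n \<in> {n. real_of_int n > - \<theta>}. g n * cpow_low (of_int n + of_real \<theta>) (- s))"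

definition L_fun :: "complex \<Rightarrow> (int \<Rightarrow> complex) \<Rightarrow> real \<Rightarrow> complex" where
  "L_fun s g \<theta> = meromorphic_continuation 1 (L_series g \<theta>) s"

definition mobius :: "int \<Rightarrow> int \<Rightarrow> int \<Rightarrow> int \<Rightarrow> complex \<Rightarrow> complex" where
  "mobius a b c d z = (of_int a * z + of_int b) / (of_int c * z + of_int d)"

definition K_region :: "int \<Rightarrow> int \<Rightarrow> complex set" where
  "K_region c d = {z. Re z > - (of_int d / of_int c) \<and> Im z > 0}"

definition denom_zeros :: "int \<Rightarrow> int \<Rightarrow> int \<Rightarrow> complex \<Rightarrow> complex set" where
  "denom_zeros k c d z =
     {u. (exp (- of_int k * u * (of_int c * z + of_int d)) - 1) * (exp (of_int k * u) - 1) = 0}"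

text \<open>
  An infinite loop is parametrised by the real line. For large \<open>T\<close> we close up its part over
  \<open>[-T, T]\<close> by the segment joining the two end points, which runs far to the right; the
  points inside the loop are those about which the closed curve so obtained winds.
\<close>

definition closed_truncation :: "(real \<Rightarrow> complex) \<Rightarrow> real \<Rightarrow> real \<Rightarrow> complex" where
  "closed_truncation \<gamma> T = (\<lambda>x. \<gamma> ((2 * x - 1) * T)) +++ linepath (\<gamma> T) (\<gamma> (- T))"

text \<open>
  \<open>hankel_loop Z \<gamma>\<close>: the loop comes in from \<open>+\<infinity>\<close> in the upper half-plane, encircles the origin
  once in the positive direction and no other point of \<open>Z\<close>, and returns to \<open>+\<infinity>\<close> in the lower
  half-plane. It stays off the branch cut \<open>[0, \<infinity>)\<close> of \<^const>\<open>cpow_2pi\<close>.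
\<close>

definition hankel_loop :: "complex set \<Rightarrow> (real \<Rightarrow> complex) \<Rightarrow> bool" where
  "hankel_loop Z \<gamma> \<longleftrightarrow>
     (\<forall>T>0. \<gamma> piecewise_C1_differentiable_on {- T..T}) \<and>
     filterlim (\<lambda>t. Re (\<gamma> t)) at_top at_bot \<and>
     filterlim (\<lambda>t. Re (\<gamma> t)) at_top at_top \<and>
     bounded (range (\<lambda>t. Im (\<gamma> t))) \<and>
     eventually (\<lambda>t. Im (\<gamma> t) > 0) at_bot \<and>
     eventually (\<lambda>t. Im (\<gamma> t) < 0) at_top \<and>
     range \<gamma> \<inter> (\<real>\<^sub>\<ge>\<^sub>0 \<union> Z) = {} \<and>
     eventually (\<lambda>T. winding_number (closed_truncation \<gamma> T) 0 = 1) at_top \<and>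
     (\<forall>w \<in> Z - {0}. eventually (\<lambda>T. winding_number (closed_truncation \<gamma> T) w = 0) at_top)"

text \<open>Loops as required in the theorem exist for every admissible \<open>z\<close>.\<close>

lemma winding_number_log:
  assumes "valid_path g" "path_image g \<inter> \<real>\<^sub>\<ge>\<^sub>0 = {}"
  shows "2 * of_real pi * \<i> * winding_number g 0 = Ln (- pathfinish g) - Ln (- pathstart g)"
proof -
  have "((\<lambda>u. 1 / (u - 0)) has_contour_integral (Ln (- pathfinish g) - Ln (- pathstart g))) g"
  proof (rule contour_integral_primitive[where S = "- \<real>\<^sub>\<ge>\<^sub>0" and f = "\<lambda>u. Ln (- u)"])
    fix u :: complex assume "u \<in> - \<real>\<^sub>\<ge>\<^sub>0"
    then have "- u \<notin> \<real>\<^sub>\<le>\<^sub>0" by (auto simp: complex_nonneg_Reals_iff complex_nonpos_Reals_iff)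
    then show "((\<lambda>u. Ln (- u)) has_field_derivative 1 / (u - 0)) (at u within - \<real>\<^sub>\<ge>\<^sub>0)"
      by (auto intro!: derivative_eq_intros simp: divide_simps)
  qed (use assms in auto)
  moreover have "0 \<notin> path_image g" using assms by auto
  ultimately show ?thesis
    using assms by (simp add: winding_number_valid_path contour_integral_unique)
qed

lemma hankel_loop_strip:
  fixes Z :: "complex set"
  assumes "\<delta> > 0" and Z: "\<And>w. w \<in> Z \<Longrightarrow> w \<noteq> 0 \<Longrightarrow> \<bar>Im w\<bar> \<ge> \<delta>"
  shows "\<exists>\<gamma>. hankel_loop Z \<gamma>"
proof
  define \<gamma> :: "real \<Rightarrow> complex" where
    "\<gamma> = (\<lambda>t. of_real (t\<^sup>2 - 1) - \<i> * of_real (\<delta> / 2 * arctan t))"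
  have Re: "Re (\<gamma> t) = t\<^sup>2 - 1" and Im: "Im (\<gamma> t) = - (\<delta> / 2 * arctan t)" for t
    by (auto simp: \<gamma>_def)
  have at: "\<bar>arctan t\<bar> < 2" for t
    using arctan_bounded[of t] pi_less_4 by (auto simp: abs_if)
  have Imb: "\<bar>Im (\<gamma> t)\<bar> < \<delta>" for t
    using at[of t] \<open>\<delta> > 0\<close> by (simp add: Im abs_mult)
  have nn: "\<gamma> t \<notin> \<real>\<^sub>\<ge>\<^sub>0" for t
    using \<open>\<delta> > 0\<close> by (auto simp: complex_nonneg_Reals_iff Re Im)
  define D :: "real \<Rightarrow> complex" where
    "D = (\<lambda>t. of_real (2 * t) - \<i> * of_real (\<delta> / 2 * inverse (1 + t\<^sup>2)))"
  have vd: "(\<gamma> has_vector_derivative D t) (at t)" for t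
    unfolding \<gamma>_def D_def
    by (intro has_vector_derivative_diff has_vector_derivative_mult_right has_vector_derivative_of_real)
       (auto intro!: derivative_eq_intros)
  have "1 + t\<^sup>2 \<noteq> 0" for t :: real
    by (metis add_pos_nonneg less_irrefl zero_le_power2 zero_less_one)
  then have cD: "continuous_on S D" for S
    unfolding D_def by (intro continuous_intros) auto
  have C1: "\<gamma> C1_differentiable_on S" for S
    unfolding C1_differentiable_on_def using vd cD by blast
  have pw: "\<gamma> piecewise_C1_differentiable_on S" for S
    by (simp add: C1 C1_differentiable_imp_piecewise)
  define p where "p = (\<lambda>T x. \<gamma> ((2 * x - 1) * T))"
  have ct: "closed_truncation \<gamma> T = p T +++ linepath (\<gamma> T) (\<gamma> (- T))" for T
    by (simp add: closed_truncation_def p_def)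
  have vp: "valid_path (p T)" for T
  proof -
    have "(p T has_vector_derivative (2 * T) *\<^sub>R D ((2 * t - 1) * T)) (at t)" for t
      unfolding p_def
      by (rule vector_diff_chain_at[OF _ vd, unfolded o_def])
         (auto intro!: derivative_eq_intros simp: has_real_derivative_iff_has_vector_derivative[symmetric])
    moreover have "continuous_on {0..1} (\<lambda>t. (2 * T) *\<^sub>R D ((2 * t - 1) * T))"
      by (intro continuous_intros continuous_on_compose2[OF cD[of UNIV]]) auto
    ultimately have "p T C1_differentiable_on {0..1}"
      unfolding C1_differentiable_on_def
      by (intro exI[of _ "\<lambda>t. (2 * T) *\<^sub>R D ((2 * t - 1) * T)"]) auto
    then show ?thesis
      unfolding valid_path_def by (rule C1_differentiable_imp_piecewise)
  qed
  have ends: "pathstart (p T) = \<gamma> (- T)" "pathfinish (p T) = \<gamma> T" for T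
    by (auto simp: p_def pathstart_def pathfinish_def)
  have pim: "path_image (p T) \<subseteq> range \<gamma>" for T
    by (auto simp: p_def path_image_def)
  define B where "B = {w. \<bar>Im w\<bar> < \<delta>}"
  have "B = {w. Im w < \<delta>} \<inter> {w. Im w > - \<delta>}" by (auto simp: B_def)
  then have cB: "convex B"
    by (simp add: convex_Int convex_halfspace_Im_gt convex_halfspace_Im_lt)
  have seg: "path_image (linepath (\<gamma> T) (\<gamma> (- T))) \<subseteq> B" for T
    using closed_segment_subset[OF _ _ cB, of "\<gamma> T" "\<gamma> (- T)"] Imb by (simp add: B_def)
  have pB: "path_image (p T) \<subseteq> B" for T
    using pim Imb by (auto simp: B_def)
  have w0: "winding_number (closed_truncation \<gamma> T) w = 0" if "w \<notin> B" for w T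
    by (rule winding_number_zero_outside[of _ B])
       (use cB seg pB that in \<open>auto simp: ct path_image_join ends vp valid_path_imp_path\<close>)
  have w1: "winding_number (closed_truncation \<gamma> T) 0 = 1" if T: "T > 1" for T
  proof -
    have ims: "Im (\<gamma> T) < 0" "Im (\<gamma> (- T)) > 0"
      using T \<open>\<delta> > 0\<close> by (auto simp: Im arctan_minus)
    have res: "Re (\<gamma> T) > 0" "Re (\<gamma> (- T)) > 0"
      using T by (auto simp: Re power2_eq_square less_1_mult)
    have "closed_segment (\<gamma> T) (\<gamma> (- T)) \<subseteq> {w. Re w > 0}"
      using res by (intro closed_segment_subset) (auto simp: convex_halfspace_Re_gt)
    then have im: "path_image (linepath (\<gamma> T) (\<gamma> (- T))) \<subseteq> {w. Re w > 0}" by simp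
    have n0: "0 \<notin> path_image (linepath (\<gamma> T) (\<gamma> (- T)))" using im by auto
    have "((\<lambda>u. 1 / (u - 0)) has_contour_integral
            (Ln (pathfinish (linepath (\<gamma> T) (\<gamma> (- T)))) - Ln (pathstart (linepath (\<gamma> T) (\<gamma> (- T))))))
            (linepath (\<gamma> T) (\<gamma> (- T)))"
    proof (rule contour_integral_primitive[where S = "{w. Re w > 0}" and f = Ln])
      fix u :: complex assume "u \<in> {w. Re w > 0}"
      then have "u \<notin> \<real>\<^sub>\<le>\<^sub>0" by (auto simp: complex_nonpos_Reals_iff)
      then show "(Ln has_field_derivative 1 / (u - 0)) (at u within {w. Re w > 0})"
        by (auto intro!: derivative_eq_intros simp: divide_simps)
    qed (use im in auto)
    then have a: "2 * of_real pi * \<i> * winding_number (linepath (\<gamma> T) (\<gamma> (- T))) 0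
                = Ln (\<gamma> (- T)) - Ln (\<gamma> T)"
      using n0 by (simp add: winding_number_valid_path contour_integral_unique)
    have b: "2 * of_real pi * \<i> * winding_number (p T) 0 = Ln (- \<gamma> T) - Ln (- \<gamma> (- T))"
      using winding_number_log[OF vp[of T]] pim[of T] nn by (force simp: ends)
    have ne: "\<gamma> T \<noteq> 0" "\<gamma> (- T) \<noteq> 0" using ims by auto
    have c: "Ln (- \<gamma> T) = Ln (\<gamma> T) + \<i> * pi" "Ln (- \<gamma> (- T)) = Ln (\<gamma> (- T)) - \<i> * pi"
      using ims ne by (auto simp: Ln_minus)
    have "\<gamma> t \<noteq> 0" for t using nn[of t] by auto
    then have "0 \<notin> range \<gamma>" by (metis imageE)
    then have n1: "0 \<notin> path_image (p T)" using pim[of T] by blast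
    have W: "winding_number (closed_truncation \<gamma> T) 0
        = winding_number (p T) 0 + winding_number (linepath (\<gamma> T) (\<gamma> (- T))) 0"
      unfolding ct using n0 n1
      by (intro winding_number_join) (auto simp: vp valid_path_imp_path ends)
    have "2 * of_real pi * \<i> * winding_number (closed_truncation \<gamma> T) 0 = 2 * of_real pi * \<i> * 1"
      by (simp only: W distrib_left a b c) simp
    then show ?thesis by simp
  qed
  show "hankel_loop Z \<gamma>"
    unfolding hankel_loop_def
  proof (intro conjI allI impI ballI)
    show "filterlim (\<lambda>t. Re (\<gamma> t)) at_top at_bot" unfolding Re by real_asymp
    show "filterlim (\<lambda>t. Re (\<gamma> t)) at_top at_top" unfolding Re by real_asymp
    show "bounded (range (\<lambda>t. Im (\<gamma> t)))"
      using Imb by (auto simp: bounded_iff intro!: exI[of _ \<delta>] less_imp_le)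
    show "\<forall>\<^sub>F t in at_bot. 0 < Im (\<gamma> t)"
      using eventually_gt_at_bot[of 0] by eventually_elim (use \<open>\<delta> > 0\<close> in \<open>auto simp: Im mult_less_0_iff\<close>)
    show "\<forall>\<^sub>F t in at_top. Im (\<gamma> t) < 0"
      using eventually_gt_at_top[of 0] by eventually_elim (use \<open>\<delta> > 0\<close> in \<open>auto simp: Im\<close>)
    show "range \<gamma> \<inter> (\<real>\<^sub>\<ge>\<^sub>0 \<union> Z) = {}"
    proof -
      have "\<gamma> t \<notin> Z" for t
        using Z[of "\<gamma> t"] Imb[of t] nn[of t] by (metis nonneg_Reals_zero_I not_le)
      then show ?thesis using nn by blast
    qed
    show "\<forall>\<^sub>F T in at_top. winding_number (closed_truncation \<gamma> T) 0 = 1"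
      using eventually_gt_at_top[of 1] by eventually_elim (rule w1)
    show "\<forall>\<^sub>F T in at_top. winding_number (closed_truncation \<gamma> T) w = 0" if "w \<in> Z - {0}" for w
      using Z[of w] that by (intro always_eventually allI w0) (auto simp: B_def)
  qed (rule pw)
qed

lemma hankel_loop_exists:
  assumes "k > 0" "c > 0" "z \<in> K_region c d"
  shows "\<exists>\<gamma>. hankel_loop (denom_zeros k c d z) \<gamma>"
proof -
  define \<tau> where "\<tau> = of_int c * z + of_int d"
  have "Re z > - (real_of_int d / real_of_int c)" using assms by (auto simp: K_region_def)
  then have "Re z * real_of_int c > - real_of_int d" using assms(2) by (simp add: field_simps)
  then have re: "Re \<tau> > 0" by (simp add: \<tau>_def algebra_simps)
  define r where "r = Re (inverse \<tau>)"
  have r: "r > 0" using re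
    by (auto simp: r_def intro!: divide_pos_pos) (metis re less_irrefl sum_power2_gt_zero_iff)
  have k: "real_of_int k > 0" using assms by simp
  define \<delta> where "\<delta> = min (2 * pi / k) (2 * pi * r / k)"
  show ?thesis
  proof (rule hankel_loop_strip[of \<delta>])
    show "\<delta> > 0" using r k by (simp add: \<delta>_def)
    fix w assume w: "w \<in> denom_zeros k c d z" "w \<noteq> 0"
    have t0: "\<tau> \<noteq> 0" using re by auto
    consider "exp (- of_int k * w * \<tau>) = 1" | "exp (of_int k * w) = 1"
      using w by (auto simp: denom_zeros_def \<tau>_def)
    then show "\<delta> \<le> \<bar>Im w\<bar>"
    proof cases
      case 1
      then obtain n :: int where n: "- of_int k * w * \<tau> = \<i> * of_real (of_int (2 * n) * pi)"
        unfolding exp_eq_1 by (auto simp: complex_eq_iff)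
      then have weq: "w = - \<i> * of_real (of_int (2 * n) * pi / k) * inverse \<tau>"
        using t0 k by (simp add: field_simps) (metis minus_minus)
      then have "n \<noteq> 0" using w by auto
      then have "\<bar>real_of_int n\<bar> \<ge> 1" by linarith
      have "Im w = - (of_int (2 * n) * pi / k * r)"
        unfolding weq by (simp add: r_def)
      then have "\<bar>Im w\<bar> = \<bar>real_of_int n\<bar> * (2 * pi * r / k)"
        using r k by (simp add: abs_mult)
      also have "\<dots> \<ge> 1 * (2 * pi * r / k)"
        by (intro mult_right_mono) (use \<open>\<bar>real_of_int n\<bar> \<ge> 1\<close> r k in auto)
      finally show ?thesis by (simp add: \<delta>_def)
    next
      case 2
      then obtain n :: int where n: "of_int k * w = \<i> * of_real (of_int (2 * n) * pi)"
        unfolding exp_eq_1 by (auto simp: complex_eq_iff)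
      then have weq: "w = \<i> * of_real (of_int (2 * n) * pi / k)"
        using k by (auto simp: field_simps)
      then have "n \<noteq> 0" using w by auto
      then have "\<bar>real_of_int n\<bar> \<ge> 1" by linarith
      have "\<bar>Im w\<bar> = \<bar>real_of_int n\<bar> * (2 * pi / k)"
        unfolding weq using k by (simp add: abs_mult)
      also have "\<dots> \<ge> 1 * (2 * pi / k)"
        by (intro mult_right_mono) (use \<open>\<bar>real_of_int n\<bar> \<ge> 1\<close> k in auto)
      finally show ?thesis by (simp add: \<delta>_def)
    qed
  qed
qed

definition loop_integral :: "(real \<Rightarrow> complex) \<Rightarrow> (complex \<Rightarrow> complex) \<Rightarrow> complex" where
  "loop_integral \<gamma> \<phi> = integral UNIV (\<lambda>t. \<phi> (\<gamma> t) * vector_derivative \<gamma> (at t))"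

definition I_integral ::
  "int \<Rightarrow> int \<Rightarrow> int \<Rightarrow> real \<Rightarrow> real \<Rightarrow> (real \<Rightarrow> complex) \<Rightarrow> int \<Rightarrow> int \<Rightarrow> int \<Rightarrow> complex \<Rightarrow> complex \<Rightarrow> complex"
  where
  "I_integral k c d R1 \<rho> \<gamma> j \<mu> v z s =
     loop_integral \<gamma> (\<lambda>u.
       cpow_2pi u (s - 1)
       * (exp (- of_real ((of_int (c * \<mu> + j) - frac R1) / of_int (c * k))
                 * (of_int c * z + of_int d) * of_int k * u)
            / (exp (- of_int k * u * (of_int c * z + of_int d)) - 1))
       * (exp (of_real ((of_int v + frac ((of_int (d * j) + \<rho>) / of_int c)) / of_int k)
                 * of_int k * u)
            / (exp (of_int k * u) - 1)))"

text \<open>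
  Identity of two meromorphic functions of \<open>s\<close> that are given by formulas: the formulas agree
  literally except where a factor may have a pole, namely at the poles \<open>0, -1, -2, \<dots>\<close> of \<open>Gamma\<close>
  and at the pole \<open>1\<close> of an \<open>L_fun\<close> (there the library functions have the dummy value 0), and
  at every point, in particular at \<open>s = 1\<close>, they agree after continuation.
\<close>

definition meromorphic_identity :: "(complex \<Rightarrow> complex) \<Rightarrow> (complex \<Rightarrow> complex) \<Rightarrow> bool" where
  "meromorphic_identity F H \<longleftrightarrow>
     F meromorphic_on UNIV \<and> H meromorphic_on UNIV \<and>
     (\<forall>s. s \<notin> insert 1 \<int>\<^sub>\<le>\<^sub>0 \<longrightarrow> F s = H s) \<and>
     (\<forall>s. remove_sings F s = remove_sings H s)"

end

theory Submission
  imports Defs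
begin

text \<open>Write \<open>(m + r\<^sub>1) Vz + n + r\<^sub>2 = W / (cz + d)\<close> with \<open>W = (M + R\<^sub>1) z + N + R\<^sub>2\<close>, where \<open>(M, N)\<close> is
  the image of \<open>(m, n)\<close> under an integral unimodular substitution. The power \<open>(W / (cz + d))\<^sup>-\<^sup>s\<close> equals
  \<open>W\<^sup>-\<^sup>s (cz + d)\<^sup>s\<close> except when \<open>-W\<close> lies in the cone \<open>0 \<le> arg < arg (cz + d)\<close>, so the two series \<open>G\<close>
  differ by \<open>-2i sin (\<pi>s)\<close> times the sum of \<open>(-W)\<^sup>-\<^sup>s\<close> over that cone. The boundary ray contributes the
  \<open>L\<close>-function. The interior is split by the residue of the first coordinate modulo \<open>ck\<close> and of the
  second modulo \<open>k\<close> into Barnes double zeta functions with generators \<open>k (cz + d)\<close> and \<open>k\<close>, which times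
  \<open>\<Gamma>(s)\<close> are Mellin transforms of \<open>exp(-uw) / ((1 - exp(-u\<alpha>)) (1 - exp(-u\<beta>)))\<close>; the factor \<open>sin (\<pi>s)\<close>
  is what turns a Mellin integral into one over the Hankel loop.

  The continuation of \<open>G\<close> comes from cutting the lattice into four quadrants and rotating each one into
  the right half-plane, where it is again a combination of Barnes sums. A Barnes
  sum can have poles only at \<open>s = 1\<close> and \<open>s = 2\<close>; the residues at \<open>s = 2\<close> are explicit and cancel when
  the four quadrants are put together.\<close>

section \<open>Integrals depending on a parameter\<close>

text \<open>On the cone each term is exp(pi i s) times a principal power, and the change of branch
  adds exp(-2 pi i s) - 1 times that term. The product of the two factors is -2i sin(pi s) =
  -exp(-pi i s) (exp(2 pi i s) - 1). The last bracket is what a Hankel loop makes of a Mellin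
  integral, exp(-pi i s) is the prefactor of the triple sum, and the minus sign is absorbed by the
  first denominator of \<open>I_integral\<close>. The loop of the theorem is arbitrary: its speed is
  not controlled, so its integral cannot be bounded through absolute values. Hence
  \<open>hankel\<close> is defined without a contour, one explicit path shows that it is entire, and
  any other loop is compared with that path through primitives. A continued function has the value 0
  at a pole, and the identity may fail literally only at 1 and at the nonpositive integers.
  Regularity of \<open>G_fun\<close> at 2 therefore has to be proved, which is why values of
  \<open>hankel\<close> at integers are tracked. Both congruence cases are instances of one
  statement, whose arithmetic input is that the weights factor as g(M) h(N) in the new
  coordinates.\<close>

lemma holomorphic_on_lebesgue_integral:
  fixes f :: "complex \<Rightarrow> 'a \<Rightarrow> complex"
  assumes meas: "\<And>s. s \<in> S \<Longrightarrow> f s \<in> borel_measurable M"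
    and holo: "\<And>x. x \<in> space M \<Longrightarrow> (\<lambda>s. f s x) holomorphic_on S"
    and bound: "\<And>s0. s0 \<in> S \<Longrightarrow> \<exists>r>0. \<exists>g. ball s0 r \<subseteq> S \<and> integrable M g \<and>
                  (\<forall>s\<in>ball s0 r. \<forall>x\<in>space M. norm (f s x) \<le> g x)"
  shows "(\<lambda>s. integral\<^sup>L M (f s)) holomorphic_on S"
proof -
  have "\<exists>D. ((\<lambda>s. integral\<^sup>L M (f s)) has_field_derivative D) (at s0)" if s0: "s0 \<in> S" for s0
  proof -
    obtain r g where r: "r > 0" "ball s0 r \<subseteq> S" and g: "integrable M g"
      and fg: "\<And>s x. s \<in> ball s0 r \<Longrightarrow> x \<in> space M \<Longrightarrow> norm (f s x) \<le> g x"
      using bound[OF s0] by blast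
    define B where "B = ball s0 (r / 2)"
    have BS: "B \<subseteq> S" using r by (force simp: B_def)
    define f' where "f' = (\<lambda>x. deriv (\<lambda>s. f s x) s0)"
    have hol: "(\<lambda>s. f s x) holomorphic_on ball s0 r" if "x \<in> space M" for x
      using holo[OF that] r holomorphic_on_subset by blast
    \<comment> \<open>A point of the ball of radius r/2 has its disc of radius r/3 inside the ball
      of radius r, so Cauchy's inequality bounds the derivative by 3 g(x) / r. This makes the
      difference quotients uniformly dominated.\<close>
    have dq: "norm (f s x - f s0 x) \<le> (3 * g x / r) * norm (s - s0)" if "s \<in> B" "x \<in> space M" for s x
    proof (rule field_differentiable_bound[where S = B and f' = "deriv (\<lambda>s. f s x)"])
      fix y assume y: "y \<in> B"
      then have yr: "cball y (r/3) \<subseteq> ball s0 r"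
        using r by (auto simp: B_def subset_iff dist_norm) (smt (verit, best) norm_triangle_sub norm_minus_commute
            norm_triangle_ineq4 diff_add_cancel dist_norm dist_triangle)
      show "((\<lambda>s. f s x) has_field_derivative deriv (\<lambda>s. f s x) y) (at y within B)"
        using hol[OF that(2)] y r
        by (intro DERIV_deriv_iff_field_differentiable[THEN iffD2, THEN has_field_derivative_at_within]
            holomorphic_on_imp_differentiable_at[of _ "ball s0 r"]) (auto simp: B_def)
      have "norm ((deriv ^^ 1) (\<lambda>s. f s x) y) \<le> fact 1 * g x / (r/3) ^ 1"
      proof (rule Cauchy_inequality)
        show "(\<lambda>s. f s x) holomorphic_on ball y (r/3)"
          by (rule holomorphic_on_subset[OF hol[OF that(2)]]) (use yr in auto)
        show "continuous_on (cball y (r/3)) (\<lambda>s. f s x)"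
          using holomorphic_on_imp_continuous_on[OF hol[OF that(2)]] yr continuous_on_subset by blast
        show "norm (f w x) \<le> g x" if "norm (y - w) = r/3" for w
          by (rule fg) (use yr that \<open>x \<in> space M\<close> in \<open>auto simp: dist_norm subset_iff\<close>)
      qed (use r in auto)
      then show "norm (deriv (\<lambda>s. f s x) y) \<le> 3 * g x / r"
        by (simp add: field_simps)
    qed (use that r in \<open>auto simp: B_def\<close>)
    have "((\<lambda>s. (integral\<^sup>L M (f s) - integral\<^sup>L M (f s0)) / (s - s0)) \<longlongrightarrow> integral\<^sup>L M f') (at s0 within B)"
      unfolding tendsto_at_iff_sequentially
    proof (intro allI impI)
      fix X :: "nat \<Rightarrow> complex" assume XB: "\<forall>i. X i \<in> B - {s0}" and X: "X \<longlonglongrightarrow> s0"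
      have int: "integrable M (f s)" if "s \<in> B" for s
        by (rule Bochner_Integration.integrable_bound[OF g])
          (use that BS fg r in \<open>auto intro!: meas AE_I2 simp: B_def intro: order_trans[OF _ abs_ge_self]\<close>)
      have "(\<lambda>i. integral\<^sup>L M (\<lambda>x. (f (X i) x - f s0 x) / (X i - s0))) \<longlonglongrightarrow> integral\<^sup>L M f'"
      proof (rule integral_dominated_convergence[where w = "\<lambda>x. 3 * g x / r"])
        have lim: "(\<lambda>i. (f (X i) x - f s0 x) / (X i - s0)) \<longlonglongrightarrow> f' x" if x: "x \<in> space M" for x
        proof -
          have "((\<lambda>s. f s x) has_field_derivative f' x) (at s0)"
            using hol[OF x] r unfolding f'_def
            by (intro DERIV_deriv_iff_field_differentiable[THEN iffD2]
               holomorphic_on_imp_differentiable_at[of _ "ball s0 r"]) auto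
          then have "((\<lambda>s. (f s x - f s0 x) / (s - s0)) \<longlongrightarrow> f' x) (at s0)"
            by (simp add: has_field_derivative_iff)
          then show ?thesis
            unfolding tendsto_at_iff_sequentially using X XB by (auto simp: o_def)
        qed
        show m: "(\<lambda>x. (f (X i) x - f s0 x) / (X i - s0)) \<in> borel_measurable M" for i
          using XB BS meas s0 by (intro borel_measurable_divide borel_measurable_diff) auto
        show "f' \<in> borel_measurable M"
          by (rule borel_measurable_LIMSEQ_metric[OF m lim])
        show "AE x in M. (\<lambda>i. (f (X i) x - f s0 x) / (X i - s0)) \<longlonglongrightarrow> f' x"
          using lim by auto
        show "AE x in M. norm ((f (X i) x - f s0 x) / (X i - s0)) \<le> 3 * g x / r" for i
          using dq XB by (intro AE_I2) (auto simp: norm_divide divide_le_eq)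
      qed (use g in auto)
      moreover have "s0 \<in> B" using r by (auto simp: B_def)
      ultimately show "((\<lambda>s. (integral\<^sup>L M (f s) - integral\<^sup>L M (f s0)) / (s - s0)) \<circ> X) \<longlonglongrightarrow> integral\<^sup>L M f'"
        using int XB by (simp add: o_def)
    qed
    moreover have "at s0 within B = at s0"
      using r by (intro at_within_open) (auto simp: B_def)
    ultimately show ?thesis by (auto simp: has_field_derivative_iff)
  qed
  then show ?thesis
    by (meson field_differentiable_at_within field_differentiable_def holomorphic_onI)
qed

text \<open>With the open half-line as the whole space, pointwise hypotheses over
  \<open>space M\<close> speak of positive u only, where u powr s is holomorphic in s and continuous
  in u.\<close>

definition pos_reals :: "real measure" where
  "pos_reals = restrict_space lborel {0<..}"

lemma space_pos_reals [simp]: "space pos_reals = {0<..}"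
  by (simp add: pos_reals_def space_restrict_space)

lemma borel_measurable_pos_reals:
  fixes f :: "real \<Rightarrow> 'a :: topological_space"
  assumes "continuous_on {0<..} f"
  shows "f \<in> borel_measurable pos_reals"
  using borel_measurable_continuous_on_restrict[OF assms]
  unfolding pos_reals_def by (metis measurable_cong_sets sets_lborel sets_restrict_space_cong)

lemma integral_pos_reals:
  fixes f :: "real \<Rightarrow> 'a :: {banach, second_countable_topology}"
  shows "integral\<^sup>L pos_reals f = (LINT x|lborel. indicator {0<..} x *\<^sub>R f x)"
  unfolding pos_reals_def by (rule integral_restrict_space) auto

lemma integrable_pos_reals:
  fixes f :: "real \<Rightarrow> 'a :: {banach, second_countable_topology}"
  shows "integrable pos_reals f \<longleftrightarrow> integrable lborel (\<lambda>x. indicator {0<..} x *\<^sub>R f x)"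
  unfolding pos_reals_def by (rule integrable_restrict_space) auto

lemma integrable_pos_reals_iff:
  fixes f :: "real \<Rightarrow> 'a :: euclidean_space"
  assumes "continuous_on {0<..} f"
  shows "integrable pos_reals f \<longleftrightarrow> f absolutely_integrable_on {0<..}"
proof -
  have "(\<lambda>x. indicator {0<..} x *\<^sub>R f x) \<in> borel_measurable borel"
    by (rule borel_measurable_continuous_on_indicator[OF _ assms]) auto
  then show ?thesis
    unfolding integrable_pos_reals set_integrable_def by (subst integrable_completion) auto
qed

lemma integral_pos_reals_eq:
  fixes f :: "real \<Rightarrow> 'a :: euclidean_space"
  assumes "continuous_on {0<..} f" "f absolutely_integrable_on {0<..}"
  shows "integral\<^sup>L pos_reals f = integral {0<..} f"
proof -
  have m: "(\<lambda>x. indicator {0<..} x *\<^sub>R f x) \<in> borel_measurable borel"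
    by (rule borel_measurable_continuous_on_indicator[OF _ assms(1)]) auto
  have "integral {0<..} f = (LINT x|lebesgue. indicator {0<..} x *\<^sub>R f x)"
    using set_lebesgue_integral_eq_integral(2)[OF assms(2)] by (simp add: set_lebesgue_integral_def)
  also have "\<dots> = integral\<^sup>L pos_reals f"
    unfolding integral_pos_reals using m by (intro integral_completion) auto
  finally show ?thesis ..
qed

lemma continuous_on_powr_pos_reals [continuous_intros]:
  "continuous_on {0<..} (\<lambda>u. complex_of_real u powr s)"
  by (intro continuous_intros) (auto simp: complex_nonpos_Reals_iff)

section \<open>The Gamma integral with a complex scale\<close>

lemma integrable_powr_exp:
  assumes "\<sigma> > 0" "\<epsilon> > 0"
  shows "integrable pos_reals (\<lambda>u. u powr (\<sigma> - 1) * exp (- \<epsilon> * u))"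
proof -
  have "integrable pos_reals (\<lambda>t. complex_of_real t powr (of_real \<sigma> - 1) / of_real (exp (\<epsilon> * t)))"
    using absolutely_integrable_Gamma_integral[of "of_real \<sigma>" \<epsilon>] assms
    by (subst integrable_pos_reals_iff) (auto intro!: continuous_intros simp del: exp_of_real simp: exp_of_real[symmetric])
  then have "integrable pos_reals (\<lambda>t. norm (complex_of_real t powr (of_real \<sigma> - 1) / of_real (exp (\<epsilon> * t))))"
    by (rule integrable_norm)
  then show ?thesis
    by (rule Bochner_Integration.integrable_cong[THEN iffD1, rotated 2])
      (auto simp: norm_divide norm_powr_real_powr' exp_minus field_simps simp flip: exp_of_real)
qed

lemma Gamma_integral_scaled:
  fixes a :: real
  assumes "Re s > 0" "a > 0"
  shows "integral\<^sup>L pos_reals (\<lambda>u. of_real u powr (s - 1) * exp (- of_real u * of_real a)) = Gamma s * of_real a powr - s"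
proof -
  let ?f = "\<lambda>u. complex_of_real u powr (s - 1) * exp (- of_real u)"
  have eq: "?f = (\<lambda>u. complex_of_real u powr (s - 1) / of_real (exp u))"
    by (auto simp: exp_minus field_simps simp flip: exp_of_real)
  have "Gamma s = integral {0<..} ?f"
    unfolding eq using Gamma_integral_complex'[OF assms(1)] by (simp add: integral_unique)
  also have "\<dots> = integral\<^sup>L pos_reals ?f"
    using absolutely_integrable_Gamma_integral'[OF assms(1)] unfolding eq[symmetric]
    by (intro integral_pos_reals_eq[symmetric] continuous_intros) auto
  also have "\<dots> = (LINT x|lborel. indicator {0<..} x *\<^sub>R ?f x)" by (rule integral_pos_reals)
  also have "\<dots> = \<bar>a\<bar> *\<^sub>R (LINT x|lborel. indicator {0<..} (0 + a * x) *\<^sub>R ?f (0 + a * x))"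
    using assms by (intro lborel_integral_real_affine) auto
  also have "(LINT x|lborel. indicator {0<..} (0 + a * x) *\<^sub>R ?f (0 + a * x)) =
     (LINT x|lborel. of_real a powr (s - 1) * (indicator {0<..} x *\<^sub>R (of_real x powr (s - 1) * exp (- of_real x * of_real a))))"
    using assms by (intro Bochner_Integration.integral_cong)
      (auto simp: indicator_def zero_less_mult_iff powr_times_real mult_ac)
  also have "\<dots> = of_real a powr (s - 1) * integral\<^sup>L pos_reals (\<lambda>u. of_real u powr (s - 1) * exp (- of_real u * of_real a))"
    unfolding integral_pos_reals by (rule integral_mult_right_zero)
  finally have "Gamma s = of_real a * of_real a powr (s - 1) *
      integral\<^sup>L pos_reals (\<lambda>u. of_real u powr (s - 1) * exp (- of_real u * of_real a))"
    using assms by (simp add: scaleR_conv_of_real)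
  moreover have "of_real a * of_real a powr (s - 1) = of_real a powr s"
    using assms by (simp add: powr_diff)
  ultimately show ?thesis using assms by (simp add: powr_minus field_simps)
qed

text \<open>Both sides are holomorphic in w on the right half-plane and agree for positive real w by
  substitution; the positive reals accumulate at 1, so the identity theorem applies. Rotating the
  ray of integration is thereby avoided.\<close>

lemma Gamma_integral_complex_scaled:
  assumes "Re s > 0" "Re w > 0"
  shows "integral\<^sup>L pos_reals (\<lambda>u. of_real u powr (s - 1) * exp (- of_real u * w)) = Gamma s * w powr - s"
proof -
  define F where "F = (\<lambda>w. integral\<^sup>L pos_reals (\<lambda>u. complex_of_real u powr (s - 1) * exp (- of_real u * w)))"
  define S where "S = {w. Re w > 0}"
  have "F holomorphic_on S"
    unfolding F_def
  proof (rule holomorphic_on_lebesgue_integral)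
    show "(\<lambda>u. complex_of_real u powr (s - 1) * exp (- of_real u * w)) \<in> borel_measurable pos_reals" for w
      by (intro borel_measurable_pos_reals continuous_intros)
    show "(\<lambda>w. complex_of_real x powr (s - 1) * exp (- of_real x * w)) holomorphic_on S" for x
      by (intro holomorphic_intros)
    fix w0 assume "w0 \<in> S"
    then have w0: "Re w0 > 0" by (auto simp: S_def)
    have re: "Re w > Re w0 / 2" if "w \<in> ball w0 (Re w0 / 2)" for w
      using that abs_Re_le_cmod[of "w0 - w"] by (auto simp: dist_norm)
    show "\<exists>r>0. \<exists>g. ball w0 r \<subseteq> S \<and> integrable pos_reals g \<and>
             (\<forall>w\<in>ball w0 r. \<forall>x\<in>space pos_reals. cmod (complex_of_real x powr (s - 1) * exp (- of_real x * w)) \<le> g x)"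
    proof (intro exI conjI ballI)
      show "integrable pos_reals (\<lambda>u. u powr (Re s - 1) * exp (- (Re w0 / 2) * u))"
        using w0 assms by (intro integrable_powr_exp) auto
      show "ball w0 (Re w0 / 2) \<subseteq> S" using re w0 by (force simp: S_def)
      fix w x assume "w \<in> ball w0 (Re w0 / 2)" "x \<in> space pos_reals"
      then show "cmod (complex_of_real x powr (s - 1) * exp (- of_real x * w)) \<le> x powr (Re s - 1) * exp (- (Re w0 / 2) * x)"
        using re[of w] by (auto simp: norm_mult norm_powr_real_powr intro!: mult_left_mono)
    qed (use w0 in auto)
  qed
  then have h: "(\<lambda>w. F w - Gamma s * w powr - s) holomorphic_on S"
    by (intro holomorphic_intros) (auto simp: S_def complex_nonpos_Reals_iff)
  have lp: "(1::complex) islimpt (complex_of_real ` {0<..})"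
  proof -
    have "(1::real) islimpt {0<..}" by (rule interior_limit_point) (auto simp: interior_open)
    then have "complex_of_real 1 islimpt (complex_of_real ` {0<..})"
      unfolding islimpt_sequential
    proof (elim exE conjE)
      fix X assume "\<forall>n. X n \<in> {0<..} - {1::real}" "X \<longlonglongrightarrow> 1"
      then show "\<exists>f. (\<forall>n. f n \<in> complex_of_real ` {0<..} - {complex_of_real 1}) \<and> f \<longlonglongrightarrow> complex_of_real 1"
        using tendsto_of_real[of X 1 sequentially, where 'a = complex] by (intro exI[of _ "\<lambda>n. of_real (X n)"]) auto
    qed
    then show ?thesis by simp
  qed
  have "F w - Gamma s * w powr - s = 0"
    by (rule analytic_continuation[OF h, of "complex_of_real ` {0<..}" 1])
      (use lp assms Gamma_integral_scaled[OF assms(1)] in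
        \<open>auto simp: S_def open_halfspace_Re_gt convex_connected convex_halfspace_Re_gt F_def\<close>)
  then show ?thesis by (simp add: F_def)
qed

section \<open>Mellin transforms and the Hankel contour\<close>

lemma mult_ln_le_linear:
  fixes M \<eta> \<rho> :: real
  assumes "M \<ge> 0" "\<eta> > 0" "\<rho> > 0"
  shows "\<exists>K. \<forall>x\<ge>\<rho>. M * \<bar>ln x\<bar> \<le> K + \<eta> * x"
proof (cases "M = 0")
  case True
  with assms show ?thesis by (intro exI[of _ 0]) auto
next
  case False
  then have M: "M > 0" using assms by simp
  show ?thesis
  \<comment> \<open>The first summand covers negative logarithms, where ln x is at least ln \<rho>.
    The second comes from ln y <= y at y = x \<eta> / M.\<close>
  proof (intro exI[of _ "M * \<bar>ln \<rho>\<bar> + M * \<bar>ln (M / \<eta>)\<bar>"] allI impI)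
    fix x assume x: "x \<ge> \<rho>"
    then have x0: "x > 0" using assms by simp
    have up: "M * ln x \<le> \<eta> * x + M * ln (M / \<eta>)"
    proof -
      have "ln (x * \<eta> / M) \<le> x * \<eta> / M"
        using ln_add_one_self_le_self2[of "x * \<eta> / M - 1"] x0 M assms by (simp add: ln_bound)
      moreover have "ln (x * \<eta> / M) = ln x - ln (M / \<eta>)"
        using x0 M assms by (simp add: ln_div ln_mult)
      ultimately have "M * (ln x - ln (M / \<eta>)) \<le> M * (x * \<eta> / M)"
        using M by (intro mult_left_mono) auto
      then show ?thesis using M by (simp add: algebra_simps)
    qed
    have lo: "- (M * ln x) \<le> M * \<bar>ln \<rho>\<bar>"
    proof -
      have "ln \<rho> \<le> ln x" using x x0 assms by simp
      then have "- ln x \<le> \<bar>ln \<rho>\<bar>" by linarith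
      then have "M * (- ln x) \<le> M * \<bar>ln \<rho>\<bar>" using M by (intro mult_left_mono) auto
      then show ?thesis by simp
    qed
    have "M * ln (M / \<eta>) \<le> M * \<bar>ln (M / \<eta>)\<bar>" using M by simp
    moreover have "M * \<bar>ln \<rho>\<bar> \<ge> 0" "M * \<bar>ln (M / \<eta>)\<bar> \<ge> 0" "\<eta> * x \<ge> 0" using M x0 assms by auto
    moreover have "M * \<bar>ln x\<bar> = max (M * ln x) (- (M * ln x))"
      using M by (auto simp: abs_if max_def mult_le_0_iff zero_le_mult_iff)
    ultimately show "M * \<bar>ln x\<bar> \<le> M * \<bar>ln \<rho>\<bar> + M * \<bar>ln (M / \<eta>)\<bar> + \<eta> * x"
      using up lo by linarith
  qed
qed

text \<open>Stated for an arbitrary argument \<theta>, so that one bound serves every branch of the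
  power that occurs. The limit 3 pi leaves room for arguments up to 2 pi.\<close>

lemma exp_mult_Complex_bound:
  fixes M \<eta> \<rho> :: real
  assumes "M \<ge> 0" "\<eta> > 0" "\<rho> > 0"
  shows "\<exists>K\<ge>0. \<forall>r s \<theta>. r \<ge> \<rho> \<longrightarrow> norm s \<le> M \<longrightarrow> \<bar>\<theta>\<bar> \<le> 3 * pi \<longrightarrow>
           norm (exp (s * Complex (ln r) \<theta>)) \<le> K * exp (\<eta> * r)"
proof -
  obtain K where K: "\<And>x. x \<ge> \<rho> \<Longrightarrow> M * \<bar>ln x\<bar> \<le> K + \<eta> * x"
    using mult_ln_le_linear[OF assms] by blast
  show ?thesis
  proof (intro exI[of _ "exp (K + M * (3 * pi))"] allI impI conjI)
    fix r s \<theta> assume r: "r \<ge> \<rho>" and s: "norm (s::complex) \<le> M" and th: "\<bar>\<theta>\<bar> \<le> 3 * pi"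
    have "Re (s * Complex (ln r) \<theta>) \<le> \<bar>Re s\<bar> * \<bar>ln r\<bar> + \<bar>Im s\<bar> * \<bar>\<theta>\<bar>"
      using abs_ge_self[of "Re s * ln r"] abs_ge_minus_self[of "Im s * \<theta>"] by (simp add: abs_mult)
    also have "\<dots> \<le> M * \<bar>ln r\<bar> + M * (3 * pi)"
      using s abs_Re_le_cmod[of s] abs_Im_le_cmod[of s] th assms by (intro add_mono mult_mono) auto
    also have "\<dots> \<le> K + \<eta> * r + M * (3 * pi)" using K[OF r] by simp
    finally show "norm (exp (s * Complex (ln r) \<theta>)) \<le> exp (K + M * (3 * pi)) * exp (\<eta> * r)"
      by (simp add: exp_add [symmetric] add_ac)
  qed auto
qed

lemma cpow_2pi_bound:
  fixes M \<eta> \<rho> :: real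
  assumes "M \<ge> 0" "\<eta> > 0" "\<rho> > 0"
  shows "\<exists>K\<ge>0. \<forall>u s. norm u \<ge> \<rho> \<longrightarrow> norm s \<le> M \<longrightarrow> norm (cpow_2pi u s) \<le> K * exp (\<eta> * norm u)"
proof -
  have "\<bar>Arg2pi u\<bar> \<le> 3 * pi" for u
    using Arg2pi_ge_0[of u] Arg2pi_lt_2pi[of u] pi_gt_zero by linarith
  then show ?thesis
    using exp_mult_Complex_bound[OF assms] unfolding cpow_2pi_def by blast
qed

text \<open>Passing to - u moves the cut from the positive axis to the negative one, where
  \<open>Ln\<close> has it; adding pi restores an argument between 0 and 2 pi.\<close>

lemma cpow_2pi_Ln:
  assumes "u \<notin> \<real>\<^sub>\<ge>\<^sub>0"
  shows "cpow_2pi u s = exp (s * (Ln (- u) + \<i> * pi))"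
proof -
  have u0: "u \<noteq> 0" using assms by auto
  have "Arg2pi u > 0"
    using assms by (simp add: Arg2pi_gt_0)
  then have "Arg2pi u = Im (Ln (- u)) + pi" by (rule Arg2pi_Ln)
  then have "Complex (ln (cmod u)) (Arg2pi u) = Ln (- u) + \<i> * pi"
    using u0 by (intro complex_eqI) (simp_all only: complex.sel Re_Ln norm_minus_cancel plus_complex.sel, simp_all)
  then show ?thesis by (simp add: cpow_2pi_def)
qed

lemma holomorphic_cpow_2pi:
  "(\<lambda>u. cpow_2pi u s) holomorphic_on (- \<real>\<^sub>\<ge>\<^sub>0)"
proof -
  have "(\<lambda>u. exp (s * (Ln (- u) + \<i> * pi))) holomorphic_on (- \<real>\<^sub>\<ge>\<^sub>0)"
    by (intro holomorphic_intros) (auto simp: complex_nonneg_Reals_iff complex_nonpos_Reals_iff)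
  then show ?thesis
    by (rule holomorphic_transform) (auto simp: cpow_2pi_Ln)
qed

lemma integrable_exp_abs:
  assumes "\<epsilon> > 0"
  shows "integrable lborel (\<lambda>t::real. exp (- \<epsilon> * \<bar>t\<bar>))"
proof -
  define h where "h = (\<lambda>t::real. indicator {0<..} t * exp (- \<epsilon> * t))"
  have "integrable pos_reals (\<lambda>u. u powr (1 - 1) * exp (- \<epsilon> * u))"
    by (rule integrable_powr_exp) (use assms in auto)
  then have h: "integrable lborel h"
    unfolding integrable_pos_reals h_def
    by (rule Bochner_Integration.integrable_cong[THEN iffD1, rotated 2]) (auto simp: indicator_def)
  have h': "integrable lborel (\<lambda>t. h (0 + (-1) * t))"
    using h by (subst lborel_integrable_real_affine_iff) auto
  have "integrable lborel (\<lambda>t. h t + h (- t))"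
    using h h' by (intro Bochner_Integration.integrable_add) auto
  \<comment> \<open>Both indicators vanish at t = 0, so the equality holds only almost
    everywhere.\<close>
  moreover have "AE t in lborel. h t + h (- t) = exp (- \<epsilon> * \<bar>t\<bar>)"
    using AE_lborel_singleton[of "0::real"] by eventually_elim (auto simp: h_def indicator_def)
  moreover have "(\<lambda>t. h t + h (- t)) \<in> borel_measurable lborel" by (simp add: h_def)
  ultimately show ?thesis
    by (subst integrable_cong_AE[symmetric]) auto
qed

text \<open>The region contains the positive axis and a disc about 0, so a loop can turn around the
  origin inside it. For small \<delta> it avoids all nonzero poles of the kernels used
  later.\<close>

definition half_strip :: "real \<Rightarrow> complex set" where
  "half_strip \<delta> = {u. \<bar>Im u\<bar> < \<delta> \<and> Re u > - \<delta>}"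

text \<open>Here p bounds the order of the pole at 0 and \<epsilon> is the rate of decay at
  infinity. Together they make the Mellin integral converge for Re s > p.\<close>

definition kernel_on :: "nat \<Rightarrow> real \<Rightarrow> real \<Rightarrow> real \<Rightarrow> (complex \<Rightarrow> complex) \<Rightarrow> bool" where
  "kernel_on p \<delta> \<epsilon> C \<Psi> \<longleftrightarrow> \<delta> > 0 \<and> \<epsilon> > 0 \<and> \<Psi> holomorphic_on (half_strip \<delta> - {0}) \<and>
     (\<forall>u \<in> half_strip \<delta> - {0}. norm (\<Psi> u) \<le> C * exp (- \<epsilon> * Re u) / norm u ^ p)"

definition mellin :: "(complex \<Rightarrow> complex) \<Rightarrow> complex \<Rightarrow> complex" where
  "mellin \<Psi> s = integral\<^sup>L pos_reals (\<lambda>u. of_real u powr (s - 1) * \<Psi> (of_real u))"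

lemma open_half_strip: "open (half_strip \<delta>)"
proof -
  have "half_strip \<delta> = {u. Im u < \<delta>} \<inter> {u. Im u > - \<delta>} \<inter> {u. Re u > - \<delta>}"
    by (auto simp: half_strip_def abs_less_iff)
  then show ?thesis
    by (simp add: open_halfspace_Im_lt open_halfspace_Im_gt open_halfspace_Re_gt open_Int)
qed

lemma convex_half_strip: "convex (half_strip \<delta>)"
proof -
  have "half_strip \<delta> = {u. Im u < \<delta>} \<inter> {u. Im u > - \<delta>} \<inter> {u. Re u > - \<delta>}"
    by (auto simp: half_strip_def abs_less_iff)
  then show ?thesis
    by (simp add: convex_halfspace_Im_lt convex_halfspace_Im_gt convex_halfspace_Re_gt convex_Int)
qed

lemma kernel_onD:
  assumes "kernel_on p \<delta> \<epsilon> C \<Psi>" "u \<in> half_strip \<delta>" "u \<noteq> 0"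
  shows "norm (\<Psi> u) \<le> C * exp (- \<epsilon> * Re u) / norm u ^ p"
  using assms unfolding kernel_on_def by blast

lemma kernel_on_C_nonneg:
  assumes "kernel_on p \<delta> \<epsilon> C \<Psi>"
  shows "C \<ge> 0"
proof -
  have "of_real (\<delta>/2) \<in> half_strip \<delta> - {0}" using assms by (auto simp: kernel_on_def half_strip_def)
  then have "norm (\<Psi> (of_real (\<delta>/2))) \<le> C * (exp (- \<epsilon> * (\<delta>/2)) / norm (of_real (\<delta>/2) :: complex) ^ p)"
    using kernel_onD[OF assms, of "of_real (\<delta>/2)"] by auto
  then have "0 \<le> C * (exp (- \<epsilon> * (\<delta>/2)) / norm (of_real (\<delta>/2) :: complex) ^ p)"
    using norm_ge_zero order_trans by blast
  moreover have "exp (- \<epsilon> * (\<delta>/2)) / norm (of_real (\<delta>/2) :: complex) ^ p > 0"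
    using assms by (auto simp: kernel_on_def intro!: divide_pos_pos)
  ultimately show ?thesis by (metis linorder_not_le mult_neg_pos)
qed

lemma kernel_on_continuous:
  assumes "kernel_on p \<delta> \<epsilon> C \<Psi>"
  shows "continuous_on {0<..} (\<lambda>u. \<Psi> (complex_of_real u))"
proof (rule continuous_on_compose2[of "half_strip \<delta> - {0}" \<Psi>])
  show "continuous_on (half_strip \<delta> - {0}) \<Psi>"
    using assms by (auto simp: kernel_on_def intro: holomorphic_on_imp_continuous_on)
qed (use assms in \<open>auto simp: half_strip_def kernel_on_def intro!: continuous_intros\<close>)

lemma kernel_on_mellin_bound:
  assumes "kernel_on p \<delta> \<epsilon> C \<Psi>" "u > 0"
  shows "norm (complex_of_real u powr (s - 1) * \<Psi> (of_real u)) \<le> C * (u powr (Re s - p - 1) * exp (- \<epsilon> * u))"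
proof -
  have "of_real u \<in> half_strip \<delta> - {0}" using assms by (auto simp: kernel_on_def half_strip_def)
  then have "norm (\<Psi> (of_real u)) \<le> C * exp (- \<epsilon> * u) / u ^ p"
    using kernel_onD[OF assms(1), of "of_real u"] assms(2) by auto
  then have "norm (complex_of_real u powr (s - 1) * \<Psi> (of_real u)) \<le> u powr (Re s - 1) * (C * exp (- \<epsilon> * u) / u ^ p)"
    using assms unfolding norm_mult by (intro mult_mono) (auto simp: norm_powr_real_powr)
  also have "\<dots> = C * (u powr (Re s - p - 1) * exp (- \<epsilon> * u))"
  proof -
    have "u powr (Re s - p - 1) = u powr (Re s - 1 - real p)" by (simp add: algebra_simps)
    also have "\<dots> = u powr (Re s - 1) / u ^ p"
      using assms by (subst powr_diff) (simp add: powr_realpow)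
    finally show ?thesis by simp
  qed
  finally show ?thesis .
qed

lemma kernel_on_mellin_measurable:
  assumes "kernel_on p \<delta> \<epsilon> C \<Psi>"
  shows "(\<lambda>u. complex_of_real u powr (s - 1) * \<Psi> (of_real u)) \<in> borel_measurable pos_reals"
  by (intro borel_measurable_pos_reals continuous_intros kernel_on_continuous[OF assms])

lemma kernel_on_mellin_integrable:
  assumes "kernel_on p \<delta> \<epsilon> C \<Psi>" "Re s > p"
  shows "integrable pos_reals (\<lambda>u. complex_of_real u powr (s - 1) * \<Psi> (of_real u))"
proof (rule Bochner_Integration.integrable_bound)
  show "integrable pos_reals (\<lambda>u. C * (u powr (Re s - p - 1) * exp (- \<epsilon> * u)))"
    using integrable_powr_exp[of "Re s - p" \<epsilon>] assms by (auto simp: kernel_on_def)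
  show "AE u in pos_reals. norm (complex_of_real u powr (s - 1) * \<Psi> (of_real u))
          \<le> norm (C * (u powr (Re s - p - 1) * exp (- \<epsilon> * u)))"
    using kernel_on_mellin_bound[OF assms(1)] by (intro AE_I2) (auto intro: order_trans[OF _ abs_ge_self])
qed (rule kernel_on_mellin_measurable[OF assms(1)])

lemma holomorphic_mellin:
  assumes "kernel_on p \<delta> \<epsilon> C \<Psi>"
  shows "mellin \<Psi> holomorphic_on {s. Re s > p}"
proof -
  have "(\<lambda>s. integral\<^sup>L pos_reals (\<lambda>u. of_real u powr (s - 1) * \<Psi> (of_real u))) holomorphic_on {s. Re s > p}"
  proof (rule holomorphic_on_lebesgue_integral)
    show "(\<lambda>s. complex_of_real x powr (s - 1) * \<Psi> (of_real x)) holomorphic_on {s. Re s > p}" 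
      if "x \<in> space pos_reals" for x
      using that by (intro holomorphic_intros) auto
    fix s0 :: complex assume "s0 \<in> {s. Re s > p}"
    then have s0: "Re s0 > p" by simp
    define r where "r = (Re s0 - p) / 2"
    define a b where "a = Re s0 - p - r" and "b = Re s0 - p + r"
    have r: "r > 0" "a > 0" "b > 0" using s0 by (auto simp: r_def a_def b_def field_simps)
    have re: "\<bar>Re s - Re s0\<bar> < r" if "s \<in> ball s0 r" for s
      using that abs_Re_le_cmod[of "s - s0"] by (auto simp: dist_norm norm_minus_commute)
    show "\<exists>r>0. \<exists>g. ball s0 r \<subseteq> {s. Re s > p} \<and> integrable pos_reals g \<and>
         (\<forall>s\<in>ball s0 r. \<forall>x\<in>space pos_reals. cmod (complex_of_real x powr (s - 1) * \<Psi> (complex_of_real x)) \<le> g x)"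
    proof (intro exI conjI ballI)
      show "integrable pos_reals (\<lambda>u. C * (u powr (a - 1) * exp (- \<epsilon> * u) + u powr (b - 1) * exp (- \<epsilon> * u)))"
        using r assms by (intro Bochner_Integration.integrable_mult_right Bochner_Integration.integrable_add
           integrable_powr_exp) (auto simp: kernel_on_def)
      show "ball s0 r \<subseteq> {s. Re s > p}" proof
        fix s assume "s \<in> ball s0 r"
        from re[OF this] have "Re s > Re s0 - r" by linarith
        moreover have "Re s0 - r = p + r" by (simp add: r_def field_simps)
        ultimately show "s \<in> {s. Re s > p}" using r by simp
      qed
      fix s x assume s: "s \<in> ball s0 r" and "x \<in> space pos_reals"
      then have x: "x > 0" by simp
      \<comment> \<open>For s in the ball the exponent lies between a - 1 and b - 1. The first power
        dominates on (0, 1], the second beyond 1, so their sum is a majorant independent of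
        s.\<close>
      have "x powr (Re s - p - 1) \<le> x powr (a - 1) + x powr (b - 1)"
      proof (cases "x \<le> 1")
        case True
        have "x powr (Re s - p - 1) \<le> x powr (a - 1)"
          using re[OF s] True x by (intro powr_mono') (auto simp: a_def)
        then show ?thesis by (simp add: add_increasing2)
      next
        case False
        have "x powr (Re s - p - 1) \<le> x powr (b - 1)"
          using re[OF s] False by (intro powr_mono) (auto simp: b_def)
        then show ?thesis by (simp add: add_increasing)
      qed
      then have "C * (x powr (Re s - p - 1) * exp (- \<epsilon> * x)) \<le> C * ((x powr (a - 1) + x powr (b - 1)) * exp (- \<epsilon> * x))"
        by (intro mult_left_mono mult_right_mono kernel_on_C_nonneg[OF assms]) auto
      then show "cmod (complex_of_real x powr (s - 1) * \<Psi> (complex_of_real x))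
          \<le> C * (x powr (a - 1) * exp (- \<epsilon> * x) + x powr (b - 1) * exp (- \<epsilon> * x))"
        using kernel_on_mellin_bound[OF assms x, of s] by (simp add: algebra_simps)
    qed (use r in auto)
  qed (rule kernel_on_mellin_measurable[OF assms])
  then show ?thesis by (simp add: mellin_def[abs_def])
qed

text \<open>The mean value inequality against -(K / \<epsilon>) exp(-\<epsilon> t), an
  antiderivative of the bound. The estimate does not depend on b, so it controls infinite
  tails.\<close>

lemma differentiable_bound_decay:
  fixes g :: "real \<Rightarrow> complex"
  assumes "a \<le> b" "\<epsilon> > 0"
    and g: "\<And>t. t \<in> {a..b} \<Longrightarrow> (g has_vector_derivative g' t) (at t within {a..b})"
    and bd: "\<And>t. t \<in> {a..b} \<Longrightarrow> norm (g' t) \<le> K * exp (- \<epsilon> * t)"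
  shows "norm (g b - g a) \<le> K / \<epsilon> * exp (- \<epsilon> * a)"
proof (cases "a = b")
  case True
  have "0 \<le> K * exp (- \<epsilon> * a)" using bd[of a] assms norm_ge_zero order_trans by (metis atLeastAtMost_iff order_refl)
  then have "K \<ge> 0" by (simp add: zero_le_mult_iff)
  then show ?thesis using True assms by simp
next
  case False
  have "norm (g b - g a) \<le> (- (K / \<epsilon>) * exp (- \<epsilon> * b)) - (- (K / \<epsilon>) * exp (- \<epsilon> * a))"
  proof (rule differentiable_bound_general)
    show "continuous_on {a..b} g"
      using g by (rule continuous_on_vector_derivative)
    show "(g has_vector_derivative g' x) (at x)" if "a < x" "x < b" for x
      using g[of x] that by (simp add: at_within_Icc_at)
    show "((\<lambda>t. - (K / \<epsilon>) * exp (- \<epsilon> * t)) has_vector_derivative K * exp (- \<epsilon> * x)) (at x)" for x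
      using assms by (auto intro!: derivative_eq_intros simp: has_real_derivative_iff_has_vector_derivative[symmetric])
  qed (use False assms bd in \<open>auto intro!: continuous_intros\<close>)
  moreover have "0 \<le> K * exp (- \<epsilon> * a)"
    using bd[of a] assms norm_ge_zero order_trans by (metis atLeastAtMost_iff order_refl)
  then have "K \<ge> 0" by (simp add: zero_le_mult_iff)
  then have "K / \<epsilon> * exp (- \<epsilon> * b) \<ge> 0" using assms by simp
  ultimately show ?thesis by simp
qed

text \<open>Go from y horizontally to the corner below or above x, then vertically to x. The
  horizontal piece costs K / \<epsilon> and the vertical one at most K B, both times the exponential
  at the leftmost abscissa.\<close>

lemma primitive_decay:
  assumes "convex S" "\<epsilon> > 0" "B \<ge> 0" "K \<ge> 0"
    and F: "\<And>u. u \<in> S \<Longrightarrow> (F has_field_derivative \<phi> u) (at u within S)"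
    and bd: "\<And>u. u \<in> S \<Longrightarrow> norm (\<phi> u) \<le> K * exp (- \<epsilon> * Re u)"
    and x: "x \<in> S" and y: "y \<in> S" and xy: "Re y \<le> Re x" "\<bar>Im x - Im y\<bar> \<le> B" and corner: "Complex (Re x) (Im y) \<in> S"
  shows "norm (F x - F y) \<le> K * (1 / \<epsilon> + B) * exp (- \<epsilon> * Re y)"
proof -
  define c where "c = Complex (Re x) (Im y)"
  have "norm (F c - F y) \<le> K / \<epsilon> * exp (- \<epsilon> * Re y)"
  proof -
    define g where "g = (\<lambda>t. F (Complex t (Im y)))"
    have inS: "Complex t (Im y) \<in> S" if "t \<in> {Re y..Re x}" for t
    proof -
      have "Complex t (Im y) \<in> closed_segment y c"
      proof -
        have "of_real t \<in> closed_segment (of_real (Re y)) (of_real (Re x) :: complex)"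
          using that xy by (simp add: closed_segment_same_Im closed_segment_eq_real_ivl)
        then show ?thesis using that xy by (simp add: closed_segment_same_Im closed_segment_eq_real_ivl c_def)
      qed
      then show ?thesis using convex_contains_segment[of S] assms(1) y corner by (auto simp: c_def)
    qed
    have "norm (g (Re x) - g (Re y)) \<le> K / \<epsilon> * exp (- \<epsilon> * Re y)"
    proof (rule differentiable_bound_decay[where g' = "\<lambda>t. \<phi> (Complex t (Im y))"])
      fix t assume t: "t \<in> {Re y..Re x}"
      have "((\<lambda>t. Complex t (Im y)) has_vector_derivative 1) (at t within {Re y..Re x})"
        unfolding Complex_eq by (auto intro!: derivative_eq_intros)
      moreover have "(F has_field_derivative \<phi> (Complex t (Im y))) (at (Complex t (Im y)) within (\<lambda>t. Complex t (Im y)) ` {Re y..Re x})"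
        by (rule DERIV_subset[OF F]) (use inS t in auto)
      ultimately have "((F \<circ> (\<lambda>t. Complex t (Im y))) has_vector_derivative 1 * \<phi> (Complex t (Im y))) (at t within {Re y..Re x})"
        by (rule field_vector_diff_chain_within)
      then show "(g has_vector_derivative \<phi> (Complex t (Im y))) (at t within {Re y..Re x})"
        by (simp add: g_def o_def)
      show "norm (\<phi> (Complex t (Im y))) \<le> K * exp (- \<epsilon> * t)" using bd[OF inS[OF t]] by simp
    qed (use xy assms in auto)
    then show ?thesis by (simp add: g_def c_def)
  qed
  moreover have "norm (F x - F c) \<le> K * exp (- \<epsilon> * Re x) * norm (x - c)"
  proof (rule field_differentiable_bound[where S = "closed_segment c x" and f' = \<phi>])
    have sub: "closed_segment c x \<subseteq> S"
      using convex_contains_segment[of S] assms(1) x corner by (auto simp: c_def)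
    fix w assume w: "w \<in> closed_segment c x"
    show "(F has_field_derivative \<phi> w) (at w within closed_segment c x)"
      by (rule DERIV_subset[OF F]) (use sub w in auto)
    have "Re w = Re x" using w by (simp add: c_def closed_segment_same_Re)
    then show "norm (\<phi> w) \<le> K * exp (- \<epsilon> * Re x)" using bd[of w] w sub by auto
  qed auto
  moreover have "K * exp (- \<epsilon> * Re x) * norm (x - c) \<le> K * exp (- \<epsilon> * Re y) * B"
  proof -
    have "norm (x - c) \<le> B" using xy cmod_le[of "x - c"] by (simp add: c_def)
    then show ?thesis using assms xy by (intro mult_mono) auto
  qed
  moreover have "norm (F x - F y) \<le> norm (F x - F c) + norm (F c - F y)"
    by (metis norm_triangle_ineq diff_add_cancel add_diff_eq)
  ultimately show ?thesis by (simp add: algebra_simps)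
qed

lemma primitive_decay_sym:
  assumes "convex S" "\<epsilon> > 0" "B \<ge> 0" "K \<ge> 0"
    and F: "\<And>u. u \<in> S \<Longrightarrow> (F has_field_derivative \<phi> u) (at u within S)"
    and bd: "\<And>u. u \<in> S \<Longrightarrow> norm (\<phi> u) \<le> K * exp (- \<epsilon> * Re u)"
    and S: "\<And>x y. x \<in> S \<Longrightarrow> y \<in> S \<Longrightarrow> \<bar>Im x - Im y\<bar> \<le> B \<and> Complex (Re x) (Im y) \<in> S"
    and xy: "x \<in> S" "y \<in> S" "m \<le> Re x" "m \<le> Re y"
  shows "norm (F x - F y) \<le> K * (1 / \<epsilon> + B) * exp (- \<epsilon> * m)"
proof -
  have *: "norm (F x - F y) \<le> K * (1 / \<epsilon> + B) * exp (- \<epsilon> * m)"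
    if xy: "x \<in> S" "y \<in> S" "m \<le> Re y" "Re y \<le> Re x" for x y
  proof -
    have "norm (F x - F y) \<le> K * (1 / \<epsilon> + B) * exp (- \<epsilon> * Re y)"
      using S[OF xy(1,2)] xy by (intro primitive_decay[OF assms(1-4) F bd]) auto
    also have "\<dots> \<le> K * (1 / \<epsilon> + B) * exp (- \<epsilon> * m)"
      using xy assms(2-4) by (intro mult_left_mono) auto
    finally show ?thesis .
  qed
  show ?thesis using *[of x y] *[of y x] xy by (cases "Re y \<le> Re x") (auto simp: norm_minus_commute)
qed

lemma has_integral_UNIV_tendsto:
  fixes f :: "real \<Rightarrow> 'a::banach"
  assumes "(f has_integral I) UNIV"
  shows "((\<lambda>T. integral {-T..T} f) \<longlongrightarrow> I) at_top"
proof (rule tendstoI)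
  fix e :: real assume "e > 0"
  with assms obtain B where B: "B > 0" and
    I: "\<And>a b. ball 0 B \<subseteq> cbox a b \<Longrightarrow> norm (integral (cbox a b) (\<lambda>x. if x \<in> UNIV then f x else 0) - I) < e"
    unfolding has_integral_alt' by meson
  show "eventually (\<lambda>T. dist (integral {-T..T} f) I < e) at_top"
    using eventually_ge_at_top[of B]
  proof eventually_elim
    case (elim T)
    have "ball 0 B \<subseteq> cbox (-T) T" using elim by (auto simp: dist_norm)
    from I[OF this] show ?case by (simp add: dist_norm)
  qed
qed

lemma has_integral_atLeast_tendsto:
  fixes f :: "real \<Rightarrow> 'a::banach"
  assumes "(f has_integral I) {0..}"
  shows "((\<lambda>T. integral {0..T} f) \<longlongrightarrow> I) at_top"
proof -
  have "((\<lambda>x. if x \<in> {0..} then f x else 0) has_integral I) UNIV"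
    using has_integral_restrict_UNIV[of "{0..}" f I] assms by simp
  then have "((\<lambda>T. integral {-T..T} (\<lambda>x. if x \<in> {0..} then f x else 0)) \<longlongrightarrow> I) at_top"
    by (rule has_integral_UNIV_tendsto)
  then show ?thesis
  proof (rule Lim_transform_eventually)
    show "eventually (\<lambda>T. integral {-T..T} (\<lambda>x. if x \<in> {0..} then f x else 0) = integral {0..T} f) at_top"
      using eventually_ge_at_top[of 0]
    proof eventually_elim
      case (elim T)
      then have "{0..} \<inter> {-T..T} = {0..T}" by auto
      then show ?case by (simp only: integral_restrict_Int)
    qed
  qed
qed

lemma kernel_on_branch_bound:
  assumes "kernel_on p \<delta> \<epsilon> C \<Psi>" "M \<ge> 0" "\<rho> > 0"
  shows "\<exists>K\<ge>0. \<forall>u\<in>half_strip \<delta>. \<forall>s \<theta>. norm u \<ge> \<rho> \<longrightarrow> norm s \<le> M \<longrightarrow> \<bar>\<theta>\<bar> \<le> 3 * pi \<longrightarrow>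
           norm (exp (s * Complex (ln (norm u)) \<theta>) * \<Psi> u) \<le> K * exp (- (\<epsilon> / 2) * Re u)"
proof -
  have \<epsilon>: "\<epsilon> > 0" "\<delta> > 0" using assms by (auto simp: kernel_on_def)
  obtain K where K: "K \<ge> 0" "\<And>r s \<theta>. r \<ge> \<rho> \<Longrightarrow> norm s \<le> M \<Longrightarrow> \<bar>\<theta>\<bar> \<le> 3 * pi \<Longrightarrow>
           norm (exp (s * Complex (ln r) \<theta>)) \<le> K * exp (\<epsilon> / 2 * r)"
    using exp_mult_Complex_bound[of M "\<epsilon> / 2" \<rho>] assms(2,3) \<epsilon> by auto
  have C: "C \<ge> 0" by (rule kernel_on_C_nonneg[OF assms(1)])
  show ?thesis
  proof (intro exI conjI ballI allI impI)
    show "K * exp (\<epsilon> / 2 * (3 * \<delta>)) * (C / \<rho> ^ p) \<ge> 0" using K C assms by simp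
    fix u s :: complex and \<theta> :: real assume u: "u \<in> half_strip \<delta>" "norm u \<ge> \<rho>" and s: "norm s \<le> M" "\<bar>\<theta>\<bar> \<le> 3 * pi"
    \<comment> \<open>Since Re u > -\<delta> and |Im u| < \<delta>, the modulus exceeds the real
      part by a bounded amount. Half of the decay rate can therefore pay for the growth of the
      power.\<close>
    have "norm u \<le> Re u + 3 * \<delta>"
      using cmod_le[of u] u by (auto simp: half_strip_def)
    then have "exp (\<epsilon> / 2 * norm u) \<le> exp (\<epsilon> / 2 * (Re u + 3 * \<delta>))" using \<epsilon> by simp
    then have "K * exp (\<epsilon> / 2 * norm u) \<le> K * exp (\<epsilon> / 2 * (Re u + 3 * \<delta>))"
      using K by (intro mult_left_mono) auto
    with K(2)[OF u(2) s] have 1: "norm (exp (s * Complex (ln (norm u)) \<theta>)) \<le> K * exp (\<epsilon> / 2 * (Re u + 3 * \<delta>))"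
      by linarith
    have "norm (\<Psi> u) \<le> C * exp (- \<epsilon> * Re u) / norm u ^ p"
      using u assms by (intro kernel_onD[OF assms(1)]) auto
    also have "\<dots> \<le> C * exp (- \<epsilon> * Re u) / \<rho> ^ p"
      using u assms C by (intro divide_left_mono power_mono mult_nonneg_nonneg mult_pos_pos zero_less_power) auto
    finally have 2: "norm (\<Psi> u) \<le> C * exp (- \<epsilon> * Re u) / \<rho> ^ p" .
    have "norm (exp (s * Complex (ln (norm u)) \<theta>) * \<Psi> u) \<le>
        (K * exp (\<epsilon> / 2 * (Re u + 3 * \<delta>))) * (C * exp (- \<epsilon> * Re u) / \<rho> ^ p)"
      unfolding norm_mult using 1 2 K by (intro mult_mono) auto
    also have "\<dots> = K * exp (\<epsilon> / 2 * (3 * \<delta>)) * (C / \<rho> ^ p) * (exp (\<epsilon> / 2 * Re u) * exp (- \<epsilon> * Re u))"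
      by (simp add: distrib_left exp_add)
    also have "exp (\<epsilon> / 2 * Re u) * exp (- \<epsilon> * Re u) = exp (- (\<epsilon> / 2) * Re u)"
      by (simp add: exp_add [symmetric])
    finally show "norm (exp (s * Complex (ln (norm u)) \<theta>) * \<Psi> u) \<le>
       K * exp (\<epsilon> / 2 * (3 * \<delta>)) * (C / \<rho> ^ p) * exp (- (\<epsilon> / 2) * Re u)" .
  qed
qed

text \<open>One smooth formula for a loop that comes in above the axis, crosses it only at
  -\<delta>/2 (for t = 0) and leaves below it. The arctangent keeps the imaginary part under pi
  \<delta> / 8, hence inside the half-strip.\<close>

definition hankel_path :: "real \<Rightarrow> real \<Rightarrow> complex" where
  "hankel_path \<delta> t = Complex (t\<^sup>2 - \<delta> / 2) (- (\<delta> / 4) * arctan t)"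

definition hankel_path' :: "real \<Rightarrow> real \<Rightarrow> complex" where
  "hankel_path' \<delta> t = Complex (2 * t) (- (\<delta> / 4) * inverse (1 + t\<^sup>2))"

lemma one_plus_square_neq_0 [simp]: "1 + t\<^sup>2 \<noteq> (0::real)"
  by (metis add_pos_nonneg less_irrefl zero_le_power2 zero_less_one)

lemma hankel_path_deriv: "(hankel_path \<delta> has_vector_derivative hankel_path' \<delta> t) (at t within A)"
proof -
  have "((\<lambda>t. of_real (t\<^sup>2 - \<delta> / 2) + \<i> * of_real (- (\<delta> / 4) * arctan t)) has_vector_derivative
      of_real (2 * t) + \<i> * of_real (- (\<delta> / 4) * inverse (1 + t\<^sup>2))) (at t within A)"
    by (intro has_vector_derivative_add has_vector_derivative_mult_right has_vector_derivative_of_real)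
       (auto intro!: derivative_eq_intros)
  then show ?thesis by (simp add: hankel_path_def[abs_def] hankel_path'_def Complex_eq)
qed

lemma continuous_hankel_path: "continuous_on A (hankel_path \<delta>)"
  by (rule continuous_on_vector_derivative[OF hankel_path_deriv])

lemma continuous_hankel_path': "continuous_on A (hankel_path' \<delta>)"
  unfolding hankel_path'_def[abs_def] Complex_eq by (intro continuous_intros) auto

lemma abs_arctan_less_2: "\<bar>arctan t\<bar> < 2"
  using arctan_bounded[of t] pi_less_4 by (auto simp: abs_if)

lemma hankel_path_in_half_strip:
  assumes "\<delta> > 0"
  shows "hankel_path \<delta> t \<in> half_strip \<delta>"
proof -
  have "\<bar>\<delta> / 4 * arctan t\<bar> < \<delta>"
    using abs_arctan_less_2[of t] assms by (simp add: abs_mult)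
  moreover have "t\<^sup>2 - \<delta> / 2 > - \<delta>" using assms zero_le_power2[of t] by linarith
  ultimately show ?thesis by (simp add: half_strip_def hankel_path_def)
qed

lemma hankel_path_not_nonneg:
  assumes "\<delta> > 0"
  shows "hankel_path \<delta> t \<notin> \<real>\<^sub>\<ge>\<^sub>0"
  using assms by (auto simp: hankel_path_def complex_nonneg_Reals_iff)

lemma norm_hankel_path_ge:
  assumes "\<delta> > 0"
  shows "\<exists>\<rho>>0. \<forall>t. norm (hankel_path \<delta> t) \<ge> \<rho>"
proof (intro exI conjI allI)
  \<comment> \<open>With this a one has a^2 = \<delta> / 4. For |t| <= a the real part is at most
    -\<delta>/4; for larger |t| the imaginary part is at least (\<delta>/4) arctan a in absolute
    value.\<close>
  define a where "a = sqrt \<delta> / 2"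
  have a: "a > 0" "a\<^sup>2 = \<delta> / 4" using assms by (auto simp: a_def power_divide)
  show "min (\<delta> / 4) (\<delta> / 4 * arctan a) > 0" using assms a by simp
  fix t
  show "norm (hankel_path \<delta> t) \<ge> min (\<delta> / 4) (\<delta> / 4 * arctan a)"
  proof (cases "\<bar>t\<bar> \<le> a")
    case True
    then have "t\<^sup>2 \<le> \<delta> / 4" using a by (metis abs_le_square_iff abs_of_pos)
    then have "\<bar>Re (hankel_path \<delta> t)\<bar> \<ge> \<delta> / 4"
      unfolding hankel_path_def complex.sel by linarith
    then show ?thesis using abs_Re_le_cmod[of "hankel_path \<delta> t"] by linarith
  next
    case False
    then have "arctan a \<le> arctan \<bar>t\<bar>" by (simp add: arctan_le_iff)
    also have "arctan \<bar>t\<bar> = \<bar>arctan t\<bar>" by (simp add: abs_if arctan_minus)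
    finally have "\<bar>Im (hankel_path \<delta> t)\<bar> \<ge> \<delta> / 4 * arctan a"
      using assms by (simp add: hankel_path_def abs_mult)
    then show ?thesis using abs_Im_le_cmod[of "hankel_path \<delta> t"] by linarith
  qed
qed

abbreviation hankel_integrand :: "real \<Rightarrow> (complex \<Rightarrow> complex) \<Rightarrow> complex \<Rightarrow> real \<Rightarrow> complex" where
  "hankel_integrand \<delta> \<Psi> s t \<equiv>
     cpow_2pi (hankel_path \<delta> t) (s - 1) * \<Psi> (hankel_path \<delta> t) * hankel_path' \<delta> t"

definition hankel_int :: "real \<Rightarrow> (complex \<Rightarrow> complex) \<Rightarrow> complex \<Rightarrow> complex" where
  "hankel_int \<delta> \<Psi> s =
     integral\<^sup>L lborel (hankel_integrand \<delta> \<Psi> s)"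

lemma hankel_int_continuous:
  assumes "kernel_on p \<delta> \<epsilon> C \<Psi>"
  shows "continuous_on A (hankel_integrand \<delta> \<Psi> s)"
proof (intro continuous_intros continuous_hankel_path')
  have \<delta>: "\<delta> > 0" using assms by (auto simp: kernel_on_def)
  show "continuous_on A (\<lambda>t. cpow_2pi (hankel_path \<delta> t) (s - 1))"
    by (rule continuous_on_compose2[OF holomorphic_on_imp_continuous_on[OF holomorphic_cpow_2pi] continuous_hankel_path])
      (use hankel_path_not_nonneg[OF \<delta>] in auto)
  show "continuous_on A (\<lambda>t. \<Psi> (hankel_path \<delta> t))"
  proof (rule continuous_on_compose2[of "half_strip \<delta> - {0}" \<Psi>])
    show "continuous_on (half_strip \<delta> - {0}) \<Psi>"
      using assms by (auto simp: kernel_on_def intro: holomorphic_on_imp_continuous_on)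
    have "hankel_path \<delta> t \<noteq> 0" for t
      using hankel_path_not_nonneg[OF \<delta>, of t] by auto
    then show "hankel_path \<delta> ` A \<subseteq> half_strip \<delta> - {0}"
      using hankel_path_in_half_strip[OF \<delta>] by auto
  qed (rule continuous_hankel_path)
qed

lemma hankel_int_bound:
  assumes "kernel_on p \<delta> \<epsilon> C \<Psi>" "M \<ge> 0"
  shows "\<exists>K. \<forall>t. \<forall>s::complex. norm (s - 1) \<le> M \<longrightarrow>
     norm (hankel_integrand \<delta> \<Psi> s t) \<le> K * exp (- 1 * \<bar>t\<bar>)"
proof -
  have \<epsilon>: "\<epsilon> > 0" "\<delta> > 0" using assms by (auto simp: kernel_on_def)
  obtain \<rho> where \<rho>: "\<rho> > 0" "\<And>t. norm (hankel_path \<delta> t) \<ge> \<rho>" using norm_hankel_path_ge[OF \<epsilon>(2)] by blast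
  obtain K where K: "K \<ge> 0" "\<And>u s \<theta>. u \<in> half_strip \<delta> \<Longrightarrow> norm u \<ge> \<rho> \<Longrightarrow> norm s \<le> M \<Longrightarrow> \<bar>\<theta>\<bar> \<le> 3 * pi \<Longrightarrow>
           norm (exp (s * Complex (ln (norm u)) \<theta>) * \<Psi> u) \<le> K * exp (- (\<epsilon> / 2) * Re u)"
    using kernel_on_branch_bound[OF assms \<rho>(1)] by blast
  define K' where "K' = K * exp (\<epsilon> / 2 * (\<delta> / 2)) * (2 + \<delta>) * exp (2 / \<epsilon>)"
  show ?thesis
  proof (intro exI allI impI)
    fix t :: real and s :: complex assume s: "norm (s - 1) \<le> M"
    have "\<bar>Arg2pi (hankel_path \<delta> t)\<bar> \<le> 3 * pi"
      using Arg2pi_ge_0[of "hankel_path \<delta> t"] Arg2pi_lt_2pi[of "hankel_path \<delta> t"] pi_gt_zero by linarith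
    then have 1: "norm (cpow_2pi (hankel_path \<delta> t) (s - 1) * \<Psi> (hankel_path \<delta> t)) \<le> K * exp (- (\<epsilon> / 2) * Re (hankel_path \<delta> t))"
      unfolding cpow_2pi_def using hankel_path_in_half_strip[OF \<epsilon>(2)] \<rho>(2) s by (intro K) auto
    have 2: "norm (hankel_path' \<delta> t) \<le> (2 + \<delta>) * exp \<bar>t\<bar>"
    proof -
      have "norm (hankel_path' \<delta> t) \<le> 2 * \<bar>t\<bar> + \<delta> / 4 * inverse (1 + t\<^sup>2)"
        using cmod_le[of "hankel_path' \<delta> t"] \<epsilon> by (simp add: hankel_path'_def abs_mult)
      also have "\<dots> \<le> 2 * \<bar>t\<bar> + \<delta> / 4 * 1"
        using \<epsilon> by (intro add_left_mono mult_left_mono) (auto simp: field_simps add_pos_nonneg)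
      also have "\<dots> \<le> 2 * exp \<bar>t\<bar> + \<delta> * exp \<bar>t\<bar>"
      proof -
        have "\<bar>t\<bar> \<le> exp \<bar>t\<bar>" "1 \<le> exp \<bar>t\<bar>" using exp_ge_add_one_self[of "\<bar>t\<bar>"] by linarith+
        moreover have "\<delta> * 1 \<le> \<delta> * exp \<bar>t\<bar>" using \<epsilon> by (intro mult_left_mono) auto
        ultimately show ?thesis using \<epsilon> by linarith
      qed
      finally show ?thesis by (simp add: algebra_simps)
    qed
    \<comment> \<open>Completing the square: the real part of the path grows like t^2, and this
      Gaussian decay absorbs the factor exp |t| used to bound the speed and still leaves
      exp(-|t|).\<close>
    have sq: "- (\<epsilon> / 2) * t\<^sup>2 + \<bar>t\<bar> \<le> 2 / \<epsilon> + - 1 * \<bar>t\<bar>"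
    proof -
      have "0 \<le> (\<epsilon> / 2) * (\<bar>t\<bar> - 2 / \<epsilon>)\<^sup>2" using \<epsilon> by simp
      also have "\<dots> = (\<epsilon> / 2) * t\<^sup>2 - 2 * \<bar>t\<bar> + 2 / \<epsilon>"
        using \<epsilon> by (simp add: power2_diff power_divide field_simps power2_eq_square)
      finally show ?thesis by linarith
    qed
    have "norm (hankel_integrand \<delta> \<Psi> s t)
       \<le> (K * exp (- (\<epsilon> / 2) * Re (hankel_path \<delta> t))) * ((2 + \<delta>) * exp \<bar>t\<bar>)"
      unfolding norm_mult[of _ "hankel_path' \<delta> t"] using 1 2 K by (intro mult_mono) auto
    also have "\<dots> = K * (2 + \<delta>) * exp (\<epsilon> / 2 * (\<delta> / 2)) * exp (- (\<epsilon> / 2) * t\<^sup>2 + \<bar>t\<bar>)"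
    proof -
      have "- (\<epsilon> / 2) * Re (hankel_path \<delta> t) = \<epsilon> / 2 * (\<delta> / 2) + - (\<epsilon> / 2) * t\<^sup>2"
        by (simp add: hankel_path_def algebra_simps)
      then show ?thesis by (simp only: exp_add mult_ac)
    qed
    also have "\<dots> \<le> K * (2 + \<delta>) * exp (\<epsilon> / 2 * (\<delta> / 2)) * exp (2 / \<epsilon> + - 1 * \<bar>t\<bar>)"
      using sq K \<epsilon> by (intro mult_left_mono) auto
    also have "\<dots> = K' * exp (- 1 * \<bar>t\<bar>)" by (simp add: K'_def exp_add exp_diff exp_minus field_simps)
    finally show "norm (hankel_integrand \<delta> \<Psi> s t) \<le> K' * exp (- 1 * \<bar>t\<bar>)" .
  qed
qed

lemma hankel_int_measurable:
  assumes "kernel_on p \<delta> \<epsilon> C \<Psi>"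
  shows "(hankel_integrand \<delta> \<Psi> s) \<in> borel_measurable lborel"
  unfolding measurable_lborel2 by (rule borel_measurable_continuous_onI[OF hankel_int_continuous[OF assms]])

lemma hankel_int_integrable:
  assumes "kernel_on p \<delta> \<epsilon> C \<Psi>"
  shows "integrable lborel (hankel_integrand \<delta> \<Psi> s)"
proof -
  obtain K where K: "\<And>t. norm (hankel_integrand \<delta> \<Psi> s t) \<le> K * exp (- 1 * \<bar>t\<bar>)"
    using hankel_int_bound[OF assms, of "norm (s - 1)"] by auto
  show ?thesis
  proof (rule Bochner_Integration.integrable_bound)
    show "integrable lborel (\<lambda>t::real. K * exp (- 1 * \<bar>t\<bar>))"
      by (intro integrable_mult_right integrable_exp_abs) auto
    show "AE t in lborel. norm (hankel_integrand \<delta> \<Psi> s t)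
        \<le> norm (K * exp (- 1 * \<bar>t\<bar>))"
      unfolding real_norm_def by (intro AE_I2 order_trans[OF K abs_ge_self])
  qed (rule hankel_int_measurable[OF assms])
qed

text \<open>The path keeps a positive distance from 0, so the pole of the kernel puts no condition
  on s, unlike for the Mellin integral.\<close>

lemma holomorphic_hankel_int:
  assumes "kernel_on p \<delta> \<epsilon> C \<Psi>"
  shows "hankel_int \<delta> \<Psi> holomorphic_on UNIV"
proof -
  have "(\<lambda>s. integral\<^sup>L lborel (hankel_integrand \<delta> \<Psi> s)) holomorphic_on UNIV"
  proof (rule holomorphic_on_lebesgue_integral)
    show "(\<lambda>s. hankel_integrand \<delta> \<Psi> s t) holomorphic_on UNIV" for t
      unfolding cpow_2pi_def by (intro holomorphic_intros)
    fix s0 :: complex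
    obtain K where K: "\<And>t s. norm (s - 1) \<le> norm s0 + 2 \<Longrightarrow> norm (hankel_integrand \<delta> \<Psi> s t) \<le> K * exp (- 1 * \<bar>t\<bar>)"
      using hankel_int_bound[OF assms, of "norm s0 + 2"] by auto
    show "\<exists>r>0. \<exists>g. ball s0 r \<subseteq> UNIV \<and> integrable lborel g \<and>
       (\<forall>s\<in>ball s0 r. \<forall>t\<in>space lborel. cmod (hankel_integrand \<delta> \<Psi> s t) \<le> g t)"
    proof (intro exI conjI ballI)
      show "integrable lborel (\<lambda>t::real. K * exp (- 1 * \<bar>t\<bar>))"
        by (intro integrable_mult_right integrable_exp_abs) auto
      fix s t assume "s \<in> ball s0 1"
      then have "norm (s - 1) \<le> norm s0 + 2"
        using norm_triangle_ineq4[of s 1] norm_triangle_sub[of s s0] by (simp add: dist_norm norm_minus_commute)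
      then show "cmod (hankel_integrand \<delta> \<Psi> s t) \<le> K * exp (- 1 * \<bar>t\<bar>)"
        by (rule K)
    qed auto
  qed (rule hankel_int_measurable[OF assms])
  then show ?thesis by (simp add: hankel_int_def[abs_def])
qed

lemma hankel_int_tendsto:
  assumes "kernel_on p \<delta> \<epsilon> C \<Psi>"
  shows "((\<lambda>T. integral {-T..T} (hankel_integrand \<delta> \<Psi> s))
           \<longlongrightarrow> hankel_int \<delta> \<Psi> s) at_top"
  unfolding hankel_int_def
  by (rule has_integral_UNIV_tendsto[OF has_integral_integral_lborel[OF hankel_int_integrable[OF assms]]])

text \<open>The branch L of the logarithm is left abstract so that the upper and the lower half of
  the strip are treated at once; on the positive axis it is ln x + c, with c = 0 above and c = 2 pi
  i below. The stronger condition Re s > p + 1 makes the integrand tend to 0 at the origin, so a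
  primitive exists up to and including 0.\<close>

lemma half_plane_primitive:
  assumes ker: "kernel_on p \<delta> \<epsilon> C \<Psi>" and s: "Re s > p + 1"
    and S: "S \<subseteq> half_strip \<delta>" "convex S" "\<And>x. x \<ge> 0 \<Longrightarrow> complex_of_real x \<in> S"
      "\<And>u x. u \<in> S \<Longrightarrow> x > - \<delta> \<Longrightarrow> Complex x (Im u) \<in> S"
    and L: "continuous_on (S - {0}) L" "L holomorphic_on (interior S - {0})"
      "\<And>u. u \<in> S \<Longrightarrow> u \<noteq> 0 \<Longrightarrow> Re (L u) = ln (norm u)"
      "\<And>u. u \<in> S \<Longrightarrow> u \<noteq> 0 \<Longrightarrow> \<bar>Im (L u)\<bar> \<le> 3 * pi"
      "\<And>x. x > 0 \<Longrightarrow> L (complex_of_real x) = of_real (ln x) + c"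
  shows "\<exists>F. (\<forall>u\<in>S. (F has_field_derivative (if u = 0 then 0 else exp ((s - 1) * L u) * \<Psi> u)) (at u within S)) \<and>
    (\<forall>g. (\<forall>t::real. g t \<in> S) \<longrightarrow> filterlim (\<lambda>t. Re (g t)) at_top at_top \<longrightarrow>
        ((\<lambda>t. F (g t) - F 0) \<longlongrightarrow> exp ((s - 1) * c) * mellin \<Psi> s) at_top)"
proof -
  define \<phi> where "\<phi> = (\<lambda>u. if u = 0 then 0 else exp ((s - 1) * L u) * \<Psi> u)"
  have \<epsilon>: "\<epsilon> > 0" "\<delta> > 0" and hol\<Psi>: "\<Psi> holomorphic_on (half_strip \<delta> - {0})" using ker by (auto simp: kernel_on_def)
  have C: "C \<ge> 0" by (rule kernel_on_C_nonneg[OF ker])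
  have \<phi>_cont': "continuous_on (S - {0}) \<phi>"
  proof -
    have "continuous_on (S - {0}) (\<lambda>u. exp ((s - 1) * L u) * \<Psi> u)"
      by (intro continuous_intros L continuous_on_subset[OF holomorphic_on_imp_continuous_on[OF hol\<Psi>]]) (use S(1) in auto)
    then show ?thesis by (rule continuous_on_eq) (auto simp: \<phi>_def)
  qed
  define K1 where "K1 = exp (\<bar>Im s\<bar> * (3 * pi)) * (C * exp (\<epsilon> * \<delta>))"
  have \<phi>_0: "norm (\<phi> u) \<le> K1 * norm u powr (Re s - 1 - p)" if u: "u \<in> S" for u
  proof (cases "u = 0")
    case False
    have "norm (exp ((s - 1) * L u)) = exp ((Re s - 1) * ln (norm u) - Im s * Im (L u))"
      using L(3)[OF u False] by simp
    also have "\<dots> \<le> exp ((Re s - 1) * ln (norm u) + \<bar>Im s\<bar> * (3 * pi))"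
    proof -
      have "- (Im s * Im (L u)) \<le> \<bar>Im s * Im (L u)\<bar>" by (rule abs_ge_minus_self)
      also have "\<dots> \<le> \<bar>Im s\<bar> * (3 * pi)"
        unfolding abs_mult using L(4)[OF u False] by (intro mult_left_mono) auto
      finally show ?thesis by simp
    qed
    also have "\<dots> = norm u powr (Re s - 1) * exp (\<bar>Im s\<bar> * (3 * pi))"
      using False by (simp add: powr_def exp_add mult_ac)
    finally have 1: "norm (exp ((s - 1) * L u)) \<le> norm u powr (Re s - 1) * exp (\<bar>Im s\<bar> * (3 * pi))" .
    have "norm (\<Psi> u) \<le> C * exp (- \<epsilon> * Re u) / norm u ^ p"
      using kernel_onD[OF ker] u S(1) False by auto
    also have "\<dots> \<le> C * exp (\<epsilon> * \<delta>) / norm u ^ p"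
    proof -
      have "- Re u \<le> \<delta>" using S(1) u by (auto simp: half_strip_def subset_iff)
      then have "\<epsilon> * (- Re u) \<le> \<epsilon> * \<delta>" using \<epsilon> by (intro mult_left_mono) auto
      then show ?thesis using C by (intro divide_right_mono mult_left_mono) auto
    qed
    finally have 2: "norm (\<Psi> u) \<le> C * exp (\<epsilon> * \<delta>) / norm u ^ p" .
    have "norm (\<phi> u) = norm (exp ((s - 1) * L u)) * norm (\<Psi> u)" using False by (simp add: \<phi>_def norm_mult)
    also have "\<dots> \<le> (norm u powr (Re s - 1) * exp (\<bar>Im s\<bar> * (3 * pi))) * (C * exp (\<epsilon> * \<delta>) / norm u ^ p)"
      using 1 2 C by (intro mult_mono) auto
    also have "\<dots> = K1 * norm u powr (Re s - 1 - p)"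
      using False by (simp add: K1_def powr_diff powr_realpow)
    finally show ?thesis .
  qed (auto simp: \<phi>_def)
  have \<phi>_cont: "continuous_on S \<phi>"
    unfolding continuous_on_def
  proof
    fix u assume u: "u \<in> S"
    show "(\<phi> \<longlongrightarrow> \<phi> u) (at u within S)"
    proof (cases "u = 0")
      case True
      \<comment> \<open>The exponent Re s - 1 - p is positive exactly because Re s > p + 1.\<close>
      have "((\<lambda>u. K1 * norm u powr (Re s - 1 - p)) \<longlongrightarrow> K1 * 0) (at 0 within S)"
        using s by (intro tendsto_mult tendsto_const tendsto_zero_powrI[where b = "Re s - 1 - p"] tendsto_norm_zero tendsto_ident_at) auto
      then have "(\<phi> \<longlongrightarrow> 0) (at 0 within S)"
        by (intro Lim_null_comparison[of \<phi> "\<lambda>u. K1 * norm u powr (Re s - 1 - p)"])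
          (auto simp: eventually_at_filter \<phi>_0)
      then show ?thesis using True by (simp add: \<phi>_def)
    next
      case False
      have "(\<phi> \<longlongrightarrow> \<phi> u) (at u within (S - {0}))"
        using \<phi>_cont' u False by (auto simp: continuous_on_def)
      moreover have "at u within (S - {0}) = at u within S"
        by (rule at_within_nhd[of u "- {0}"]) (use False in auto)
      ultimately show ?thesis by simp
    qed
  qed
  have "\<phi> field_differentiable at u" if u: "u \<in> interior S - {0}" for u
  proof -
    have "\<phi> holomorphic_on (interior S - {0})"
    proof (rule holomorphic_transform)
      show "(\<lambda>u. exp ((s - 1) * L u) * \<Psi> u) holomorphic_on (interior S - {0})"
        by (intro holomorphic_intros L holomorphic_on_subset[OF hol\<Psi>]) (use S(1) interior_subset in blast)
    qed (auto simp: \<phi>_def)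
    then show ?thesis
      using u by (intro holomorphic_on_imp_differentiable_at[of _ "interior S - {0}"]) auto
  qed
  \<comment> \<open>Only continuity is known at 0 and on the boundary of S. Convexity with
    holomorphy in the interior off the exceptional set {0} still yields a primitive on all of
    S.\<close>
  then obtain F where F: "\<And>u. u \<in> S \<Longrightarrow> (F has_field_derivative \<phi> u) (at u within S)"
    using holomorphic_convex_primitive[of S "{0}" \<phi>] S(2) \<phi>_cont by blast
  have real: "((\<lambda>x. F (of_real x) - F 0) \<longlongrightarrow> exp ((s - 1) * c) * mellin \<Psi> s) at_top"
  proof -
    define f where "f = (\<lambda>x. \<phi> (complex_of_real x))"
    have f: "f x = exp ((s - 1) * c) * (of_real x powr (s - 1) * \<Psi> (of_real x))" if "x > 0" for x
      using that L(5)[OF that] by (simp add: f_def \<phi>_def powr_def distrib_left exp_add Ln_of_real mult_ac)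
    have int: "integrable pos_reals (\<lambda>x. of_real x powr (s - 1) * \<Psi> (of_real x))"
      using s by (intro kernel_on_mellin_integrable[OF ker]) auto
    have eq: "(\<lambda>x. exp ((s - 1) * c) * (indicator {0<..} x *\<^sub>R (of_real x powr (s - 1) * \<Psi> (of_real x)))) = (\<lambda>x. if x \<in> {0..} then f x else 0)"
      using f by (auto simp: fun_eq_iff indicator_def) (auto simp: f_def \<phi>_def)
    have "((\<lambda>x. exp ((s - 1) * c) * (indicator {0<..} x *\<^sub>R (of_real x powr (s - 1) * \<Psi> (of_real x)))) has_integral exp ((s - 1) * c) * mellin \<Psi> s) UNIV"
      unfolding mellin_def integral_pos_reals
      using int[unfolded integrable_pos_reals] by (intro has_integral_mult_right has_integral_integral_lborel)
    then have "(f has_integral exp ((s - 1) * c) * mellin \<Psi> s) {0..}"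
      unfolding eq has_integral_restrict_UNIV .
    then have "((\<lambda>x. integral {0..x} f) \<longlongrightarrow> exp ((s - 1) * c) * mellin \<Psi> s) at_top"
      by (rule has_integral_atLeast_tendsto)
    moreover have "eventually (\<lambda>x. integral {0..x} f = F (of_real x) - F 0) at_top"
      using eventually_ge_at_top[of 0]
    proof eventually_elim
      case (elim x)
      have "(f has_integral F (of_real x) - F (of_real 0)) {0..x}"
      proof (rule fundamental_theorem_of_calculus[OF elim])
        fix t assume t: "t \<in> {0..x}"
        have "(complex_of_real has_vector_derivative of_real 1) (at t within {0..x})"
          by (intro derivative_intros)
        moreover have "(F has_field_derivative \<phi> (of_real t)) (at (of_real t) within complex_of_real ` {0..x})"
          by (rule DERIV_subset[OF F]) (use t S(3) in auto)
        ultimately have "((F \<circ> complex_of_real) has_vector_derivative of_real 1 * \<phi> (of_real t)) (at t within {0..x})"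
          by (rule field_vector_diff_chain_within)
        then show "((\<lambda>x. F (of_real x)) has_vector_derivative f t) (at t within {0..x})"
          by (simp add: o_def f_def)
      qed
      then show ?case by (simp add: integral_unique)
    qed
    ultimately show ?thesis by (rule Lim_transform_eventually)
  qed
  show ?thesis
  proof (intro exI[of _ F] conjI ballI allI impI)
    show "(F has_field_derivative (if u = 0 then 0 else exp ((s - 1) * L u) * \<Psi> u)) (at u within S)" if "u \<in> S" for u
      using F[OF that] by (simp add: \<phi>_def)
    fix g :: "real \<Rightarrow> complex" assume g: "\<forall>t. g t \<in> S" and lim: "filterlim (\<lambda>t. Re (g t)) at_top at_top"
    obtain K where K: "K \<ge> 0" "\<And>u s' \<theta>. u \<in> half_strip \<delta> \<Longrightarrow> norm u \<ge> 1 \<Longrightarrow> norm s' \<le> norm (s - 1) \<Longrightarrow> \<bar>\<theta>\<bar> \<le> 3 * pi \<Longrightarrow>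
           norm (exp (s' * Complex (ln (norm u)) \<theta>) * \<Psi> u) \<le> K * exp (- (\<epsilon> / 2) * Re u)"
      using kernel_on_branch_bound[OF ker, of "norm (s - 1)" 1] by auto
    \<comment> \<open>The point g t is replaced by its projection to the real axis. The vertical
      segment between them has bounded length and lies far to the right, so the primitive changes by
      an exponentially small amount.\<close>
    have dec: "norm (F (g t) - F (of_real (Re (g t)))) \<le> K * (1 / (\<epsilon> / 2) + 2 * \<delta>) * exp (- (\<epsilon> / 2) * Re (g t))"
      if t: "Re (g t) \<ge> 1" for t
    proof -
      have "norm (F (g t) - F (of_real (Re (g t)))) \<le> K * (1 / (\<epsilon> / 2) + 2 * \<delta>) * exp (- (\<epsilon> / 2) * Re (complex_of_real (Re (g t))))"
      proof (rule primitive_decay[where S = "S \<inter> {u. Re u \<ge> 1}" and \<phi> = \<phi>])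
        show "convex (S \<inter> {u. Re u \<ge> 1})" using S(2) by (intro convex_Int convex_halfspace_Re_ge)
        show "(F has_field_derivative \<phi> u) (at u within S \<inter> {u. 1 \<le> Re u})" if "u \<in> S \<inter> {u. 1 \<le> Re u}" for u
          by (rule DERIV_subset[OF F]) (use that in auto)
        show "norm (\<phi> u) \<le> K * exp (- (\<epsilon> / 2) * Re u)" if "u \<in> S \<inter> {u. 1 \<le> Re u}" for u
        proof -
          have u: "u \<in> S" "u \<noteq> 0" "norm u \<ge> 1" using that complex_Re_le_cmod[of u] by auto
          then have "L u = Complex (ln (norm u)) (Im (L u))" using L(3) by (simp add: complex_eq_iff)
          with K(2)[of u "s - 1" "Im (L u)"] u S(1) L(4)[of u] show ?thesis by (auto simp: \<phi>_def)
        qed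
        have "\<bar>Im (g t)\<bar> < \<delta>" using g S(1) by (auto simp: half_strip_def)
        then show "\<bar>Im (g t) - Im (complex_of_real (Re (g t)))\<bar> \<le> 2 * \<delta>" using \<epsilon> by simp
        have "Complex (Re (g t)) (Im 0) \<in> S" using S(3)[of 0] t \<epsilon> by (intro S(4)) auto
        then show "Complex (Re (g t)) (Im (complex_of_real (Re (g t)))) \<in> S \<inter> {u. 1 \<le> Re u}" using t by simp
      qed (use \<epsilon> K t g S(3) in auto)
      then show ?thesis by simp
    qed
    define K2 where "K2 = K * (1 / (\<epsilon> / 2) + 2 * \<delta>)"
    have "((\<lambda>x. K2 * exp (- (\<epsilon> / 2) * x)) \<longlongrightarrow> 0) at_top" using \<epsilon> by real_asymp
    then have 1: "((\<lambda>t. K2 * exp (- (\<epsilon> / 2) * Re (g t))) \<longlongrightarrow> 0) at_top"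
      using lim by (rule filterlim_compose)
    have "eventually (\<lambda>t. Re (g t) \<ge> 1) at_top"
      using lim unfolding filterlim_at_top by blast
    then have 2: "eventually (\<lambda>t. norm (F (g t) - F (of_real (Re (g t)))) \<le> K2 * exp (- (\<epsilon> / 2) * Re (g t))) at_top"
      unfolding K2_def by eventually_elim (rule dec)
    have 3: "((\<lambda>t. F (g t) - F (of_real (Re (g t)))) \<longlongrightarrow> 0) at_top"
      by (rule Lim_null_comparison[OF 2 1])
    have 4: "((\<lambda>t. F (of_real (Re (g t))) - F 0) \<longlongrightarrow> exp ((s - 1) * c) * mellin \<Psi> s) at_top"
      by (rule filterlim_compose[OF real lim])
    show "((\<lambda>t. F (g t) - F 0) \<longlongrightarrow> exp ((s - 1) * c) * mellin \<Psi> s) at_top"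
      using tendsto_add[OF 3 4] by simp
  qed
qed

text \<open>Multiplication by -i turns the closed upper half-plane without 0 into the closed right
  half-plane without 0, off the cut of \<open>Ln\<close>. In this form the branch is continuous on
  both real half-axes, which bound the upper half-strip.\<close>

lemma upper_branch:
  assumes "u \<noteq> 0" "Im u \<ge> 0"
  defines "L \<equiv> Ln (- \<i> * u) + \<i> * (pi / 2)"
  shows "Re L = ln (norm u)" "\<bar>Im L\<bar> \<le> 3 * pi" "L = Ln u"
proof -
  show "L = Ln u" using Ln_times_ii[of "- \<i> * u"] assms by simp
  then show "Re L = ln (norm u)" "\<bar>Im L\<bar> \<le> 3 * pi"
    using assms mpi_less_Im_Ln[of u] Im_Ln_le_pi[of u] pi_gt_zero by (auto simp: abs_le_iff)
qed

text \<open>The mirror image: multiplication by i gives arguments in [-pi/2, pi/2], and adding 3 pi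
  / 2 moves them to [pi, 2 pi], the range of the loop's branch below the axis.\<close>

lemma lower_branch:
  assumes "u \<noteq> 0" "Im u \<le> 0"
  defines "L \<equiv> Ln (\<i> * u) + \<i> * (3 * pi / 2)"
  shows "Re L = ln (norm u)" "\<bar>Im L\<bar> \<le> 3 * pi" "L = Ln (- u) + \<i> * pi"
proof -
  have "Ln (\<i> * (\<i> * u)) = Ln (\<i> * u) + \<i> * (pi / 2)" using assms by (subst Ln_times_ii) auto
  then show L: "L = Ln (- u) + \<i> * pi" by (simp add: L_def field_simps)
  then show "Re L = ln (norm u)" "\<bar>Im L\<bar> \<le> 3 * pi"
    using assms mpi_less_Im_Ln[of "- u"] Im_Ln_le_pi[of "- u"] pi_gt_zero by (auto simp: abs_le_iff)
qed

lemma cpow_2pi_upper: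
  assumes "u \<notin> \<real>\<^sub>\<ge>\<^sub>0" "Im u \<ge> 0"
  shows "cpow_2pi u s = exp (s * (Ln (- \<i> * u) + \<i> * (pi / 2)))"
proof -
  have u: "u \<noteq> 0" using assms by auto
  have "Ln (- u) = Ln u - \<i> * pi" using assms u by (subst Ln_minus) (auto simp: complex_nonneg_Reals_iff)
  then show ?thesis using upper_branch(3)[OF u assms(2)] assms by (simp add: cpow_2pi_Ln)
qed

lemma cpow_2pi_lower:
  assumes "u \<notin> \<real>\<^sub>\<ge>\<^sub>0" "Im u \<le> 0"
  shows "cpow_2pi u s = exp (s * (Ln (\<i> * u) + \<i> * (3 * pi / 2)))"
proof -
  have u: "u \<noteq> 0" using assms by auto
  then show ?thesis using lower_branch(3)[OF u assms(2)] assms by (simp add: cpow_2pi_Ln)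
qed

text \<open>The loop is collapsed onto the positive axis. Its incoming half contributes minus the
  Mellin integral, its outgoing half exp(2 pi i (s - 1)) times it, and nothing is left at 0 because
  the primitives extend continuously there.\<close>

lemma hankel_int_eq_mellin_aux:
  assumes ker: "kernel_on p \<delta> \<epsilon> C \<Psi>" and s: "Re s > p + 1"
  shows "hankel_int \<delta> \<Psi> s = (exp (2 * of_real pi * \<i> * s) - 1) * mellin \<Psi> s"
proof -
  have \<delta>: "\<delta> > 0" using ker by (auto simp: kernel_on_def)
  define Lu Ll where "Lu = (\<lambda>u. Ln (- \<i> * u) + \<i> * (pi / 2))" and "Ll = (\<lambda>u. Ln (\<i> * u) + \<i> * (3 * pi / 2))"
  define Su Sl where "Su = half_strip \<delta> \<inter> {u. Im u \<ge> 0}" and "Sl = half_strip \<delta> \<inter> {u. Im u \<le> 0}"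
  have conv: "convex Su" "convex Sl"
    unfolding Su_def Sl_def by (intro convex_Int convex_half_strip convex_halfspace_Im_ge convex_halfspace_Im_le)+
  have nn: "- \<i> * u \<notin> \<real>\<^sub>\<le>\<^sub>0" if "u \<in> Su - {0}" for u
    using that by (auto simp: Su_def complex_nonpos_Reals_iff complex_eq_iff)
  have nl: "\<i> * u \<notin> \<real>\<^sub>\<le>\<^sub>0" if "u \<in> Sl - {0}" for u
    using that by (auto simp: Sl_def complex_nonpos_Reals_iff complex_eq_iff)
  have Lu_holo: "continuous_on (Su - {0}) Lu" "Lu holomorphic_on (interior Su - {0})"
    unfolding Lu_def using interior_subset[of Su] nn by (auto intro!: continuous_intros holomorphic_intros)
  have Ll_holo: "continuous_on (Sl - {0}) Ll" "Ll holomorphic_on (interior Sl - {0})"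
    unfolding Ll_def using interior_subset[of Sl] nl by (auto intro!: continuous_intros holomorphic_intros)
  have bu: "Re (Lu u) = ln (norm u)" "\<bar>Im (Lu u)\<bar> \<le> 3 * pi" if "u \<in> Su" "u \<noteq> 0" for u
    unfolding Lu_def using that by (auto simp only: Su_def Int_iff mem_Collect_eq intro!: upper_branch(1,2))
  have bl: "Re (Ll u) = ln (norm u)" "\<bar>Im (Ll u)\<bar> \<le> 3 * pi" if "u \<in> Sl" "u \<noteq> 0" for u
    unfolding Ll_def using that by (auto simp only: Sl_def Int_iff mem_Collect_eq intro!: lower_branch(1,2))
  have sub: "Su \<subseteq> half_strip \<delta>" "Sl \<subseteq> half_strip \<delta>"
    "\<And>x. x \<ge> 0 \<Longrightarrow> complex_of_real x \<in> Su" "\<And>x. x \<ge> 0 \<Longrightarrow> complex_of_real x \<in> Sl"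
    "\<And>u x. u \<in> Su \<Longrightarrow> x > - \<delta> \<Longrightarrow> Complex x (Im u) \<in> Su" "\<And>u x. u \<in> Sl \<Longrightarrow> x > - \<delta> \<Longrightarrow> Complex x (Im u) \<in> Sl"
    using \<delta> by (auto simp: Su_def Sl_def half_strip_def)
  have lu: "Lu (complex_of_real x) = complex_of_real (ln x) + 0" if "x > 0" for x
    using upper_branch(3)[of "of_real x"] that by (simp add: Lu_def Ln_of_real)
  have ll: "Ll (complex_of_real x) = complex_of_real (ln x) + 2 * of_real pi * \<i>" if "x > 0" for x
    using lower_branch(3)[of "of_real x"] that by (simp add: Ll_def Ln_minus Ln_of_real)
  have "\<exists>F. (\<forall>u\<in>Su. (F has_field_derivative (if u = 0 then 0 else exp ((s - 1) * Lu u) * \<Psi> u)) (at u within Su)) \<and>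
    (\<forall>g. (\<forall>t::real. g t \<in> Su) \<longrightarrow> filterlim (\<lambda>t. Re (g t)) at_top at_top \<longrightarrow>
        ((\<lambda>t. F (g t) - F 0) \<longlongrightarrow> exp ((s - 1) * 0) * mellin \<Psi> s) at_top)"
    by (rule half_plane_primitive[OF ker s]) (fact sub(1) conv(1) sub(3) sub(5) Lu_holo(1) Lu_holo(2) bu(1) bu(2) lu)+
  then obtain Fu where Fu1:
      "\<forall>u\<in>Su. (Fu has_field_derivative (if u = 0 then 0 else exp ((s - 1) * Lu u) * \<Psi> u)) (at u within Su)"
    and Fu2: "\<forall>g. (\<forall>t::real. g t \<in> Su) \<longrightarrow> filterlim (\<lambda>t. Re (g t)) at_top at_top \<longrightarrow>
        ((\<lambda>t. Fu (g t) - Fu 0) \<longlongrightarrow> exp ((s - 1) * 0) * mellin \<Psi> s) at_top"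
    by (elim exE conjE)
  note Fu = Fu1[rule_format] and Fu_lim = Fu2[rule_format]
  have "\<exists>F. (\<forall>u\<in>Sl. (F has_field_derivative (if u = 0 then 0 else exp ((s - 1) * Ll u) * \<Psi> u)) (at u within Sl)) \<and>
    (\<forall>g. (\<forall>t::real. g t \<in> Sl) \<longrightarrow> filterlim (\<lambda>t. Re (g t)) at_top at_top \<longrightarrow>
        ((\<lambda>t. F (g t) - F 0) \<longlongrightarrow> exp ((s - 1) * (2 * of_real pi * \<i>)) * mellin \<Psi> s) at_top)"
    by (rule half_plane_primitive[OF ker s]) (fact sub(2) conv(2) sub(4) sub(6) Ll_holo(1) Ll_holo(2) bl(1) bl(2) ll)+
  then obtain Fl where Fl1:
      "\<forall>u\<in>Sl. (Fl has_field_derivative (if u = 0 then 0 else exp ((s - 1) * Ll u) * \<Psi> u)) (at u within Sl)"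
    and Fl2: "\<forall>g. (\<forall>t::real. g t \<in> Sl) \<longrightarrow> filterlim (\<lambda>t. Re (g t)) at_top at_top \<longrightarrow>
        ((\<lambda>t. Fl (g t) - Fl 0) \<longlongrightarrow> exp ((s - 1) * (2 * of_real pi * \<i>)) * mellin \<Psi> s) at_top"
    by (elim exE conjE)
  note Fl = Fl1[rule_format] and Fl_lim = Fl2[rule_format]
  define f where "f = (hankel_integrand \<delta> \<Psi> s)"
  have h: "hankel_path \<delta> t \<in> half_strip \<delta>" "hankel_path \<delta> t \<notin> \<real>\<^sub>\<ge>\<^sub>0" "hankel_path \<delta> t \<noteq> 0" for t
    using hankel_path_in_half_strip[OF \<delta>] hankel_path_not_nonneg[OF \<delta>, of t] by auto
  have hu: "hankel_path \<delta> t \<in> Su" if "t \<le> 0" for t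
    using h that \<delta> by (auto simp: Su_def hankel_path_def mult_le_0_iff)
  have hl: "hankel_path \<delta> t \<in> Sl" if "t \<ge> 0" for t
    using h that \<delta> by (auto simp: Sl_def hankel_path_def)
  have Iu: "(f has_integral (Fu (hankel_path \<delta> 0) - Fu (hankel_path \<delta> (-T)))) {-T..0}" if "T \<ge> 0" for T
  proof (rule fundamental_theorem_of_calculus)
    fix t assume t: "t \<in> {-T..0}"
    let ?D = "exp ((s - 1) * Lu (hankel_path \<delta> t)) * \<Psi> (hankel_path \<delta> t)"
    have "(Fu has_field_derivative ?D) (at (hankel_path \<delta> t) within (hankel_path \<delta> ` {-T..0}))"
    proof (rule DERIV_subset)
      show "(Fu has_field_derivative ?D) (at (hankel_path \<delta> t) within Su)"
        using Fu[OF hu, of t] h(3)[of t] t by simp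
      show "hankel_path \<delta> ` {-T..0} \<subseteq> Su" using hu by auto
    qed
    from field_vector_diff_chain_within[OF hankel_path_deriv this]
    have "((\<lambda>t. Fu (hankel_path \<delta> t)) has_vector_derivative hankel_path' \<delta> t * ?D) (at t within {-T..0})"
      by (simp add: o_def)
    moreover have "hankel_path' \<delta> t * ?D = f t"
      using cpow_2pi_upper[OF h(2)] hu[of t] t by (simp add: f_def Su_def Lu_def)
    ultimately show "((\<lambda>t. Fu (hankel_path \<delta> t)) has_vector_derivative f t) (at t within {-T..0})" by simp
  qed (use that in auto)
  have Il: "(f has_integral (Fl (hankel_path \<delta> T) - Fl (hankel_path \<delta> 0))) {0..T}" if "T \<ge> 0" for T
  proof (rule fundamental_theorem_of_calculus)
    fix t assume t: "t \<in> {0..T}"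
    let ?D = "exp ((s - 1) * Ll (hankel_path \<delta> t)) * \<Psi> (hankel_path \<delta> t)"
    have "(Fl has_field_derivative ?D) (at (hankel_path \<delta> t) within (hankel_path \<delta> ` {0..T}))"
    proof (rule DERIV_subset)
      show "(Fl has_field_derivative ?D) (at (hankel_path \<delta> t) within Sl)"
        using Fl[OF hl, of t] h(3)[of t] t by simp
      show "hankel_path \<delta> ` {0..T} \<subseteq> Sl" using hl by auto
    qed
    from field_vector_diff_chain_within[OF hankel_path_deriv this]
    have "((\<lambda>t. Fl (hankel_path \<delta> t)) has_vector_derivative hankel_path' \<delta> t * ?D) (at t within {0..T})"
      by (simp add: o_def)
    moreover have "hankel_path' \<delta> t * ?D = f t"
      using cpow_2pi_lower[OF h(2)] hl[of t] t by (simp add: f_def Sl_def Ll_def)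
    ultimately show "((\<lambda>t. Fl (hankel_path \<delta> t)) has_vector_derivative f t) (at t within {0..T})" by simp
  qed (use that in auto)
  \<comment> \<open>The two primitives live on different half-strips and carry different branches.
    On the negative segment from 0 to the vertex of the path both branches equal
    \<open>cpow_2pi\<close>, so the increments agree and the halves can be glued.\<close>
  have mid: "Fu (hankel_path \<delta> 0) - Fu 0 = Fl (hankel_path \<delta> 0) - Fl 0"
  proof -
    let ?l = "linepath 0 (hankel_path \<delta> 0)"
    have seg: "closed_segment 0 (hankel_path \<delta> 0) \<subseteq> Su \<inter> Sl"
      using hu[of 0] hl[of 0] conv \<delta>
      by (intro closed_segment_subset convex_Int) (auto simp: Su_def Sl_def half_strip_def)
    have neg: "w = 0 \<or> (w \<noteq> 0 \<and> w \<notin> \<real>\<^sub>\<ge>\<^sub>0 \<and> Im w = 0)" if w: "w \<in> closed_segment 0 (hankel_path \<delta> 0)" for w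
    proof -
      obtain x where x: "0 \<le> x" "x \<le> 1" "w = x *\<^sub>R hankel_path \<delta> 0"
        using w by (auto simp: in_segment)
      have w: "w = of_real (- x * (\<delta> / 2))" by (simp add: x(3) hankel_path_def complex_eq_iff)
      show ?thesis using x(1) \<delta> unfolding w by (auto simp: complex_nonneg_Reals_iff mult_le_0_iff)
    qed
    define \<phi> where "\<phi> = (\<lambda>u. if u = 0 then 0 else cpow_2pi u (s - 1) * \<Psi> u)"
    have du: "(Fu has_field_derivative \<phi> w) (at w within closed_segment 0 (hankel_path \<delta> 0))"
      if w: "w \<in> closed_segment 0 (hankel_path \<delta> 0)" for w
    proof -
      have "(Fu has_field_derivative (if w = 0 then 0 else exp ((s - 1) * Lu w) * \<Psi> w)) (at w within closed_segment 0 (hankel_path \<delta> 0))"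
        by (rule DERIV_subset[OF Fu]) (use seg w in auto)
      moreover have "(if w = 0 then 0 else exp ((s - 1) * Lu w) * \<Psi> w) = \<phi> w"
        using neg[OF w] cpow_2pi_upper[of w "s - 1"] by (auto simp: \<phi>_def Lu_def)
      ultimately show ?thesis by simp
    qed
    have dl: "(Fl has_field_derivative \<phi> w) (at w within closed_segment 0 (hankel_path \<delta> 0))"
      if w: "w \<in> closed_segment 0 (hankel_path \<delta> 0)" for w
    proof -
      have "(Fl has_field_derivative (if w = 0 then 0 else exp ((s - 1) * Ll w) * \<Psi> w)) (at w within closed_segment 0 (hankel_path \<delta> 0))"
        by (rule DERIV_subset[OF Fl]) (use seg w in auto)
      moreover have "(if w = 0 then 0 else exp ((s - 1) * Ll w) * \<Psi> w) = \<phi> w"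
        using neg[OF w] cpow_2pi_lower[of w "s - 1"] by (auto simp: \<phi>_def Ll_def)
      ultimately show ?thesis by simp
    qed
    have "(\<phi> has_contour_integral (Fu (pathfinish ?l) - Fu (pathstart ?l))) ?l"
      by (rule contour_integral_primitive[OF du]) auto
    moreover have "(\<phi> has_contour_integral (Fl (pathfinish ?l) - Fl (pathstart ?l))) ?l"
      by (rule contour_integral_primitive[OF dl]) auto
    ultimately show ?thesis using has_contour_integral_unique by fastforce
  qed
  have val: "integral {-T..T} f = (Fl (hankel_path \<delta> T) - Fl 0) - (Fu (hankel_path \<delta> (-T)) - Fu 0)" if "T \<ge> 0" for T
  proof -
    have "(f has_integral (Fu (hankel_path \<delta> 0) - Fu (hankel_path \<delta> (-T))) + (Fl (hankel_path \<delta> T) - Fl (hankel_path \<delta> 0))) {-T..T}"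
      by (rule has_integral_combine[OF _ _ Iu Il]) (use that in auto)
    then show ?thesis using mid by (simp add: integral_unique algebra_simps)
  qed
  \<comment> \<open>\<open>Fu_lim\<close> asks for a curve that stays in the upper half-strip for
    all parameters, hence the absolute value.\<close>
  have "((\<lambda>t. Fu (hankel_path \<delta> (- \<bar>t\<bar>)) - Fu 0) \<longlongrightarrow> exp ((s - 1) * 0) * mellin \<Psi> s) at_top"
  proof (rule Fu_lim)
    have "filterlim (\<lambda>t::real. t\<^sup>2 - \<delta> / 2) at_top at_top" by real_asymp
    then show "filterlim (\<lambda>t. Re (hankel_path \<delta> (- \<bar>t\<bar>))) at_top at_top" by (simp add: hankel_path_def)
  qed (use hu in auto)
  moreover have "((\<lambda>t. Fl (hankel_path \<delta> \<bar>t\<bar>) - Fl 0) \<longlongrightarrow> exp ((s - 1) * (2 * of_real pi * \<i>)) * mellin \<Psi> s) at_top"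
  proof (rule Fl_lim)
    have "filterlim (\<lambda>t::real. t\<^sup>2 - \<delta> / 2) at_top at_top" by real_asymp
    then show "filterlim (\<lambda>t. Re (hankel_path \<delta> \<bar>t\<bar>)) at_top at_top" by (simp add: hankel_path_def)
  qed (use hl in auto)
  ultimately have "((\<lambda>t. (Fl (hankel_path \<delta> \<bar>t\<bar>) - Fl 0) - (Fu (hankel_path \<delta> (- \<bar>t\<bar>)) - Fu 0)) \<longlongrightarrow>
      exp ((s - 1) * (2 * of_real pi * \<i>)) * mellin \<Psi> s - exp ((s - 1) * 0) * mellin \<Psi> s) at_top"
    by (rule tendsto_diff[rotated])
  then have "((\<lambda>T. integral {-T..T} f) \<longlongrightarrow> exp ((s - 1) * (2 * of_real pi * \<i>)) * mellin \<Psi> s - exp ((s - 1) * 0) * mellin \<Psi> s) at_top"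
  proof (rule Lim_transform_eventually)
    show "eventually (\<lambda>T. (Fl (hankel_path \<delta> \<bar>T\<bar>) - Fl 0) - (Fu (hankel_path \<delta> (- \<bar>T\<bar>)) - Fu 0) = integral {-T..T} f) at_top"
      using eventually_ge_at_top[of 0] by eventually_elim (simp add: val)
  qed
  moreover have "((\<lambda>T. integral {-T..T} f) \<longlongrightarrow> hankel_int \<delta> \<Psi> s) at_top"
    unfolding f_def by (rule hankel_int_tendsto[OF ker])
  ultimately have "hankel_int \<delta> \<Psi> s = exp ((s - 1) * (2 * of_real pi * \<i>)) * mellin \<Psi> s - exp ((s - 1) * 0) * mellin \<Psi> s"
    using tendsto_unique trivial_limit_at_top_linorder by blast
  moreover have "exp ((s - 1) * (2 * of_real pi * \<i>)) = exp (2 * of_real pi * \<i> * s)"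
  proof -
    have "(s - 1) * (2 * of_real pi * \<i>) = 2 * of_real pi * \<i> * s - 2 * of_real pi * \<i>" by (simp add: algebra_simps)
    then show ?thesis by (simp add: exp_diff)
  qed
  ultimately show ?thesis by (simp add: algebra_simps)
qed

text \<open>Both sides are holomorphic for Re s > p, so the margin of one is removed by
  continuation. This matters later: a kernel of order 1 is evaluated at s = 2, which the stronger
  condition would exclude.\<close>

lemma hankel_int_eq_mellin:
  assumes ker: "kernel_on p \<delta> \<epsilon> C \<Psi>" and s: "Re s > p"
  shows "hankel_int \<delta> \<Psi> s = (exp (2 * of_real pi * \<i> * s) - 1) * mellin \<Psi> s"
proof -
  define D where "D = (\<lambda>s. hankel_int \<delta> \<Psi> s - (exp (2 * of_real pi * \<i> * s) - 1) * mellin \<Psi> s)"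
  have D: "D holomorphic_on {s. Re s > p}"
    unfolding D_def using holomorphic_on_subset[OF holomorphic_hankel_int[OF ker]] holomorphic_mellin[OF ker]
    by (intro holomorphic_intros) auto
  have "D s = 0"
  proof (rule analytic_continuation_open[of "{s. Re s > real p + 1}" "{s. Re s > real p}" D "\<lambda>_. 0"])
    show "{s. Re s > real p + 1} \<noteq> {}" by (auto intro!: exI[of _ "of_real (p + 2)"])
  qed (use s D hankel_int_eq_mellin_aux[OF ker] D_def in \<open>auto simp: open_halfspace_Re_gt convex_connected convex_halfspace_Re_gt intro: holomorphic_intros\<close>)
  then show ?thesis by (simp add: D_def)
qed

definition kernel :: "nat \<Rightarrow> (complex \<Rightarrow> complex) \<Rightarrow> bool" where
  "kernel p \<Psi> \<longleftrightarrow> (\<exists>\<delta> \<epsilon> C. kernel_on p \<delta> \<epsilon> C \<Psi>)"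

text \<open>The entire continuation of \<open>(e\<^sup>2\<^sup>\<pi>\<^sup>i\<^sup>s - 1)\<close> times the Mellin transform. It is not tied to a particular
  contour or order of the kernel, so linearity in the kernel is immediate.\<close>

definition hankel :: "(complex \<Rightarrow> complex) \<Rightarrow> complex \<Rightarrow> complex" where
  "hankel \<Psi> = (THE H. H holomorphic_on UNIV \<and>
     (\<exists>\<sigma>. \<forall>s. Re s > \<sigma> \<longrightarrow> H s = (exp (2 * of_real pi * \<i> * s) - 1) * mellin \<Psi> s))"

lemma entire_eqI:
  assumes "F holomorphic_on UNIV" "G holomorphic_on UNIV" "\<And>s. Re s > \<sigma> \<Longrightarrow> F s = G s"
  shows "F = (G :: complex \<Rightarrow> complex)"
proof
  fix s
  have "F s - G s = 0"
  proof (rule analytic_continuation_open[of "{s. Re s > \<sigma>}" UNIV "\<lambda>s. F s - G s" "\<lambda>_. 0"])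
    show "{s. Re s > \<sigma>} \<noteq> {}" by (auto intro!: exI[of _ "of_real (\<sigma> + 1)"])
  qed (use assms in \<open>auto simp: open_halfspace_Re_gt intro!: holomorphic_intros\<close>)
  then show "F s = G s" by simp
qed

lemma hankelI:
  assumes "H holomorphic_on UNIV"
    and "\<And>s. Re s > \<sigma> \<Longrightarrow> H s = (exp (2 * of_real pi * \<i> * s) - 1) * mellin \<Psi> s"
  shows "hankel \<Psi> = H"
  unfolding hankel_def
proof (rule the_equality)
  fix G assume G: "G holomorphic_on UNIV \<and>
    (\<exists>\<sigma>. \<forall>s. Re s > \<sigma> \<longrightarrow> G s = (exp (2 * of_real pi * \<i> * s) - 1) * mellin \<Psi> s)"
  then obtain \<tau> where "\<And>s. Re s > \<tau> \<Longrightarrow> G s = (exp (2 * of_real pi * \<i> * s) - 1) * mellin \<Psi> s" by blast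
  then show "G = H" using G assms by (intro entire_eqI[where \<sigma> = "max \<sigma> \<tau>"]) auto
qed (use assms in blast)

lemma hankel_eq_hankel_int: "kernel_on p \<delta> \<epsilon> C \<Psi> \<Longrightarrow> hankel \<Psi> = hankel_int \<delta> \<Psi>"
  by (rule hankelI[OF holomorphic_hankel_int hankel_int_eq_mellin])

lemma holomorphic_hankel: "kernel p \<Psi> \<Longrightarrow> hankel \<Psi> holomorphic_on UNIV"
  unfolding kernel_def using holomorphic_hankel_int hankel_eq_hankel_int by metis

lemma hankel_eq_mellin:
  "kernel p \<Psi> \<Longrightarrow> Re s > p \<Longrightarrow> hankel \<Psi> s = (exp (2 * of_real pi * \<i> * s) - 1) * mellin \<Psi> s"
  unfolding kernel_def using hankel_int_eq_mellin hankel_eq_hankel_int by metis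

lemma exp_2pi_i_of_int: "exp (2 * of_real pi * \<i> * of_int n) = 1"
  using exp_integer_2pi[of "of_int n"] by (simp add: mult_ac)

text \<open>To the right of p the Mellin integral is finite while exp(2 pi i s) - 1 vanishes at
  integers. These zeros are what rules out poles of the continued series.\<close>

lemma hankel_of_int_eq_0:
  assumes "kernel p \<Psi>" "n > int p"
  shows "hankel \<Psi> (of_int n) = 0"
  using hankel_eq_mellin[OF assms(1), of "of_int n"] assms(2) by (simp add: exp_2pi_i_of_int)

lemma hankel_add_mult:
  assumes "kernel p \<Psi>" "kernel q \<Phi>"
  shows "hankel (\<lambda>u. \<Psi> u + a * \<Phi> u) s = hankel \<Psi> s + a * hankel \<Phi> s"
proof -
  have "hankel (\<lambda>u. \<Psi> u + a * \<Phi> u) = (\<lambda>s. hankel \<Psi> s + a * hankel \<Phi> s)"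
  proof (rule hankelI)
    show "(\<lambda>s. hankel \<Psi> s + a * hankel \<Phi> s) holomorphic_on UNIV"
      using assms by (intro holomorphic_intros holomorphic_hankel)
    fix s assume "Re s > max (real p) (real q)"
    then have s: "Re s > p" "Re s > q" by auto
    obtain \<delta> \<epsilon> C \<delta>' \<epsilon>' C' where k: "kernel_on p \<delta> \<epsilon> C \<Psi>" "kernel_on q \<delta>' \<epsilon>' C' \<Phi>"
      using assms by (auto simp: kernel_def)
    have "mellin (\<lambda>u. \<Psi> u + a * \<Phi> u) s = mellin \<Psi> s + a * mellin \<Phi> s"
      unfolding mellin_def using kernel_on_mellin_integrable[OF k(1) s(1)] kernel_on_mellin_integrable[OF k(2) s(2)]
      by (simp add: distrib_left mult.left_commute[of _ a] Bochner_Integration.integral_add)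
    then show "hankel \<Psi> s + a * hankel \<Phi> s = (exp (2 * of_real pi * \<i> * s) - 1) * mellin (\<lambda>u. \<Psi> u + a * \<Phi> u) s"
      using hankel_eq_mellin[OF assms(1) s(1)] hankel_eq_mellin[OF assms(2) s(2)]
      by (simp only: distrib_left mult.left_commute)
  qed
  then show ?thesis by simp
qed

section \<open>Arbitrary loops around the origin\<close>

text \<open>The star centre is -1. Simple connectedness of the slit plane makes closed curves off
  the cut have winding number 0 about every point of the cut.\<close>

lemma starlike_slit_plane: "starlike (- \<real>\<^sub>\<ge>\<^sub>0 :: complex set)"
  unfolding starlike_def
proof (intro bexI ballI)
  show "(- 1 :: complex) \<in> - \<real>\<^sub>\<ge>\<^sub>0" by (simp add: complex_nonneg_Reals_iff)
  fix x :: complex assume x: "x \<in> - \<real>\<^sub>\<ge>\<^sub>0"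
  show "closed_segment (- 1) x \<subseteq> - \<real>\<^sub>\<ge>\<^sub>0"
  proof
    fix y assume "y \<in> closed_segment (- 1) x"
    then obtain u where u: "0 \<le> u" "u \<le> 1" "y = (1 - u) *\<^sub>R (- 1) + u *\<^sub>R x" by (auto simp: in_segment)
    show "y \<in> - \<real>\<^sub>\<ge>\<^sub>0"
    proof (cases "u = 0")
      case True
      then show ?thesis using u by (simp add: complex_nonneg_Reals_iff)
    next
      case False
      show ?thesis
      proof
        assume "y \<in> \<real>\<^sub>\<ge>\<^sub>0"
        then have "Im x = 0" "u * Re x \<ge> 1 - u" using u False by (auto simp: complex_nonneg_Reals_iff)
        then have "Re x \<ge> 0" using u False by (metis diff_ge_0_iff_ge order_trans less_eq_real_def linorder_not_le mult_pos_neg)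
        then show False using x \<open>Im x = 0\<close> by (simp add: complex_nonneg_Reals_iff)
      qed
    qed
  qed
qed

lemma simply_connected_slit_plane: "simply_connected (- \<real>\<^sub>\<ge>\<^sub>0 :: complex set)"
  by (rule starlike_imp_simply_connected[OF starlike_slit_plane])

definition truncation :: "(real \<Rightarrow> complex) \<Rightarrow> real \<Rightarrow> real \<Rightarrow> complex" where
  "truncation \<gamma> T = (\<lambda>x. \<gamma> ((2 * x - 1) * T))"

lemma closed_truncation_eq: "closed_truncation \<gamma> T = truncation \<gamma> T +++ linepath (\<gamma> T) (\<gamma> (- T))"
  by (simp add: closed_truncation_def truncation_def)

lemma truncation_ends [simp]:
  "pathstart (truncation \<gamma> T) = \<gamma> (- T)" "pathfinish (truncation \<gamma> T) = \<gamma> T"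
  by (auto simp: truncation_def pathstart_def pathfinish_def)

lemma path_image_truncation: "path_image (truncation \<gamma> T) \<subseteq> range \<gamma>"
  by (auto simp: truncation_def path_image_def)

lemma valid_path_truncation:
  assumes "\<gamma> piecewise_C1_differentiable_on {-T..T}" "T > 0"
  shows "valid_path (truncation \<gamma> T)"
proof -
  have "(\<gamma> \<circ> (\<lambda>x. (2 * x - 1) * T)) piecewise_C1_differentiable_on {0..1}"
  proof (rule piecewise_C1_differentiable_compose)
    show "(\<lambda>x. (2 * x - 1) * T) piecewise_C1_differentiable_on {0..1}"
      by (intro C1_differentiable_imp_piecewise derivative_intros)
    have "{-T..T} \<supseteq> (\<lambda>x. (2 * x - 1) * T) ` {0..1}"
    proof clarify
      fix x :: real assume x: "x \<in> {0..1}"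
      have "x * T \<le> 1 * T" "0 * T \<le> x * T" using x assms by (intro mult_right_mono; simp)+
      then show "(2 * x - 1) * T \<in> {-T..T}" by (simp add: algebra_simps)
    qed
    then show "\<gamma> piecewise_C1_differentiable_on ((\<lambda>x. (2 * x - 1) * T) ` {0..1})"
      using assms(1) piecewise_C1_differentiable_on_subset by blast
    fix y
    have "{0..1} \<inter> (\<lambda>x. (2 * x - 1) * T) -` {y} \<subseteq> {(y / T + 1) / 2}"
      using assms(2) by (auto simp: field_simps)
    then show "finite ({0..1} \<inter> (\<lambda>x. (2 * x - 1) * T) -` {y})" by (rule finite_subset) simp
  qed
  then show ?thesis by (simp add: valid_path_def truncation_def o_def)
qed

lemma truncation_integral:
  assumes \<gamma>: "\<gamma> piecewise_C1_differentiable_on {-T..T}" "T > 0"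
    and I: "(\<phi> has_contour_integral I) (truncation \<gamma> T)"
  shows "((\<lambda>t. \<phi> (\<gamma> t) * vector_derivative \<gamma> (at t)) has_integral I) {-T..T}"
proof -
  define p where "p = truncation \<gamma> T"
  obtain S where S: "finite S" and diff: "\<And>t. t \<in> {-T..T} - S \<Longrightarrow> \<gamma> differentiable at t"
    using \<gamma>(1) by (auto simp: piecewise_C1_differentiable_on_def C1_differentiable_on_eq)
  define h where "h = (\<lambda>x. \<phi> (p x) * vector_derivative p (at x))"
  have "(h has_integral I) (cbox 0 1)"
    using I by (simp add: has_contour_integral p_def h_def)
  from has_integral_affinity[OF this, of "1 / (2 * T)" "1/2"]
  have "((\<lambda>x. h (1 / (2 * T) * x + 1 / 2)) has_integral (2 * T) *\<^sub>R I) ((\<lambda>x. (2 * T) * x - T) ` {0..1})"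
    using assms(2) by simp
  moreover have "(\<lambda>x. (2 * T) * x - T) ` {0..1} = {-T..T}"
  proof (intro equalityI subsetI)
    fix y assume "y \<in> (\<lambda>x. (2 * T) * x - T) ` {0..1}"
    then obtain x where x: "x \<in> {0..1}" "y = (2 * T) * x - T" by auto
    have "T * x \<le> T * 1" "T * 0 \<le> T * x" using x assms by (intro mult_left_mono; simp)+
    then show "y \<in> {-T..T}" using x by simp
  next
    fix y assume "y \<in> {-T..T}"
    then show "y \<in> (\<lambda>x. (2 * T) * x - T) ` {0..1}"
      using assms(2) by (intro image_eqI[of _ _ "(y + T) / (2 * T)"]) (auto simp: field_simps)
  qed
  ultimately have "((\<lambda>x. h (1 / (2 * T) * x + 1 / 2)) has_integral (2 * T) *\<^sub>R I) {-T..T}" by simp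
  then have "((\<lambda>x. (1 / (2 * T)) *\<^sub>R h (1 / (2 * T) * x + 1 / 2)) has_integral (1 / (2 * T)) *\<^sub>R ((2 * T) *\<^sub>R I)) {-T..T}"
    by (rule has_integral_cmul)
  then have "((\<lambda>x. (1 / (2 * T)) *\<^sub>R h (1 / (2 * T) * x + 1 / 2)) has_integral I) {-T..T}"
    using assms(2) by simp
  then show ?thesis
  proof (rule has_integral_spike_finite[OF S, rotated])
    fix t assume t: "t \<in> {-T..T} - S"
    define x where "x = 1 / (2 * T) * t + 1 / 2"
    have xt: "(2 * x - 1) * T = t" using assms(2) by (simp add: x_def field_simps)
    have "vector_derivative (\<gamma> \<circ> (\<lambda>x. (2 * x - 1) * T)) (at x) =
       vector_derivative (\<lambda>x. (2 * x - 1) * T) (at x) *\<^sub>R vector_derivative \<gamma> (at ((2 * x - 1) * T))"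
      by (rule vector_derivative_chain_at) (use diff[OF t] xt in \<open>auto intro!: derivative_intros\<close>)
    moreover have "vector_derivative (\<lambda>x. (2 * x - 1) * T) (at x) = 2 * T"
      by (rule vector_derivative_at) (auto intro!: derivative_eq_intros simp: has_real_derivative_iff_has_vector_derivative[symmetric])
    ultimately have "vector_derivative p (at x) = (2 * T) *\<^sub>R vector_derivative \<gamma> (at t)"
      by (simp add: p_def truncation_def o_def xt)
    moreover have "p x = \<gamma> t" by (simp add: p_def truncation_def xt)
    ultimately show "\<phi> (\<gamma> t) * vector_derivative \<gamma> (at t) = (1 / (2 * T)) *\<^sub>R h (1 / (2 * T) * t + 1 / 2)"
      using assms(2) unfolding x_def[symmetric] h_def by simp
  qed
qed

lemma primitive_integral:
  fixes S :: "complex set"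
  assumes "a \<le> b" "\<And>u. u \<in> S \<Longrightarrow> (F has_field_derivative \<phi> u) (at u within S)"
    "\<gamma> piecewise_C1_differentiable_on {a..b}" "\<And>t. t \<in> {a..b} \<Longrightarrow> \<gamma> t \<in> S"
  shows "((\<lambda>t. \<phi> (\<gamma> t) * vector_derivative \<gamma> (at t)) has_integral (F (\<gamma> b) - F (\<gamma> a))) {a..b}"
  unfolding has_integral_localized_vector_derivative[symmetric]
  by (rule contour_integral_primitive_lemma[where S = S]) (use assms piecewise_C1_imp_differentiable in auto)

lemma hankel_path_piecewise_C1: "hankel_path \<delta> piecewise_C1_differentiable_on A"
  by (intro C1_differentiable_imp_piecewise, unfold C1_differentiable_on_def)
    (intro exI[of _ "hankel_path' \<delta>"] conjI ballI hankel_path_deriv continuous_hankel_path')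

lemma winding_number_join4:
  assumes "path g1" "path g2" "path g3" "path g4"
    and "pathfinish g1 = pathstart g2" "pathfinish g2 = pathstart g3" "pathfinish g3 = pathstart g4"
    and "w \<notin> path_image g1" "w \<notin> path_image g2" "w \<notin> path_image g3" "w \<notin> path_image g4"
  shows "winding_number (g1 +++ (g2 +++ (g3 +++ g4))) w =
    winding_number g1 w + (winding_number g2 w + (winding_number g3 w + winding_number g4 w))"
  using assms by (simp add: winding_number_join path_image_join)

lemma contour_integral_join4:
  assumes "f contour_integrable_on g1" "f contour_integrable_on g2" "f contour_integrable_on g3" "f contour_integrable_on g4"
    and "valid_path g1" "valid_path g2" "valid_path g3" "valid_path g4"
    and "pathfinish g1 = pathstart g2" "pathfinish g2 = pathstart g3" "pathfinish g3 = pathstart g4"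
  shows "contour_integral (g1 +++ (g2 +++ (g3 +++ g4))) f =
    contour_integral g1 f + (contour_integral g2 f + (contour_integral g3 f + contour_integral g4 f))"
  using assms by (simp add: contour_integral_join valid_path_join contour_integrable_joinI)

text \<open>Past the last zero met by the strip containing both loops, the closed curve that runs along
  \<open>\<gamma>\<close> and back along the reference loop has winding number 0 about every point outside the
  domain of the integrand.\<close>

lemma hankel_loop_deform:
  assumes hol: "\<phi> holomorphic_on (- (\<real>\<^sub>\<ge>\<^sub>0 \<union> Z))" and Z: "closed Z"
    and \<gamma>: "\<gamma> piecewise_C1_differentiable_on {-T..T}" "range \<gamma> \<inter> (\<real>\<^sub>\<ge>\<^sub>0 \<union> Z) = {}" "T > 0"
      "\<And>t. \<bar>Im (\<gamma> t)\<bar> < B"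
    and \<delta>: "\<delta> > 0" "\<delta> \<le> B" "Z \<inter> half_strip \<delta> \<subseteq> {0}"
    and X: "X > 0" "\<And>w. w \<in> Z \<Longrightarrow> \<bar>Im w\<bar> < B \<Longrightarrow> Re w \<le> X"
    and wind: "\<And>w. w \<in> Z - {0} \<Longrightarrow> \<bar>Im w\<bar> < B \<Longrightarrow> winding_number (closed_truncation \<gamma> T) w = 0"
    and far: "Re (\<gamma> T) > X" "Re (\<gamma> (-T)) > X" "Re (hankel_path \<delta> T) > X" "Re (hankel_path \<delta> (-T)) > X"
      "Im (\<gamma> T) < 0" "Im (\<gamma> (-T)) > 0"
    and Gu: "\<And>u. u \<in> {u. Re u > X \<and> 0 < Im u \<and> Im u < B} \<Longrightarrow> (Gu has_field_derivative \<phi> u) (at u within {u. Re u > X \<and> 0 < Im u \<and> Im u < B})"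
    and Gl: "\<And>u. u \<in> {u. Re u > X \<and> Im u < 0 \<and> - B < Im u} \<Longrightarrow> (Gl has_field_derivative \<phi> u) (at u within {u. Re u > X \<and> Im u < 0 \<and> - B < Im u})"
  shows "((\<lambda>t. \<phi> (\<gamma> t) * vector_derivative \<gamma> (at t)) has_integral
     (contour_integral (truncation (hankel_path \<delta>) T) \<phi> + (Gl (\<gamma> T) - Gl (hankel_path \<delta> T)) - (Gu (\<gamma> (-T)) - Gu (hankel_path \<delta> (-T))))) {-T..T}"
proof -
  define h where "h = hankel_path \<delta>"
  define p q where "p = truncation \<gamma> T" and "q = truncation h T"
  define \<Omega> where "\<Omega> = - (\<real>\<^sub>\<ge>\<^sub>0 \<union> Z)"
  have open\<Omega>: "open \<Omega>" unfolding \<Omega>_def using Z by (intro open_Compl closed_Un closed_nonneg_Reals_complex)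
  define l1 l2 l3 l4 where "l1 = linepath (\<gamma> T) (h T)" and "l2 = linepath (h (-T)) (\<gamma> (-T))"
    and "l3 = linepath (\<gamma> T) (\<gamma> (-T))" and "l4 = linepath (h T) (h (-T))"
  note l_defs = l1_def l2_def l3_def l4_def
  have hstrip: "h t \<in> half_strip \<delta>" "h t \<notin> \<real>\<^sub>\<ge>\<^sub>0" "h t \<noteq> 0" for t
    using hankel_path_in_half_strip[OF \<delta>(1)] hankel_path_not_nonneg[OF \<delta>(1), of t] by (auto simp: h_def)
  have hIm: "\<bar>Im (h t)\<bar> < B" for t using hstrip(1)[of t] \<delta> by (auto simp: half_strip_def)
  have hsgn: "Im (h T) < 0" "Im (h (-T)) > 0" using \<delta>(1) \<gamma>(3) by (auto simp: h_def hankel_path_def arctan_minus)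
  have g\<Omega>: "\<gamma> t \<in> \<Omega>" for t using \<gamma>(2) by (auto simp: \<Omega>_def)
  have h\<Omega>: "h t \<in> \<Omega>" for t using hstrip[of t] \<delta>(3) by (auto simp: \<Omega>_def)
  have p\<Omega>: "path_image p \<subseteq> \<Omega>" and q\<Omega>: "path_image q \<subseteq> \<Omega>"
    using path_image_truncation[of \<gamma> T] path_image_truncation[of h T] g\<Omega> h\<Omega> by (auto simp: p_def q_def)
  define Ru Rl where "Ru = {u. Re u > X \<and> 0 < Im u \<and> Im u < B}" and "Rl = {u. Re u > X \<and> Im u < 0 \<and> - B < Im u}"
  have "Ru = {u. Re u > X} \<inter> {u. 0 < Im u} \<inter> {u. Im u < B}" "Rl = {u. Re u > X} \<inter> {u. Im u < 0} \<inter> {u. - B < Im u}"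
    by (auto simp: Ru_def Rl_def)
  then have convR: "convex Ru" "convex Rl"
    by (simp_all add: convex_halfspace_Im_lt convex_halfspace_Im_gt convex_halfspace_Re_gt convex_Int)
  have R\<Omega>: "Ru \<subseteq> \<Omega>" "Rl \<subseteq> \<Omega>" using X(2) by (force simp: Ru_def Rl_def \<Omega>_def complex_nonneg_Reals_iff)+
  have inR: "\<gamma> T \<in> Rl" "h T \<in> Rl" "\<gamma> (-T) \<in> Ru" "h (-T) \<in> Ru"
    using far \<gamma>(4)[of T] \<gamma>(4)[of "-T"] hIm[of T] hIm[of "-T"] hsgn by (auto simp: Ru_def Rl_def h_def abs_less_iff)
  have l1R: "path_image l1 \<subseteq> Rl" and l2R: "path_image l2 \<subseteq> Ru"
    using inR convR by (auto simp: l_defs closed_segment_subset)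
  have vp: "valid_path p" and vq: "valid_path q"
    using valid_path_truncation[OF \<gamma>(1,3)] valid_path_truncation[OF hankel_path_piecewise_C1 \<gamma>(3)] by (auto simp: p_def q_def h_def)
  have ends: "pathstart p = \<gamma> (-T)" "pathfinish p = \<gamma> T" "pathstart q = h (-T)" "pathfinish q = h T"
    by (auto simp: p_def q_def)
  \<comment> \<open>The connecting segments l1 and l2 stay on one side of the real axis each, so Q
    avoids the cut, whereas the closing segments l3 and l4 cross it.\<close>
  define Q where "Q = p +++ (l1 +++ (reversepath q +++ l2))"
  have Q_img: "path_image Q = path_image p \<union> path_image l1 \<union> path_image q \<union> path_image l2"
    using ends by (auto simp: Q_def l1_def l2_def path_image_join)
  have Q\<Omega>: "path_image Q \<subseteq> \<Omega>" unfolding Q_img using p\<Omega> q\<Omega> l1R l2R R\<Omega> by blast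
  have Qv: "valid_path Q" "pathfinish Q = pathstart Q"
    using vp vq ends by (auto simp: Q_def l1_def l2_def intro!: valid_path_join)
  have strip: "convex {u. \<bar>Im u\<bar> < B}"
  proof -
    have "{u. \<bar>Im u\<bar> < B} = {u. Im u < B} \<inter> {u. - B < Im u}" by auto
    then show ?thesis by (simp add: convex_halfspace_Im_lt convex_halfspace_Im_gt convex_Int)
  qed
  have Q_strip: "path_image Q \<subseteq> {u. \<bar>Im u\<bar> < B}"
    unfolding Q_img using path_image_truncation[of \<gamma> T] path_image_truncation[of h T] \<gamma>(4) hIm l1R l2R
    by (auto simp: p_def q_def Ru_def Rl_def)
  \<comment> \<open>Points outside the domain are of three kinds: on the cut, beyond the strip, or
    in the strip with real part at most X. Only the last kind uses the hypothesis on the winding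
    numbers of the given loop.\<close>
  have wQ: "winding_number Q w = 0" if w: "w \<notin> \<Omega>" for w
  proof (cases "w \<in> \<real>\<^sub>\<ge>\<^sub>0")
    case True
    show ?thesis
      by (rule simply_connected_imp_winding_number_zero[OF simply_connected_slit_plane])
        (use Qv Q\<Omega> True in \<open>auto simp: \<Omega>_def valid_path_imp_path\<close>)
  next
    case nn: False
    then have wZ: "w \<in> Z" "w \<noteq> 0" using w by (auto simp: \<Omega>_def)
    show ?thesis
    proof (cases "\<bar>Im w\<bar> < B")
      case False
      then show ?thesis
        using Qv Q_strip by (intro winding_number_zero_outside[OF _ strip]) (auto simp: valid_path_imp_path)
    next
      case True
      have Rew: "Re w \<le> X" using X(2) wZ True by blast
      define H where "H = {u. Re u > X}"
      have cH: "convex H" by (simp add: H_def convex_halfspace_Re_gt)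
      have inH: "\<gamma> T \<in> H" "\<gamma> (-T) \<in> H" "h T \<in> H" "h (-T) \<in> H" using far by (auto simp: H_def h_def)
      then have lH: "path_image l1 \<subseteq> H" "path_image l2 \<subseteq> H" "path_image l3 \<subseteq> H" "path_image l4 \<subseteq> H"
        using cH by (auto simp: l_defs closed_segment_subset)
      have wH: "w \<notin> H" using Rew by (simp add: H_def)
      have nl: "w \<notin> path_image l1" "w \<notin> path_image l2" "w \<notin> path_image l3" "w \<notin> path_image l4"
        using lH wH by blast+
      have np: "w \<notin> path_image p" "w \<notin> path_image q" using p\<Omega> q\<Omega> w by blast+
      have w1: "winding_number p w + winding_number l3 w = 0"
      proof -
        have "winding_number (p +++ l3) w = winding_number p w + winding_number l3 w"
          using np nl vp ends by (intro winding_number_join) (auto simp: l3_def valid_path_imp_path)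
        moreover have "winding_number (p +++ l3) w = 0"
          using wind[of w] wZ True by (simp add: closed_truncation_eq p_def l3_def)
        ultimately show ?thesis by simp
      qed
      have w2: "winding_number q w + winding_number l4 w = 0"
      proof -
        have "winding_number (q +++ l4) w = winding_number q w + winding_number l4 w"
          using np nl vq ends by (intro winding_number_join) (auto simp: l4_def valid_path_imp_path)
        moreover have "winding_number (q +++ l4) w = 0"
        proof (rule winding_number_zero_outside[OF _ convex_half_strip])
          show "path_image (q +++ l4) \<subseteq> half_strip \<delta>"
          proof -
            have "path_image l4 \<subseteq> half_strip \<delta>"
              unfolding l4_def path_image_linepath by (intro closed_segment_subset hstrip(1) convex_half_strip)
            moreover have "path_image q \<subseteq> half_strip \<delta>"
              using path_image_truncation[of h T] hstrip(1) unfolding q_def by blast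
            ultimately show ?thesis using ends by (subst path_image_join) (auto simp: l4_def)
          qed
          show "w \<notin> half_strip \<delta>" using \<delta>(3) wZ by auto
        qed (use vq ends in \<open>auto simp: l4_def valid_path_imp_path\<close>)
        ultimately show ?thesis by simp
      qed
      \<comment> \<open>The closed quadrilateral made of l1, l4, l2 and the reversed l3 lies in the
        half-plane Re > X, to which w does not belong. So the two closing segments can be traded
        against the two connecting ones.\<close>
      have w3: "winding_number l1 w + winding_number l4 w + winding_number l2 w = winding_number l3 w"
      proof -
        have "path_image (l1 +++ (l4 +++ (l2 +++ reversepath l3))) \<subseteq> H"
          using lH closed_segment_commute[of "\<gamma> T" "\<gamma> (-T)"] by (simp add: path_image_join l_defs)
        then have "winding_number (l1 +++ (l4 +++ (l2 +++ reversepath l3))) w = 0"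
          using wH by (intro winding_number_zero_outside[OF _ cH]) (simp_all add: l_defs)
        moreover have "winding_number (l1 +++ (l4 +++ (l2 +++ reversepath l3))) w =
          winding_number l1 w + (winding_number l4 w + (winding_number l2 w + winding_number (reversepath l3) w))"
          using nl closed_segment_commute[of "\<gamma> T" "\<gamma> (-T)"] by (intro winding_number_join4) (simp_all add: l_defs)
        moreover have "winding_number (reversepath l3) w = - winding_number l3 w"
          using nl by (intro winding_number_reversepath) (auto simp: l_defs)
        ultimately show ?thesis by (simp add: algebra_simps)
      qed
      have "winding_number Q w = winding_number p w + (winding_number l1 w + (winding_number (reversepath q) w + winding_number l2 w))"
        unfolding Q_def using nl np vp vq ends
        by (intro winding_number_join4) (simp_all add: l1_def l2_def valid_path_imp_path)
      also have "winding_number (reversepath q) w = - winding_number q w"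
        using np vq by (intro winding_number_reversepath) (auto simp: valid_path_imp_path)
      finally have wQ: "winding_number Q w = winding_number p w + (winding_number l1 w + (- winding_number q w + winding_number l2 w))" .
      have "winding_number p w = - winding_number l3 w" "winding_number q w = - winding_number l4 w"
        using w1 w2 by (simp_all add: eq_neg_iff_add_eq_0)
      then show ?thesis unfolding wQ w3[symmetric] by simp
    qed
  qed
  have "(\<phi> has_contour_integral 0) Q"
    by (rule Cauchy_theorem_global[OF open\<Omega> _ Qv Q\<Omega> wQ]) (use hol in \<open>simp_all add: \<Omega>_def\<close>)
  have ci: "\<phi> contour_integrable_on g" if "valid_path g" "path_image g \<subseteq> \<Omega>" for g
    using contour_integrable_holomorphic_simple[OF _ open\<Omega> that] hol by (simp add: \<Omega>_def)
  have int1: "contour_integral l1 \<phi> = Gl (h T) - Gl (\<gamma> T)"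
    using contour_integral_primitive[of Rl Gl \<phi> l1] Gl l1R by (simp add: l1_def Rl_def contour_integral_unique)
  have int2: "contour_integral l2 \<phi> = Gu (\<gamma> (-T)) - Gu (h (-T))"
    using contour_integral_primitive[of Ru Gu \<phi> l2] Gu l2R by (simp add: l2_def Ru_def contour_integral_unique)
  have ints: "\<phi> contour_integrable_on p" "\<phi> contour_integrable_on q" "\<phi> contour_integrable_on l1" "\<phi> contour_integrable_on l2"
    using p\<Omega> q\<Omega> l1R l2R R\<Omega> vp vq by (auto intro!: ci simp: l1_def l2_def)
  have "contour_integral Q \<phi> = contour_integral p \<phi> + (contour_integral l1 \<phi> + (contour_integral (reversepath q) \<phi> + contour_integral l2 \<phi>))"
    unfolding Q_def using ints vp vq ends
    by (intro contour_integral_join4) (simp_all add: l1_def l2_def contour_integrable_reversepath)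
  also have "contour_integral (reversepath q) \<phi> = - contour_integral q \<phi>"
    using vq by (rule contour_integral_reversepath)
  also have "contour_integral Q \<phi> = 0" using \<open>(\<phi> has_contour_integral 0) Q\<close> by (rule contour_integral_unique)
  finally have "contour_integral p \<phi> = contour_integral q \<phi> + (Gl (\<gamma> T) - Gl (h T)) - (Gu (\<gamma> (-T)) - Gu (h (-T)))"
    unfolding int1 int2 by (simp add: algebra_simps)
  moreover have "(\<phi> has_contour_integral contour_integral p \<phi>) p"
    using ints(1) by (rule has_contour_integral_integral)
  ultimately show ?thesis
    using truncation_integral[OF \<gamma>(1,3), of \<phi> "contour_integral p \<phi>"] by (simp add: p_def q_def h_def)
qed


text \<open>A strip that contains the loop meets Z in finitely many points, so the winding
  conditions, each of which holds only eventually, hold together for large T. The remaining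
  differences are increments of primitives far to the right, which decay.\<close>

lemma loop_integral_eq_hankel:
  assumes ker: "kernel_on p \<delta> \<epsilon> C \<Psi>"
    and hol: "\<Psi> holomorphic_on (- Z)" and Z: "closed Z" "Z \<inter> half_strip \<delta> \<subseteq> {0}"
      "\<And>B. finite (Z \<inter> {w. \<bar>Im w\<bar> < B})"
    and decay: "\<And>B. \<exists>X C \<eta>. \<eta> > 0 \<and> (\<forall>u. Re u > X \<longrightarrow> \<bar>Im u\<bar> < B \<longrightarrow> norm (\<Psi> u) \<le> C * exp (- \<eta> * Re u))"
    and loop: "hankel_loop Z \<gamma>"
  shows "loop_integral \<gamma> (\<lambda>u. cpow_2pi u (s - 1) * \<Psi> u) = hankel \<Psi> s"
proof -
  define \<phi> where "\<phi> = (\<lambda>u. cpow_2pi u (s - 1) * \<Psi> u)"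
  define h where "h = hankel_path \<delta>"
  have \<delta>: "\<delta> > 0" using ker by (auto simp: kernel_on_def)
  have pw: "\<gamma> piecewise_C1_differentiable_on {a..b}" for a b
  proof -
    have "\<gamma> piecewise_C1_differentiable_on {- (max 1 (max \<bar>a\<bar> \<bar>b\<bar>))..max 1 (max \<bar>a\<bar> \<bar>b\<bar>)}"
      using loop unfolding hankel_loop_def by (metis less_max_iff_disj zero_less_one)
    then show ?thesis by (rule piecewise_C1_differentiable_on_subset) auto
  qed
  obtain B0 where B0: "\<And>t. \<bar>Im (\<gamma> t)\<bar> \<le> B0"
    using loop unfolding hankel_loop_def bounded_iff by auto
  define B where "B = max \<delta> (B0 + 1)"
  have B: "\<bar>Im (\<gamma> t)\<bar> < B" "\<delta> \<le> B" "B > 0" for t using B0[of t] \<delta> by (auto simp: B_def)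
  obtain X1 C1 \<eta> where \<eta>: "\<eta> > 0"
    and X1: "\<And>u. Re u > X1 \<Longrightarrow> \<bar>Im u\<bar> < B \<Longrightarrow> norm (\<Psi> u) \<le> C1 * exp (- \<eta> * Re u)"
    using decay[of B] by blast
  define ZB where "ZB = Z \<inter> {w. \<bar>Im w\<bar> < B}"
  have ZB: "finite ZB" unfolding ZB_def by (rule Z)
  define X where "X = Max (insert 1 (insert X1 (Re ` ZB)))"
  have X: "X \<ge> 1" "X \<ge> X1" "\<And>w. w \<in> ZB \<Longrightarrow> Re w \<le> X"
    unfolding X_def using ZB by (auto intro!: Max_ge simp del: Max_insert)
  obtain K0 where K0: "K0 \<ge> 0" "\<And>u. norm u \<ge> 1 \<Longrightarrow> norm (cpow_2pi u (s - 1)) \<le> K0 * exp (\<eta> / 2 * norm u)"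
    using cpow_2pi_bound[of "norm (s - 1)" "\<eta> / 2" 1] \<eta> by auto
  define K where "K = K0 * exp (\<eta> / 2 * B) * \<bar>C1\<bar>"
  have K: "K \<ge> 0" using K0 by (simp add: K_def)
  have \<phi>_bd: "norm (\<phi> u) \<le> K * exp (- (\<eta> / 2) * Re u)" if u: "Re u > X" "\<bar>Im u\<bar> < B" for u
  proof -
    have "norm u \<ge> 1" using complex_Re_le_cmod[of u] u X by linarith
    then have "norm (cpow_2pi u (s - 1)) \<le> K0 * exp (\<eta> / 2 * norm u)" by (rule K0)
    also have "\<dots> \<le> K0 * exp (\<eta> / 2 * (Re u + B))"
      using cmod_le[of u] u X K0 \<eta> by (intro mult_left_mono) auto
    finally have 1: "norm (cpow_2pi u (s - 1)) \<le> K0 * exp (\<eta> / 2 * (Re u + B))" .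
    have "norm (\<Psi> u) \<le> C1 * exp (- \<eta> * Re u)" using X1 u X by auto
    also have "\<dots> \<le> \<bar>C1\<bar> * exp (- \<eta> * Re u)" by (intro mult_right_mono) auto
    finally have "norm (\<phi> u) \<le> (K0 * exp (\<eta> / 2 * (Re u + B))) * (\<bar>C1\<bar> * exp (- \<eta> * Re u))"
      unfolding \<phi>_def norm_mult using 1 K0 by (intro mult_mono) auto
    also have "\<dots> = K * (exp (\<eta> / 2 * Re u) * exp (- \<eta> * Re u))"
      by (simp add: K_def distrib_left exp_add)
    also have "exp (\<eta> / 2 * Re u) * exp (- \<eta> * Re u) = exp (- (\<eta> / 2) * Re u)"
      by (simp add: exp_add [symmetric])
    finally show ?thesis .
  qed
  have hol\<phi>: "\<phi> holomorphic_on (- (\<real>\<^sub>\<ge>\<^sub>0 \<union> Z))"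
    unfolding \<phi>_def by (intro holomorphic_on_mult holomorphic_on_subset[OF holomorphic_cpow_2pi] holomorphic_on_subset[OF hol]) auto
  define Ru Rl where "Ru = {u. Re u > X \<and> 0 < Im u \<and> Im u < B}" and "Rl = {u. Re u > X \<and> Im u < 0 \<and> - B < Im u}"
  have Req: "Ru = {u. Re u > X} \<inter> {u. 0 < Im u} \<inter> {u. Im u < B}" "Rl = {u. Re u > X} \<inter> {u. Im u < 0} \<inter> {u. - B < Im u}"
    by (auto simp: Ru_def Rl_def)
  have convR: "convex Ru" "convex Rl" "open Ru" "open Rl"
    unfolding Req by (simp_all add: convex_halfspace_Im_lt convex_halfspace_Im_gt convex_halfspace_Re_gt convex_Int
       open_halfspace_Im_lt open_halfspace_Im_gt open_halfspace_Re_gt open_Int)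
  have R\<Omega>: "Ru \<subseteq> - (\<real>\<^sub>\<ge>\<^sub>0 \<union> Z)" "Rl \<subseteq> - (\<real>\<^sub>\<ge>\<^sub>0 \<union> Z)"
  proof -
    have "u \<notin> Z" if "Re u > X" "\<bar>Im u\<bar> < B" for u using X(3)[of u] that by (auto simp: ZB_def)
    then show "Ru \<subseteq> - (\<real>\<^sub>\<ge>\<^sub>0 \<union> Z)" "Rl \<subseteq> - (\<real>\<^sub>\<ge>\<^sub>0 \<union> Z)"
      by (auto simp: Ru_def Rl_def complex_nonneg_Reals_iff)
  qed
  obtain Gu where Gu: "\<And>u. u \<in> Ru \<Longrightarrow> (Gu has_field_derivative \<phi> u) (at u within Ru)"
    using holomorphic_convex_primitive'[OF convR(1) convR(3) holomorphic_on_subset[OF hol\<phi> R\<Omega>(1)]] by blast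
  obtain Gl where Gl: "\<And>u. u \<in> Rl \<Longrightarrow> (Gl has_field_derivative \<phi> u) (at u within Rl)"
    using holomorphic_convex_primitive'[OF convR(2) convR(4) holomorphic_on_subset[OF hol\<phi> R\<Omega>(2)]] by blast
  define K2 where "K2 = K * (1 / (\<eta> / 2) + 2 * B)"
  have decay_u: "norm (Gu x - Gu y) \<le> K2 * exp (- (\<eta> / 2) * m)" if "x \<in> Ru" "y \<in> Ru" "m \<le> Re x" "m \<le> Re y" for x y m
    unfolding K2_def
    by (rule primitive_decay_sym[OF convR(1) _ _ K Gu]) (use that \<eta> B(3) \<phi>_bd in \<open>auto simp: Ru_def\<close>)
  have decay_l: "norm (Gl x - Gl y) \<le> K2 * exp (- (\<eta> / 2) * m)" if "x \<in> Rl" "y \<in> Rl" "m \<le> Re x" "m \<le> Re y" for x y m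
    unfolding K2_def
    by (rule primitive_decay_sym[OF convR(2) _ _ K Gl]) (use that \<eta> B(3) \<phi>_bd in \<open>auto simp: Rl_def\<close>)
  define f where "f = (\<lambda>t. \<phi> (\<gamma> t) * vector_derivative \<gamma> (at t))"
  have Re_top: "filterlim (\<lambda>t. Re (\<gamma> t)) at_top at_top" and Re_bot: "filterlim (\<lambda>t. Re (\<gamma> t)) at_top at_bot"
    and Im_top: "eventually (\<lambda>t. Im (\<gamma> t) < 0) at_top" and Im_bot: "eventually (\<lambda>t. Im (\<gamma> t) > 0) at_bot"
    and avoid: "range \<gamma> \<inter> (\<real>\<^sub>\<ge>\<^sub>0 \<union> Z) = {}"
    and wind: "\<And>w. w \<in> Z - {0} \<Longrightarrow> eventually (\<lambda>T. winding_number (closed_truncation \<gamma> T) w = 0) at_top"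
    using loop unfolding hankel_loop_def by blast+
  have Hlim: "((\<lambda>T. contour_integral (truncation h T) \<phi>) \<longlongrightarrow> hankel \<Psi> s) at_top"
  proof (rule Lim_transform_eventually)
    show "((\<lambda>T. integral {-T..T} (\<lambda>t. cpow_2pi (h t) (s - 1) * \<Psi> (h t) * hankel_path' \<delta> t)) \<longlongrightarrow> hankel \<Psi> s) at_top"
      unfolding hankel_eq_hankel_int[OF ker] h_def by (rule hankel_int_tendsto[OF ker])
    show "\<forall>\<^sub>F T in at_top. integral {-T..T} (\<lambda>t. cpow_2pi (h t) (s - 1) * \<Psi> (h t) * hankel_path' \<delta> t) = contour_integral (truncation h T) \<phi>"
      using eventually_gt_at_top[of 0]
    proof eventually_elim
      case (elim T)
      have "h t \<in> - (\<real>\<^sub>\<ge>\<^sub>0 \<union> Z)" for t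
        using hankel_path_in_half_strip[OF \<delta>, of t] hankel_path_not_nonneg[OF \<delta>, of t] Z(2) by (auto simp: h_def)
      then have sub: "path_image (truncation h T) \<subseteq> - (\<real>\<^sub>\<ge>\<^sub>0 \<union> Z)"
        using path_image_truncation[of h T] by blast
      have "\<phi> contour_integrable_on truncation h T"
        using hol\<phi> sub Z(1) valid_path_truncation[OF hankel_path_piecewise_C1 elim] unfolding h_def
        by (intro contour_integrable_holomorphic_simple[of _ "- (\<real>\<^sub>\<ge>\<^sub>0 \<union> Z)"] open_Compl closed_Un closed_nonneg_Reals_complex) auto
      then have "(\<phi> has_contour_integral contour_integral (truncation h T) \<phi>) (truncation h T)"
        by (rule has_contour_integral_integral)
      then have "((\<lambda>t. \<phi> (h t) * vector_derivative h (at t)) has_integral contour_integral (truncation h T) \<phi>) {-T..T}"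
        using hankel_path_piecewise_C1 elim unfolding h_def by (intro truncation_integral) auto
      moreover have "vector_derivative h (at t) = hankel_path' \<delta> t" for t
        unfolding h_def by (rule vector_derivative_at[OF hankel_path_deriv])
      ultimately show ?case by (simp add: \<phi>_def integral_unique)
    qed
  qed
  \<comment> \<open>\<open>has_integral_alt'\<close> compares with every large interval, not only
    with symmetric ones, so the two tails have independent end points. They are evaluated by
    primitives, because the integrand along an arbitrary loop need not be absolutely
    integrable.\<close>
  have main: "\<exists>T>0. \<forall>a b. a \<le> - T \<longrightarrow> b \<ge> T \<longrightarrow> (\<exists>I. (f has_integral I) {a..b} \<and> norm (I - hankel \<Psi> s) < e)" if e: "e > 0" for e
  proof -
    have hRe: "filterlim (\<lambda>t. Re (h t)) at_top at_top" "filterlim (\<lambda>t. Re (h (- t))) at_top at_top"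
    proof -
      have "filterlim (\<lambda>t::real. t\<^sup>2 - \<delta> / 2) at_top at_top" by real_asymp
      then show "filterlim (\<lambda>t. Re (h t)) at_top at_top" "filterlim (\<lambda>t. Re (h (- t))) at_top at_top"
        by (simp_all add: h_def hankel_path_def)
    qed
    have "((\<lambda>x. K2 * exp (- (\<eta> / 2) * x)) \<longlongrightarrow> 0) at_top" using \<eta> by real_asymp
    then have "eventually (\<lambda>x. K2 * exp (- (\<eta> / 2) * x) < e / 3 \<and> x > X) at_top"
      using e by (intro eventually_conj order_tendstoD(2)[where a = "e / 3"] eventually_gt_at_top) auto
    then obtain m where m: "m > X" "K2 * exp (- (\<eta> / 2) * m) < e / 3"
      using eventually_happens'[OF trivial_limit_at_top_linorder] by blast
    have ev: "eventually (\<lambda>T. T > 0 \<and> Re (h T) \<ge> m \<and> Re (h (-T)) \<ge> m \<and>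
        norm (contour_integral (truncation h T) \<phi> - hankel \<Psi> s) < e / 3 \<and>
        (\<forall>w\<in>ZB - {0}. winding_number (closed_truncation \<gamma> T) w = 0)) at_top"
    proof (intro eventually_conj eventually_gt_at_top)
      show "eventually (\<lambda>T. m \<le> Re (h T)) at_top" "eventually (\<lambda>T. m \<le> Re (h (- T))) at_top"
        using hRe unfolding filterlim_at_top by blast+
      show "eventually (\<lambda>T. norm (contour_integral (truncation h T) \<phi> - hankel \<Psi> s) < e / 3) at_top"
        using tendstoD[OF Hlim, of "e / 3"] e by (simp add: dist_norm)
      show "eventually (\<lambda>T. \<forall>w\<in>ZB - {0}. winding_number (closed_truncation \<gamma> T) w = 0) at_top"
        using ZB wind by (intro eventually_ball_finite) (auto simp: ZB_def)
    qed
    have "eventually (\<lambda>t. Re (\<gamma> t) \<ge> m \<and> Im (\<gamma> t) < 0) at_top"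
      using Re_top Im_top unfolding filterlim_at_top by (intro eventually_conj) blast+
    then obtain T1 where T1: "\<And>t. t \<ge> T1 \<Longrightarrow> Re (\<gamma> t) \<ge> m \<and> Im (\<gamma> t) < 0"
      by (auto simp: eventually_at_top_linorder)
    have "eventually (\<lambda>t. Re (\<gamma> t) \<ge> m \<and> Im (\<gamma> t) > 0) at_bot"
      using Re_bot Im_bot unfolding filterlim_at_top by (intro eventually_conj) blast+
    then obtain T2 where T2: "\<And>t. t \<le> T2 \<Longrightarrow> Re (\<gamma> t) \<ge> m \<and> Im (\<gamma> t) > 0"
      by (auto simp: eventually_at_bot_linorder)
    have "eventually (\<lambda>T. (T > 0 \<and> Re (h T) \<ge> m \<and> Re (h (-T)) \<ge> m \<and>
        norm (contour_integral (truncation h T) \<phi> - hankel \<Psi> s) < e / 3 \<and>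
        (\<forall>w\<in>ZB - {0}. winding_number (closed_truncation \<gamma> T) w = 0)) \<and> T \<ge> max T1 (- T2)) at_top"
      by (intro eventually_conj ev eventually_ge_at_top)
    then obtain T where T: "T > 0" "Re (h T) \<ge> m" "Re (h (-T)) \<ge> m"
        "norm (contour_integral (truncation h T) \<phi> - hankel \<Psi> s) < e / 3"
        "\<forall>w\<in>ZB - {0}. winding_number (closed_truncation \<gamma> T) w = 0" and T': "T \<ge> max T1 (- T2)"
      using eventually_happens'[OF trivial_limit_at_top_linorder] by blast
    have T1T: "T \<ge> T1" "- T \<le> T2" using T' by linarith+
    show ?thesis
    proof (intro exI[of _ T] conjI allI impI T(1))
      fix a b assume ab: "a \<le> - T" "b \<ge> T"
      have g: "\<gamma> t \<in> Rl" "Re (\<gamma> t) \<ge> m" if "t \<ge> T" for t using T1[of t] T1T m that B(1)[of t] by (auto simp: Rl_def)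
      have g': "\<gamma> t \<in> Ru" "Re (\<gamma> t) \<ge> m" if "t \<le> - T" for t using T2[of t] T1T m that B(1)[of t] by (auto simp: Ru_def)
      have hIm: "\<bar>Im (h t)\<bar> < B" for t
        using hankel_path_in_half_strip[OF \<delta>, of t] B(2) by (auto simp: h_def half_strip_def)
      have hs: "Im (h T) < 0" "Im (h (- T)) > 0" using T(1) \<delta> by (auto simp: h_def hankel_path_def arctan_minus)
      have hR: "h T \<in> Rl" "h (-T) \<in> Ru" using hIm[of T] hIm[of "-T"] hs T m by (auto simp: Rl_def Ru_def)
      have mid: "(f has_integral (contour_integral (truncation h T) \<phi> + (Gl (\<gamma> T) - Gl (h T)) - (Gu (\<gamma> (-T)) - Gu (h (-T))))) {-T..T}"
        unfolding f_def h_def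
      proof (rule hankel_loop_deform[OF hol\<phi> Z(1) pw avoid T(1) B(1) \<delta> B(2) Z(2)])
        show "X > 0" using X by simp
        show "Re (\<gamma> T) > X" "Re (\<gamma> (-T)) > X" "Im (\<gamma> T) < 0" "Im (\<gamma> (-T)) > 0"
          using g(1)[of T] g'(1)[of "-T"] by (auto simp: Rl_def Ru_def)
        show "Re (hankel_path \<delta> T) > X" "Re (hankel_path \<delta> (-T)) > X" using T m by (auto simp: h_def)
        show "winding_number (closed_truncation \<gamma> T) w = 0" if "w \<in> Z - {0}" "\<bar>Im w\<bar> < B" for w
          using T(5) that by (auto simp: ZB_def)
        show "Re w \<le> X" if "w \<in> Z" "\<bar>Im w\<bar> < B" for w using X(3)[of w] that by (auto simp: ZB_def)
      qed (use Gu Gl in \<open>simp_all add: Ru_def Rl_def\<close>)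
      have left: "(f has_integral (Gu (\<gamma> (-T)) - Gu (\<gamma> a))) {a..-T}"
        unfolding f_def using ab g' by (intro primitive_integral[OF _ Gu pw]) auto
      have right: "(f has_integral (Gl (\<gamma> b) - Gl (\<gamma> T))) {T..b}"
        unfolding f_def using ab g by (intro primitive_integral[OF _ Gl pw]) auto
      \<comment> \<open>The values of the primitives at the points \<gamma> T and \<gamma> (-T)
        cancel between the middle part and the tails.\<close>
      define I where "I = contour_integral (truncation h T) \<phi> + (Gu (h (-T)) - Gu (\<gamma> a)) + (Gl (\<gamma> b) - Gl (h T))"
      have "(f has_integral (Gu (\<gamma> (-T)) - Gu (\<gamma> a) +
          (contour_integral (truncation h T) \<phi> + (Gl (\<gamma> T) - Gl (h T)) - (Gu (\<gamma> (-T)) - Gu (h (-T)))) + (Gl (\<gamma> b) - Gl (\<gamma> T)))) {a..b}"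
        by (rule has_integral_combine[OF _ _ has_integral_combine[OF _ _ left mid] right]) (use ab T(1) in auto)
      then have "(f has_integral I) {a..b}" by (simp add: I_def algebra_simps)
      moreover have "norm (I - hankel \<Psi> s) < e"
      proof -
        have eqI: "I - hankel \<Psi> s = (contour_integral (truncation h T) \<phi> - hankel \<Psi> s) + (Gu (h (-T)) - Gu (\<gamma> a)) + (Gl (\<gamma> b) - Gl (h T))"
          by (simp add: I_def)
        have "norm (Gu (h (-T)) - Gu (\<gamma> a)) < e / 3"
          using decay_u[OF hR(2) g'(1)[OF ab(1)], of m] g'(2)[OF ab(1)] T(3) m(2) by linarith
        moreover have "norm (Gl (\<gamma> b) - Gl (h T)) < e / 3"
          using decay_l[OF g(1)[OF ab(2)] hR(1), of m] g(2)[OF ab(2)] T(2) m(2) by linarith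
        ultimately show ?thesis
          unfolding eqI using T(4) norm_triangle_ineq[of "contour_integral (truncation h T) \<phi> - hankel \<Psi> s" "Gu (h (-T)) - Gu (\<gamma> a)"]
            norm_triangle_ineq[of "(contour_integral (truncation h T) \<phi> - hankel \<Psi> s) + (Gu (h (-T)) - Gu (\<gamma> a))" "Gl (\<gamma> b) - Gl (h T)"]
          by linarith
      qed
      ultimately show "\<exists>I. (f has_integral I) {a..b} \<and> norm (I - hankel \<Psi> s) < e" by blast
    qed
  qed
  have "(f has_integral hankel \<Psi> s) UNIV"
    unfolding has_integral_alt'
  proof (intro conjI allI impI)
    fix a b :: real
    from main[OF zero_less_one] obtain T where T: "T > 0"
      "\<And>a b. a \<le> - T \<Longrightarrow> b \<ge> T \<Longrightarrow> \<exists>I. (f has_integral I) {a..b} \<and> norm (I - hankel \<Psi> s) < 1" by blast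
    have "f integrable_on {min a (-T)..max b T}" using T(2)[of "min a (-T)" "max b T"] by (auto simp: integrable_on_def)
    then have "f integrable_on cbox a b" unfolding cbox_interval by (rule integrable_on_subinterval) auto
    then show "(\<lambda>x. if x \<in> UNIV then f x else 0) integrable_on cbox a b" by simp
  next
    fix e :: real assume "e > 0"
    from main[OF this] obtain T where T: "T > 0"
      "\<And>a b. a \<le> - T \<Longrightarrow> b \<ge> T \<Longrightarrow> \<exists>I. (f has_integral I) {a..b} \<and> norm (I - hankel \<Psi> s) < e" by blast
    show "\<exists>B>0. \<forall>a b. ball 0 B \<subseteq> cbox a b \<longrightarrow> norm (integral (cbox a b) (\<lambda>x. if x \<in> UNIV then f x else 0) - hankel \<Psi> s) < e"
    proof (intro exI[of _ "T + 1"] conjI allI impI)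
      fix a b :: real assume sub: "ball 0 (T + 1) \<subseteq> cbox a b"
      have "T \<in> ball 0 (T + 1)" "- T \<in> ball 0 (T + 1)" using T(1) by (auto simp: dist_norm)
      then have "T \<in> cbox a b" "- T \<in> cbox a b" using sub by blast+
      then have "a \<le> - T" "b \<ge> T" by auto
      from T(2)[OF this] show "norm (integral (cbox a b) (\<lambda>x. if x \<in> UNIV then f x else 0) - hankel \<Psi> s) < e"
        by (auto simp: integral_unique)
    qed (use T(1) in auto)
  qed
  then show ?thesis unfolding loop_integral_def f_def \<phi>_def by (rule integral_unique)
qed

section \<open>Kernels of Hurwitz and Barnes type\<close>

lemma kernelI_poly:
  assumes "\<delta> > 0" "\<eta> > 0" "C \<ge> 0" and hol: "\<Psi> holomorphic_on (half_strip \<delta> - {0})"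
    and bd: "\<And>u. u \<in> half_strip \<delta> \<Longrightarrow> u \<noteq> 0 \<Longrightarrow> norm (\<Psi> u) * norm u ^ p \<le> C * (1 + norm u) ^ n * exp (- \<eta> * Re u)"
  shows "\<exists>C'. kernel_on p \<delta> (\<eta> / 2) C' \<Psi>"
proof
  \<comment> \<open>Chosen so that n \<theta> <= \<eta> / 2: the n-th power of 1 + |u| then grows
    more slowly than half of the decay. The + 1 covers n = 0.\<close>
  define \<theta> where "\<theta> = \<eta> / (2 * (real n + 1))"
  have \<theta>: "\<theta> > 0" "real n * \<theta> \<le> \<eta> / 2"
    using assms(2) by (auto simp: \<theta>_def field_simps)
  define C' where "C' = C * (1 / \<theta>) ^ n * exp (\<eta> / 2 * (1 + 3 * \<delta>))"
  show "kernel_on p \<delta> (\<eta> / 2) C' \<Psi>"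
    unfolding kernel_on_def
  proof (intro conjI ballI hol assms(1))
    fix u assume u: "u \<in> half_strip \<delta> - {0}"
    have nu: "norm u \<le> Re u + 3 * \<delta>" using cmod_le[of u] u by (auto simp: half_strip_def)
    have "\<theta> * (1 + norm u) \<le> exp (\<theta> * (1 + norm u))"
      using exp_ge_add_one_self[of "\<theta> * (1 + norm u)"] by linarith
    then have "1 + norm u \<le> (1 / \<theta>) * exp (\<theta> * (1 + norm u))" using \<theta> by (simp add: field_simps)
    then have "(1 + norm u) ^ n \<le> ((1 / \<theta>) * exp (\<theta> * (1 + norm u))) ^ n"
      by (intro power_mono) auto
    also have "\<dots> = (1 / \<theta>) ^ n * exp (real n * \<theta> * (1 + norm u))"
      unfolding power_mult_distrib exp_of_nat_mult [symmetric] by (simp add: mult_ac)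
    also have "\<dots> \<le> (1 / \<theta>) ^ n * exp (\<eta> / 2 * (1 + norm u))"
    proof (rule mult_left_mono)
      show "exp (real n * \<theta> * (1 + norm u)) \<le> exp (\<eta> / 2 * (1 + norm u))"
        unfolding exp_le_cancel_iff using \<theta>(2) by (rule mult_right_mono) simp
    qed (use \<theta> in simp)
    also have "\<dots> \<le> (1 / \<theta>) ^ n * exp (\<eta> / 2 * (1 + (Re u + 3 * \<delta>)))"
      using \<theta> nu assms(2) by (intro mult_left_mono) auto
    finally have 1: "(1 + norm u) ^ n \<le> (1 / \<theta>) ^ n * exp (\<eta> / 2 * (1 + (Re u + 3 * \<delta>)))" .
    have "norm (\<Psi> u) * norm u ^ p \<le> C * (1 + norm u) ^ n * exp (- \<eta> * Re u)" using bd u by auto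
    also have "\<dots> \<le> C * ((1 / \<theta>) ^ n * exp (\<eta> / 2 * (1 + (Re u + 3 * \<delta>)))) * exp (- \<eta> * Re u)"
      using 1 assms(3) by (intro mult_right_mono mult_left_mono) auto
    also have "\<dots> = C' * (exp (\<eta> / 2 * Re u) * exp (- \<eta> * Re u))"
      by (simp add: C'_def distrib_left exp_add)
    also have "exp (\<eta> / 2 * Re u) * exp (- \<eta> * Re u) = exp (- (\<eta> / 2) * Re u)"
      by (simp add: exp_add [symmetric])
    finally show "norm (\<Psi> u) \<le> C' * exp (- (\<eta> / 2) * Re u) / norm u ^ p"
      using u by (simp add: pos_le_divide_eq)
  qed (use assms in auto)
qed

text \<open>This splits off the simple zero of 1 - exp(-u \<alpha>) at the origin; the remaining
  factor has an inverse that is bounded near 0.\<close>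

definition exp_quot :: "complex \<Rightarrow> complex \<Rightarrow> complex" where
  "exp_quot \<alpha> u = (if u = 0 then \<alpha> else (1 - exp (- u * \<alpha>)) / u)"

lemma holomorphic_exp_quot: "exp_quot \<alpha> holomorphic_on UNIV"
proof -
  have "(\<lambda>u. if u = 0 then deriv (\<lambda>u. - exp (- u * \<alpha>)) 0 else (- exp (- u * \<alpha>) - - exp (- 0 * \<alpha>)) / (u - 0)) holomorphic_on UNIV"
    by (rule pole_lemma_open) (auto intro!: holomorphic_intros)
  moreover have "deriv (\<lambda>u. - exp (- u * \<alpha>)) 0 = \<alpha>"
    by (rule DERIV_imp_deriv) (auto intro!: derivative_eq_intros)
  ultimately have "(\<lambda>u. if u = 0 then \<alpha> else (- exp (- u * \<alpha>) - - exp (- 0 * \<alpha>)) / (u - 0)) holomorphic_on UNIV"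
    by (simp only:)
  then show ?thesis by (rule holomorphic_transform) (simp add: exp_quot_def)
qed

lemma exp_eq_1_imp_Im:
  assumes "exp (- u * \<alpha>) = 1" "u \<noteq> 0" "Re \<alpha> > 0"
  shows "\<bar>Im u\<bar> \<ge> 2 * pi * Re \<alpha> / (norm \<alpha>)\<^sup>2"
    and "\<exists>n::int. u = 2 * of_int n * of_real pi * \<i> / \<alpha> \<and> \<bar>Im u\<bar> = \<bar>of_int n\<bar> * (2 * pi * Re \<alpha> / (norm \<alpha>)\<^sup>2)"
proof -
  have \<alpha>: "\<alpha> \<noteq> 0" using assms by auto
  obtain m :: int where m: "- u * \<alpha> = of_int (2 * m) * pi * \<i>"
    using assms(1) unfolding exp_eq_1 by (auto simp: complex_eq_iff)
  then have u: "u = 2 * of_int (- m) * of_real pi * \<i> / \<alpha>"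
    using \<alpha> by (simp add: field_simps) (metis minus_minus)
  have "\<i> / \<alpha> = \<i> * cnj \<alpha> / (norm \<alpha>)\<^sup>2"
    by (simp add: complex_div_cnj[of \<i> \<alpha>])
  then have "Im (\<i> / \<alpha>) = Re \<alpha> / (norm \<alpha>)\<^sup>2" by (simp add: Im_divide_of_real)
  moreover have "u = of_real (2 * of_int (- m) * pi) * (\<i> / \<alpha>)" by (simp add: u)
  ultimately have "Im u = 2 * of_int (- m) * pi * (Re \<alpha> / (norm \<alpha>)\<^sup>2)"
    by (metis Im_complex_of_real Re_complex_of_real add_0 mult_zero_left times_complex.simps(2) add.right_neutral)
  then have Im: "\<bar>Im u\<bar> = \<bar>of_int (- m)\<bar> * (2 * pi * Re \<alpha> / (norm \<alpha>)\<^sup>2)"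
    using assms by (simp add: abs_mult)
  have "m \<noteq> 0" using u assms by auto
  then have "\<bar>real_of_int (- m)\<bar> \<ge> 1" by linarith
  then have "1 * (2 * pi * Re \<alpha> / (norm \<alpha>)\<^sup>2) \<le> \<bar>of_int (- m)\<bar> * (2 * pi * Re \<alpha> / (norm \<alpha>)\<^sup>2)"
    using assms by (intro mult_right_mono) auto
  with Im show "\<bar>Im u\<bar> \<ge> 2 * pi * Re \<alpha> / (norm \<alpha>)\<^sup>2" by simp
  show "\<exists>n::int. u = 2 * of_int n * of_real pi * \<i> / \<alpha> \<and> \<bar>Im u\<bar> = \<bar>of_int n\<bar> * (2 * pi * Re \<alpha> / (norm \<alpha>)\<^sup>2)"
    using u Im by blast
qed

text \<open>The nonzero zeros \<open>2\<pi>in / \<alpha>\<close> of \<open>1 - exp (-u\<alpha>)\<close> have \<open>\<bar>Im u\<bar> = 2\<pi>\<bar>n\<bar> Re \<alpha> / \<bar>\<alpha>\<bar>\<^sup>2\<close>.\<close>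

definition zero_free :: "complex \<Rightarrow> real \<Rightarrow> bool" where
  "zero_free \<alpha> \<delta> \<longleftrightarrow> \<delta> < 2 * pi * Re \<alpha> / (norm \<alpha>)\<^sup>2"

lemma zero_freeD:
  assumes "zero_free \<alpha> \<delta>" "Re \<alpha> > 0" "u \<noteq> 0" "\<bar>Im u\<bar> \<le> \<delta>"
  shows "exp (- u * \<alpha>) \<noteq> 1"
  using exp_eq_1_imp_Im(1)[of u \<alpha>] assms by (auto simp: zero_free_def)

lemma exp_quot_nonzero:
  assumes "zero_free \<alpha> \<delta>" "Re \<alpha> > 0" "\<bar>Im u\<bar> \<le> \<delta>"
  shows "exp_quot \<alpha> u \<noteq> 0"
  using zero_freeD[OF assms(1,2) _ assms(3)] assms(2) by (auto simp: exp_quot_def)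

text \<open>The threshold forces Re (u \<alpha>) >= 1 although \<alpha> may be far from real, and
  exp(-1) is at most 1/2.\<close>

lemma exp_decay_half:
  assumes "Re \<alpha> > 0" "Re u \<ge> (B * \<bar>Im \<alpha>\<bar> + 1) / Re \<alpha>" "\<bar>Im u\<bar> \<le> B"
  shows "norm (1 - exp (- u * \<alpha>)) \<ge> 1 / 2"
proof -
  have "B * \<bar>Im \<alpha>\<bar> + 1 \<le> Re u * Re \<alpha>" using assms by (simp add: field_simps)
  moreover have "\<bar>Im u * Im \<alpha>\<bar> \<le> B * \<bar>Im \<alpha>\<bar>" using assms unfolding abs_mult by (intro mult_right_mono) auto
  ultimately have "Re (- u * \<alpha>) \<le> - 1" by simp
  then have "norm (exp (- u * \<alpha>)) \<le> exp (- 1)" by simp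
  also have "\<dots> \<le> 1 / 2"
    using exp_ge_add_one_self[of 1] by (simp add: exp_minus field_simps)
  finally have "norm (exp (- u * \<alpha>)) \<le> 1 / 2" .
  moreover have "norm (1::complex) \<le> norm (1 - exp (- u * \<alpha>)) + norm (exp (- u * \<alpha>))"
    by (metis diff_add_cancel norm_triangle_ineq)
  ultimately show ?thesis by simp
qed

text \<open>Left of X a closed rectangle is compact, and the strict inequality in
  \<open>zero_free\<close> excludes zeros on its horizontal edges as well. Right of X the
  exponential is at most 1/2 and the factor u causes the linear growth.\<close>

lemma exp_quot_bound:
  assumes "zero_free \<alpha> \<delta>" "Re \<alpha> > 0" "\<delta> > 0"
  shows "\<exists>C\<ge>0. \<forall>u\<in>half_strip \<delta>. norm (inverse (exp_quot \<alpha> u)) \<le> C * (1 + norm u)"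
proof -
  define X where "X = (\<delta> * \<bar>Im \<alpha>\<bar> + 1) / Re \<alpha>"
  define R where "R = cbox (Complex (- \<delta>) (- \<delta>)) (Complex X \<delta>)"
  have "continuous_on R (\<lambda>u. inverse (exp_quot \<alpha> u))"
    using exp_quot_nonzero[OF assms(1,2)]
    by (intro continuous_intros holomorphic_on_imp_continuous_on holomorphic_on_subset[OF holomorphic_exp_quot])
      (auto simp: R_def in_cbox_complex_iff)
  then have "bounded ((\<lambda>u. inverse (exp_quot \<alpha> u)) ` R)"
    by (intro compact_imp_bounded compact_continuous_image) (auto simp: R_def)
  then obtain C where C: "\<And>u. u \<in> R \<Longrightarrow> norm (inverse (exp_quot \<alpha> u)) \<le> C" by (auto simp: bounded_iff)
  show ?thesis
  proof (intro exI[of _ "max 2 C"] conjI ballI)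
    fix u assume u: "u \<in> half_strip \<delta>"
    show "norm (inverse (exp_quot \<alpha> u)) \<le> max 2 C * (1 + norm u)"
    proof (cases "Re u \<le> X")
      case True
      then have "norm (inverse (exp_quot \<alpha> u)) \<le> max 2 C"
        using u C[of u] by (auto simp: R_def in_cbox_complex_iff half_strip_def abs_less_iff)
      also have "max 2 C * 1 \<le> max 2 C * (1 + norm u)" by (intro mult_left_mono) auto
      finally show ?thesis by simp
    next
      case False
      have "X > 0" using assms by (auto simp: X_def intro!: divide_pos_pos add_nonneg_pos)
      then have u0: "u \<noteq> 0" using False by auto
      have "norm (1 - exp (- u * \<alpha>)) \<ge> 1 / 2"
        by (rule exp_decay_half[where B = \<delta>]) (use assms False u in \<open>auto simp: X_def half_strip_def\<close>)
      then have "norm u / norm (1 - exp (- u * \<alpha>)) \<le> norm u / (1 / 2)"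
        by (intro divide_left_mono mult_pos_pos) auto
      also have "\<dots> \<le> max 2 C * (1 + norm u)"
      proof -
        have "norm u / (1/2) = 2 * norm u" by simp
        also have "\<dots> \<le> max 2 C * (1 + norm u)" by (intro mult_mono) auto
        finally show ?thesis .
      qed
      finally show ?thesis using u0 by (simp add: exp_quot_def norm_divide norm_inverse)
    qed
  qed auto
qed

text \<open>For Re (u \<alpha>) > 0 this is the geometric series of exp(-u (w + n \<alpha>)) over n
  >= 0; the Barnes kernel is the same with two generators.\<close>

definition hurwitz_kernel :: "complex \<Rightarrow> complex \<Rightarrow> complex \<Rightarrow> complex" where
  "hurwitz_kernel w \<alpha> u = exp (- u * w) / (1 - exp (- u * \<alpha>))"

definition barnes_kernel :: "complex \<Rightarrow> complex \<Rightarrow> complex \<Rightarrow> complex \<Rightarrow> complex" where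
  "barnes_kernel w \<alpha> \<beta> u = exp (- u * w) / ((1 - exp (- u * \<alpha>)) * (1 - exp (- u * \<beta>)))"

lemma exp_mult_bound:
  assumes "u \<in> half_strip \<delta>"
  shows "norm (exp (- u * w)) \<le> exp (\<delta> * \<bar>Im w\<bar>) * exp (- Re w * Re u)"
proof -
  have "\<bar>Im u * Im w\<bar> \<le> \<delta> * \<bar>Im w\<bar>"
    using assms unfolding abs_mult by (intro mult_right_mono) (auto simp: half_strip_def)
  then have "Re (- u * w) \<le> \<delta> * \<bar>Im w\<bar> + - Re w * Re u" by simp
  then show ?thesis by (simp add: exp_add [symmetric])
qed

lemma kernel_on_hurwitz:
  assumes "zero_free \<alpha> \<delta>" "Re \<alpha> > 0" "\<delta> > 0" "Re w > 0"
  shows "\<exists>C. kernel_on 1 \<delta> (Re w / 2) C (hurwitz_kernel w \<alpha>)"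
proof -
  obtain C where C: "C \<ge> 0" "\<And>u. u \<in> half_strip \<delta> \<Longrightarrow> norm (inverse (exp_quot \<alpha> u)) \<le> C * (1 + norm u)"
    using exp_quot_bound[OF assms(1-3)] by blast
  show ?thesis
  proof (rule kernelI_poly[where n = 1 and C = "exp (\<delta> * \<bar>Im w\<bar>) * C"])
    have nz: "1 - exp (- u * \<alpha>) \<noteq> 0" if "u \<in> half_strip \<delta> - {0}" for u
      using zero_freeD[OF assms(1,2), of u] that by (auto simp: half_strip_def)
    then show "hurwitz_kernel w \<alpha> holomorphic_on half_strip \<delta> - {0}"
      unfolding hurwitz_kernel_def[abs_def] by (intro holomorphic_intros) blast
    fix u assume u: "u \<in> half_strip \<delta>" "u \<noteq> 0"
    have "norm (hurwitz_kernel w \<alpha> u) * norm u ^ 1 = norm (exp (- u * w)) * norm (inverse (exp_quot \<alpha> u))"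
      using u by (simp add: hurwitz_kernel_def exp_quot_def norm_divide norm_mult norm_inverse)
    also have "\<dots> \<le> (exp (\<delta> * \<bar>Im w\<bar>) * exp (- Re w * Re u)) * (C * (1 + norm u))"
      using exp_mult_bound[OF u(1)] C(2)[OF u(1)] by (intro mult_mono) auto
    finally show "norm (hurwitz_kernel w \<alpha> u) * norm u ^ 1 \<le> exp (\<delta> * \<bar>Im w\<bar>) * C * (1 + norm u) ^ 1 * exp (- Re w * Re u)"
      by (simp add: mult_ac)
  qed (use assms C in auto)
qed

lemma kernel_on_barnes:
  assumes "zero_free \<alpha> \<delta>" "zero_free \<beta> \<delta>" "Re \<alpha> > 0" "Re \<beta> > 0" "\<delta> > 0" "Re w > 0"
  shows "\<exists>C. kernel_on 2 \<delta> (Re w / 2) C (barnes_kernel w \<alpha> \<beta>)"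
proof -
  obtain C where C: "C \<ge> 0" "\<And>u. u \<in> half_strip \<delta> \<Longrightarrow> norm (inverse (exp_quot \<alpha> u)) \<le> C * (1 + norm u)"
    using exp_quot_bound[of \<alpha> \<delta>] assms by blast
  obtain C' where C': "C' \<ge> 0" "\<And>u. u \<in> half_strip \<delta> \<Longrightarrow> norm (inverse (exp_quot \<beta> u)) \<le> C' * (1 + norm u)"
    using exp_quot_bound[of \<beta> \<delta>] assms by blast
  show ?thesis
  proof (rule kernelI_poly[where n = 2 and C = "exp (\<delta> * \<bar>Im w\<bar>) * C * C'"])
    have nz: "(1 - exp (- u * \<alpha>)) * (1 - exp (- u * \<beta>)) \<noteq> 0" if "u \<in> half_strip \<delta> - {0}" for u
      using zero_freeD[of \<alpha> \<delta> u] zero_freeD[of \<beta> \<delta> u] assms that by (auto simp: half_strip_def)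
    then show "barnes_kernel w \<alpha> \<beta> holomorphic_on half_strip \<delta> - {0}"
      unfolding barnes_kernel_def[abs_def] by (intro holomorphic_intros) blast
    fix u assume u: "u \<in> half_strip \<delta>" "u \<noteq> 0"
    have "norm (barnes_kernel w \<alpha> \<beta> u) * norm u ^ 2 = norm (exp (- u * w)) * norm (inverse (exp_quot \<alpha> u)) * norm (inverse (exp_quot \<beta> u))"
      using u by (simp add: barnes_kernel_def exp_quot_def norm_divide norm_mult norm_inverse power2_eq_square)
    also have "\<dots> \<le> (exp (\<delta> * \<bar>Im w\<bar>) * exp (- Re w * Re u)) * (C * (1 + norm u)) * (C' * (1 + norm u))"
      using exp_mult_bound[OF u(1)] C(2)[OF u(1)] C'(2)[OF u(1)] C(1) by (intro mult_mono) auto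
    finally show "norm (barnes_kernel w \<alpha> \<beta> u) * norm u ^ 2 \<le> exp (\<delta> * \<bar>Im w\<bar>) * C * C' * (1 + norm u) ^ 2 * exp (- Re w * Re u)"
      by (simp add: mult_ac power2_eq_square)
  qed (use assms C C' in auto)
qed

lemma zero_free_exists:
  assumes "Re \<alpha> > 0" "Re \<beta> > 0"
  shows "\<exists>\<delta>>0. zero_free \<alpha> \<delta> \<and> zero_free \<beta> \<delta>"
proof -
  have "2 * pi * Re \<gamma> / (norm \<gamma>)\<^sup>2 > 0" if "Re \<gamma> > 0" for \<gamma>
    using that by (auto intro!: divide_pos_pos)
  then have "min (2 * pi * Re \<alpha> / (norm \<alpha>)\<^sup>2) (2 * pi * Re \<beta> / (norm \<beta>)\<^sup>2) > 0"
    using assms by simp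
  then obtain \<delta> where "0 < \<delta>" "\<delta> < min (2 * pi * Re \<alpha> / (norm \<alpha>)\<^sup>2) (2 * pi * Re \<beta> / (norm \<beta>)\<^sup>2)"
    using dense by blast
  then show ?thesis by (auto simp: zero_free_def)
qed

lemma kernel_hurwitz: "Re \<alpha> > 0 \<Longrightarrow> Re w > 0 \<Longrightarrow> kernel 1 (hurwitz_kernel w \<alpha>)"
  unfolding kernel_def using kernel_on_hurwitz zero_free_exists by meson

lemma kernel_barnes: "Re \<alpha> > 0 \<Longrightarrow> Re \<beta> > 0 \<Longrightarrow> Re w > 0 \<Longrightarrow> kernel 2 (barnes_kernel w \<alpha> \<beta>)"
  unfolding kernel_def using kernel_on_barnes zero_free_exists by meson

section \<open>The double pole of the Barnes kernel\<close>

lemma kernel_exp_over_square: "kernel 2 (\<lambda>u. exp (- u) / u ^ 2)"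
proof -
  have "\<exists>C'. kernel_on 2 1 (1 / 2) C' (\<lambda>u. exp (- u) / u ^ 2)"
    by (rule kernelI_poly[where n = 0 and C = 1]) (auto intro!: holomorphic_intros simp: norm_divide norm_power)
  then show ?thesis by (auto simp: kernel_def)
qed

text \<open>At 0 the Barnes kernel behaves like 1 / (\<alpha> \<beta> u^2). Subtracting that
  multiple of exp(-u) / u^2, which has the same double pole and still decays, leaves a pole of order
  at most 1.\<close>

lemma kernel_barnes_minus_pole:
  assumes "Re \<alpha> > 0" "Re \<beta> > 0" "Re w > 0"
  shows "kernel 1 (\<lambda>u. barnes_kernel w \<alpha> \<beta> u + (- (1 / (\<alpha> * \<beta>))) * (exp (- u) / u ^ 2))"
proof -
  obtain \<delta> where \<delta>: "\<delta> > 0" "zero_free \<alpha> \<delta>" "zero_free \<beta> \<delta>" using zero_free_exists assms by blast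
  obtain C where C: "C \<ge> 0" "\<And>u. u \<in> half_strip \<delta> \<Longrightarrow> norm (inverse (exp_quot \<alpha> u)) \<le> C * (1 + norm u)"
    using exp_quot_bound[of \<alpha> \<delta>] assms \<delta> by blast
  obtain C' where C': "C' \<ge> 0" "\<And>u. u \<in> half_strip \<delta> \<Longrightarrow> norm (inverse (exp_quot \<beta> u)) \<le> C' * (1 + norm u)"
    using exp_quot_bound[of \<beta> \<delta>] assms \<delta> by blast
  \<comment> \<open>N is u^2 times the difference. It vanishes at 0, so one factor u can be divided
    out, which gives M below.\<close>
  define N where "N = (\<lambda>u. exp (- u * w) * inverse (exp_quot \<alpha> u) * inverse (exp_quot \<beta> u) - exp (- u) / (\<alpha> * \<beta>))"
  have holN: "N holomorphic_on half_strip \<delta>"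
  proof -
    have "exp_quot \<alpha> u \<noteq> 0" "exp_quot \<beta> u \<noteq> 0" if "u \<in> half_strip \<delta>" for u
      using exp_quot_nonzero[of \<alpha> \<delta> u] exp_quot_nonzero[of \<beta> \<delta> u] assms \<delta> that by (auto simp: half_strip_def)
    moreover have "\<alpha> * \<beta> \<noteq> 0" using assms by auto
    ultimately show ?thesis
      unfolding N_def by (intro holomorphic_intros holomorphic_on_subset[OF holomorphic_exp_quot]) auto
  qed
  have N0: "N 0 = 0" by (simp add: N_def exp_quot_def field_simps)
  define M where "M = (\<lambda>u. if u = 0 then deriv N 0 else (N u - N 0) / (u - 0))"
  have holM: "M holomorphic_on half_strip \<delta>"
    unfolding M_def by (rule pole_lemma_open[OF holN open_half_strip])
  define \<eta> where "\<eta> = min 1 (Re w)"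
  have \<eta>: "\<eta> > 0" "\<eta> \<le> 1" "\<eta> \<le> Re w" using assms by (auto simp: \<eta>_def)
  \<comment> \<open>The two terms decay at the different rates Re w and 1. Both are reduced to the
    smaller rate \<eta>; the factor exp(c \<delta>) pays for the part of the half-strip with
    negative real part, where the faster exponential is the larger one.\<close>
  have exp_mono: "exp (- c * x) \<le> exp (c * \<delta>) * exp (- \<eta> * x)" if "x > - \<delta>" "c \<ge> \<eta>" for c x
  proof -
    have "(c - \<eta>) * (- x) \<le> (c - \<eta>) * \<delta>" using that by (intro mult_left_mono) auto
    also have "\<dots> \<le> c * \<delta>" using \<eta> \<delta> by (intro mult_right_mono) auto
    finally have "- c * x \<le> c * \<delta> + - \<eta> * x" by (simp add: algebra_simps)
    then show ?thesis by (simp add: exp_add [symmetric])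
  qed
  define A where "A = exp (\<delta> * \<bar>Im w\<bar>) * C * C' * exp (Re w * \<delta>) + norm (1 / (\<alpha> * \<beta>)) * exp (1 * \<delta>)"
  have A: "A \<ge> 0" using C C' by (simp add: A_def)
  have N_bd: "norm (N u) \<le> A * (1 + norm u) ^ 2 * exp (- \<eta> * Re u)" if u: "u \<in> half_strip \<delta>" for u
  proof -
    have re: "Re u > - \<delta>" using u by (simp add: half_strip_def)
    have "norm (exp (- u * w) * inverse (exp_quot \<alpha> u) * inverse (exp_quot \<beta> u))
        \<le> (exp (\<delta> * \<bar>Im w\<bar>) * exp (- Re w * Re u)) * (C * (1 + norm u)) * (C' * (1 + norm u))"
      unfolding norm_mult using exp_mult_bound[OF u, of w] C(2)[OF u] C'(2)[OF u] C(1) by (intro mult_mono) auto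
    also have "\<dots> \<le> (exp (\<delta> * \<bar>Im w\<bar>) * (exp (Re w * \<delta>) * exp (- \<eta> * Re u))) * (C * (1 + norm u)) * (C' * (1 + norm u))"
      using exp_mono[OF re \<eta>(3)] C C' by (intro mult_right_mono mult_left_mono) auto
    finally have 1: "norm (exp (- u * w) * inverse (exp_quot \<alpha> u) * inverse (exp_quot \<beta> u))
      \<le> (exp (\<delta> * \<bar>Im w\<bar>) * C * C' * exp (Re w * \<delta>)) * (1 + norm u) ^ 2 * exp (- \<eta> * Re u)"
      by (simp add: power2_eq_square mult_ac)
    have "norm (exp (- u) / (\<alpha> * \<beta>)) = norm (1 / (\<alpha> * \<beta>)) * exp (- 1 * Re u)" by (simp add: norm_divide norm_mult)
    also have "\<dots> \<le> norm (1 / (\<alpha> * \<beta>)) * (exp (1 * \<delta>) * exp (- \<eta> * Re u))"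
      using exp_mono[OF re \<eta>(2)] by (intro mult_left_mono) auto
    also have "\<dots> \<le> norm (1 / (\<alpha> * \<beta>)) * (exp (1 * \<delta>) * exp (- \<eta> * Re u)) * (1 + norm u) ^ 2"
      using mult_left_mono[of 1 "(1 + norm u) ^ 2" "norm (1 / (\<alpha> * \<beta>)) * (exp (1 * \<delta>) * exp (- \<eta> * Re u))"]
      by (simp only: mult_1_right) (simp add: one_le_power)
    finally have 2: "norm (exp (- u) / (\<alpha> * \<beta>)) \<le> (norm (1 / (\<alpha> * \<beta>)) * exp (1 * \<delta>)) * (1 + norm u) ^ 2 * exp (- \<eta> * Re u)"
      by (simp add: mult_ac)
    have "norm (N u) \<le> norm (exp (- u * w) * inverse (exp_quot \<alpha> u) * inverse (exp_quot \<beta> u)) + norm (exp (- u) / (\<alpha> * \<beta>))"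
      unfolding N_def by (rule norm_triangle_ineq4)
    also have "\<dots> \<le> A * (1 + norm u) ^ 2 * exp (- \<eta> * Re u)"
      using add_mono[OF 1 2] by (simp add: A_def distrib_right)
    finally show ?thesis .
  qed
  \<comment> \<open>M is bounded by compactness on the disc of radius r, and off that disc dividing
    by u costs at most 1 / r.\<close>
  define r where "r = \<delta> / 2"
  have r: "r > 0" "cball 0 r \<subseteq> half_strip \<delta>"
  proof -
    show "r > 0" using \<delta> by (simp add: r_def)
    show "cball 0 r \<subseteq> half_strip \<delta>"
    proof
      fix u :: complex assume "u \<in> cball 0 r"
      then have "\<bar>Im u\<bar> \<le> r" "\<bar>Re u\<bar> \<le> r" using abs_Im_le_cmod[of u] abs_Re_le_cmod[of u] by auto
      then show "u \<in> half_strip \<delta>" using \<delta>(1) unfolding half_strip_def r_def mem_Collect_eq by linarith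
    qed
  qed
  have "bounded (M ` cball 0 r)"
    by (intro compact_imp_bounded compact_continuous_image holomorphic_on_imp_continuous_on holomorphic_on_subset[OF holM] r) auto
  then obtain C0 where C0: "\<And>u. u \<in> cball 0 r \<Longrightarrow> norm (M u) \<le> C0" unfolding bounded_iff by blast
  define A' where "A' = max 0 C0 * exp (\<eta> * r) + A / r"
  have M_bd: "norm (M u) \<le> A' * (1 + norm u) ^ 2 * exp (- \<eta> * Re u)" if u: "u \<in> half_strip \<delta>" for u
  proof (cases "norm u \<le> r")
    case True
    have "exp (\<eta> * r) * exp (- \<eta> * Re u) = exp (\<eta> * (r - Re u))" by (simp add: exp_add [symmetric] algebra_simps)
    moreover have "Re u \<le> r" using True complex_Re_le_cmod[of u] by linarith
    ultimately have e: "1 \<le> exp (\<eta> * r) * exp (- \<eta> * Re u)" using \<eta> by simp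
    have "norm (M u) \<le> max 0 C0 * 1 * 1" using C0[of u] True by (simp add: dist_norm)
    also have "\<dots> \<le> max 0 C0 * (1 + norm u) ^ 2 * (exp (\<eta> * r) * exp (- \<eta> * Re u))"
      using e by (intro mult_mono) (auto intro!: mult_nonneg_nonneg)
    also have "\<dots> = (max 0 C0 * exp (\<eta> * r)) * (1 + norm u) ^ 2 * exp (- \<eta> * Re u)"
      by (simp only: mult_ac)
    also have "\<dots> \<le> A' * (1 + norm u) ^ 2 * exp (- \<eta> * Re u)"
      using A r by (intro mult_right_mono) (auto simp: A'_def)
    finally show ?thesis .
  next
    case False
    then have u0: "u \<noteq> 0" using r by auto
    have "norm (M u) = norm (N u) / norm u" using u0 N0 by (simp add: M_def norm_divide)
    also have "\<dots> \<le> norm (N u) / r" using False r by (intro divide_left_mono mult_pos_pos) auto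
    also have "\<dots> \<le> (A * (1 + norm u) ^ 2 * exp (- \<eta> * Re u)) / r"
      using N_bd[OF u] r by (intro divide_right_mono) auto
    also have "\<dots> = (A / r) * (1 + norm u) ^ 2 * exp (- \<eta> * Re u)"
      by simp
    also have "\<dots> \<le> A' * (1 + norm u) ^ 2 * exp (- \<eta> * Re u)"
      by (intro mult_right_mono) (auto simp: A'_def)
    finally show ?thesis .
  qed
  let ?\<Psi> = "\<lambda>u. barnes_kernel w \<alpha> \<beta> u + (- (1 / (\<alpha> * \<beta>))) * (exp (- u) / u ^ 2)"
  have eq: "?\<Psi> u = M u / u" if "u \<noteq> 0" for u
  proof -
    have gen: "E / (A * B) + (- (1 / c)) * (E' / u ^ 2) = (E * inverse (A / u) * inverse (B / u) - E' / c - 0) / (u - 0) / u"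
      for E A B c E' :: complex
      using that by (simp add: inverse_eq_divide power2_eq_square diff_divide_distrib)
    show ?thesis
      using that unfolding M_def N0 by (simp only: if_False N_def barnes_kernel_def exp_quot_def gen)
  qed
  have "\<exists>C. kernel_on 1 \<delta> (\<eta> / 2) C ?\<Psi>"
  proof (rule kernelI_poly[where n = 2 and C = A'])
    have "(\<lambda>u. M u / u) holomorphic_on half_strip \<delta> - {0}"
      by (intro holomorphic_intros holomorphic_on_subset[OF holM]) auto
    then show "?\<Psi> holomorphic_on half_strip \<delta> - {0}"
      by (rule holomorphic_transform) (use eq in auto)
    fix u assume u: "u \<in> half_strip \<delta>" "u \<noteq> 0"
    then show "norm (?\<Psi> u) * norm u ^ 1 \<le> A' * (1 + norm u) ^ 2 * exp (- \<eta> * Re u)"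
      unfolding eq[OF u(2)] using M_bd[OF u(1)] by (simp add: norm_divide)
  qed (use \<delta> \<eta> A r in \<open>auto simp: A'_def\<close>)
  then show ?thesis by (auto simp: kernel_def)
qed

text \<open>The difference kernel has order 1, so its transform vanishes at 2. The remaining
  constant is never evaluated: it suffices that it is the same for all kernels and that w does not
  enter.\<close>

lemma hankel_barnes_at_2:
  assumes "Re \<alpha> > 0" "Re \<beta> > 0" "Re w > 0"
  shows "hankel (barnes_kernel w \<alpha> \<beta>) 2 = hankel (\<lambda>u. exp (- u) / u ^ 2) 2 / (\<alpha> * \<beta>)"
proof -
  have "hankel (\<lambda>u. barnes_kernel w \<alpha> \<beta> u + (- (1 / (\<alpha> * \<beta>))) * (exp (- u) / u ^ 2)) 2 = 0"
    using hankel_of_int_eq_0[OF kernel_barnes_minus_pole[OF assms], of 2] by simp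
  then show ?thesis
    using hankel_add_mult[OF kernel_barnes[OF assms] kernel_exp_over_square, of "- (1 / (\<alpha> * \<beta>))" 2] by simp
qed

lemma barnes_loop_integral:
  assumes \<alpha>: "Re \<alpha> > 0" and \<beta>: "Re \<beta> > 0" and w: "Re w > 0"
    and loop: "hankel_loop {u. (1 - exp (- u * \<alpha>)) * (1 - exp (- u * \<beta>)) = 0} \<gamma>"
  shows "loop_integral \<gamma> (\<lambda>u. cpow_2pi u (s - 1) * barnes_kernel w \<alpha> \<beta> u) = hankel (barnes_kernel w \<alpha> \<beta>) s"
proof -
  define Z where "Z = {u. (1 - exp (- u * \<alpha>)) * (1 - exp (- u * \<beta>)) = 0}"
  obtain \<delta> where \<delta>: "\<delta> > 0" "zero_free \<alpha> \<delta>" "zero_free \<beta> \<delta>" using zero_free_exists \<alpha> \<beta> by blast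
  obtain C where ker: "kernel_on 2 \<delta> (Re w / 2) C (barnes_kernel w \<alpha> \<beta>)"
    using kernel_on_barnes[of \<alpha> \<delta> \<beta> w] \<alpha> \<beta> w \<delta> by blast
  show ?thesis
  proof (rule loop_integral_eq_hankel[OF ker])
    show "barnes_kernel w \<alpha> \<beta> holomorphic_on - Z"
      unfolding barnes_kernel_def[abs_def] by (intro holomorphic_intros) (auto simp: Z_def)
    show "closed Z" unfolding Z_def by (intro closed_Collect_eq continuous_intros)
    show "Z \<inter> half_strip \<delta> \<subseteq> {0}"
      using zero_freeD[OF \<delta>(2) \<alpha>] zero_freeD[OF \<delta>(3) \<beta>] by (force simp: Z_def half_strip_def)
    show "finite (Z \<inter> {u. \<bar>Im u\<bar> < B})" for B
    proof -
      have fin: "finite {u. exp (- u * \<alpha>) = 1 \<and> \<bar>Im u\<bar> < B}" if \<alpha>: "Re \<alpha> > 0" for \<alpha>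
      proof (rule finite_subset)
        \<comment> \<open>The spacing of the imaginary parts of the zeros, so that a bound on |Im u|
          bounds the index n.\<close>
        define q where "q = 2 * pi * Re \<alpha> / (norm \<alpha>)\<^sup>2"
        have q: "q > 0" using \<alpha> by (auto simp: q_def intro!: divide_pos_pos)
        show "{u. exp (- u * \<alpha>) = 1 \<and> \<bar>Im u\<bar> < B} \<subseteq>
           insert 0 ((\<lambda>n. 2 * of_int n * of_real pi * \<i> / \<alpha>) ` {- \<lceil>B / q\<rceil>..\<lceil>B / q\<rceil>})"
        proof
          fix u assume u: "u \<in> {u. exp (- u * \<alpha>) = 1 \<and> \<bar>Im u\<bar> < B}"
          show "u \<in> insert 0 ((\<lambda>n. 2 * of_int n * of_real pi * \<i> / \<alpha>) ` {- \<lceil>B / q\<rceil>..\<lceil>B / q\<rceil>})"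
          proof (cases "u = 0")
            case False
            then obtain n :: int where n: "u = 2 * of_int n * of_real pi * \<i> / \<alpha>" "\<bar>Im u\<bar> = \<bar>of_int n\<bar> * q"
              using exp_eq_1_imp_Im(2)[of u \<alpha>] \<alpha> u by (auto simp: q_def)
            then have "\<bar>of_int n\<bar> < B / q" using u q by (simp add: field_simps)
            then have "n \<in> {- \<lceil>B / q\<rceil>..\<lceil>B / q\<rceil>}"
              using le_of_int_ceiling[of "B / q"] by (simp only: atLeastAtMost_iff) linarith
            then show ?thesis using n(1) by blast
          qed auto
        qed
      qed auto
      have "Z \<inter> {u. \<bar>Im u\<bar> < B} = {u. exp (- u * \<alpha>) = 1 \<and> \<bar>Im u\<bar> < B} \<union> {u. exp (- u * \<beta>) = 1 \<and> \<bar>Im u\<bar> < B}"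
        by (auto simp: Z_def)
      then show ?thesis using fin[OF \<alpha>] fin[OF \<beta>] by simp
    qed
    show "\<exists>X C \<eta>. \<eta> > 0 \<and> (\<forall>u. Re u > X \<longrightarrow> \<bar>Im u\<bar> < B \<longrightarrow> norm (barnes_kernel w \<alpha> \<beta> u) \<le> C * exp (- \<eta> * Re u))" for B
    proof (intro exI conjI allI impI)
      fix u assume u: "Re u > max ((B * \<bar>Im \<alpha>\<bar> + 1) / Re \<alpha>) ((B * \<bar>Im \<beta>\<bar> + 1) / Re \<beta>)" "\<bar>Im u\<bar> < B"
      have "norm (1 - exp (- u * \<alpha>)) \<ge> 1 / 2" "norm (1 - exp (- u * \<beta>)) \<ge> 1 / 2"
        using u exp_decay_half[OF \<alpha>, of B u] exp_decay_half[OF \<beta>, of B u] by auto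
      then have d: "norm ((1 - exp (- u * \<alpha>)) * (1 - exp (- u * \<beta>))) \<ge> 1 / 2 * (1 / 2)"
        unfolding norm_mult by (intro mult_mono) auto
      have "B > 0" using u by linarith
      have "\<bar>Im u * Im w\<bar> \<le> B * \<bar>Im w\<bar>"
        using u unfolding abs_mult by (intro mult_right_mono) auto
      then have "Re (- u * w) \<le> B * \<bar>Im w\<bar> + - Re w * Re u" by simp
      then have n: "norm (exp (- u * w)) \<le> exp (B * \<bar>Im w\<bar>) * exp (- Re w * Re u)" by (simp add: exp_add [symmetric])
      have "norm (barnes_kernel w \<alpha> \<beta> u) \<le> (exp (B * \<bar>Im w\<bar>) * exp (- Re w * Re u)) / (1 / 2 * (1 / 2))"
        unfolding barnes_kernel_def norm_divide using n d by (intro frac_le) auto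
      then show "norm (barnes_kernel w \<alpha> \<beta> u) \<le> (4 * exp (B * \<bar>Im w\<bar>)) * exp (- Re w * Re u)" by simp
    qed (rule w)
    show "hankel_loop Z \<gamma>" using loop by (simp add: Z_def)
  qed
qed

section \<open>Lattice sums as Mellin transforms\<close>

text \<open>Dominated convergence is applied to partial sums along the exhausting sets F N, not to
  sums of absolute values; the partial sums have a closed form and hence a good majorant D. Absolute
  summability then identifies the limit along F with the unordered sum.\<close>

lemma mellin_has_sum:
  fixes W :: "'i \<Rightarrow> complex" and F :: "nat \<Rightarrow> 'i set"
  assumes fin: "\<And>N. finite (F N)" and cof: "filterlim F (finite_subsets_at_top UNIV) sequentially"
    and W: "\<And>i. Re (W i) > 0" and s: "Re s > 0"
    and summ: "(\<lambda>i. norm (W i powr - s)) summable_on UNIV"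
    and lim: "\<And>u. u > 0 \<Longrightarrow> (\<lambda>N. \<Sum>i\<in>F N. exp (- of_real u * W i)) \<longlonglongrightarrow> \<Psi> (of_real u)"
    and bd: "\<And>u N. u > 0 \<Longrightarrow> norm (\<Sum>i\<in>F N. exp (- of_real u * W i)) \<le> D u"
    and D: "integrable pos_reals (\<lambda>u. u powr (Re s - 1) * D u)"
  shows "((\<lambda>i. W i powr - s) has_sum (mellin \<Psi> s / Gamma s)) UNIV"
proof -
  have G0: "Gamma s \<noteq> 0" using s by (auto simp: Gamma_eq_zero_iff elim!: nonpos_Ints_cases)
  define P where "P = (\<lambda>N u. of_real u powr (s - 1) * (\<Sum>i\<in>F N. exp (- of_real u * W i)))"
  have int: "integrable pos_reals (\<lambda>u. of_real u powr (s - 1) * exp (- of_real u * W i))" for i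
  proof (rule Bochner_Integration.integrable_bound[OF integrable_powr_exp[OF s W]])
    show "(\<lambda>u. of_real u powr (s - 1) * exp (- of_real u * W i)) \<in> borel_measurable pos_reals"
      by (intro borel_measurable_pos_reals continuous_intros)
    show "AE u in pos_reals. norm (of_real u powr (s - 1) * exp (- of_real u * W i)) \<le> norm (u powr (Re s - 1) * exp (- Re (W i) * u))"
      by (intro AE_I2) (auto simp: norm_mult norm_powr_real_powr)
  qed
  have "integral\<^sup>L pos_reals (P N) = Gamma s * (\<Sum>i\<in>F N. W i powr - s)" for N
  proof -
    have "integral\<^sup>L pos_reals (P N) = (\<Sum>i\<in>F N. integral\<^sup>L pos_reals (\<lambda>u. of_real u powr (s - 1) * exp (- of_real u * W i)))"
      unfolding P_def sum_distrib_left by (rule Bochner_Integration.integral_sum[OF int])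
    then show ?thesis by (simp only: Gamma_integral_complex_scaled[OF s W] sum_distrib_left)
  qed
  moreover have "(\<lambda>N. integral\<^sup>L pos_reals (P N)) \<longlonglongrightarrow> mellin \<Psi> s"
    unfolding mellin_def
  proof (rule integral_dominated_convergence[where w = "\<lambda>u. u powr (Re s - 1) * D u"])
    show m: "P N \<in> borel_measurable pos_reals" for N
      unfolding P_def by (intro borel_measurable_pos_reals continuous_intros)
    have l: "(\<lambda>N. P N u) \<longlonglongrightarrow> of_real u powr (s - 1) * \<Psi> (of_real u)" if "u \<in> space pos_reals" for u
      unfolding P_def using lim[of u] that by (intro tendsto_mult tendsto_const) auto
    show "(\<lambda>u. of_real u powr (s - 1) * \<Psi> (of_real u)) \<in> borel_measurable pos_reals"
      by (rule borel_measurable_LIMSEQ_metric[OF m l])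
    show "AE u in pos_reals. (\<lambda>N. P N u) \<longlonglongrightarrow> of_real u powr (s - 1) * \<Psi> (of_real u)"
      using l by (intro AE_I2)
    show "AE u in pos_reals. norm (P N u) \<le> u powr (Re s - 1) * D u" for N
      using bd by (intro AE_I2) (auto simp: P_def norm_mult norm_powr_real_powr intro!: mult_left_mono)
  qed (rule D)
  ultimately have l1: "(\<lambda>N. Gamma s * (\<Sum>i\<in>F N. W i powr - s)) \<longlonglongrightarrow> mellin \<Psi> s" by simp
  define S where "S = infsum (\<lambda>i. W i powr - s) UNIV"
  have S: "((\<lambda>i. W i powr - s) has_sum S) UNIV"
    unfolding S_def by (rule has_sum_infsum[OF Infinite_Sum.abs_summable_summable[OF summ]])
  then have "(\<lambda>N. \<Sum>i\<in>F N. W i powr - s) \<longlonglongrightarrow> S"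
    unfolding has_sum_def by (rule filterlim_compose[OF _ cof])
  then have "(\<lambda>N. Gamma s * (\<Sum>i\<in>F N. W i powr - s)) \<longlonglongrightarrow> Gamma s * S" by (intro tendsto_intros)
  from LIMSEQ_unique[OF this l1] have "S = mellin \<Psi> s / Gamma s" using G0 by (simp add: field_simps)
  with S show ?thesis by simp
qed

text \<open>The argument of W is bounded, so the imaginary part of s costs only a constant
  factor.\<close>

lemma norm_powr_neg_le:
  assumes "Re W \<ge> c" "c > 0" "Re s > 0"
  shows "norm (W powr - s) \<le> exp (\<bar>Im s\<bar> * pi) * c powr - Re s"
proof -
  have W: "W \<noteq> 0" using assms by auto
  have th: "\<bar>Im (Ln W)\<bar> \<le> pi" using mpi_less_Im_Ln[OF W] Im_Ln_le_pi[OF W] by (auto simp: abs_le_iff)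
  have "norm (W powr - s) = exp (- Re s * ln (norm W) + Im s * Im (Ln W))"
    using W by (simp add: powr_def)
  also have "\<dots> \<le> exp (- Re s * ln c + \<bar>Im s\<bar> * pi)"
  proof -
    have "c \<le> norm W" using assms complex_Re_le_cmod[of W] by linarith
    then have "ln c \<le> ln (norm W)" using assms by (subst ln_le_cancel_iff) auto
    then have "Re s * ln c \<le> Re s * ln (norm W)" using assms by (intro mult_left_mono) auto
    moreover have "Im s * Im (Ln W) \<le> \<bar>Im s\<bar> * pi"
      using abs_ge_self[of "Im s * Im (Ln W)"] mult_left_mono[OF th, of "\<bar>Im s\<bar>"] by (simp add: abs_mult)
    ultimately show ?thesis by simp
  qed
  also have "\<dots> = exp (\<bar>Im s\<bar> * pi) * c powr - Re s"
    using assms by (simp add: powr_def exp_add [symmetric])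
  finally show ?thesis .
qed

section \<open>Hurwitz and Barnes sums, without and with periodic weights\<close>

lemma geometric_exp:
  assumes "Re (u * \<alpha>) > 0"
  shows "(\<Sum>m<N. exp (- u * (of_nat m * \<alpha>))) = (1 - exp (- u * \<alpha>) ^ N) / (1 - exp (- u * \<alpha>))"
    and "exp (- u * \<alpha>) \<noteq> 1" and "norm (exp (- u * \<alpha>)) < 1"
proof -
  show n: "norm (exp (- u * \<alpha>)) < 1" using assms by simp
  then show 1: "exp (- u * \<alpha>) \<noteq> 1" by (metis less_irrefl norm_one)
  have "(\<Sum>m<N. exp (- u * (of_nat m * \<alpha>))) = (\<Sum>m<N. exp (- u * \<alpha>) ^ m)"
    by (intro sum.cong) (auto simp: exp_of_nat_mult [symmetric] mult_ac)
  also have "\<dots> = (1 - exp (- u * \<alpha>) ^ N) / (1 - exp (- u * \<alpha>))"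
    by (simp only: sum_gp_strict 1 if_False)
  finally show "(\<Sum>m<N. exp (- u * (of_nat m * \<alpha>))) = (1 - exp (- u * \<alpha>) ^ N) / (1 - exp (- u * \<alpha>))" .
qed

lemma filterlim_lessThan_finite_subsets:
  "filterlim (\<lambda>N. {..<N}) (finite_subsets_at_top UNIV) (sequentially :: nat filter)"
  unfolding filterlim_finite_subsets_at_top
proof (intro allI impI)
  fix X :: "nat set" assume "finite X \<and> X \<subseteq> UNIV"
  then obtain M where "\<And>x. x \<in> X \<Longrightarrow> x < M" using finite_nat_set_iff_bounded by auto
  then have "X \<subseteq> {..<N}" if "M \<le> N" for N using that by (auto intro: less_le_trans)
  then show "\<forall>\<^sub>F N in sequentially. finite {..<N} \<and> X \<subseteq> {..<N} \<and> {..<N} \<subseteq> UNIV"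
    by (intro eventually_mono[OF eventually_ge_at_top[of M]]) simp
qed

lemma filterlim_square_finite_subsets:
  "filterlim (\<lambda>N. {..<N} \<times> {..<N}) (finite_subsets_at_top UNIV) (sequentially :: nat filter)"
  unfolding filterlim_finite_subsets_at_top
proof (intro allI impI)
  fix X :: "(nat \<times> nat) set" assume "finite X \<and> X \<subseteq> UNIV"
  then have "finite (fst ` X \<union> snd ` X)" by simp
  then obtain M where M: "\<And>x. x \<in> fst ` X \<union> snd ` X \<Longrightarrow> x < M"
    using finite_nat_set_iff_bounded[of "fst ` X \<union> snd ` X"] by blast
  have "X \<subseteq> {..<M} \<times> {..<M}"
  proof
    fix p assume "p \<in> X"
    then show "p \<in> {..<M} \<times> {..<M}" using M[of "fst p"] M[of "snd p"] by (cases p) force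
  qed
  then have "X \<subseteq> {..<N} \<times> {..<N}" if "M \<le> N" for N using that by (auto intro: less_le_trans)
  then show "\<forall>\<^sub>F N in sequentially. finite ({..<N} \<times> {..<N}) \<and> X \<subseteq> {..<N} \<times> {..<N} \<and> {..<N} \<times> {..<N} \<subseteq> UNIV"
    by (intro eventually_mono[OF eventually_ge_at_top[of M]]) simp
qed

lemma summable_on_Suc_powr:
  assumes "a > 1"
  shows "(\<lambda>n::nat. (1 + real n) powr - a) summable_on UNIV"
proof -
  have "summable (\<lambda>n. real n powr - a)" using assms by (subst summable_real_powr_iff) auto
  then have "summable (\<lambda>n. real (Suc n) powr - a)" by (subst summable_Suc_iff)
  then have "summable (\<lambda>n. norm ((1 + real n) powr - a))" by (simp add: add_ac)
  then show ?thesis by (rule norm_summable_imp_summable_on)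
qed

lemma hurwitz_has_sum:
  assumes "Re \<alpha> > 0" "Re w > 0" "Re s > 1"
  shows "((\<lambda>n::nat. (w + of_nat n * \<alpha>) powr - s) has_sum (mellin (hurwitz_kernel w \<alpha>) s / Gamma s)) UNIV"
proof (rule mellin_has_sum[where F = "\<lambda>N. {..<N}" and D = "\<lambda>u. 2 * norm (hurwitz_kernel w \<alpha> (of_real u))"])
  have psum: "(\<Sum>n<N. exp (- of_real u * (w + of_nat n * \<alpha>))) = hurwitz_kernel w \<alpha> (of_real u) * (1 - exp (- of_real u * \<alpha>) ^ N)"
    if "u > 0" for u N
  proof -
    have p: "Re (of_real u * \<alpha>) > 0" using that assms by simp
    have "(\<Sum>n<N. exp (- of_real u * (w + of_nat n * \<alpha>))) = exp (- of_real u * w) * (\<Sum>n<N. exp (- of_real u * (of_nat n * \<alpha>)))"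
      unfolding sum_distrib_left by (intro sum.cong) (auto simp: exp_add [symmetric] algebra_simps)
    then show ?thesis unfolding geometric_exp(1)[OF p] by (simp add: hurwitz_kernel_def)
  qed
  show "(\<lambda>N. \<Sum>n<N. exp (- of_real u * (w + of_nat n * \<alpha>))) \<longlonglongrightarrow> hurwitz_kernel w \<alpha> (of_real u)" if u: "u > 0" for u
  proof -
    have p: "Re (of_real u * \<alpha>) > 0" using u assms by simp
    have "(\<lambda>N. hurwitz_kernel w \<alpha> (of_real u) * (1 - exp (- of_real u * \<alpha>) ^ N)) \<longlonglongrightarrow> hurwitz_kernel w \<alpha> (of_real u) * (1 - 0)"
      by (intro tendsto_intros LIMSEQ_power_zero geometric_exp(3) p)
    then show ?thesis unfolding psum[OF u] by simp
  qed
  \<comment> \<open>The partial sum is the kernel times 1 - q^N with |q| < 1, whence the factor 2.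
    With two generators the corresponding factor is 4.\<close>
  show "norm (\<Sum>n<N. exp (- of_real u * (w + of_nat n * \<alpha>))) \<le> 2 * norm (hurwitz_kernel w \<alpha> (of_real u))" if u: "u > 0" for u N
  proof -
    have p: "Re (of_real u * \<alpha>) > 0" using u assms by simp
    have "norm (exp (- of_real u * \<alpha>) ^ N) \<le> 1"
      using geometric_exp(3)[OF p] by (simp only: norm_power) (intro power_le_one; simp)
    then have "norm (1 - exp (- of_real u * \<alpha>) ^ N) \<le> 2"
      using norm_triangle_ineq4[of 1 "exp (- of_real u * \<alpha>) ^ N"] by simp
    from mult_left_mono[OF this norm_ge_zero[of "hurwitz_kernel w \<alpha> (of_real u)"]]
    show ?thesis unfolding psum[OF u] norm_mult by simp
  qed
  show "integrable pos_reals (\<lambda>u. u powr (Re s - 1) * (2 * norm (hurwitz_kernel w \<alpha> (of_real u))))"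
  proof -
    obtain \<delta> C where k: "kernel_on 1 \<delta> (Re w / 2) C (hurwitz_kernel w \<alpha>)"
      using kernel_on_hurwitz zero_free_exists assms by meson
    have "integrable pos_reals (\<lambda>u. 2 * norm (of_real u powr (s - 1) * hurwitz_kernel w \<alpha> (of_real u)))"
      using kernel_on_mellin_integrable[OF k, of s] assms by (intro integrable_mult_right integrable_norm) auto
    then show ?thesis
      by (rule Bochner_Integration.integrable_cong[THEN iffD1, rotated 2]) (auto simp: norm_mult norm_powr_real_powr)
  qed
  show "(\<lambda>n. norm ((w + of_nat n * \<alpha>) powr - s)) summable_on UNIV"
  proof -
    define c where "c = min (Re w) (Re \<alpha>)"
    have c: "c > 0" "c \<le> Re w" "c \<le> Re \<alpha>" using assms by (auto simp: c_def)
    define K where "K = exp (\<bar>Im s\<bar> * pi) * c powr - Re s"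
    have "(\<lambda>n::nat. K * (1 + real n) powr - Re s) summable_on UNIV"
      using assms by (intro summable_on_cmult_right summable_on_Suc_powr)
    then show ?thesis
    proof (rule summable_on_comparison_test)
      fix n :: nat
      have "real n * c \<le> real n * Re \<alpha>" using c by (intro mult_left_mono) auto
      then have "c * (1 + real n) \<le> Re (w + of_nat n * \<alpha>)" using c by (simp add: algebra_simps)
      then have "norm ((w + of_nat n * \<alpha>) powr - s) \<le> exp (\<bar>Im s\<bar> * pi) * (c * (1 + real n)) powr - Re s"
        using c assms by (intro norm_powr_neg_le) auto
      also have "\<dots> = K * (1 + real n) powr - Re s" using c by (simp add: K_def powr_mult)
      finally show "norm ((w + of_nat n * \<alpha>) powr - s) \<le> K * (1 + real n) powr - Re s" .
    qed auto
  qed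
qed (use assms filterlim_lessThan_finite_subsets in \<open>auto intro!: add_pos_nonneg\<close>)

lemma barnes_has_sum:
  assumes "Re \<alpha> > 0" "Re \<beta> > 0" "Re w > 0" "Re s > 2"
  shows "((\<lambda>(m::nat, n::nat). (w + of_nat m * \<alpha> + of_nat n * \<beta>) powr - s) has_sum (mellin (barnes_kernel w \<alpha> \<beta>) s / Gamma s)) UNIV"
proof -
  define W where "W = (\<lambda>p::nat \<times> nat. w + of_nat (fst p) * \<alpha> + of_nat (snd p) * \<beta>)"
  have "((\<lambda>p. W p powr - s) has_sum (mellin (barnes_kernel w \<alpha> \<beta>) s / Gamma s)) UNIV"
  proof (rule mellin_has_sum[where F = "\<lambda>N. {..<N} \<times> {..<N}" and D = "\<lambda>u. 4 * norm (barnes_kernel w \<alpha> \<beta> (of_real u))"])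
    have psum: "(\<Sum>p\<in>{..<N} \<times> {..<N}. exp (- of_real u * W p)) =
        barnes_kernel w \<alpha> \<beta> (of_real u) * ((1 - exp (- of_real u * \<alpha>) ^ N) * (1 - exp (- of_real u * \<beta>) ^ N))"
      if "u > 0" for u N
    proof -
      have p: "Re (of_real u * \<alpha>) > 0" "Re (of_real u * \<beta>) > 0" using that assms by simp_all
      have "(\<Sum>p\<in>{..<N} \<times> {..<N}. exp (- of_real u * W p)) =
        exp (- of_real u * w) * ((\<Sum>n<N. exp (- of_real u * (of_nat n * \<alpha>))) * (\<Sum>n<N. exp (- of_real u * (of_nat n * \<beta>))))"
        unfolding sum_product sum.cartesian_product unfolding sum_distrib_left
        by (intro sum.cong) (auto simp: W_def exp_add [symmetric] algebra_simps)
      then show ?thesis unfolding geometric_exp(1)[OF p(1)] geometric_exp(1)[OF p(2)] by (simp add: barnes_kernel_def)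
    qed
    show "(\<lambda>N. \<Sum>p\<in>{..<N} \<times> {..<N}. exp (- of_real u * W p)) \<longlonglongrightarrow> barnes_kernel w \<alpha> \<beta> (of_real u)" if u: "u > 0" for u
    proof -
      have p: "Re (of_real u * \<alpha>) > 0" "Re (of_real u * \<beta>) > 0" using u assms by simp_all
      have "(\<lambda>N. barnes_kernel w \<alpha> \<beta> (of_real u) * ((1 - exp (- of_real u * \<alpha>) ^ N) * (1 - exp (- of_real u * \<beta>) ^ N)))
         \<longlonglongrightarrow> barnes_kernel w \<alpha> \<beta> (of_real u) * ((1 - 0) * (1 - 0))"
        by (intro tendsto_intros LIMSEQ_power_zero geometric_exp(3) p)
      then show ?thesis unfolding psum[OF u] by simp
    qed
    show "norm (\<Sum>p\<in>{..<N} \<times> {..<N}. exp (- of_real u * W p)) \<le> 4 * norm (barnes_kernel w \<alpha> \<beta> (of_real u))" if u: "u > 0" for u N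
    proof -
      have b: "norm (1 - exp (- of_real u * \<alpha>) ^ N) \<le> 2" if "Re \<alpha> > 0" for \<alpha>
      proof -
        have p: "Re (of_real u * \<alpha>) > 0" using u that by simp
        have "norm (exp (- of_real u * \<alpha>) ^ N) \<le> 1"
          using geometric_exp(3)[OF p] by (simp only: norm_power) (intro power_le_one; simp)
        then show ?thesis
          using norm_triangle_ineq4[of 1 "exp (- of_real u * \<alpha>) ^ N"] by simp
      qed
      have "norm ((1 - exp (- of_real u * \<alpha>) ^ N) * (1 - exp (- of_real u * \<beta>) ^ N)) \<le> 2 * 2"
        unfolding norm_mult by (intro mult_mono b assms) auto
      then have "norm (barnes_kernel w \<alpha> \<beta> (of_real u)) * norm ((1 - exp (- of_real u * \<alpha>) ^ N) * (1 - exp (- of_real u * \<beta>) ^ N))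
         \<le> norm (barnes_kernel w \<alpha> \<beta> (of_real u)) * (2 * 2)" by (intro mult_left_mono) auto
      then show ?thesis unfolding psum[OF u] by (simp add: norm_mult mult_ac)
    qed
    show "integrable pos_reals (\<lambda>u. u powr (Re s - 1) * (4 * norm (barnes_kernel w \<alpha> \<beta> (of_real u))))"
    proof -
      obtain \<delta> C where k: "kernel_on 2 \<delta> (Re w / 2) C (barnes_kernel w \<alpha> \<beta>)"
        using kernel_on_barnes zero_free_exists assms by meson
      have "integrable pos_reals (\<lambda>u. 4 * norm (of_real u powr (s - 1) * barnes_kernel w \<alpha> \<beta> (of_real u)))"
        using kernel_on_mellin_integrable[OF k, of s] assms by (intro integrable_mult_right integrable_norm) auto
      then show ?thesis
        by (rule Bochner_Integration.integrable_cong[THEN iffD1, rotated 2]) (auto simp: norm_mult norm_powr_real_powr)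
    qed
    show "(\<lambda>p. norm (W p powr - s)) summable_on UNIV"
    proof -
      define c where "c = min (Re w) (min (Re \<alpha>) (Re \<beta>))"
      have c: "c > 0" "c \<le> Re w" "c \<le> Re \<alpha>" "c \<le> Re \<beta>" using assms by (auto simp: c_def)
      define K where "K = exp (\<bar>Im s\<bar> * pi) * c powr - Re s"
      \<comment> \<open>Since (1 + m + n)^2 >= (1 + m)(1 + n), half of the exponent can be given to
        each index. The double sum is then dominated by a product of two series with exponent a >
        1.\<close>
      define a where "a = Re s / 2"
      have a: "a > 1" using assms by (simp add: a_def)
      define g where "g = (\<lambda>p::nat \<times> nat. (1 + real (fst p)) powr - a * (1 + real (snd p)) powr - a)"
      have "(\<lambda>p. norm (g p)) summable_on UNIV \<times> UNIV"
        unfolding Infinite_Sum.abs_summable_on_Sigma_iff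
      proof (intro conjI ballI)
        have eq: "(\<lambda>n. norm (g (m, n))) = (\<lambda>n. (1 + real m) powr - a * (1 + real n) powr - a)" for m
          by (simp add: g_def)
        show "(\<lambda>n. norm (g (m, n))) summable_on UNIV" for m
          unfolding eq by (rule summable_on_cmult_right[OF summable_on_Suc_powr[OF a]])
        have "(\<lambda>m::nat. (1 + real m) powr - a * \<bar>\<Sum>\<^sub>\<infinity>n::nat. (1 + real n) powr - a\<bar>) summable_on UNIV"
          by (rule summable_on_cmult_left[OF summable_on_Suc_powr[OF a]])
        then show "(\<lambda>m. norm (\<Sum>\<^sub>\<infinity>n. norm (g (m, n)))) summable_on UNIV"
          unfolding eq infsum_cmult_right' by (simp add: abs_mult)
      qed
      then have "g summable_on UNIV" using Infinite_Sum.abs_summable_summable[of g UNIV] by simp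
      then have "(\<lambda>p. K * g p) summable_on UNIV" by (rule summable_on_cmult_right)
      then show ?thesis
      proof (rule summable_on_comparison_test)
        fix p :: "nat \<times> nat"
        define m n where "m = real (fst p)" and "n = real (snd p)"
        have mn: "m \<ge> 0" "n \<ge> 0" by (auto simp: m_def n_def)
        have "m * c \<le> m * Re \<alpha>" "n * c \<le> n * Re \<beta>" using c mn by (auto intro!: mult_left_mono)
        then have "c * (1 + m + n) \<le> Re (W p)" using c by (simp add: W_def m_def n_def algebra_simps)
        then have "norm (W p powr - s) \<le> exp (\<bar>Im s\<bar> * pi) * (c * (1 + m + n)) powr - Re s"
          using c mn assms by (intro norm_powr_neg_le mult_pos_pos) auto
        also have "\<dots> = K * (1 + m + n) powr - Re s" using c mn by (simp add: K_def powr_mult)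
        also have "(1 + m + n) powr - Re s = ((1 + m + n) powr 2) powr - a"
          unfolding powr_powr by (simp add: a_def)
        also have "(1 + m + n) powr 2 = (1 + m + n) ^ 2"
          using mn by (intro powr_numeral) simp
        also have "((1 + m + n) ^ 2) powr - a \<le> ((1 + m) * (1 + n)) powr - a"
        proof (rule powr_mono2')
          have "(1 + m + n) ^ 2 = (1 + m) * (1 + n) + (m + n + m * n + m * m + n * n)"
            by (simp add: power2_eq_square algebra_simps)
          then show "(1 + m) * (1 + n) \<le> (1 + m + n) ^ 2" using mn by simp
        qed (use mn a in auto)
        also have "\<dots> = g p" using mn by (simp add: g_def m_def n_def powr_mult)
        finally show "norm (W p powr - s) \<le> K * g p" by (simp add: K_def mult_left_mono)
      qed auto
    qed
  qed (use assms filterlim_square_finite_subsets in \<open>auto simp: W_def intro!: add_pos_nonneg\<close>)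
  then show ?thesis by (simp add: W_def case_prod_unfold)
qed

lemma div_mod_bij_nat:
  fixes k :: nat
  assumes "k > 0"
  shows "inj (\<lambda>l. \<mu> + k * l)" and "(\<Union>\<mu><k. range (\<lambda>l. \<mu> + k * l)) = UNIV"
proof -
  show "inj (\<lambda>l. \<mu> + k * l)" using assms by (auto simp: inj_on_def)
  have "n \<in> (\<Union>\<mu><k. range (\<lambda>l. \<mu> + k * l))" for n
  proof (rule UN_I)
    show "n mod k \<in> {..<k}" using assms by simp
    show "n \<in> range (\<lambda>l. n mod k + k * l)" by (rule image_eqI[of _ _ "n div k"]) auto
  qed
  then show "(\<Union>\<mu><k. range (\<lambda>l. \<mu> + k * l)) = UNIV" by blast
qed

lemma periodic_nat_mult:
  fixes g :: "nat \<Rightarrow> 'a"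
  assumes "\<And>n. g (n + k) = g n"
  shows "g (n + k * l) = g n"
proof (induction l)
  case (Suc l)
  have "g (n + k * Suc l) = g (n + k * l + k)" by (simp add: algebra_simps)
  then show ?case using assms Suc by simp
qed simp

text \<open>On a residue class modulo k the weight is constant and the sum is an unweighted Hurwitz
  sum with step k \<alpha>.\<close>

lemma hurwitz_weighted_has_sum:
  fixes k :: nat and g :: "nat \<Rightarrow> complex"
  assumes "k > 0" and g: "\<And>n. g (n + k) = g n"
    and re: "Re \<alpha> > 0" "Re w > 0" "Re s > 1"
  shows "((\<lambda>n. g n * (w + of_nat n * \<alpha>) powr - s) has_sum
     ((\<Sum>\<nu><k. g \<nu> * mellin (hurwitz_kernel (w + of_nat \<nu> * \<alpha>) (of_nat k * \<alpha>)) s) / Gamma s)) UNIV"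
proof -
  have "((\<lambda>n. g n * (w + of_nat n * \<alpha>) powr - s) has_sum
     (g \<nu> * (mellin (hurwitz_kernel (w + of_nat \<nu> * \<alpha>) (of_nat k * \<alpha>)) s / Gamma s))) (range (\<lambda>l. \<nu> + k * l))" for \<nu>
  proof (subst has_sum_reindex)
    show "inj (\<lambda>l. \<nu> + k * l)" by (rule div_mod_bij_nat[OF assms(1)])
    have "((\<lambda>l. g \<nu> * (w + of_nat \<nu> * \<alpha> + of_nat l * (of_nat k * \<alpha>)) powr - s) has_sum
       (g \<nu> * (mellin (hurwitz_kernel (w + of_nat \<nu> * \<alpha>) (of_nat k * \<alpha>)) s / Gamma s))) UNIV"
      using assms by (intro has_sum_cmult_right hurwitz_has_sum) (auto intro!: add_pos_nonneg)
    then show "((\<lambda>n. g n * (w + of_nat n * \<alpha>) powr - s) \<circ> (\<lambda>l. \<nu> + k * l) has_sum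
       (g \<nu> * (mellin (hurwitz_kernel (w + of_nat \<nu> * \<alpha>) (of_nat k * \<alpha>)) s / Gamma s))) UNIV"
      by (rule has_sum_cong[THEN iffD1, rotated]) (simp add: periodic_nat_mult[of g, OF g], simp add: algebra_simps)
  qed
  then have "((\<lambda>n. g n * (w + of_nat n * \<alpha>) powr - s) has_sum
     (\<Sum>\<nu><k. g \<nu> * (mellin (hurwitz_kernel (w + of_nat \<nu> * \<alpha>) (of_nat k * \<alpha>)) s / Gamma s))) (\<Union>\<nu><k. range (\<lambda>l. \<nu> + k * l))"
  proof (intro sum_has_sum)
    fix a a' assume a: "a \<in> {..<k}" "a' \<in> {..<k}" "a \<noteq> a'"
    show "range (\<lambda>l. a + k * l) \<inter> range (\<lambda>l. a' + k * l) = {}"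
    proof (rule ccontr)
      assume "range (\<lambda>l. a + k * l) \<inter> range (\<lambda>l. a' + k * l) \<noteq> {}"
      then obtain l l' where "a + k * l = a' + k * l'" by auto
      then have "(a + k * l) mod k = (a' + k * l') mod k" by simp
      then show False using a by simp
    qed
  qed auto
  then show ?thesis by (simp add: div_mod_bij_nat[OF assms(1)] sum_divide_distrib)
qed

lemma barnes_weighted_has_sum:
  fixes k :: nat and G :: "nat \<Rightarrow> nat \<Rightarrow> complex"
  assumes "k > 0" and G: "\<And>m n. G (m + k) n = G m n" "\<And>m n. G m (n + k) = G m n"
    and re: "Re \<alpha> > 0" "Re \<beta> > 0" "Re w > 0" "Re s > 2"
  shows "((\<lambda>(m, n). G m n * (w + of_nat m * \<alpha> + of_nat n * \<beta>) powr - s) has_sum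
     ((\<Sum>(\<mu>, \<nu>)\<in>{..<k} \<times> {..<k}. G \<mu> \<nu> *
        mellin (barnes_kernel (w + of_nat \<mu> * \<alpha> + of_nat \<nu> * \<beta>) (of_nat k * \<alpha>) (of_nat k * \<beta>)) s) / Gamma s)) UNIV"
proof -
  define h where "h = (\<lambda>p q. (fst p + k * fst q, snd p + k * snd q) :: nat \<times> nat)"
  define t where "t = (\<lambda>p. G (fst p) (snd p) * (w + of_nat (fst p) * \<alpha> + of_nat (snd p) * \<beta>) powr - s)"
  define M where "M = (\<lambda>p::nat \<times> nat. mellin (barnes_kernel (w + of_nat (fst p) * \<alpha> + of_nat (snd p) * \<beta>) (of_nat k * \<alpha>) (of_nat k * \<beta>)) s)"
  have G': "G (m + k * l) (n + k * l') = G m n" for m n l l'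
    using periodic_nat_mult[of "\<lambda>m. G m (n + k * l')" k m l] periodic_nat_mult[of "\<lambda>n. G m n" k n l'] G by simp
  have "(t has_sum (G (fst p) (snd p) * (M p / Gamma s))) (range (h p))" for p
  proof (subst has_sum_reindex)
    show "inj (h p)" using assms(1) by (auto simp: inj_on_def h_def)
    have "((\<lambda>(l::nat, l'::nat). (w + of_nat (fst p) * \<alpha> + of_nat (snd p) * \<beta> + of_nat l * (of_nat k * \<alpha>) + of_nat l' * (of_nat k * \<beta>)) powr - s) has_sum
       (M p / Gamma s)) UNIV"
      unfolding M_def using assms by (intro barnes_has_sum) (auto intro!: add_pos_nonneg)
    from has_sum_cmult_right[OF this, of "G (fst p) (snd p)"]
    show "(t \<circ> h p has_sum (G (fst p) (snd p) * (M p / Gamma s))) UNIV"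
      by (rule has_sum_cong[THEN iffD1, rotated]) (auto simp: o_def t_def h_def G' algebra_simps)
  qed
  then have "(t has_sum (\<Sum>p\<in>{..<k} \<times> {..<k}. G (fst p) (snd p) * (M p / Gamma s))) (\<Union>p\<in>{..<k} \<times> {..<k}. range (h p))"
  proof (intro sum_has_sum)
    fix a a' assume a: "a \<in> {..<k} \<times> {..<k}" "a' \<in> {..<k} \<times> {..<k}" "a \<noteq> a'"
    show "range (h a) \<inter> range (h a') = {}"
    proof (rule ccontr)
      assume "range (h a) \<inter> range (h a') \<noteq> {}"
      then obtain x where "x \<in> range (h a)" "x \<in> range (h a')" by blast
      then obtain l l' where "h a l = h a' l'" by (metis rangeE)
      then have "fst (h a l) mod k = fst (h a' l') mod k" "snd (h a l) mod k = snd (h a' l') mod k" by simp_all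
      then show False using a by (auto simp: h_def prod_eq_iff)
    qed
  qed auto
  moreover have "(\<Union>p\<in>{..<k} \<times> {..<k}. range (h p)) = UNIV"
  proof -
    have "(m, n) \<in> (\<Union>p\<in>{..<k} \<times> {..<k}. range (h p))" for m n
    proof (rule UN_I)
      show "(m mod k, n mod k) \<in> {..<k} \<times> {..<k}" using assms(1) by simp
      show "(m, n) \<in> range (h (m mod k, n mod k))"
        by (rule image_eqI[of _ _ "(m div k, n div k)"]) (auto simp: h_def)
    qed
    then show ?thesis by auto
  qed
  ultimately have "(t has_sum (\<Sum>p\<in>{..<k} \<times> {..<k}. G (fst p) (snd p) * (M p / Gamma s))) UNIV" by simp
  then show ?thesis by (simp add: t_def M_def case_prod_unfold sum_divide_distrib)
qed

section \<open>Meromorphic continuation\<close>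

text \<open>So \<phi> is X / ((exp(2 pi i s) - 1) Gamma(s)). The zeros of X cancel those of the
  denominator at integers from 2 on, and the poles of Gamma cancel those at integers up to 0; only s
  = 1 can remain a pole.\<close>

definition mellin_rep :: "real \<Rightarrow> (complex \<Rightarrow> complex) \<Rightarrow> (complex \<Rightarrow> complex) \<Rightarrow> bool" where
  "mellin_rep \<sigma> \<phi> X \<longleftrightarrow> X holomorphic_on UNIV \<and> (\<forall>n\<ge>2. X (of_int n) = 0) \<and> \<phi> holomorphic_on {s. Re s > \<sigma>} \<and>
     (\<forall>s. Re s > \<sigma> \<longrightarrow> (exp (2 * of_real pi * \<i> * s) - 1) * (Gamma s * \<phi> s) = X s)"

lemma exp_2pi_eq_1_iff: "exp (2 * of_real pi * \<i> * s) = 1 \<longleftrightarrow> s \<in> \<int>"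
proof
  assume "exp (2 * of_real pi * \<i> * s) = 1"
  then obtain n :: int where n: "2 * of_real pi * \<i> * s = of_int (2 * n) * pi * \<i>"
    unfolding exp_eq_1 by (auto simp: complex_eq_iff)
  then have "s = of_int n" by (simp add: field_simps)
  then show "s \<in> \<int>" by simp
next
  assume "s \<in> \<int>"
  then show "exp (2 * of_real pi * \<i> * s) = 1" by (auto elim!: Ints_cases simp: exp_2pi_i_of_int)
qed

lemma Gamma_mult_rGamma:
  assumes "Re s > 0"
  shows "Gamma s * rGamma s = 1"
proof -
  have "Gamma s \<noteq> 0" using assms by (auto simp: Gamma_eq_zero_iff elim!: nonpos_Ints_cases)
  then show ?thesis by (simp add: rGamma_inverse_Gamma)
qed

lemma eventually_not_Ints: "eventually (\<lambda>w. w \<notin> \<int>) (at (s :: complex))"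
proof (cases "s \<in> \<int>")
  case True
  then obtain n where n: "s = of_int n" by (auto elim: Ints_cases)
  have "w \<notin> \<int>" if w: "w \<in> ball s 1 - {s}" for w
  proof
    assume "w \<in> \<int>"
    then obtain m where m: "w = of_int m" by (auto elim: Ints_cases)
    have "dist s w = \<bar>of_int (n - m)\<bar>"
      unfolding n m dist_norm of_int_diff [symmetric] by (rule norm_of_int)
    then have "\<bar>n - m\<bar> < 1" using w by auto
    then show False using w m n by auto
  qed
  moreover have "eventually (\<lambda>w. w \<in> ball s 1 - {s}) (at s)"
    by (rule eventually_at_in_open) auto
  ultimately show ?thesis by (auto elim: eventually_mono)
next
  case False
  then have "eventually (\<lambda>w. w \<in> - \<int>) (at s)"
    by (intro eventually_at_in_open') auto
  then show ?thesis by simp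
qed

lemma mellin_rep_continuation:
  assumes rep: "mellin_rep \<sigma> \<phi> X" and \<sigma>: "\<sigma> \<ge> 1"
  defines "F \<equiv> meromorphic_continuation \<sigma> \<phi>"
  shows "F nicely_meromorphic_on UNIV" "\<And>s. Re s > \<sigma> \<Longrightarrow> F s = \<phi> s"
    "F holomorphic_on (- insert 1 \<int>\<^sub>\<le>\<^sub>0)"
proof -
  have X: "X holomorphic_on UNIV" "\<And>n. n \<ge> 2 \<Longrightarrow> X (of_int n) = 0"
    and \<phi>: "\<phi> holomorphic_on {s. Re s > \<sigma>}"
    and eq: "\<And>s. Re s > \<sigma> \<Longrightarrow> (exp (2 * of_real pi * \<i> * s) - 1) * (Gamma s * \<phi> s) = X s"
    using rep by (auto simp: mellin_rep_def)
  \<comment> \<open>Written with the entire function \<open>rGamma\<close>, numerator and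
    denominator are both entire, so the quotient is meromorphic at once.\<close>
  define Y where "Y = (\<lambda>s. (X s * rGamma s) / (exp (2 * of_real pi * \<i> * s) - 1))"
  have numh: "(\<lambda>s. X s * rGamma s) holomorphic_on UNIV" by (intro holomorphic_intros X)
  then have num: "(\<lambda>s. X s * rGamma s) analytic_on UNIV" by (simp add: analytic_on_open)
  have "(\<lambda>s. exp (2 * of_real pi * \<i> * s) - 1) holomorphic_on UNIV" by (intro holomorphic_intros)
  then have den: "(\<lambda>s. exp (2 * of_real pi * \<i> * s) - 1) analytic_on UNIV" by (simp add: analytic_on_open)
  have Y: "Y meromorphic_on UNIV"
    unfolding Y_def by (intro meromorphic_on_divide analytic_on_imp_meromorphic_on num den)
  define F0 where "F0 = remove_sings Y"
  have F0: "F0 nicely_meromorphic_on UNIV"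
    unfolding F0_def by (rule remove_sings_nicely_meromorphic[OF Y])
  have Y_an: "Y analytic_on {s}" if "s \<notin> \<int>" for s
    unfolding Y_def using exp_2pi_eq_1_iff[of s] that
    by (intro analytic_on_divide analytic_on_subset[OF num] analytic_on_subset[OF den]) auto
  have F0_an: "F0 analytic_on {s}" if s: "s \<notin> insert 1 \<int>\<^sub>\<le>\<^sub>0" for s
  proof (cases "s \<in> \<int>")
    case False
    then show ?thesis unfolding F0_def by (intro remove_sings_analytic_on Y_an)
  next
    case True
    then obtain n where n: "s = of_int n" by (auto elim: Ints_cases)
    have "n \<ge> 2"
    proof (rule ccontr)
      assume "\<not> n \<ge> 2"
      then have "n = 1 \<or> n \<le> 0" by linarith
      then show False using s n nonpos_Ints_of_int[of n, where 'a = complex] by auto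
    qed
    then have "X s = 0" using X(2) n by simp
    \<comment> \<open>At an integer n >= 2 the zero of the denominator is simple and the numerator
      vanishes too, so the quotient has a finite limit and the singularity is removable.\<close>
    have "((\<lambda>w. (X w * rGamma w) / (exp (2 * of_real pi * \<i> * w) - 1)) \<longlongrightarrow>
        deriv (\<lambda>s. X s * rGamma s) s / (2 * of_real pi * \<i>)) (at s)"
    proof (rule lhopital_complex_simple)
      show "((\<lambda>s. X s * rGamma s) has_field_derivative deriv (\<lambda>s. X s * rGamma s) s) (at s)"
        using numh by (intro holomorphic_derivI[of _ UNIV]) auto
      show "((\<lambda>w. exp (2 * of_real pi * \<i> * w) - 1) has_field_derivative 2 * of_real pi * \<i>) (at s)"
        using exp_2pi_i_of_int[of n] by (auto intro!: derivative_eq_intros simp: n mult_ac)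
    qed (use \<open>X s = 0\<close> exp_2pi_i_of_int[of n] n in auto)
    then show ?thesis
      unfolding F0_def using Y
      by (intro remove_sings_analytic_at) (auto simp: Y_def[symmetric] meromorphic_on_altdef intro: meromorphic_on_isolated_singularity)
  qed
  have F0_eq: "F0 s = \<phi> s" if s: "Re s > \<sigma>" for s
  proof -
    have G: "Gamma s * rGamma s = 1" if "Re s > \<sigma>" for s
      using that \<sigma> by (intro Gamma_mult_rGamma) auto
    \<comment> \<open>The quotient Y can be cancelled only off the integers. The integers in the
      half-plane follow by continuity of both functions.\<close>
    have 1: "F0 w = \<phi> w" if "Re w > \<sigma>" "w \<notin> \<int>" for w
    proof -
      have "F0 w = Y w" unfolding F0_def by (rule remove_sings_at_analytic[OF Y_an[OF that(2)]])
      also have "\<dots> = ((exp (2 * of_real pi * \<i> * w) - 1) * (Gamma w * \<phi> w)) * rGamma w / (exp (2 * of_real pi * \<i> * w) - 1)"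
        by (simp add: Y_def eq[OF that(1)])
      also have "\<dots> = (Gamma w * rGamma w) * \<phi> w" using exp_2pi_eq_1_iff[of w] that by (simp add: field_simps)
      finally show ?thesis using G[OF that(1)] by simp
    qed
    have "eventually (\<lambda>w. w \<notin> \<int>) (at s)" by (rule eventually_not_Ints)
    moreover have "eventually (\<lambda>w. w \<in> {w. Re w > \<sigma>}) (at s)"
      using s by (intro eventually_at_in_open') (auto simp: open_halfspace_Re_gt)
    ultimately have ev: "eventually (\<lambda>w. F0 w = \<phi> w) (at s)" by eventually_elim (use 1 in auto)
    have "s \<notin> insert 1 \<int>\<^sub>\<le>\<^sub>0" using s \<sigma> by (auto elim!: nonpos_Ints_cases)
    then have "F0 \<midarrow>s\<rightarrow> F0 s" using F0_an analytic_at_imp_isCont isContD by blast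
    then have l: "\<phi> \<midarrow>s\<rightarrow> F0 s" using ev by (rule Lim_transform_eventually)
    have "isCont \<phi> s"
      using holomorphic_on_imp_continuous_on[OF \<phi>] s by (simp add: continuous_on_eq_continuous_at open_halfspace_Re_gt)
    then have "\<phi> \<midarrow>s\<rightarrow> \<phi> s" by (rule isContD)
    from LIM_unique[OF l this] show ?thesis .
  qed
  have "F = F0" unfolding F_def by (rule meromorphic_continuation_eqI[OF F0 F0_eq])
  then show "F nicely_meromorphic_on UNIV" "\<And>s. Re s > \<sigma> \<Longrightarrow> F s = \<phi> s" using F0 F0_eq by auto
  have "F0 analytic_on (- insert 1 \<int>\<^sub>\<le>\<^sub>0)" using F0_an analytic_on_analytic_at by blast
  then show "F holomorphic_on (- insert 1 \<int>\<^sub>\<le>\<^sub>0)" unfolding \<open>F = F0\<close> by (rule analytic_imp_holomorphic)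
qed

section \<open>The L-series\<close>

lemma cpow_low_of_real:
  assumes "x > 0"
  shows "cpow_low (of_real x) s = of_real x powr s"
proof -
  have "Arg (of_real x) = 0" using assms by (simp add: Arg_eq_0)
  then show ?thesis using assms
    by (simp add: cpow_low_def arg_low_def powr_def Ln_of_real complex_of_real_def[symmetric])
qed

lemma holomorphic_mellin_kernel: "kernel p \<Psi> \<Longrightarrow> mellin \<Psi> holomorphic_on {s. Re s > p}"
  unfolding kernel_def using holomorphic_mellin by blast

lemma periodic_seq_nat:
  assumes "periodic_seq (int k) g"
  shows "g (m + int (n + k)) = g (m + int n)" "g (m - int (n + k)) = g (m - int n)"
proof -
  have p: "g (n + int k) = g n" for n using assms by (simp add: periodic_seq_def)
  show "g (m + int (n + k)) = g (m + int n)" using p[of "m + int n"] by (simp add: add_ac)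
  show "g (m - int (n + k)) = g (m - int n)" using p[of "m - int (n + k)"] by (simp add: algebra_simps)
qed

text \<open>The start n0 is the least integer strictly above -\<theta>. It is floor plus one and not
  the ceiling, because for integral \<theta> the term with base 0 is excluded.\<close>

lemma L_series_has_sum:
  fixes k :: nat and g :: "int \<Rightarrow> complex" and \<theta> :: real
  assumes k: "k > 0" and g: "periodic_seq (int k) g" and s: "Re s > 1"
  defines "n0 \<equiv> \<lfloor>- \<theta>\<rfloor> + 1"
  defines "w \<equiv> of_int n0 + complex_of_real \<theta>"
  shows "((\<lambda>n. g n * cpow_low (of_int n + of_real \<theta>) (- s)) has_sum
      ((\<Sum>\<nu><k. g (n0 + int \<nu>) * mellin (hurwitz_kernel (w + of_nat \<nu> * 1) (of_nat k * 1)) s) / Gamma s))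
      {n. real_of_int n > - \<theta>}" (is "(?t has_sum ?S) _") and "Re w > 0"
proof -
  have w: "real_of_int n0 + \<theta> > 0" unfolding n0_def by linarith
  then show w': "Re w > 0" by (simp add: w_def)
  have "((\<lambda>n::nat. g (n0 + int n) * (w + of_nat n * 1) powr - s) has_sum ?S) UNIV"
    using hurwitz_weighted_has_sum[of k "\<lambda>n. g (n0 + int n)" 1 w s] k s w' periodic_seq_nat(1)[OF g] by simp
  moreover have "g (n0 + int n) * (w + of_nat n * 1) powr - s = ?t (n0 + int n)" for n
  proof -
    have pos: "of_int n0 + \<theta> + real n > 0" using w by simp
    have e: "of_int (n0 + int n) + complex_of_real \<theta> = of_real (of_int n0 + \<theta> + real n)"
      "w + of_nat n * 1 = of_real (of_int n0 + \<theta> + real n)" by (simp_all add: w_def)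
    show ?thesis by (simp only: e cpow_low_of_real[OF pos])
  qed
  ultimately have "((\<lambda>n::nat. ?t (n0 + int n)) has_sum ?S) UNIV" by (simp only:)
  moreover have "bij_betw (\<lambda>n::nat. n0 + int n) UNIV {n. real_of_int n > - \<theta>}"
  proof (rule bij_betwI[of _ _ _ "\<lambda>n. nat (n - n0)"])
    have "n \<ge> n0" if "real_of_int n > - \<theta>" for n unfolding n0_def using that by linarith
    then show "n0 + int (nat (n - n0)) = n" if "n \<in> {n. real_of_int n > - \<theta>}" for n using that by auto
    show "(\<lambda>n::nat. n0 + int n) \<in> UNIV \<rightarrow> {n. real_of_int n > - \<theta>}" using w by auto
  qed auto
  ultimately show "(?t has_sum ?S) {n. real_of_int n > - \<theta>}" using has_sum_reindex_bij_betw by blast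
qed

lemma L_series_mellin_rep:
  fixes k :: nat and g :: "int \<Rightarrow> complex" and \<theta> :: real
  assumes "k > 0" "periodic_seq (int k) g"
  shows "\<exists>X. mellin_rep 1 (L_series g \<theta>) X"
proof -
  define n0 where "n0 = \<lfloor>- \<theta>\<rfloor> + 1"
  define w where "w = of_int n0 + complex_of_real \<theta>"
  define K where "K = (\<lambda>\<nu>. hurwitz_kernel (w + of_nat \<nu> * 1) (of_nat k * 1))"
  note L = L_series_has_sum[OF assms, of _ \<theta>, folded n0_def, folded w_def, folded K_def]
  have w: "Re w > 0" by (rule L(2)[of 2]) simp
  have ker: "kernel 1 (K \<nu>)" for \<nu> unfolding K_def using assms w by (intro kernel_hurwitz) (auto intro!: add_pos_nonneg)
  have eq: "L_series g \<theta> s = (\<Sum>\<nu><k. g (n0 + int \<nu>) * mellin (K \<nu>) s) * rGamma s" if "Re s > 1" for s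
    using infsumI[OF L(1)[OF that]] by (simp add: L_series_def rGamma_inverse_Gamma K_def divide_inverse)
  have "mellin_rep 1 (L_series g \<theta>) (\<lambda>s. \<Sum>\<nu><k. g (n0 + int \<nu>) * hankel (K \<nu>) s)"
    unfolding mellin_rep_def
  proof (intro conjI allI impI)
    show "(\<lambda>s. \<Sum>\<nu><k. g (n0 + int \<nu>) * hankel (K \<nu>) s) holomorphic_on UNIV"
      by (intro holomorphic_intros holomorphic_hankel[OF ker])
    show "(\<Sum>\<nu><k. g (n0 + int \<nu>) * hankel (K \<nu>) (of_int n)) = 0" if "n \<ge> 2" for n
      using hankel_of_int_eq_0[OF ker] that by simp
    have "(\<lambda>s. (\<Sum>\<nu><k. g (n0 + int \<nu>) * mellin (K \<nu>) s) * rGamma s) holomorphic_on {s. Re s > 1}"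
      using holomorphic_mellin_kernel[OF ker] by (intro holomorphic_intros) auto
    then show "L_series g \<theta> holomorphic_on {s. Re s > 1}"
      by (rule holomorphic_transform) (simp add: eq)
    fix s assume s: "Re s > 1"
    then have "Gamma s \<noteq> 0" "rGamma s = 1 / Gamma s"
      by (auto simp: Gamma_eq_zero_iff rGamma_inverse_Gamma field_simps elim!: nonpos_Ints_cases)
    then show "(exp (2 * of_real pi * \<i> * s) - 1) * (Gamma s * L_series g \<theta> s) = (\<Sum>\<nu><k. g (n0 + int \<nu>) * hankel (K \<nu>) s)"
      using s hankel_eq_mellin[OF ker, of s] by (simp add: eq sum_distrib_left sum_distrib_right mult_ac)
  qed
  then show ?thesis by blast
qed

section \<open>The series G and its continuation\<close>

lemma arg_low_bounds: "- pi \<le> arg_low W" "arg_low W < pi"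
  using mpi_less_Arg[of W] Arg_le_pi[of W] by (auto simp: arg_low_def)

lemma polar_arg_low: "W = of_real (norm W) * exp (\<i> * of_real (arg_low W))"
proof -
  have "W = of_real (norm W) * exp (\<i> * of_real (Arg W))" using Arg_eq[of W] by (cases "W = 0") auto
  moreover have "exp (\<i> * of_real (arg_low W)) = exp (\<i> * of_real (Arg W))"
    by (auto simp: arg_low_def exp_minus)
  ultimately show ?thesis by simp
qed

lemma arg_low_unique:
  assumes "W = of_real r * exp (\<i> * of_real a)" "r > 0" "- pi \<le> a" "a < pi"
  shows "arg_low W = a"
proof (cases "a = - pi")
  case True
  then have "W = of_real (- r)" using assms(1) by (simp add: exp_minus)
  then have "Arg W = pi" using assms(2) by (simp add: Arg_eq_pi)
  then show ?thesis using True by (simp add: arg_low_def)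
next
  case False
  then have "Arg W = a" using assms by (intro Arg_unique[of r]) auto
  then show ?thesis using assms by (simp add: arg_low_def)
qed

text \<open>The power of a product splits as long as the sum of the arguments does not leave the
  range [-pi, pi) of the branch.\<close>

lemma cpow_low_rotate:
  assumes "Re W > 0" "- pi \<le> \<theta> + Arg W" "\<theta> + Arg W < pi"
  shows "cpow_low (exp (\<i> * of_real \<theta>) * W) s = exp (\<i> * of_real \<theta> * s) * W powr s"
proof -
  have W: "W \<noteq> 0" using assms by auto
  have "exp (\<i> * of_real \<theta>) * W = of_real (norm W) * exp (\<i> * of_real (\<theta> + Arg W))"
    using Arg_eq[OF W] by (simp add: exp_add distrib_left mult_ac)
  then have a: "arg_low (exp (\<i> * of_real \<theta>) * W) = \<theta> + Arg W"
    using W assms by (intro arg_low_unique[of _ "norm W"]) auto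
  have n: "norm (exp (\<i> * of_real \<theta>) * W) = norm W" by (simp add: norm_mult)
  have "Complex (ln (norm W)) (\<theta> + Arg W) = \<i> * of_real \<theta> + Ln W"
    using W by (simp add: complex_eq_iff Arg_eq_Im_Ln)
  then show ?thesis
    using W unfolding cpow_low_def a n by (simp add: powr_def distrib_left exp_add mult_ac)
qed

text \<open>A priori \<theta> + Arg W lies between -pi/2 and 3 pi / 2. A nonnegative sine leaves
  [0, pi], and the condition on real values excludes pi.\<close>

lemma upper_cone_angle:
  assumes \<theta>: "0 < \<theta>" "\<theta> < pi" and W: "Re W > 0"
    and up: "Im (exp (\<i> * of_real \<theta>) * W) \<ge> 0" "Im (exp (\<i> * of_real \<theta>) * W) = 0 \<Longrightarrow> Re (exp (\<i> * of_real \<theta>) * W) > 0"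
  shows "0 \<le> \<theta> + Arg W" "\<theta> + Arg W < pi"
proof -
  have W0: "W \<noteq> 0" using W by auto
  have "\<bar>Arg W\<bar> < pi / 2" using W W0 Re_Ln_pos_lt[OF W0] by (simp add: Arg_eq_Im_Ln)
  then have a: "- (pi / 2) < \<theta> + Arg W" "\<theta> + Arg W < 3 * pi / 2" using \<theta> by auto
  define r where "r = norm W"
  have r: "r > 0" using W0 by (simp add: r_def)
  have "exp (\<i> * of_real \<theta>) * W = of_real r * exp (\<i> * of_real (\<theta> + Arg W))"
    using Arg_eq[OF W0] by (simp add: exp_add distrib_left mult_ac r_def)
  then have Im: "Im (exp (\<i> * of_real \<theta>) * W) = r * sin (\<theta> + Arg W)" and Re: "Re (exp (\<i> * of_real \<theta>) * W) = r * cos (\<theta> + Arg W)"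
    by (simp_all add: Im_exp Re_exp)
  have s: "sin (\<theta> + Arg W) \<ge> 0" using up(1) r unfolding Im by (simp add: zero_le_mult_iff)
  show "0 \<le> \<theta> + Arg W"
  proof (rule ccontr)
    assume "\<not> 0 \<le> \<theta> + Arg W"
    then have "sin (- (\<theta> + Arg W)) > 0" using a pi_gt_zero by (intro sin_gt_zero) linarith+
    then have "- sin (\<theta> + Arg W) > 0" by (simp only: sin_minus)
    then show False using s by simp
  qed
  show "\<theta> + Arg W < pi"
  proof (rule ccontr)
    assume n: "\<not> \<theta> + Arg W < pi"
    show False
    proof (cases "\<theta> + Arg W = pi")
      case True
      then show False using up(2) r unfolding Im Re by simp
    next
      case False
      then have "sin (\<theta> + Arg W - pi) > 0" using a n by (intro sin_gt_zero) linarith+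
      then show False using s by (simp add: sin_diff)
    qed
  qed
qed

lemma periodic_seq_mod:
  assumes "periodic_seq (int k) g"
  shows "g (n mod int k) = g n"
proof -
  have p: "g (n + int k) = g n" for n using assms by (simp add: periodic_seq_def)
  have nn: "g (n + int k * int l) = g n" for n l
  proof (induction l)
    case (Suc l)
    have "g (n + int k * int (Suc l)) = g (n + int k * int l + int k)" by (simp add: algebra_simps)
    then show ?case using p Suc by simp
  qed simp
  have "g (n + int k * l) = g n" for n l
  proof (cases "l \<ge> 0")
    case True
    then show ?thesis using nn[of n "nat l"] by simp
  next
    case False
    then show ?thesis using nn[of "n + int k * l" "nat (- l)"] by simp
  qed
  from this[of "n mod int k" "n div int k"] show ?thesis by simp
qed

lemma periodic_seq_cong:
  assumes "periodic_seq (int k) g" "[m = n] (mod int k)"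
  shows "g m = g n"
  using periodic_seq_mod[OF assms(1), of m] periodic_seq_mod[OF assms(1), of n] assms(2) by (simp add: cong_def)

text \<open>Counting up or down from any start gives a complete residue system. So the weights of
  all quadrants have the same sum, whatever their corners and directions, and their values at s = 2
  can cancel.\<close>

lemma sum_periodic:
  fixes g :: "int \<Rightarrow> complex"
  assumes k: "k > 0" and g: "periodic_seq (int k) g" and \<epsilon>: "\<epsilon> = 1 \<or> \<epsilon> = - 1"
  shows "(\<Sum>\<mu><k. g (m0 + \<epsilon> * int \<mu>)) = (\<Sum>\<mu><k. g (int \<mu>))"
proof -
  have *: "(\<Sum>\<mu><k. g (m0 + \<epsilon> * int \<mu>)) = (\<Sum>x\<in>{0..<int k}. g x)" if \<epsilon>: "\<epsilon> = 1 \<or> \<epsilon> = - 1" for m0 \<epsilon>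
  proof -
    have inj: "inj_on (\<lambda>\<mu>. (m0 + \<epsilon> * int \<mu>) mod int k) {..<k}"
    proof (rule inj_onI)
      fix x y assume xy: "x \<in> {..<k}" "y \<in> {..<k}" "(m0 + \<epsilon> * int x) mod int k = (m0 + \<epsilon> * int y) mod int k"
      then have "int k dvd (m0 + \<epsilon> * int x) - (m0 + \<epsilon> * int y)" by (simp add: mod_eq_dvd_iff)
      then have "int k dvd \<epsilon> * (int x - int y)" by (simp add: algebra_simps)
      then have "int k dvd int x - int y" using \<epsilon> by (auto simp: dvd_diff_commute)
      then have "int k dvd \<bar>int x - int y\<bar>" by simp
      moreover have "\<bar>int x - int y\<bar> < int k" using xy by auto
      ultimately show "x = y" using zdvd_not_zless[of "\<bar>int x - int y\<bar>" "int k"] by force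
    qed
    have "(\<lambda>\<mu>. (m0 + \<epsilon> * int \<mu>) mod int k) ` {..<k} \<subseteq> {0..<int k}" using k by auto
    moreover have "card ((\<lambda>\<mu>. (m0 + \<epsilon> * int \<mu>) mod int k) ` {..<k}) = card {0..<int k}"
      using card_image[OF inj] by simp
    ultimately have "(\<lambda>\<mu>. (m0 + \<epsilon> * int \<mu>) mod int k) ` {..<k} = {0..<int k}"
      by (intro card_subset_eq) auto
    then have "bij_betw (\<lambda>\<mu>. (m0 + \<epsilon> * int \<mu>) mod int k) {..<k} {0..<int k}" using inj by (simp add: bij_betw_def)
    from sum.reindex_bij_betw[OF this, of g] show ?thesis by (simp add: periodic_seq_mod[OF g])
  qed
  from *[OF \<epsilon>, of m0] *[of 1 0] show ?thesis by simp
qed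

section \<open>The lattice sum over quadrants\<close>

definition G_term :: "complex \<Rightarrow> (int \<Rightarrow> complex) \<Rightarrow> (int \<Rightarrow> complex) \<Rightarrow> real \<Rightarrow> real \<Rightarrow> complex \<Rightarrow> int \<times> int \<Rightarrow> complex" where
  "G_term z g h r1 r2 s = (\<lambda>(m, n). g m * h n * cpow_low ((of_int m + of_real r1) * z + of_int n + of_real r2) (- s))"

definition quadrant :: "int \<Rightarrow> int \<Rightarrow> int \<Rightarrow> int \<Rightarrow> (int \<times> int) set" where
  "quadrant m0 n0 \<epsilon>1 \<epsilon>2 = range (\<lambda>(i::nat, j::nat). (m0 + \<epsilon>1 * int i, n0 + \<epsilon>2 * int j))"

text \<open>The rotation by -\<theta> brings corner and generators into the right half-plane, where
  principal powers and Barnes sums apply. The hypothesis \<open>angle\<close> ensures that rotating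
  back stays within the branch of \<open>cpow_low\<close>, so each term changes only by the common
  factor exp(-i \<theta> s).\<close>

lemma quadrant_rep:
  fixes k :: nat and g h :: "int \<Rightarrow> complex" and z :: complex and r1 r2 \<theta> :: real and m0 n0 \<epsilon>1 \<epsilon>2 :: int
  assumes k: "k > 0" and g: "periodic_seq (int k) g" and h: "periodic_seq (int k) h" and z: "z \<noteq> 0"
    and \<epsilon>: "\<epsilon>1 = 1 \<or> \<epsilon>1 = - 1" "\<epsilon>2 = 1 \<or> \<epsilon>2 = - 1"
  defines "\<alpha> \<equiv> exp (- (\<i> * of_real \<theta>)) * (of_int \<epsilon>1 * z)" and "\<beta> \<equiv> exp (- (\<i> * of_real \<theta>)) * of_int \<epsilon>2"
    and "w \<equiv> exp (- (\<i> * of_real \<theta>)) * ((of_int m0 + of_real r1) * z + of_int n0 + of_real r2)"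
  assumes re: "Re \<alpha> > 0" "Re \<beta> > 0" "Re w > 0"
    and angle: "\<And>i j :: nat. - pi \<le> \<theta> + Arg (w + of_nat i * \<alpha> + of_nat j * \<beta>) \<and> \<theta> + Arg (w + of_nat i * \<alpha> + of_nat j * \<beta>) < pi"
  shows "\<exists>X \<Phi>. X holomorphic_on UNIV \<and> (\<forall>n\<ge>3. X (of_int n) = 0) \<and>
     X 2 = of_int (\<epsilon>1 * \<epsilon>2) * ((\<Sum>\<mu><k. g (int \<mu>)) * (\<Sum>\<nu><k. h (int \<nu>)) * hankel (\<lambda>u. exp (- u) / u ^ 2) 2 / (of_nat k ^ 2 * z)) \<and>
     \<Phi> holomorphic_on {s. Re s > 2} \<and>
     (\<forall>s. Re s > 2 \<longrightarrow> (G_term z g h r1 r2 s has_sum \<Phi> s) (quadrant m0 n0 \<epsilon>1 \<epsilon>2) \<and>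
        (exp (2 * of_real pi * \<i> * s) - 1) * (Gamma s * \<Phi> s) = X s)"
proof -
  define G where "G = (\<lambda>i j :: nat. g (m0 + \<epsilon>1 * int i) * h (n0 + \<epsilon>2 * int j))"
  define P where "P = (\<lambda>p::nat \<times> nat. barnes_kernel (w + of_nat (fst p) * \<alpha> + of_nat (snd p) * \<beta>) (of_nat k * \<alpha>) (of_nat k * \<beta>))"
  define I where "I = {..<k} \<times> {..<k}"
  have rew: "Re (w + of_nat i * \<alpha> + of_nat j * \<beta>) > 0" for i j :: nat using re by (auto intro!: add_pos_nonneg)
  have ker: "kernel 2 (P p)" for p
    unfolding P_def using k re rew by (intro kernel_barnes) auto
  define X where "X = (\<lambda>s. exp (- (\<i> * of_real \<theta> * s)) * (\<Sum>p\<in>I. G (fst p) (snd p) * hankel (P p) s))"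
  define \<Phi> where "\<Phi> = (\<lambda>s. exp (- (\<i> * of_real \<theta> * s)) * (\<Sum>p\<in>I. G (fst p) (snd p) * mellin (P p) s) * rGamma s)"
  have per: "g (m0 + \<epsilon>1 * int (i + k)) = g (m0 + \<epsilon>1 * int i)" "h (n0 + \<epsilon>2 * int (i + k)) = h (n0 + \<epsilon>2 * int i)" for i
    using \<epsilon> by (auto intro!: periodic_seq_cong[OF g] periodic_seq_cong[OF h] simp: cong_iff_dvd_diff algebra_simps)
  show ?thesis
  proof (rule exI[of _ X], rule exI[of _ \<Phi>], intro conjI allI impI)
    show "X holomorphic_on UNIV" unfolding X_def by (intro holomorphic_intros holomorphic_hankel[OF ker])
    show "X (of_int n) = 0" if "n \<ge> 3" for n using hankel_of_int_eq_0[OF ker, of n] that by (simp add: X_def)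
    show "\<Phi> holomorphic_on {s. Re s > 2}"
      unfolding \<Phi>_def using holomorphic_mellin_kernel[OF ker] by (intro holomorphic_intros) auto
    show "X 2 = of_int (\<epsilon>1 * \<epsilon>2) * ((\<Sum>\<mu><k. g (int \<mu>)) * (\<Sum>\<nu><k. h (int \<nu>)) * hankel (\<lambda>u. exp (- u) / u ^ 2) 2 / (of_nat k ^ 2 * z))"
    proof -
      define C where "C = hankel (\<lambda>u. exp (- u) / u ^ 2) 2"
      have hk2: "hankel (P p) 2 = C / ((of_nat k * \<alpha>) * (of_nat k * \<beta>))" for p
        unfolding P_def C_def using k re rew by (intro hankel_barnes_at_2) auto
      have "X 2 = exp (- (\<i> * of_real \<theta> * 2)) * ((\<Sum>p\<in>I. G (fst p) (snd p)) * (C / ((of_nat k * \<alpha>) * (of_nat k * \<beta>))))"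
        by (simp only: X_def hk2 sum_distrib_right)
      also have "(\<Sum>p\<in>I. G (fst p) (snd p)) = (\<Sum>\<mu><k. g (m0 + \<epsilon>1 * int \<mu>)) * (\<Sum>\<nu><k. h (n0 + \<epsilon>2 * int \<nu>))"
        unfolding I_def G_def sum_product sum.cartesian_product by (simp add: case_prod_unfold)
      also have "\<dots> = (\<Sum>\<mu><k. g (int \<mu>)) * (\<Sum>\<nu><k. h (int \<nu>))"
        using sum_periodic[OF k g \<epsilon>(1)] sum_periodic[OF k h \<epsilon>(2)] by simp
      \<comment> \<open>The product of the generators carries exp(-2 i \<theta>), which cancels the
        prefactor at s = 2. The value there depends on the quadrant only through the sign
        \<epsilon>1 \<epsilon>2.\<close>
      also have "(of_nat k * \<alpha>) * (of_nat k * \<beta>) = exp (- (\<i> * of_real \<theta> * 2)) * (of_int (\<epsilon>1 * \<epsilon>2) * (of_nat k ^ 2 * z))"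
      proof -
        have "exp (- (\<i> * of_real \<theta>)) * exp (- (\<i> * of_real \<theta>)) = exp (- (\<i> * of_real \<theta> * 2))"
          by (simp add: exp_add [symmetric] mult_ac)
        then have "\<alpha> * \<beta> = exp (- (\<i> * of_real \<theta> * 2)) * (of_int (\<epsilon>1 * \<epsilon>2) * z)"
          by (simp add: \<alpha>_def \<beta>_def mult_ac)
        then show ?thesis by (simp add: power2_eq_square mult_ac)
      qed
      finally show ?thesis using \<epsilon> by (auto simp: C_def)
    qed
    fix s assume s: "Re s > 2"
    have G0: "Gamma s * rGamma s = 1" using s by (intro Gamma_mult_rGamma) auto
    then have rG: "rGamma s = 1 / Gamma s" by (metis nonzero_eq_divide_eq mult.commute mult_zero_left zero_neq_one)
    have "(exp (2 * of_real pi * \<i> * s) - 1) * (Gamma s * \<Phi> s) =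
       exp (- (\<i> * of_real \<theta> * s)) * ((exp (2 * of_real pi * \<i> * s) - 1) * (\<Sum>p\<in>I. G (fst p) (snd p) * mellin (P p) s)) * (Gamma s * rGamma s)"
      by (simp only: \<Phi>_def mult_ac)
    also have "\<dots> = X s"
      using hankel_eq_mellin[OF ker, of s] s unfolding G0 X_def by (simp add: sum_distrib_left mult_ac)
    finally show "(exp (2 * of_real pi * \<i> * s) - 1) * (Gamma s * \<Phi> s) = X s" .
    have "((\<lambda>(i, j). G i j * (w + of_nat i * \<alpha> + of_nat j * \<beta>) powr - s) has_sum
       ((\<Sum>(\<mu>, \<nu>)\<in>I. G \<mu> \<nu> * mellin (P (\<mu>, \<nu>)) s) / Gamma s)) UNIV"
      unfolding I_def P_def fst_conv snd_conv using k re s per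
      by (intro barnes_weighted_has_sum) (auto simp: G_def)
    from has_sum_cmult_right[OF this, of "exp (- (\<i> * of_real \<theta> * s))"]
    have 1: "((\<lambda>p. exp (- (\<i> * of_real \<theta> * s)) * (case p of (i, j) \<Rightarrow> G i j * (w + of_nat i * \<alpha> + of_nat j * \<beta>) powr - s)) has_sum \<Phi> s) UNIV"
      by (simp add: \<Phi>_def rG case_prod_unfold)
    have 2: "exp (- (\<i> * of_real \<theta> * s)) * (case p of (i, j) \<Rightarrow> G i j * (w + of_nat i * \<alpha> + of_nat j * \<beta>) powr - s) =
       G_term z g h r1 r2 s (case p of (i, j) \<Rightarrow> (m0 + \<epsilon>1 * int i, n0 + \<epsilon>2 * int j))" for p :: "nat \<times> nat"
    proof -
      obtain i j where p: "p = (i, j)" by (cases p)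
      define W where "W = w + of_nat i * \<alpha> + of_nat j * \<beta>"
      have e: "exp (\<i> * of_real \<theta>) * exp (- (\<i> * of_real \<theta>)) = 1" by (simp add: exp_add [symmetric])
      have "exp (\<i> * of_real \<theta>) * W = (exp (\<i> * of_real \<theta>) * exp (- (\<i> * of_real \<theta>))) *
          ((of_int m0 + of_real r1) * z + of_int n0 + of_real r2 + of_nat i * (of_int \<epsilon>1 * z) + of_nat j * of_int \<epsilon>2)"
        unfolding W_def w_def \<alpha>_def \<beta>_def by (simp add: distrib_left mult_ac)
      also have "\<dots> = (of_int (m0 + \<epsilon>1 * int i) + of_real r1) * z + of_int (n0 + \<epsilon>2 * int j) + of_real r2"
        unfolding e by (simp add: algebra_simps)
      finally have eW: "(of_int (m0 + \<epsilon>1 * int i) + of_real r1) * z + of_int (n0 + \<epsilon>2 * int j) + of_real r2 = exp (\<i> * of_real \<theta>) * W" ..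
      have "cpow_low (exp (\<i> * of_real \<theta>) * W) (- s) = exp (\<i> * of_real \<theta> * (- s)) * W powr (- s)"
        using angle[of i j] rew[of i j] unfolding W_def by (intro cpow_low_rotate) auto
      then show ?thesis by (simp only: p prod.case G_term_def eW G_def W_def[symmetric]) simp
    qed
    have inj: "inj (\<lambda>(i::nat, j::nat). (m0 + \<epsilon>1 * int i, n0 + \<epsilon>2 * int j))"
      using \<epsilon> by (auto simp: inj_on_def)
    show "(G_term z g h r1 r2 s has_sum \<Phi> s) (quadrant m0 n0 \<epsilon>1 \<epsilon>2)"
      unfolding quadrant_def has_sum_reindex[OF inj] o_def using 1 unfolding 2 .
  qed
qed

text \<open>The quadrants form a pinwheel around the omitted point: each takes exactly one of its
  two boundary half-axes. Floor, ceiling and the shifts by one encode which of the inequalities are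
  strict.\<close>

lemma quadrants_cover:
  fixes r1 r2 :: real
  defines "Q1 \<equiv> quadrant \<lceil>- r1\<rceil> (\<lfloor>- r2\<rfloor> + 1) 1 1" and "Q2 \<equiv> quadrant (\<lfloor>- r1\<rfloor> + 1) \<lfloor>- r2\<rfloor> 1 (- 1)"
    and "Q3 \<equiv> quadrant \<lfloor>- r1\<rfloor> (\<lceil>- r2\<rceil> - 1) (- 1) (- 1)" and "Q4 \<equiv> quadrant (\<lceil>- r1\<rceil> - 1) \<lceil>- r2\<rceil> (- 1) 1"
  shows "{(m, n). \<not> (real_of_int m = - r1 \<and> real_of_int n = - r2)} = Q1 \<union> (Q2 \<union> (Q3 \<union> Q4))"
    "Q1 \<inter> (Q2 \<union> (Q3 \<union> Q4)) = {}" "Q2 \<inter> (Q3 \<union> Q4) = {}" "Q3 \<inter> Q4 = {}"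
proof -
  have qq: "quadrant m0 n0 \<epsilon>1 \<epsilon>2 = {(m, n). \<epsilon>1 * (m - m0) \<ge> 0 \<and> \<epsilon>2 * (n - n0) \<ge> 0}"
    if \<epsilon>: "\<epsilon>1 * \<epsilon>1 = 1" "\<epsilon>2 * \<epsilon>2 = 1" for m0 n0 \<epsilon>1 \<epsilon>2
  proof (intro equalityI subsetI)
    fix p assume "p \<in> {(m, n). \<epsilon>1 * (m - m0) \<ge> 0 \<and> \<epsilon>2 * (n - n0) \<ge> 0}"
    then obtain m n where p: "p = (m, n)" "\<epsilon>1 * (m - m0) \<ge> 0" "\<epsilon>2 * (n - n0) \<ge> 0" by auto
    have e: "\<epsilon>1 * (\<epsilon>1 * (m - m0)) = m - m0" "\<epsilon>2 * (\<epsilon>2 * (n - n0)) = n - n0"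
      using \<epsilon> by (simp_all add: mult.assoc [symmetric])
    have "p = (case (nat (\<epsilon>1 * (m - m0)), nat (\<epsilon>2 * (n - n0))) of (i, j) \<Rightarrow> (m0 + \<epsilon>1 * int i, n0 + \<epsilon>2 * int j))"
      by (simp only: p(1) prod.case nat_0_le[OF p(2)] nat_0_le[OF p(3)] e) simp
    then show "p \<in> quadrant m0 n0 \<epsilon>1 \<epsilon>2" unfolding quadrant_def by blast
  next
    fix p assume "p \<in> quadrant m0 n0 \<epsilon>1 \<epsilon>2"
    then show "p \<in> {(m, n). \<epsilon>1 * (m - m0) \<ge> 0 \<and> \<epsilon>2 * (n - n0) \<ge> 0}"
      using \<epsilon> by (auto simp: quadrant_def mult.assoc [symmetric])
  qed
  have qpp: "quadrant m0 n0 1 1 = {(m, n). m \<ge> m0 \<and> n \<ge> n0}" and qpm: "quadrant m0 n0 1 (- 1) = {(m, n). m \<ge> m0 \<and> n \<le> n0}"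
    and qmm: "quadrant m0 n0 (- 1) (- 1) = {(m, n). m \<le> m0 \<and> n \<le> n0}" and qmp: "quadrant m0 n0 (- 1) 1 = {(m, n). m \<le> m0 \<and> n \<ge> n0}"
    for m0 n0 by (subst qq; auto)+
  have e: "m \<ge> \<lceil>- r\<rceil> \<longleftrightarrow> real_of_int m + r \<ge> 0" "m \<ge> \<lfloor>- r\<rfloor> + 1 \<longleftrightarrow> real_of_int m + r > 0"
     "m \<le> \<lfloor>- r\<rfloor> \<longleftrightarrow> real_of_int m + r \<le> 0" "m \<le> \<lceil>- r\<rceil> - 1 \<longleftrightarrow> real_of_int m + r < 0" for m r
    by linarith+
  have q: "Q1 = {(m, n). real_of_int m + r1 \<ge> 0 \<and> real_of_int n + r2 > 0}" "Q2 = {(m, n). real_of_int m + r1 > 0 \<and> real_of_int n + r2 \<le> 0}"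
    "Q3 = {(m, n). real_of_int m + r1 \<le> 0 \<and> real_of_int n + r2 < 0}" "Q4 = {(m, n). real_of_int m + r1 < 0 \<and> real_of_int n + r2 \<ge> 0}"
    unfolding Q1_def Q2_def Q3_def Q4_def qpp qpm qmm qmp e by (rule refl)+
  show "{(m, n). \<not> (real_of_int m = - r1 \<and> real_of_int n = - r2)} = Q1 \<union> (Q2 \<union> (Q3 \<union> Q4))"
    unfolding q by auto
  show "Q1 \<inter> (Q2 \<union> (Q3 \<union> Q4)) = {}" "Q2 \<inter> (Q3 \<union> Q4) = {}" "Q3 \<inter> Q4 = {}"
    unfolding q by auto
qed


text \<open>Going round the origin the sign \<epsilon>1 \<epsilon>2 alternates, so the values of the
  four entire functions at 2 are Q, -Q, Q, -Q and add to zero. A single quadrant may have a pole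
  there.\<close>

lemma G_series_mellin_rep:
  fixes k :: nat and g h :: "int \<Rightarrow> complex" and z :: complex and r1 r2 :: real
  assumes k: "k > 0" and g: "periodic_seq (int k) g" and h: "periodic_seq (int k) h" and z: "Im z > 0"
  shows "\<exists>X. mellin_rep 2 (G_series z g h r1 r2) X"
    and "Re s > 2 \<Longrightarrow> (G_term z g h r1 r2 s has_sum G_series z g h r1 r2 s) {(m, n). \<not> (real_of_int m = - r1 \<and> real_of_int n = - r2)}"
proof -
  define D where "D = {(m, n). \<not> (real_of_int m = - r1 \<and> real_of_int n = - r2)}"
  define Q where "Q = (\<Sum>\<mu><k. g (int \<mu>)) * (\<Sum>\<nu><k. h (int \<nu>)) * hankel (\<lambda>u. exp (- u) / u ^ 2) 2 / (of_nat k ^ 2 * z)"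
  define A where "A = Arg z"
  have z0: "z \<noteq> 0" using z by auto
  have A: "0 < A" "A < pi" using Arg_lt_pi[of z] z by (auto simp: A_def)
  have zA: "z = of_real (norm z) * exp (\<i> * of_real A)" using Arg_eq[OF z0] by (simp add: A_def)
  have expz: "exp (- (\<i> * of_real \<theta>)) * z = of_real (norm z) * exp (\<i> * of_real (A - \<theta>))" for \<theta>
  proof -
    have "exp (- (\<i> * of_real \<theta>)) * z = of_real (norm z) * (exp (- (\<i> * of_real \<theta>)) * exp (\<i> * of_real A))"
      by (subst zA) (simp only: mult_ac)
    then show ?thesis by (simp add: exp_add [symmetric] algebra_simps)
  qed
  have Re_rot: "Re (exp (- (\<i> * of_real \<theta>)) * z) = norm z * cos (A - \<theta>)" for \<theta>
    unfolding expz by (simp add: Re_exp)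
  have Re_one: "Re (exp (- (\<i> * of_real \<theta>))) = cos \<theta>" for \<theta> by (simp add: Re_exp)
  have nz: "norm z > 0" using z0 by simp
  have rotpi: "exp (- (\<i> * of_real (\<theta> - pi))) = - exp (- (\<i> * of_real \<theta>))" for \<theta>
  proof -
    have "exp (- (\<i> * of_real (\<theta> - pi))) = exp (- (\<i> * of_real \<theta>) + \<i> * of_real pi)" by (simp add: algebra_simps)
    also have "\<dots> = exp (- (\<i> * of_real \<theta>)) * exp (\<i> * of_real pi)" by (rule exp_add)
    finally show ?thesis by simp
  qed
  have inv: "exp (\<i> * of_real \<theta>) * (exp (- (\<i> * of_real \<theta>)) * W) = W" for \<theta> W
    by (simp add: mult.assoc [symmetric] exp_add [symmetric])
  text \<open>The cone over the generators \<open>\<epsilon>1 * z\<close> and \<open>\<epsilon>2\<close>, rotated by \<open>- \<theta>\<close> into the right half-plane;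
    \<open>\<sigma>\<close> distinguishes the cone from its reflection in the origin.\<close>
  have cone: "\<exists>X \<Phi>. X holomorphic_on UNIV \<and> (\<forall>n\<ge>3. X (of_int n) = 0) \<and>
     X 2 = of_int (\<epsilon>1 * \<epsilon>2) * Q \<and> \<Phi> holomorphic_on {s. Re s > 2} \<and>
     (\<forall>s. Re s > 2 \<longrightarrow> (G_term z g h r1 r2 s has_sum \<Phi> s) (quadrant m0 n0 \<epsilon>1 \<epsilon>2) \<and>
        (exp (2 * of_real pi * \<i> * s) - 1) * (Gamma s * \<Phi> s) = X s)"
    if \<epsilon>: "\<sigma> = 1 \<or> \<sigma> = - 1" "\<epsilon>1 = \<sigma>" "\<epsilon>2 = 1 \<or> \<epsilon>2 = - 1"
      and xy: "of_int \<sigma> * (of_int m0 + r1) \<ge> 0" "of_int \<epsilon>2 * (of_int n0 + r2) \<ge> 0"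
        "if \<epsilon>2 = \<sigma> then of_int \<epsilon>2 * (of_int n0 + r2) > 0 else of_int \<sigma> * (of_int m0 + r1) > 0"
    for \<sigma> \<epsilon>1 \<epsilon>2 m0 n0
  proof -
    \<comment> \<open>The bisector of the cone: up to the sign \<sigma> the generators are z and 1,
      at angles A and 0, or z and -1, at angles A and pi. The opening is less than pi, so both
      generators land in the right half-plane.\<close>
    define \<theta>0 where "\<theta>0 = (if \<epsilon>2 = \<sigma> then A / 2 else (A + pi) / 2)"
    define \<theta> where "\<theta> = (if \<sigma> = 1 then \<theta>0 else \<theta>0 - pi)"
    define \<alpha> where "\<alpha> = exp (- (\<i> * of_real \<theta>)) * (of_int \<epsilon>1 * z)"
    define \<beta> where "\<beta> = exp (- (\<i> * of_real \<theta>)) * of_int \<epsilon>2"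
    define w where "w = exp (- (\<i> * of_real \<theta>)) * ((of_int m0 + of_real r1) * z + of_int n0 + of_real r2)"
    have \<theta>0: "0 < \<theta>0" "\<theta>0 < pi" using A by (auto simp: \<theta>0_def)
    have rot: "exp (- (\<i> * of_real \<theta>)) = of_int \<sigma> * exp (- (\<i> * of_real \<theta>0))"
      using \<epsilon>(1) rotpi[of \<theta>0] by (auto simp: \<theta>_def)
    have \<sigma>\<sigma>: "of_int \<sigma> * of_int \<sigma> = (1::real)" "of_int \<sigma> * of_int \<sigma> = (1::complex)" using \<epsilon>(1) by auto
    have \<alpha>': "\<alpha> = exp (- (\<i> * of_real \<theta>0)) * z"
      using \<sigma>\<sigma>(2) unfolding \<alpha>_def rot \<epsilon>(2) by (simp add: mult_ac)
    have \<beta>': "\<beta> = of_int (\<sigma> * \<epsilon>2) * exp (- (\<i> * of_real \<theta>0))" unfolding \<beta>_def rot by (simp add: mult_ac)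
    have Re\<alpha>: "Re \<alpha> > 0"
    proof -
      have "cos (A - \<theta>0) > 0" using A by (intro cos_gt_zero_pi) (auto simp: \<theta>0_def field_simps)
      then show ?thesis unfolding \<alpha>' Re_rot using nz by simp
    qed
    have Re\<beta>: "Re \<beta> > 0"
    proof (cases "\<epsilon>2 = \<sigma>")
      case True
      have "cos (A / 2) > 0" using A by (intro cos_gt_zero_pi) auto
      then show ?thesis using True \<epsilon>(1) Re_one[of "A / 2"] unfolding \<beta>' by (auto simp: \<theta>0_def)
    next
      case False
      then have "\<sigma> * \<epsilon>2 = - 1" using \<epsilon> by auto
      moreover have "cos ((A + pi) / 2) < 0"
      proof -
        have "cos ((A + pi) / 2) = - sin (A / 2)" by (simp add: add_divide_distrib cos_add)
        moreover have "sin (A / 2) > 0" using A by (intro sin_gt_zero) auto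
        ultimately show ?thesis by simp
      qed
      ultimately show ?thesis using False Re_one[of "(A + pi) / 2"] unfolding \<beta>' by (simp add: \<theta>0_def)
    qed
    define x y where "x = of_int \<sigma> * (of_int m0 + r1)" and "y = of_int \<epsilon>2 * (of_int n0 + r2)"
    have xy': "x \<ge> 0" "y \<ge> 0" "if \<epsilon>2 = \<sigma> then y > 0 else x > 0" using xy by (auto simp: x_def y_def)
    have ww: "w = of_real x * \<alpha> + of_real y * \<beta>"
    proof -
      have "of_int \<epsilon>2 * of_int \<epsilon>2 = (1::complex)" using \<epsilon>(3) by auto
      then have "of_real y * \<beta> = exp (- (\<i> * of_real \<theta>)) * (of_int n0 + of_real r2)"
        unfolding \<beta>_def y_def by (simp add: mult_ac; metis mult.assoc mult_1)
      moreover have "of_real x * \<alpha> = exp (- (\<i> * of_real \<theta>)) * ((of_int m0 + of_real r1) * z)"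
        using \<sigma>\<sigma>(2) unfolding \<alpha>_def x_def \<epsilon>(2) by (simp add: mult_ac; metis mult.assoc mult_1)
      ultimately show ?thesis unfolding w_def by (simp add: algebra_simps)
    qed
    have Re_pos: "Re (of_real x * \<alpha> + of_real y * \<beta>) > 0" if "x \<ge> 0" "y \<ge> 0" "x > 0 \<or> y > 0" for x y
    proof -
      have "Re (of_real x * \<alpha> + of_real y * \<beta>) = x * Re \<alpha> + y * Re \<beta>" by simp
      also have "\<dots> > 0" using that Re\<alpha> Re\<beta>
        by (elim disjE) (auto intro: add_pos_nonneg add_nonneg_pos)
      finally show ?thesis .
    qed
    have Rew: "Re w > 0" unfolding ww using xy' by (intro Re_pos) (auto split: if_splits)
    have ang: "- pi \<le> \<theta> + Arg (w + of_nat i * \<alpha> + of_nat j * \<beta>) \<and> \<theta> + Arg (w + of_nat i * \<alpha> + of_nat j * \<beta>) < pi" for i j :: nat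
    proof -
      define W where "W = w + of_nat i * \<alpha> + of_nat j * \<beta>"
      define x' y' where "x' = x + real i" and "y' = y + real j"
      have xy2: "x' \<ge> 0" "y' \<ge> 0" "if \<epsilon>2 = \<sigma> then y' > 0 else x' > 0" using xy' by (auto simp: x'_def y'_def)
      have WW: "W = of_real x' * \<alpha> + of_real y' * \<beta>" by (simp add: W_def ww x'_def y'_def algebra_simps)
      have ReW: "Re W > 0" unfolding WW using xy2 by (intro Re_pos) (auto split: if_splits)
      have eW: "exp (\<i> * of_real \<theta>0) * W = of_real x' * z + of_real (of_int (\<sigma> * \<epsilon>2) * y')"
      proof -
        have "exp (\<i> * of_real \<theta>0) * W = of_real x' * (exp (\<i> * of_real \<theta>0) * (exp (- (\<i> * of_real \<theta>0)) * z))
           + of_real y' * (exp (\<i> * of_real \<theta>0) * (exp (- (\<i> * of_real \<theta>0)) * of_int (\<sigma> * \<epsilon>2)))"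
          unfolding WW \<alpha>' \<beta>' by (simp only: distrib_left mult_ac)
        then show ?thesis unfolding inv by (simp add: mult_ac)
      qed
      have up: "0 \<le> Im (exp (\<i> * complex_of_real \<theta>0) * W)" unfolding eW using xy2 z by simp
      have up0: "0 < Re (exp (\<i> * complex_of_real \<theta>0) * W)" if "Im (exp (\<i> * complex_of_real \<theta>0) * W) = 0"
      proof -
        have "x' = 0" using that unfolding eW using z by simp
        then have "\<epsilon>2 = \<sigma>" "y' > 0" using xy2 by (auto split: if_splits)
        then show ?thesis unfolding eW using \<open>x' = 0\<close> \<epsilon>(1) by auto
      qed
      \<comment> \<open>The cones with \<sigma> = 1 fill the angles [0, pi), and subtracting pi puts
        their reflections into [-pi, 0). The asymmetric branch range is met exactly, negative real
        values getting the argument -pi.\<close>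
      have "0 \<le> \<theta>0 + Arg W" "\<theta>0 + Arg W < pi"
        using upper_cone_angle[OF \<theta>0 ReW up up0] by blast+
      then show ?thesis using pi_gt_zero unfolding W_def[symmetric] \<theta>_def by auto
    qed
    show ?thesis
      unfolding Q_def
      by (rule quadrant_rep[OF k g h z0 _ \<epsilon>(3), of \<epsilon>1 \<theta> m0 r1 n0 r2])
        (use Re\<alpha> Re\<beta> Rew ang \<epsilon> in \<open>auto simp only: \<alpha>_def \<beta>_def w_def\<close>)
  qed
  have r: "of_int \<lceil>- r\<rceil> + r \<ge> 0" "of_int (\<lfloor>- r\<rfloor> + 1) + r > 0" "of_int \<lfloor>- r\<rfloor> + r \<le> 0" "of_int (\<lceil>- r\<rceil> - 1) + r < 0" for r :: real
    by linarith+
  define Q1 Q2 Q3 Q4 where "Q1 = quadrant \<lceil>- r1\<rceil> (\<lfloor>- r2\<rfloor> + 1) 1 1" and "Q2 = quadrant (\<lfloor>- r1\<rfloor> + 1) \<lfloor>- r2\<rfloor> 1 (- 1)"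
    and "Q3 = quadrant \<lfloor>- r1\<rfloor> (\<lceil>- r2\<rceil> - 1) (- 1) (- 1)" and "Q4 = quadrant (\<lceil>- r1\<rceil> - 1) \<lceil>- r2\<rceil> (- 1) 1"
  have cov: "D = Q1 \<union> (Q2 \<union> (Q3 \<union> Q4))" "Q1 \<inter> (Q2 \<union> (Q3 \<union> Q4)) = {}" "Q2 \<inter> (Q3 \<union> Q4) = {}" "Q3 \<inter> Q4 = {}"
    unfolding D_def Q1_def Q2_def Q3_def Q4_def by (rule quadrants_cover)+
  obtain X1 \<Phi>1 where 1: "X1 holomorphic_on UNIV" "\<And>n. n \<ge> 3 \<Longrightarrow> X1 (of_int n) = 0" "X1 2 = Q" "\<Phi>1 holomorphic_on {s. Re s > 2}"
    "\<And>s. Re s > 2 \<Longrightarrow> (G_term z g h r1 r2 s has_sum \<Phi>1 s) Q1"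
    "\<And>s. Re s > 2 \<Longrightarrow> (exp (2 * of_real pi * \<i> * s) - 1) * (Gamma s * \<Phi>1 s) = X1 s"
    using cone[of 1 1 1 "\<lceil>- r1\<rceil>" "\<lfloor>- r2\<rfloor> + 1"] r[of r1] r[of r2] unfolding Q1_def by auto
  obtain X2 \<Phi>2 where 2: "X2 holomorphic_on UNIV" "\<And>n. n \<ge> 3 \<Longrightarrow> X2 (of_int n) = 0" "X2 2 = - Q" "\<Phi>2 holomorphic_on {s. Re s > 2}"
    "\<And>s. Re s > 2 \<Longrightarrow> (G_term z g h r1 r2 s has_sum \<Phi>2 s) Q2"
    "\<And>s. Re s > 2 \<Longrightarrow> (exp (2 * of_real pi * \<i> * s) - 1) * (Gamma s * \<Phi>2 s) = X2 s"
    using cone[of 1 1 "- 1" "\<lfloor>- r1\<rfloor> + 1" "\<lfloor>- r2\<rfloor>"] r[of r1] r[of r2] unfolding Q2_def by auto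
  obtain X3 \<Phi>3 where 3: "X3 holomorphic_on UNIV" "\<And>n. n \<ge> 3 \<Longrightarrow> X3 (of_int n) = 0" "X3 2 = Q" "\<Phi>3 holomorphic_on {s. Re s > 2}"
    "\<And>s. Re s > 2 \<Longrightarrow> (G_term z g h r1 r2 s has_sum \<Phi>3 s) Q3"
    "\<And>s. Re s > 2 \<Longrightarrow> (exp (2 * of_real pi * \<i> * s) - 1) * (Gamma s * \<Phi>3 s) = X3 s"
    using cone[of "- 1" "- 1" "- 1" "\<lfloor>- r1\<rfloor>" "\<lceil>- r2\<rceil> - 1"] r[of r1] r[of r2] unfolding Q3_def by auto
  obtain X4 \<Phi>4 where 4: "X4 holomorphic_on UNIV" "\<And>n. n \<ge> 3 \<Longrightarrow> X4 (of_int n) = 0" "X4 2 = - Q" "\<Phi>4 holomorphic_on {s. Re s > 2}"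
    "\<And>s. Re s > 2 \<Longrightarrow> (G_term z g h r1 r2 s has_sum \<Phi>4 s) Q4"
    "\<And>s. Re s > 2 \<Longrightarrow> (exp (2 * of_real pi * \<i> * s) - 1) * (Gamma s * \<Phi>4 s) = X4 s"
    using cone[of "- 1" "- 1" 1 "\<lceil>- r1\<rceil> - 1" "\<lceil>- r2\<rceil>"] r[of r1] r[of r2] unfolding Q4_def by auto
  have sum: "(G_term z g h r1 r2 s has_sum (\<Phi>1 s + (\<Phi>2 s + (\<Phi>3 s + \<Phi>4 s)))) D" if "Re s > 2" for s
    unfolding cov(1) using 1(5) 2(5) 3(5) 4(5) that cov(2-4) by (intro has_sum_Un_disjoint) auto
  have Geq: "G_series z g h r1 r2 s = \<Phi>1 s + (\<Phi>2 s + (\<Phi>3 s + \<Phi>4 s))" if "Re s > 2" for s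
    using infsumI[OF sum[OF that]] by (simp add: G_series_def G_term_def D_def)
  then show "Re s > 2 \<Longrightarrow> (G_term z g h r1 r2 s has_sum G_series z g h r1 r2 s) {(m, n). \<not> (real_of_int m = - r1 \<and> real_of_int n = - r2)}"
    using sum unfolding D_def by simp
  have "mellin_rep 2 (G_series z g h r1 r2) (\<lambda>s. X1 s + (X2 s + (X3 s + X4 s)))"
    unfolding mellin_rep_def
  proof (intro conjI allI impI)
    show "(\<lambda>s. X1 s + (X2 s + (X3 s + X4 s))) holomorphic_on UNIV" by (intro holomorphic_intros 1 2 3 4)
    show "X1 (of_int n) + (X2 (of_int n) + (X3 (of_int n) + X4 (of_int n))) = 0" if "n \<ge> 2" for n
    proof (cases "n = 2")
      case True
      then show ?thesis using 1(3) 2(3) 3(3) 4(3) by simp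
    next
      case False
      then have "n \<ge> 3" using that by simp
      then show ?thesis using 1(2) 2(2) 3(2) 4(2) by simp
    qed
    have "(\<lambda>s. \<Phi>1 s + (\<Phi>2 s + (\<Phi>3 s + \<Phi>4 s))) holomorphic_on {s. Re s > 2}" by (intro holomorphic_intros 1 2 3 4)
    then show "G_series z g h r1 r2 holomorphic_on {s. Re s > 2}" by (rule holomorphic_transform) (simp add: Geq)
    fix s assume s: "Re s > 2"
    show "(exp (2 * of_real pi * \<i> * s) - 1) * (Gamma s * G_series z g h r1 r2 s) = X1 s + (X2 s + (X3 s + X4 s))"
      unfolding Geq[OF s] 1(6)[OF s, symmetric] 2(6)[OF s, symmetric] 3(6)[OF s, symmetric] 4(6)[OF s, symmetric]
      by (simp only: distrib_left)
  qed
  then show "\<exists>X. mellin_rep 2 (G_series z g h r1 r2) X" by blast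
qed

section \<open>The change of branch and the transformation formula\<close>

lemma cpow_low_exp: "W \<noteq> 0 \<Longrightarrow> - pi \<le> a \<Longrightarrow> a < pi \<Longrightarrow> W = of_real r * exp (\<i> * of_real a) \<Longrightarrow> r > 0 \<Longrightarrow>
    cpow_low W s = exp (s * (of_real (ln r) + \<i> * of_real a))"
  using arg_low_unique[of W r a] by (simp add: cpow_low_def norm_mult Complex_eq)

text \<open>The argument of W / \<tau> is the difference of the arguments unless this drops below
  -pi. Then 2 pi has to be added, which multiplies the power by exp(-2 pi i s).\<close>

lemma cpow_low_quotient:
  assumes \<tau>: "Im \<tau> > 0" and W: "W \<noteq> 0"
  shows "cpow_low \<tau> (- s) * cpow_low (W / \<tau>) (- s) =
    (if Im (- W) \<ge> 0 \<and> Im (- W * cnj \<tau>) < 0 then exp (- (2 * of_real pi * \<i> * s)) else 1) * cpow_low W (- s)"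
proof -
  define A where "A = arg_low \<tau>"
  define \<omega> where "\<omega> = arg_low W"
  define R r where "R = norm W" and "r = norm \<tau>"
  have \<tau>0: "\<tau> \<noteq> 0" using \<tau> by auto
  have pos: "R > 0" "r > 0" using W \<tau>0 by (auto simp: R_def r_def)
  have We: "W = of_real R * exp (\<i> * of_real \<omega>)" and \<tau>e: "\<tau> = of_real r * exp (\<i> * of_real A)"
    using polar_arg_low[of W] polar_arg_low[of \<tau>] by (auto simp: R_def r_def \<omega>_def A_def)
  have \<omega>: "- pi \<le> \<omega>" "\<omega> < pi" unfolding \<omega>_def by (rule arg_low_bounds)+
  have A: "0 < A" "A < pi"
  proof -
    have "0 < Arg \<tau>" "Arg \<tau> < pi" using Arg_lt_pi[of \<tau>] \<tau> by auto
    then show "0 < A" "A < pi" by (auto simp: A_def arg_low_def)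
  qed
  have quot: "W / \<tau> = of_real (R / r) * exp (\<i> * of_real (\<omega> - A))"
    unfolding We \<tau>e by (simp add: exp_diff right_diff_distrib)
  have lnq: "ln (R / r) = ln R - ln r" using pos by (simp add: ln_div)
  have cW: "cpow_low W (- s) = exp (- s * (of_real (ln R) + \<i> * of_real \<omega>))"
    using W \<omega> We pos by (intro cpow_low_exp) auto
  have c\<tau>: "cpow_low \<tau> (- s) = exp (- s * (of_real (ln r) + \<i> * of_real A))"
    using \<tau>0 A \<tau>e pos by (intro cpow_low_exp) auto
  \<comment> \<open>Here - W has the argument \<omega> + pi in [0, 2 pi), and a drop below -pi means
    that this argument is less than A. The two imaginary parts are positive multiples of the sines
    of \<omega> + pi and \<omega> + pi - A, whose signs decide this.\<close>
  have "(Im (- W) \<ge> 0 \<and> Im (- W * cnj \<tau>) < 0) \<longleftrightarrow> \<omega> - A < - pi"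
  proof -
    have 1: "Im (- W) = R * sin (\<omega> + pi)" unfolding We by (simp add: Im_exp)
    have "- W * cnj \<tau> = - of_real (R * r) * exp (\<i> * of_real (\<omega> - A))"
      unfolding We \<tau>e by (simp add: exp_cnj exp_add [symmetric] algebra_simps)
    then have 2: "Im (- W * cnj \<tau>) = R * r * sin (\<omega> + pi - A)"
      by (simp add: Im_exp sin_diff sin_add cos_add algebra_simps)
    have 3: "Im (- W) \<ge> 0 \<longleftrightarrow> sin (\<omega> + pi) \<ge> 0" "Im (- W * cnj \<tau>) < 0 \<longleftrightarrow> sin (\<omega> + pi - A) < 0"
      unfolding 1 2 using pos by (auto simp: zero_le_mult_iff mult_less_0_iff mult_le_0_iff)
    show ?thesis
    proof
      assume "Im (- W) \<ge> 0 \<and> Im (- W * cnj \<tau>) < 0"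
      then have s: "sin (\<omega> + pi) \<ge> 0" "sin (\<omega> + pi - A) < 0" using 3 by auto
      have "\<omega> + pi \<le> pi"
      proof (rule ccontr)
        assume "\<not> \<omega> + pi \<le> pi"
        then have "sin \<omega> > 0" using \<omega> by (intro sin_gt_zero) auto
        then show False using s by simp
      qed
      show "\<omega> - A < - pi"
      proof (rule ccontr)
        assume "\<not> \<omega> - A < - pi"
        then have "sin (\<omega> + pi - A) \<ge> 0" using A \<open>\<omega> + pi \<le> pi\<close> by (intro sin_ge_zero) auto
        then show False using s by simp
      qed
    next
      assume l: "\<omega> - A < - pi"
      have "sin (\<omega> + pi) \<ge> 0" using l A \<omega> by (intro sin_ge_zero) auto
      moreover have "sin (- (\<omega> + pi - A)) > 0" using l A \<omega> by (intro sin_gt_zero) auto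
      then have "sin (\<omega> + pi - A) < 0" by (simp only: sin_minus)
      ultimately show "Im (- W) \<ge> 0 \<and> Im (- W * cnj \<tau>) < 0" using 3 by simp
    qed
  qed
  moreover have "cpow_low (W / \<tau>) (- s) = exp (- s * (of_real (ln (R / r)) + \<i> * of_real (\<omega> - A)))" if "\<not> \<omega> - A < - pi"
    using that W \<tau>0 A \<omega> pos quot by (intro cpow_low_exp) auto
  moreover have "cpow_low (W / \<tau>) (- s) = exp (- s * (of_real (ln (R / r)) + \<i> * of_real (\<omega> - A + 2 * pi)))" if "\<omega> - A < - pi"
  proof (rule cpow_low_exp)
    have "exp (\<i> * of_real (\<omega> - A + 2 * pi)) = exp (\<i> * of_real (\<omega> - A))"
      using exp_2pi_i_of_int[of 1] by (simp add: distrib_left exp_add mult_ac)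
    then show "W / \<tau> = of_real (R / r) * exp (\<i> * of_real (\<omega> - A + 2 * pi))" using quot by simp
  qed (use that W \<tau>0 A \<omega> pos in auto)
  ultimately show ?thesis
    unfolding cW c\<tau> by (auto simp: exp_add [symmetric] lnq algebra_simps)
qed

text \<open>Since Arg W lies in [0, pi), the negative has argument Arg W - pi within [-pi, 0).
  Positive real W is included because the branch takes the value -pi on the negative axis.\<close>

lemma cpow_low_minus:
  assumes "Re W > 0" "Im W \<ge> 0"
  shows "cpow_low (- W) (- s) = exp (\<i> * of_real pi * s) * W powr (- s)"
proof -
  have W: "W \<noteq> 0" using assms by auto
  have "0 \<le> Arg W" "Arg W < pi"
    using Im_Ln_pos_le[OF W] Re_Ln_pos_lt[OF W] assms by (auto simp: Arg_eq_Im_Ln[OF W])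
  then have "cpow_low (exp (\<i> * of_real (- pi)) * W) (- s) = exp (\<i> * of_real (- pi) * (- s)) * W powr (- s)"
    using assms by (intro cpow_low_rotate) auto
  then show ?thesis by (simp add: exp_minus)
qed

text \<open>The lattice points \<open>(M, N)\<close> for which the branch changes: those with
  \<open>0 \<le> arg (- w) < arg (c * z + d)\<close>, where \<open>w = (M + R1) * z + N + R2\<close>.\<close>

definition branch_cone :: "int \<Rightarrow> int \<Rightarrow> real \<Rightarrow> real \<Rightarrow> (int \<times> int) set" where
  "branch_cone c d R1 R2 = {(M, N). of_int M + R1 \<le> 0 \<and> of_int d * (of_int M + R1) > of_int c * (of_int N + R2)}"

lemma Im_mobius_pos:
  assumes "a * d - b * c = 1" "Im z > 0" "of_int c * z + of_int d \<noteq> 0"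
  shows "Im (mobius a b c d z) > 0"
proof -
  define \<tau> where "\<tau> = of_int c * z + of_int d"
  have detr: "real_of_int a * of_int d - of_int b * of_int c = 1"
    using arg_cong[OF assms(1), of real_of_int] by simp
  have "mobius a b c d z = (of_int a * z + of_int b) * cnj \<tau> / of_real ((norm \<tau>)\<^sup>2)"
    unfolding mobius_def \<tau>_def[symmetric] by (simp add: complex_div_cnj[of _ \<tau>])
  then have "Im (mobius a b c d z) = Im ((of_int a * z + of_int b) * cnj \<tau>) / (norm \<tau>)\<^sup>2"
    by (simp only: Im_divide_of_real)
  also have "Im ((of_int a * z + of_int b) * cnj \<tau>) = (of_int a * of_int d - of_int b * of_int c) * Im z"
    by (simp add: \<tau>_def algebra_simps)
  finally show ?thesis using assms unfolding detr by (simp add: \<tau>_def)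
qed

text \<open>The factorisation of the weights in the new coordinates is taken as a hypothesis, so
  that both congruence cases are covered. Only the terms in the cone change, and S is their sum
  before the change.\<close>

lemma G_series_transform:
  fixes k :: nat and a b c d :: int
  assumes k: "k > 0" and f: "periodic_seq (int k) f" "periodic_seq (int k) fs"
    and gh: "periodic_seq (int k) g" "periodic_seq (int k) h" "\<And>M N. f (d * M - c * N) * fs (- b * M + a * N) = g M * h N"
    and det: "a * d - b * c = 1" and c: "c > 0" and z: "Im z > 0"
    and R1: "R1 = of_int a * r1 + of_int c * r2" and R2: "R2 = of_int b * r1 + of_int d * r2"
    and s: "Re s > 2"
    and cone: "(G_term z g h R1 R2 s has_sum S) (branch_cone c d R1 R2)"
  shows "cpow_low (of_int c * z + of_int d) (- s) * G_series (mobius a b c d z) f fs r1 r2 s =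
     G_series z g h R1 R2 s + (exp (- (2 * of_real pi * \<i> * s)) - 1) * S"
proof -
  define \<tau> where "\<tau> = of_int c * z + of_int d"
  define E where "E = branch_cone c d R1 R2"
  define D where "D = {(m, n). \<not> (real_of_int m = - r1 \<and> real_of_int n = - r2)}"
  define D' where "D' = {(m, n). \<not> (real_of_int m = - R1 \<and> real_of_int n = - R2)}"
  define T where "T = (\<lambda>(m, n). (a * m + c * n, b * m + d * n))"
  define e where "e = exp (- (2 * of_real pi * \<i> * s))"
  have Im\<tau>: "Im \<tau> > 0" using z c by (simp add: \<tau>_def)
  then have \<tau>0: "\<tau> \<noteq> 0" by auto
  have detr: "real_of_int a * of_int d - of_int b * of_int c = 1" using arg_cong[OF det, of real_of_int] by simp
  have inv_r: "r1 = of_int d * R1 - of_int c * R2" "r2 = of_int a * R2 - of_int b * R1"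
  proof -
    have "of_int d * R1 - of_int c * R2 = (of_int a * of_int d - of_int b * of_int c) * r1" "of_int a * R2 - of_int b * R1 = (of_int a * of_int d - of_int b * of_int c) * r2"
      unfolding R1 R2 by (simp_all add: algebra_simps)
    then show "r1 = of_int d * R1 - of_int c * R2" "r2 = of_int a * R2 - of_int b * R1" using detr by simp_all
  qed
  \<comment> \<open>Determinant one makes the inverse integral, and the same matrix takes (-r1, -r2)
    to (-R1, -R2), so the omitted pairs correspond.\<close>
  have bij: "bij_betw T D D'"
  proof (rule bij_betwI[of _ _ _ "\<lambda>(M, N). (d * M - c * N, - b * M + a * N)"])
    have 1: "d * (a * m + c * n) - c * (b * m + d * n) = m" "- b * (a * m + c * n) + a * (b * m + d * n) = n" for m n
    proof -
      have "d * (a * m + c * n) - c * (b * m + d * n) = (a * d - b * c) * m" "- b * (a * m + c * n) + a * (b * m + d * n) = (a * d - b * c) * n"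
        by (simp_all add: algebra_simps)
      then show "d * (a * m + c * n) - c * (b * m + d * n) = m" "- b * (a * m + c * n) + a * (b * m + d * n) = n" using det by simp_all
    qed
    have 2: "a * (d * M - c * N) + c * (- b * M + a * N) = M" "b * (d * M - c * N) + d * (- b * M + a * N) = N" for M N
    proof -
      have "a * (d * M - c * N) + c * (- b * M + a * N) = (a * d - b * c) * M" "b * (d * M - c * N) + d * (- b * M + a * N) = (a * d - b * c) * N"
        by (simp_all add: algebra_simps)
      then show "a * (d * M - c * N) + c * (- b * M + a * N) = M" "b * (d * M - c * N) + d * (- b * M + a * N) = N" using det by simp_all
    qed
    show "(case T x of (M, N) \<Rightarrow> (d * M - c * N, - b * M + a * N)) = x" for x
      using 1 by (cases x) (simp add: T_def)
    show "T (case y of (M, N) \<Rightarrow> (d * M - c * N, - b * M + a * N)) = y" for y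
      using 2 by (cases y) (simp add: T_def)
    show "T \<in> D \<rightarrow> D'"
    proof (intro Pi_I)
      fix p assume "p \<in> D"
      then obtain m n where p: "p = (m, n)" and mn: "\<not> (real_of_int m = - r1 \<and> real_of_int n = - r2)" by (auto simp: D_def)
      have False if "real_of_int (a * m + c * n) = - R1 \<and> real_of_int (b * m + d * n) = - R2"
      proof -
        have "real_of_int (d * (a * m + c * n) - c * (b * m + d * n)) = - r1"
          using that unfolding inv_r of_int_diff of_int_mult[of d] of_int_mult[of c "b * m + d * n"] by simp
        moreover have "real_of_int (- b * (a * m + c * n) + a * (b * m + d * n)) = - r2"
          using that unfolding inv_r of_int_add of_int_mult[of "- b"] of_int_mult[of a "b * m + d * n"] by simp
        ultimately show False using mn unfolding 1 by simp
      qed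
      then show "T p \<in> D'" by (auto simp: p T_def D'_def)
    qed
    show "(\<lambda>(M, N). (d * M - c * N, - b * M + a * N)) \<in> D' \<rightarrow> D"
    proof (intro Pi_I)
      fix p assume "p \<in> D'"
      then obtain M N where p: "p = (M, N)" and MN: "\<not> (real_of_int M = - R1 \<and> real_of_int N = - R2)" by (auto simp: D'_def)
      have False if "real_of_int (d * M - c * N) = - r1 \<and> real_of_int (- b * M + a * N) = - r2"
      proof -
        have "real_of_int (a * (d * M - c * N) + c * (- b * M + a * N)) = - R1"
          using that unfolding R1 of_int_add of_int_mult[of a] of_int_mult[of c "- b * M + a * N"] by simp
        moreover have "real_of_int (b * (d * M - c * N) + d * (- b * M + a * N)) = - R2"
          using that unfolding R2 of_int_add[of "b * _"] of_int_mult[of b "d * M - c * N"] of_int_mult[of d "- b * M + a * N"] by simp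
        ultimately show False using MN unfolding 2 by simp
      qed
      then show "(case p of (M, N) \<Rightarrow> (d * M - c * N, - b * M + a * N)) \<in> D" by (auto simp: p D_def)
    qed
  qed
  have E_sub: "E \<subseteq> D'"
    unfolding E_def D'_def branch_cone_def by auto
  have G: "(G_term z g h R1 R2 s has_sum G_series z g h R1 R2 s) D'"
    unfolding D'_def using G_series_mellin_rep(2)[OF k gh(1,2) z s] .
  \<comment> \<open>Extended by zero from the cone to the whole index set, the correction can be
    added term by term; on the cone 1 + (e - 1) = e.\<close>
  have "((\<lambda>p. if p \<in> E then (e - 1) * G_term z g h R1 R2 s p else 0) has_sum (e - 1) * S) D'"
  proof -
    have "((\<lambda>p. (e - 1) * G_term z g h R1 R2 s p) has_sum (e - 1) * S) E"
      unfolding E_def by (rule has_sum_cmult_right[OF cone])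
    then show ?thesis by (rule has_sum_cong_neutral[THEN iffD1, rotated -1]) (use E_sub in auto)
  qed
  from has_sum_add[OF G this]
  have "((\<lambda>p. (if p \<in> E then e else 1) * G_term z g h R1 R2 s p) has_sum G_series z g h R1 R2 s + (e - 1) * S) D'"
    by (rule has_sum_cong[THEN iffD1, rotated]) (simp add: algebra_simps)
  then have 1: "((\<lambda>p. (if T p \<in> E then e else 1) * G_term z g h R1 R2 s (T p)) has_sum G_series z g h R1 R2 s + (e - 1) * S) D"
    unfolding has_sum_reindex_bij_betw[OF bij, of "\<lambda>p. (if p \<in> E then e else 1) * G_term z g h R1 R2 s p"] .
  have Vz: "Im (mobius a b c d z) > 0"
    using Im_mobius_pos[OF det z] \<tau>0 by (simp add: \<tau>_def)
  have "(G_term (mobius a b c d z) f fs r1 r2 s has_sum G_series (mobius a b c d z) f fs r1 r2 s) D"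
    unfolding D_def using G_series_mellin_rep(2)[OF k f Vz s] .
  then have 2: "((\<lambda>p. cpow_low \<tau> (- s) * G_term (mobius a b c d z) f fs r1 r2 s p) has_sum
      cpow_low \<tau> (- s) * G_series (mobius a b c d z) f fs r1 r2 s) D"
    by (rule has_sum_cmult_right)
  have eq: "cpow_low \<tau> (- s) * G_term (mobius a b c d z) f fs r1 r2 s p = (if T p \<in> E then e else 1) * G_term z g h R1 R2 s (T p)"
    if p: "p \<in> D" for p
  proof -
    obtain m n where pm: "p = (m, n)" by (cases p)
    define M N where "M = a * m + c * n" and "N = b * m + d * n"
    define W where "W = (of_int M + of_real R1) * z + of_int N + of_real R2"
    have mM: "m = d * M - c * N" "n = - b * M + a * N"
    proof -
      have "d * M - c * N = (a * d - b * c) * m" "- b * M + a * N = (a * d - b * c) * n"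
        by (simp_all add: M_def N_def algebra_simps)
      then show "m = d * M - c * N" "n = - b * M + a * N" using det by simp_all
    qed
    have fg: "f m * fs n = g M * h N" unfolding mM by (rule gh(3))
    have TD: "T p \<in> D'" using bij p by (auto dest: bij_betwE)
    have Tp: "T p = (M, N)" by (simp add: T_def pm M_def N_def)
    have W0: "W \<noteq> 0"
    proof
      assume W0: "W = 0"
      have "Im W = (of_int M + R1) * Im z" by (simp add: W_def)
      then have "of_int M + R1 = 0" using W0 z by simp
      moreover have "Re W = (of_int M + R1) * Re z + (of_int N + R2)" by (simp add: W_def)
      ultimately have "of_int N + R2 = 0" using W0 by simp
      with \<open>of_int M + R1 = 0\<close> show False using TD unfolding Tp D'_def by auto
    qed
    have quot: "(of_int m + of_real r1) * mobius a b c d z + of_int n + of_real r2 = W / \<tau>"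
    proof -
      have "((of_int m + of_real r1) * mobius a b c d z + of_int n + of_real r2) * \<tau> =
         (of_int m + of_real r1) * (of_int a * z + of_int b) + (of_int n + of_real r2) * \<tau>"
      proof -
        have "(x * (y / \<tau>) + u + v) * \<tau> = x * y + (u + v) * \<tau>" for x y u v using \<tau>0 by (simp add: field_simps)
        then show ?thesis unfolding mobius_def \<tau>_def[symmetric] .
      qed
      also have "\<dots> = W" by (simp add: W_def \<tau>_def M_def N_def R1 R2 algebra_simps)
      finally show ?thesis using \<tau>0 by (simp add: field_simps)
    qed
    \<comment> \<open>Both imaginary parts are linear in the lattice coordinates with the positive
      factor Im z, which turns the condition on angles into the two inequalities defining the
      cone.\<close>
    have "(Im (- W) \<ge> 0 \<and> Im (- W * cnj \<tau>) < 0) \<longleftrightarrow> (M, N) \<in> E"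
    proof -
      have i1: "Im (- W) = - (of_int M + R1) * Im z" by (simp add: W_def algebra_simps)
      have i2: "Im (- W * cnj \<tau>) = - (of_int d * (of_int M + R1) - of_int c * (of_int N + R2)) * Im z"
        by (simp add: W_def \<tau>_def algebra_simps)
      show ?thesis unfolding i1 i2 E_def branch_cone_def using z
        by (auto simp: mult_le_0_iff zero_less_mult_iff mult_less_0_iff zero_le_mult_iff)
    qed
    then have "cpow_low \<tau> (- s) * cpow_low (W / \<tau>) (- s) = (if (M, N) \<in> E then e else 1) * cpow_low W (- s)"
      using cpow_low_quotient[OF Im\<tau> W0, of s] by (simp add: e_def)
    then have "cpow_low \<tau> (- s) * (f m * fs n * cpow_low (W / \<tau>) (- s)) = (if (M, N) \<in> E then e else 1) * (g M * h N * cpow_low W (- s))"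
      unfolding fg by (metis mult.left_commute)
    then show ?thesis unfolding Tp unfolding pm G_term_def prod.case quot W_def[symmetric] .
  qed
  have "((\<lambda>p. cpow_low \<tau> (- s) * G_term (mobius a b c d z) f fs r1 r2 s p) has_sum G_series z g h R1 R2 s + (e - 1) * S) D"
    using 1 by (rule has_sum_cong[THEN iffD2, rotated]) (simp add: eq)
  from has_sum_unique[OF 2 this] show ?thesis by (simp add: \<tau>_def e_def)
qed


section \<open>Parametrisation of the branch cone\<close>

lemma periodic_seq_mult:
  assumes "periodic_seq (int k) g"
  shows "periodic_seq (int k) (\<lambda>n. g (m * n))"
  unfolding periodic_seq_def
  by (intro allI periodic_seq_cong[OF assms]) (simp add: cong_iff_dvd_diff algebra_simps)

lemma periodic_seq_minus:
  assumes "periodic_seq (int k) g"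
  shows "periodic_seq (int k) (\<lambda>n. g (- n))"
  using periodic_seq_mult[OF assms, of "- 1"] by simp

text \<open>For M = -(floor R1 + j + c \<mu>) the cone condition bounds -N from below, and
  \<open>cone_floor c d R1 R2 j + d * \<mu>\<close> is the largest excluded value of -N.\<close>

definition cone_floor :: "int \<Rightarrow> int \<Rightarrow> real \<Rightarrow> real \<Rightarrow> int \<Rightarrow> int" where
  "cone_floor c d R1 R2 j = \<lfloor>R2 + of_int d * (of_int j - frac R1) / of_int c\<rfloor>"

definition cone_weight :: "int \<Rightarrow> int \<Rightarrow> real \<Rightarrow> real \<Rightarrow> (int \<Rightarrow> complex) \<Rightarrow> (int \<Rightarrow> complex) \<Rightarrow> int \<Rightarrow> nat \<Rightarrow> nat \<Rightarrow> complex" where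
  "cone_weight c d R1 R2 g h j \<mu> \<nu> =
     g (- (\<lfloor>R1\<rfloor> + j + c * int \<mu>)) * h (- (cone_floor c d R1 R2 j + d * int \<mu> + 1 + int \<nu>))"

text \<open>The value of -W at the corner of the j-th residue class, in coordinates along cz + d and
  1. The fractional part is subtracted from 1 because the cone inequality is strict.\<close>

definition cone_base :: "int \<Rightarrow> int \<Rightarrow> complex \<Rightarrow> real \<Rightarrow> real \<Rightarrow> int \<Rightarrow> complex" where
  "cone_base c d z R1 R2 j = of_real ((of_int j - frac R1) / of_int c) * (of_int c * z + of_int d)
      + of_real (1 - frac (R2 + of_int d * (of_int j - frac R1) / of_int c))"

lemma cone_base_pos:
  assumes c: "c > 0" and j: "j \<ge> 1" and z: "Im z \<ge> 0" "Re (of_int c * z + of_int d) > 0"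
  shows "Re (cone_base c d z R1 R2 j) > 0" "Im (cone_base c d z R1 R2 j) \<ge> 0"
proof -
  have x0: "of_int j - frac R1 > 0" using frac_lt_1[of R1] j by linarith
  then have x: "(of_int j - frac R1) / of_int c > 0" using c by simp
  have y: "1 - frac (R2 + of_int d * (of_int j - frac R1) / of_int c) > 0" using frac_lt_1 by (simp add: algebra_simps)
  have "Re (cone_base c d z R1 R2 j) = (of_int j - frac R1) / of_int c * Re (of_int c * z + of_int d) + (1 - frac (R2 + of_int d * (of_int j - frac R1) / of_int c))"
    by (simp add: cone_base_def)
  then show "Re (cone_base c d z R1 R2 j) > 0" using mult_pos_pos[OF x z(2)] y by linarith
  have "Im (cone_base c d z R1 R2 j) = (of_int j - frac R1) / of_int c * (of_int c * Im z)"
    by (simp add: cone_base_def)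
  then show "Im (cone_base c d z R1 R2 j) \<ge> 0" using x0 z c by simp
qed

text \<open>Lowering (M, N) by (c, d) adds cz + d to -W, and lowering N by 1 adds 1. So the points
  of the open cone with -M - floor R1 in a fixed class modulo c are a corner plus nonnegative
  multiples of these two generators, which is a Barnes sum.\<close>

lemma branch_cone_has_sum:
  fixes k :: nat and c d :: int
  assumes k: "k > 0" and gh: "periodic_seq (int k) g" "periodic_seq (int k) h" and c: "c > 0"
    and z: "Im z > 0" "Re (of_int c * z + of_int d) > 0" and s: "Re s > 2"
  defines "\<tau> \<equiv> of_int c * z + of_int d"
  shows "(G_term z g h R1 R2 s has_sum exp (\<i> * of_real pi * s) *
     ((if R1 \<in> \<int> then g (- \<lfloor>R1\<rfloor>) else 0) * L_series (\<lambda>n. h (- n)) (- R2) s +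
      (\<Sum>j = 1..c. (\<Sum>(\<mu>, \<nu>)\<in>{..<k} \<times> {..<k}. cone_weight c d R1 R2 g h j \<mu> \<nu> *
         mellin (barnes_kernel (cone_base c d z R1 R2 j + of_nat \<mu> * \<tau> + of_nat \<nu> * 1) (of_nat k * \<tau>) (of_nat k * 1)) s) / Gamma s)))
     (branch_cone c d R1 R2)"
proof -
  define F where "F = cone_floor c d R1 R2"
  define w where "w = cone_base c d z R1 R2"
  \<comment> \<open>The boundary ray on which -W is positive. It belongs to the cone, and it
    contains lattice points only if R1 is an integer.\<close>
  define E0 where "E0 = {(M, N). real_of_int M = - R1 \<and> real_of_int N < - R2}"
  define e where "e = (\<lambda>j. \<lambda>(\<mu>::nat, \<nu>::nat). (- (\<lfloor>R1\<rfloor> + j + c * int \<mu>), - (F j + d * int \<mu> + 1 + int \<nu>)))"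
  define E where "E = (\<lambda>j. range (e j))"
  define t where "t = G_term z g h R1 R2 s"
  define \<epsilon> where "\<epsilon> = exp (\<i> * of_real pi * s)"
  have cr: "real_of_int c > 0" using c by simp
  have Im\<tau>: "Im \<tau> > 0" and Re\<tau>: "Re \<tau> > 0" using z c by (simp_all add: \<tau>_def)
  have L: "((\<lambda>n. h (- n) * cpow_low (of_int n + of_real (- R2)) (- s)) has_sum L_series (\<lambda>n. h (- n)) (- R2) s) {n. real_of_int n > - (- R2)}"
  proof -
    have "Re s > 1" using s by simp
    from L_series_has_sum(1)[OF k periodic_seq_minus[OF gh(2)] this, of "- R2"]
    have "(\<lambda>n. h (- n) * cpow_low (of_int n + of_real (- R2)) (- s)) summable_on {n. real_of_int n > - (- R2)}"
      by (auto simp: summable_on_def)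
    then show ?thesis unfolding L_series_def by (rule has_sum_infsum)
  qed
  have S0: "(t has_sum \<epsilon> * ((if R1 \<in> \<int> then g (- \<lfloor>R1\<rfloor>) else 0) * L_series (\<lambda>n. h (- n)) (- R2) s)) E0"
  proof (cases "R1 \<in> \<int>")
    case False
    then have "E0 = {}" by (auto simp: E0_def) (metis Ints_minus Ints_of_int minus_minus)
    then show ?thesis using False by simp
  next
    case True
    then have R1: "real_of_int \<lfloor>R1\<rfloor> = R1" by (auto elim!: Ints_cases)
    \<comment> \<open>The second coordinate is reflected, so that the ray is summed over n > R2;
      this is where the shift -R2 in the L-series comes from.\<close>
    have bij: "bij_betw (\<lambda>n. (- \<lfloor>R1\<rfloor>, - n)) {n. real_of_int n > - (- R2)} E0"
    proof (rule bij_betwI[of _ _ _ "\<lambda>p. - snd p"])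
      show "(\<lambda>n. (- \<lfloor>R1\<rfloor>, - n)) \<in> {n. real_of_int n > - (- R2)} \<rightarrow> E0" using R1 by (auto simp: E0_def)
      show "(\<lambda>p. - snd p) \<in> E0 \<rightarrow> {n. real_of_int n > - (- R2)}" by (auto simp: E0_def)
      fix p assume "p \<in> E0"
      then obtain M N where p: "p = (M, N)" "real_of_int M = - R1" by (auto simp: E0_def)
      then have "real_of_int M = real_of_int (- \<lfloor>R1\<rfloor>)" by (simp only: p(2) of_int_minus R1)
      then have "M = - \<lfloor>R1\<rfloor>" by (simp only: of_int_eq_iff)
      then show "(- \<lfloor>R1\<rfloor>, - (- snd p)) = p" using p by simp
    qed auto
    have eq: "\<epsilon> * (g (- \<lfloor>R1\<rfloor>) * (h (- n) * cpow_low (of_int n + of_real (- R2)) (- s))) = t (- \<lfloor>R1\<rfloor>, - n)"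
      if n: "n \<in> {n. real_of_int n > - (- R2)}" for n
    proof -
      define x where "x = real_of_int n - R2"
      have x: "x > 0" using n by (simp add: x_def)
      have w1: "(of_int (- \<lfloor>R1\<rfloor>) + of_real R1) * z + of_int (- n) + of_real R2 = - complex_of_real x"
      proof -
        have "complex_of_int (- \<lfloor>R1\<rfloor>) + of_real R1 = of_real (real_of_int (- \<lfloor>R1\<rfloor>) + R1)" by simp
        also have "real_of_int (- \<lfloor>R1\<rfloor>) + R1 = 0" by (simp only: of_int_minus R1 add.left_inverse)
        finally show ?thesis by (simp add: x_def)
      qed
      have w2: "of_int n + of_real (- R2) = complex_of_real x" by (simp add: x_def)
      show ?thesis
        unfolding t_def G_term_def prod.case w1 w2 using x cpow_low_minus[of "of_real x" s] cpow_low_of_real[OF x, of "- s"]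
        by (simp add: \<epsilon>_def)
    qed
    have "((\<lambda>n. \<epsilon> * (g (- \<lfloor>R1\<rfloor>) * (h (- n) * cpow_low (of_int n + of_real (- R2)) (- s)))) has_sum
      \<epsilon> * (g (- \<lfloor>R1\<rfloor>) * L_series (\<lambda>n. h (- n)) (- R2) s)) {n. real_of_int n > - (- R2)}"
      by (intro has_sum_cmult_right L)
    then have "((\<lambda>n. t (- \<lfloor>R1\<rfloor>, - n)) has_sum \<epsilon> * (g (- \<lfloor>R1\<rfloor>) * L_series (\<lambda>n. h (- n)) (- R2) s)) {n. real_of_int n > - (- R2)}"
      by (rule has_sum_cong[THEN iffD1, rotated]) (rule eq)
    then show ?thesis using True has_sum_reindex_bij_betw[OF bij, of t] by simp
  qed
  have coords: "- (of_int (fst (e j (\<mu>, \<nu>))) + R1) = of_int j - frac R1 + of_int c * real \<mu>"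
    "- (of_int (snd (e j (\<mu>, \<nu>))) + R2) = of_int d * (of_int j - frac R1) / of_int c + of_int d * real \<mu> + real \<nu>
        + (1 - frac (R2 + of_int d * (of_int j - frac R1) / of_int c))" for j \<mu> \<nu>
    by (simp_all add: e_def F_def cone_floor_def frac_def)
  have Sj: "(t has_sum \<epsilon> * ((\<Sum>(\<mu>, \<nu>)\<in>{..<k} \<times> {..<k}. cone_weight c d R1 R2 g h j \<mu> \<nu> *
         mellin (barnes_kernel (w j + of_nat \<mu> * \<tau> + of_nat \<nu> * 1) (of_nat k * \<tau>) (of_nat k * 1)) s) / Gamma s)) (E j)"
    if j: "j \<in> {1..c}" for j
  proof -
    have wj: "Re (w j) > 0" "Im (w j) \<ge> 0" using cone_base_pos[OF c _ _ z(2), of j R1 R2] j z(1) by (auto simp: w_def)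
    have "((\<lambda>(\<mu>, \<nu>). cone_weight c d R1 R2 g h j \<mu> \<nu> * (w j + of_nat \<mu> * \<tau> + of_nat \<nu> * 1) powr - s) has_sum
      ((\<Sum>(\<mu>, \<nu>)\<in>{..<k} \<times> {..<k}. cone_weight c d R1 R2 g h j \<mu> \<nu> *
         mellin (barnes_kernel (w j + of_nat \<mu> * \<tau> + of_nat \<nu> * 1) (of_nat k * \<tau>) (of_nat k * 1)) s) / Gamma s)) UNIV"
    proof (rule barnes_weighted_has_sum[OF k])
      have cg: "g (- (\<lfloor>R1\<rfloor> + j + c * int (\<mu> + k))) = g (- (\<lfloor>R1\<rfloor> + j + c * int \<mu>))" for \<mu>
        by (rule periodic_seq_cong[OF gh(1)]) (simp add: cong_iff_dvd_diff algebra_simps)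
      have ch: "h (- (F j + d * int (\<mu> + k) + 1 + int \<nu>)) = h (- (F j + d * int \<mu> + 1 + int \<nu>))"
        "h (- (F j + d * int \<mu> + 1 + int (\<nu> + k))) = h (- (F j + d * int \<mu> + 1 + int \<nu>))" for \<mu> \<nu>
        by (rule periodic_seq_cong[OF gh(2)]; simp add: cong_iff_dvd_diff algebra_simps)+
      show "cone_weight c d R1 R2 g h j (\<mu> + k) \<nu> = cone_weight c d R1 R2 g h j \<mu> \<nu>"
        "cone_weight c d R1 R2 g h j \<mu> (\<nu> + k) = cone_weight c d R1 R2 g h j \<mu> \<nu>" for \<mu> \<nu>
        unfolding cone_weight_def F_def[symmetric] cg ch by (rule refl)+
    qed (use Re\<tau> wj s in auto)
    from has_sum_cmult_right[OF this, of \<epsilon>]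
    have 1: "((\<lambda>p. \<epsilon> * (case p of (\<mu>, \<nu>) \<Rightarrow> cone_weight c d R1 R2 g h j \<mu> \<nu> * (w j + of_nat \<mu> * \<tau> + of_nat \<nu> * 1) powr - s)) has_sum
      \<epsilon> * ((\<Sum>(\<mu>, \<nu>)\<in>{..<k} \<times> {..<k}. cone_weight c d R1 R2 g h j \<mu> \<nu> *
         mellin (barnes_kernel (w j + of_nat \<mu> * \<tau> + of_nat \<nu> * 1) (of_nat k * \<tau>) (of_nat k * 1)) s) / Gamma s)) UNIV" .
    have eq: "\<epsilon> * (case p of (\<mu>, \<nu>) \<Rightarrow> cone_weight c d R1 R2 g h j \<mu> \<nu> * (w j + of_nat \<mu> * \<tau> + of_nat \<nu> * 1) powr - s) = t (e j p)" for p
    proof -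
      obtain \<mu> \<nu> where p: "p = (\<mu>, \<nu>)" by (cases p)
      define X Y where "X = - (of_int (fst (e j (\<mu>, \<nu>))) + R1)" and "Y = - (of_int (snd (e j (\<mu>, \<nu>))) + R2)"
      define W where "W = w j + of_nat \<mu> * \<tau> + of_nat \<nu> * 1"
      have "(of_int (fst (e j (\<mu>, \<nu>))) + of_real R1) * z + of_int (snd (e j (\<mu>, \<nu>))) + of_real R2 = - (of_real X * z + of_real Y)"
        by (simp add: X_def Y_def algebra_simps)
      also have "of_real X * z + of_real Y = W"
      proof -
        define q where "q = of_int j - frac R1"
        define \<phi> where "\<phi> = 1 - frac (R2 + of_int d * q / of_int c)"
        have "X = of_int c * (q / of_int c + real \<mu>)" "Y = of_int d * (q / of_int c + real \<mu>) + (real \<nu> + \<phi>)"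
          unfolding X_def Y_def coords q_def[symmetric] \<phi>_def using cr by (simp_all add: field_simps)
        then have "of_real X * z + of_real Y = of_real (q / of_int c + real \<mu>) * \<tau> + of_real (real \<nu> + \<phi>)"
          by (simp only: \<tau>_def of_real_mult of_real_add of_real_of_int_eq) (simp add: algebra_simps)
        also have "\<dots> = W"
          by (simp only: W_def w_def cone_base_def q_def[symmetric] \<phi>_def \<tau>_def[symmetric] of_real_add of_real_of_nat_eq) (simp add: algebra_simps)
        finally show ?thesis .
      qed
      finally have W: "(of_int (fst (e j (\<mu>, \<nu>))) + of_real R1) * z + of_int (snd (e j (\<mu>, \<nu>))) + of_real R2 = - W" .
      have "Re W > 0" "Im W \<ge> 0" using wj Re\<tau> Im\<tau> by (auto simp: W_def intro!: add_pos_nonneg)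
      then have "cpow_low (- W) (- s) = \<epsilon> * W powr (- s)" unfolding \<epsilon>_def by (rule cpow_low_minus)
      moreover have "t (e j (\<mu>, \<nu>)) = g (fst (e j (\<mu>, \<nu>))) * h (snd (e j (\<mu>, \<nu>))) * cpow_low (- W) (- s)"
        unfolding t_def G_term_def W[symmetric] by (simp add: case_prod_unfold)
      moreover have "cone_weight c d R1 R2 g h j \<mu> \<nu> = g (fst (e j (\<mu>, \<nu>))) * h (snd (e j (\<mu>, \<nu>)))"
        by (simp add: cone_weight_def e_def F_def)
      ultimately show ?thesis unfolding p prod.case W_def[symmetric] by (simp only: mult_ac)
    qed
    have inj: "inj (e j)" using c by (auto simp: inj_on_def e_def)
    show ?thesis unfolding E_def has_sum_reindex[OF inj] o_def using 1 unfolding eq .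
  qed
  have Xpos: "of_int j - frac R1 + of_int c * real \<mu> > 0" if "j \<in> {1..c}" for j \<mu>
  proof -
    have "real_of_int j \<ge> 1" using that by simp
    moreover have "of_int c * real \<mu> \<ge> 0" using cr by simp
    ultimately show ?thesis using frac_lt_1[of R1] by linarith
  qed
  have disj: "E i \<inter> E j = {}" if ij: "i \<in> {1..c}" "j \<in> {1..c}" "i \<noteq> j" for i j
  proof (rule ccontr)
    assume "E i \<inter> E j \<noteq> {}"
    then obtain x where "x \<in> range (e i)" "x \<in> range (e j)" unfolding E_def by blast
    then obtain p q where "e i p = e j q" by (metis rangeE)
    then have "(i - 1) + c * int (fst p) = (j - 1) + c * int (fst q)" by (simp add: e_def case_prod_unfold)
    then have "((i - 1) + c * int (fst p)) mod c = ((j - 1) + c * int (fst q)) mod c" by (simp only:)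
    then have "(i - 1) mod c = (j - 1) mod c" by (simp only: mod_mult_self2)
    then show False using ij by (simp add: mod_pos_pos_trivial)
  qed
  have disj0: "E0 \<inter> (\<Union>j\<in>{1..c}. E j) = {}"
  proof -
    have "e j (\<mu>, \<nu>) \<notin> E0" if "j \<in> {1..c}" for j \<mu> \<nu>
    proof
      assume "e j (\<mu>, \<nu>) \<in> E0"
      then have "- (of_int (fst (e j (\<mu>, \<nu>))) + R1) = 0" by (simp add: E0_def case_prod_unfold)
      then show False using Xpos[OF that, of \<mu>] coords(1)[of j \<mu> \<nu>] by linarith
    qed
    then show ?thesis by (auto simp: E_def)
  qed
  have cover: "branch_cone c d R1 R2 = E0 \<union> (\<Union>j\<in>{1..c}. E j)"
  proof (intro equalityI subsetI)
    fix p assume "p \<in> E0 \<union> (\<Union>j\<in>{1..c}. E j)"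
    then consider "p \<in> E0" | j where "j \<in> {1..c}" "p \<in> E j" by blast
    then show "p \<in> branch_cone c d R1 R2"
    proof cases
      case 1
      then obtain M N where p: "p = (M, N)" "real_of_int M = - R1" "real_of_int N + R2 < 0" by (auto simp: E0_def)
      then have "of_int c * (real_of_int N + R2) < 0" using cr by (simp add: mult_less_0_iff)
      then show ?thesis using p by (simp add: branch_cone_def)
    next
      case (2 j)
      then obtain \<mu> \<nu> where p: "p = e j (\<mu>, \<nu>)" by (auto simp: E_def)
      define X Y where "X = - (of_int (fst (e j (\<mu>, \<nu>))) + R1)" and "Y = - (of_int (snd (e j (\<mu>, \<nu>))) + R2)"
      define q where "q = of_int j - frac R1"
      define \<phi> where "\<phi> = 1 - frac (R2 + of_int d * q / of_int c)"
      have \<phi>: "\<phi> > 0" using frac_lt_1 by (simp add: \<phi>_def algebra_simps)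
      have X: "X = q + of_int c * real \<mu>" and Y: "Y = of_int d * q / of_int c + of_int d * real \<mu> + real \<nu> + \<phi>"
        unfolding X_def Y_def coords q_def \<phi>_def by simp_all
      have "X > 0" using Xpos[OF 2(1), of \<mu>] by (simp add: X q_def)
      moreover have "of_int c * Y - of_int d * X = of_int c * (real \<nu> + \<phi>)"
        unfolding X Y using cr by (simp add: field_simps)
      moreover have "of_int c * (real \<nu> + \<phi>) > 0" using cr \<phi> by (simp add: add_nonneg_pos)
      ultimately show ?thesis
        unfolding p branch_cone_def X_def Y_def by (auto simp: case_prod_unfold algebra_simps)
    qed
  next
    fix p assume "p \<in> branch_cone c d R1 R2"
    then obtain M N where p: "p = (M, N)" and M: "of_int M + R1 \<le> 0" and N: "of_int d * (of_int M + R1) > of_int c * (of_int N + R2)"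
      by (auto simp: branch_cone_def)
    show "p \<in> E0 \<union> (\<Union>j\<in>{1..c}. E j)"
    proof (cases "of_int M + R1 = 0")
      case True
      then have "real_of_int N + R2 < 0" using N cr by (simp add: mult_less_0_iff)
      then show ?thesis using True by (auto simp: p E0_def)
    next
      case False
      then have "- real_of_int M > R1" using M by simp
      then have "- M - \<lfloor>R1\<rfloor> - 1 \<ge> 0" by linarith
      \<comment> \<open>Division by c with remainder, shifted by one so that j runs from 1 to c.
        Then j - frac R1 is positive also when R1 is integral, and the boundary ray stays
        separate.\<close>
      define \<mu> j where "\<mu> = nat ((- M - \<lfloor>R1\<rfloor> - 1) div c)" and "j = (- M - \<lfloor>R1\<rfloor> - 1) mod c + 1"
      have j: "j \<in> {1..c}" using c pos_mod_bound[OF c] by (auto simp: j_def add1_zle_eq)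
      have "int \<mu> = (- M - \<lfloor>R1\<rfloor> - 1) div c" using \<open>- M - \<lfloor>R1\<rfloor> - 1 \<ge> 0\<close> c by (simp add: \<mu>_def pos_imp_zdiv_nonneg_iff)
      then have "- M - \<lfloor>R1\<rfloor> - 1 = c * int \<mu> + (j - 1)" by (simp add: j_def)
      then have Meq: "M = - (\<lfloor>R1\<rfloor> + j + c * int \<mu>)" by simp
      define q where "q = of_int j - frac R1"
      have "of_int M + R1 = - (q + of_int c * real \<mu>)" by (simp add: Meq q_def frac_def)
      then have "of_int d * - (q + of_int c * real \<mu>) > of_int c * (of_int N + R2)" using N by simp
      then have "R2 + of_int d * q / of_int c < of_int (- N - d * int \<mu>)"
        using cr by (simp add: field_simps)
      then have "F j + 1 \<le> - N - d * int \<mu>"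
        unfolding F_def cone_floor_def q_def[symmetric] by linarith
      define \<nu> where "\<nu> = nat (- N - d * int \<mu> - F j - 1)"
      have "int \<nu> = - N - d * int \<mu> - F j - 1" using \<open>F j + 1 \<le> - N - d * int \<mu>\<close> by (simp add: \<nu>_def)
      then have "p = e j (\<mu>, \<nu>)" by (simp add: p e_def Meq)
      then have "p \<in> E j" unfolding E_def by (rule range_eqI)
      then show ?thesis using j by blast
    qed
  qed
  have "(t has_sum (\<Sum>j = 1..c. \<epsilon> * ((\<Sum>(\<mu>, \<nu>)\<in>{..<k} \<times> {..<k}. cone_weight c d R1 R2 g h j \<mu> \<nu> *
         mellin (barnes_kernel (w j + of_nat \<mu> * \<tau> + of_nat \<nu> * 1) (of_nat k * \<tau>) (of_nat k * 1)) s) / Gamma s))) (\<Union>j\<in>{1..c}. E j)"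
    by (rule sum_has_sum) (use Sj disj in auto)
  from has_sum_Un_disjoint[OF S0 this disj0] show ?thesis
    unfolding cover by (simp add: t_def \<epsilon>_def w_def distrib_left sum_distrib_left)
qed

text \<open>The denominator exp(-k u \<tau>) - 1 has the opposite sign, which gives the minus. The
  other quotient is expanded by exp(-k u), which turns the exponent v + frac(...) into -(k - v -
  frac(...)), with positive bracket because v < k.\<close>

lemma I_integral_eq_hankel:
  fixes k c d j \<mu> v :: int
  assumes k: "k > 0" and c: "c > 0" and z: "Re (of_int c * z + of_int d) > 0"
    and j: "j \<ge> 1" and \<mu>: "\<mu> \<ge> 0" and v: "v < k"
    and loop: "hankel_loop (denom_zeros k c d z) \<gamma>"
  defines "\<tau> \<equiv> of_int c * z + of_int d"
  shows "I_integral k c d R1 \<rho> \<gamma> j \<mu> v z s =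
    - hankel (barnes_kernel (of_real ((of_int (c * \<mu> + j) - frac R1) / of_int c) * \<tau> +
        of_real (of_int k - of_int v - frac ((of_int (d * j) + \<rho>) / of_int c))) (of_int k * \<tau>) (of_int k)) s"
proof -
  define x where "x = (of_int (c * \<mu> + j) - frac R1) / of_int c"
  define \<phi> where "\<phi> = frac ((of_int (d * j) + \<rho>) / of_int c)"
  define w where "w = of_real x * \<tau> + of_real (of_int k - of_int v - \<phi>)"
  have kr: "real_of_int k > 0" "complex_of_int k \<noteq> 0" using k by auto
  have cr: "real_of_int c > 0" using c by simp
  have "c * \<mu> \<ge> 0" using c \<mu> by simp
  then have "real_of_int (c * \<mu> + j) \<ge> 1" using j by linarith
  then have x: "x > 0" using frac_lt_1[of R1] cr by (simp add: x_def)
  have "real_of_int v + 1 \<le> of_int k" using v by linarith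
  then have y: "of_int k - of_int v - \<phi> > 0" using frac_lt_1[of "(of_int (d * j) + \<rho>) / of_int c"] by (simp add: \<phi>_def)
  have Re\<tau>: "Re \<tau> > 0" using z by (simp add: \<tau>_def)
  have "Re w = x * Re \<tau> + (of_int k - of_int v - \<phi>)" by (simp add: w_def)
  then have Rew: "Re w > 0" using mult_pos_pos[OF x Re\<tau>] y by linarith
  have zeros: "denom_zeros k c d z = {u. (1 - exp (- u * (of_int k * \<tau>))) * (1 - exp (- u * of_int k)) = 0}"
  proof -
    have "exp (of_int k * u) = 1 \<longleftrightarrow> exp (- u * of_int k) = 1" for u :: complex
      by (simp add: exp_minus mult.commute)
    then show ?thesis by (auto simp: denom_zeros_def \<tau>_def mult_ac)
  qed
  have eq: "cpow_2pi u (s - 1)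
       * (exp (- of_real ((of_int (c * \<mu> + j) - frac R1) / of_int (c * k))
                 * (of_int c * z + of_int d) * of_int k * u)
            / (exp (- of_int k * u * (of_int c * z + of_int d)) - 1))
       * (exp (of_real ((of_int v + frac ((of_int (d * j) + \<rho>) / of_int c)) / of_int k)
                 * of_int k * u)
            / (exp (of_int k * u) - 1)) = - (cpow_2pi u (s - 1) * barnes_kernel w (of_int k * \<tau>) (of_int k) u)" for u
  proof -
    have e1: "- complex_of_real ((of_int (c * \<mu> + j) - frac R1) / of_int (c * k)) * (of_int c * z + of_int d) * of_int k * u = - u * (of_real x * \<tau>)"
    proof -
      have xk: "(of_int (c * \<mu> + j) - frac R1) / of_int (c * k) = x / of_int k" by (simp add: x_def)
      show ?thesis unfolding xk \<tau>_def[symmetric] using kr by simp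
    qed
    have e2: "complex_of_real ((of_int v + frac ((of_int (d * j) + \<rho>) / of_int c)) / of_int k) * of_int k * u = u * of_real (of_int v + \<phi>)"
      using kr unfolding \<phi>_def[symmetric] by (simp add: field_simps)
    have e3: "- of_int k * u * (of_int c * z + of_int d) = - u * (of_int k * \<tau>)" by (simp add: \<tau>_def)
    define p q where "p = exp (of_int k * u)" and "q = exp (- u * of_int k)"
    have pq: "p * q = 1" by (simp add: p_def q_def exp_add [symmetric])
    have ew: "exp (- u * w) = exp (- u * (of_real x * \<tau>)) * (exp (u * of_real (of_int v + \<phi>)) * q)"
      by (simp add: w_def q_def exp_add [symmetric] algebra_simps)
    \<comment> \<open>When q = 1 also p = 1 and both sides are 0 as quotients by 0, so the
      integrands agree everywhere and poles need no separate treatment.\<close>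
    have qq: "y * q / (1 - q) = y / (p - 1)" for y
    proof (cases "q = 1")
      case True
      then show ?thesis using pq by simp
    next
      case False
      then have "p \<noteq> 1" using pq by auto
      moreover have "y * q * (p - 1) = y * (p * q) - y * q" by (simp add: algebra_simps)
      then have "y * q * (p - 1) = y * (1 - q)" unfolding pq by (simp add: right_diff_distrib)
      ultimately show ?thesis using False by (simp add: frac_eq_eq)
    qed
    have "barnes_kernel w (of_int k * \<tau>) (of_int k) u =
      exp (- u * (of_real x * \<tau>)) / (1 - exp (- u * (of_int k * \<tau>))) * (exp (u * of_real (of_int v + \<phi>)) / (p - 1))"
      unfolding barnes_kernel_def q_def[symmetric] ew qq[symmetric] by (rule times_divide_times_eq[symmetric])
    moreover have neg: "A / (B - 1) = - (A / (1 - B))" for A B :: complex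
      using minus_divide_right[of A "1 - B"] by simp
    ultimately show ?thesis
      unfolding e1 e2 e3 p_def[symmetric] neg[of _ "exp (- u * (of_int k * \<tau>))"] by simp
  qed
  have "I_integral k c d R1 \<rho> \<gamma> j \<mu> v z s = loop_integral \<gamma> (\<lambda>u. - (cpow_2pi u (s - 1) * barnes_kernel w (of_int k * \<tau>) (of_int k) u))"
    unfolding I_integral_def eq ..
  also have "\<dots> = - loop_integral \<gamma> (\<lambda>u. cpow_2pi u (s - 1) * barnes_kernel w (of_int k * \<tau>) (of_int k) u)"
    by (simp add: loop_integral_def)
  also have "loop_integral \<gamma> (\<lambda>u. cpow_2pi u (s - 1) * barnes_kernel w (of_int k * \<tau>) (of_int k) u) = hankel (barnes_kernel w (of_int k * \<tau>) (of_int k)) s"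
    using kr Re\<tau> Rew loop unfolding zeros by (intro barnes_loop_integral) auto
  finally show ?thesis by (simp add: w_def x_def \<phi>_def)
qed

text \<open>The second sum is reversed because the loop integral with index v corresponds to the
  Barnes index \<nu> = k - 1 - v.\<close>

lemma sum_int_interval:
  assumes "k = int n"
  shows "(\<Sum>\<mu> = 0..k - 1. F \<mu>) = (\<Sum>\<mu><n. F (int \<mu>))"
    and "(\<Sum>v = 0..k - 1. F v) = (\<Sum>\<nu><n. F (k - 1 - int \<nu>))"
proof -
  show "(\<Sum>\<mu> = 0..k - 1. F \<mu>) = (\<Sum>\<mu><n. F (int \<mu>))"
    by (rule sum.reindex_bij_witness[of _ int nat]) (use assms in auto)
  show "(\<Sum>v = 0..k - 1. F v) = (\<Sum>\<nu><n. F (k - 1 - int \<nu>))"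
    by (rule sum.reindex_bij_witness[of _ "\<lambda>\<nu>. k - 1 - int \<nu>" "\<lambda>v. nat (k - 1 - v)"]) (use assms in auto)
qed

text \<open>The excluded set is closed and countable, so its complement is open and connected and
  equality spreads there from a half-plane. Near an excluded point the functions agree in a
  punctured neighbourhood, which settles the continued values.\<close>

lemma meromorphic_identityI:
  assumes F: "F meromorphic_on UNIV" "F holomorphic_on (- insert 1 \<int>\<^sub>\<le>\<^sub>0)"
    and H: "H meromorphic_on UNIV" "H holomorphic_on (- insert 1 \<int>\<^sub>\<le>\<^sub>0)"
    and eq: "\<And>s. Re s > \<sigma> \<Longrightarrow> F s = H s" and \<sigma>: "\<sigma> \<ge> 1"
  shows "meromorphic_identity F H"
proof -
  have eq': "F s = H s" if s: "s \<notin> insert 1 \<int>\<^sub>\<le>\<^sub>0" for s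
  proof (rule analytic_continuation_open[of "{s. Re s > \<sigma>}" "- insert 1 \<int>\<^sub>\<le>\<^sub>0" F H])
    show "open {s. Re s > \<sigma>}" by (rule open_halfspace_Re_gt)
    have "closed (insert 1 \<int>\<^sub>\<le>\<^sub>0 :: complex set)" by (intro closed_insert closed_nonpos_Ints)
    then show "open (- insert 1 \<int>\<^sub>\<le>\<^sub>0 :: complex set)" by (rule open_Compl)
    show "{s. Re s > \<sigma>} \<noteq> {}" by (auto intro!: exI[of _ "of_real (\<sigma> + 1)"])
    have "countable (insert 1 \<int>\<^sub>\<le>\<^sub>0 :: complex set)"
      by (rule countable_subset[of _ "\<int>"]) (auto simp: Ints_def)
    then show "connected (- insert 1 \<int>\<^sub>\<le>\<^sub>0 :: complex set)"
      by (intro path_connected_imp_connected path_connected_complement_countable) auto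
    show "{s. Re s > \<sigma>} \<subseteq> - insert 1 \<int>\<^sub>\<le>\<^sub>0" using \<sigma> by (auto elim!: nonpos_Ints_cases)
  qed (use F H eq s in auto)
  have "remove_sings F s = remove_sings H s" for s
  proof (rule remove_sings_cong)
    show "eventually (\<lambda>w. F w = H w) (at s)"
      using eventually_not_Ints[of s]
    proof eventually_elim
      case (elim w)
      then have "w \<notin> insert 1 \<int>\<^sub>\<le>\<^sub>0" using nonpos_Ints_subset_Ints by auto
      then show ?case by (rule eq')
    qed
  qed simp
  then show ?thesis using F H eq' by (auto simp: meromorphic_identity_def)
qed

text \<open>For Re s > 2 everything is a convergent sum and the identity is algebra; the rest is
  continuation. The weights appear as g and h at negated arguments because the cone consists of the
  points where -W, not W, is in the first quadrant.\<close>

lemma G_transformation: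
  fixes k :: nat and a b c d :: int and f fs g h :: "int \<Rightarrow> complex" and r1 r2 R1 R2 \<rho> :: real and z :: complex
  assumes k: "k > 0" and f: "periodic_seq (int k) f" "periodic_seq (int k) fs"
    and gh: "periodic_seq (int k) g" "periodic_seq (int k) h" "\<And>M N. f (d * M - c * N) * fs (- b * M + a * N) = g M * h N"
    and det: "a * d - b * c = 1" and c: "c > 0"
    and R1: "R1 = of_int a * r1 + of_int c * r2" and R2: "R2 = of_int b * r1 + of_int d * r2"
    and \<rho>: "\<rho> = frac R2 * of_int c - frac R1 * of_int d"
    and z: "z \<in> K_region c d" and loop: "hankel_loop (denom_zeros (int k) c d z) \<gamma>"
  shows "meromorphic_identity
     (\<lambda>s. cpow_low (of_int c * z + of_int d) (- s) * Gamma s * G_fun (mobius a b c d z) s f fs r1 r2)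
     (\<lambda>s. Gamma s * G_fun z s g h R1 R2
        - 2 * \<i> * Gamma s * sin (of_real pi * s) * L_fun s (\<lambda>n. h (- n)) (- R2) * (if R1 \<in> \<int> then g (- \<lfloor>R1\<rfloor>) else 0)
        + exp (2 * of_real pi * \<i> * (- s / 2)) *
          (\<Sum>j = 1..c. \<Sum>\<mu> = 0..int k - 1. \<Sum>v = 0..int k - 1.
             h (- (\<lfloor>R2 + of_int d * (of_int j - frac R1) / of_int c\<rfloor> - v + d * \<mu>)) * g (- (\<mu> * c + j + \<lfloor>R1\<rfloor>))
             * I_integral (int k) c d R1 \<rho> \<gamma> j \<mu> v z s))"
    (is "meromorphic_identity ?F ?H")
proof -
  define \<tau> where "\<tau> = of_int c * z + of_int d"
  have cr: "real_of_int c > 0" using c by simp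
  have Imz: "Im z > 0" and "Re z > - (of_int d / of_int c)" using z by (auto simp: K_region_def)
  then have "of_int c * Re z > - of_int d" using cr by (simp add: field_simps)
  then have Re\<tau>: "Re \<tau> > 0" by (simp add: \<tau>_def)
  define G1 G2 L where "G1 = G_series (mobius a b c d z) f fs r1 r2" and "G2 = G_series z g h R1 R2"
    and "L = L_series (\<lambda>n. h (- n)) (- R2)"
  define K0 where "K0 = (if R1 \<in> \<int> then g (- \<lfloor>R1\<rfloor>) else 0)"
  define P where "P = (\<lambda>j p. barnes_kernel (cone_base c d z R1 R2 j + of_nat (fst p) * \<tau> + of_nat (snd p) * 1) (of_nat k * \<tau>) (of_nat k * 1))"
  define wt where "wt = (\<lambda>j p. cone_weight c d R1 R2 g h j (fst p) (snd p))"
  define J where "J = {..<k} \<times> {..<k}"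
  have "\<tau> \<noteq> 0" using Re\<tau> by auto
  then have Vz: "Im (mobius a b c d z) > 0"
    using Im_mobius_pos[OF det Imz] by (simp add: \<tau>_def)
  obtain X1 X2 X3 where rep: "mellin_rep 2 G1 X1" "mellin_rep 2 G2 X2" "mellin_rep 1 L X3"
    using G_series_mellin_rep(1)[OF k f Vz] G_series_mellin_rep(1)[OF k gh(1,2) Imz] L_series_mellin_rep[OF k periodic_seq_minus[OF gh(2)]]
    unfolding G1_def G2_def L_def by metis
  note cont1 = mellin_rep_continuation[OF rep(1)] and cont2 = mellin_rep_continuation[OF rep(2)] and cont3 = mellin_rep_continuation[OF rep(3)]
  have Gf1: "G_fun (mobius a b c d z) s f fs r1 r2 = meromorphic_continuation 2 G1 s"
    and Gf2: "G_fun z s g h R1 R2 = meromorphic_continuation 2 G2 s"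
    and Lf: "L_fun s (\<lambda>n. h (- n)) (- R2) = meromorphic_continuation 1 L s" for s
    by (simp_all add: G_fun_def L_fun_def G1_def G2_def L_def)
  have ker: "kernel 2 (P j p)" if "j \<in> {1..c}" for j p
  proof -
    have "Re (cone_base c d z R1 R2 j) > 0" using cone_base_pos(1)[OF c] that Imz Re\<tau> by (simp add: \<tau>_def)
    then show ?thesis unfolding P_def using k Re\<tau> by (intro kernel_barnes) (auto intro!: add_pos_nonneg)
  qed
  define Isum where "Isum = (\<lambda>s. \<Sum>j = 1..c. \<Sum>p\<in>J. wt j p * - hankel (P j p) s)"
  have Isum: "(\<Sum>j = 1..c. \<Sum>\<mu> = 0..int k - 1. \<Sum>v = 0..int k - 1.
             h (- (\<lfloor>R2 + of_int d * (of_int j - frac R1) / of_int c\<rfloor> - v + d * \<mu>)) * g (- (\<mu> * c + j + \<lfloor>R1\<rfloor>))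
             * I_integral (int k) c d R1 \<rho> \<gamma> j \<mu> v z s) = Isum s" for s
    unfolding Isum_def
  proof (rule sum.cong)
    fix j assume j: "j \<in> {1..c}"
    have "(\<Sum>\<mu> = 0..int k - 1. \<Sum>v = 0..int k - 1.
             h (- (\<lfloor>R2 + of_int d * (of_int j - frac R1) / of_int c\<rfloor> - v + d * \<mu>)) * g (- (\<mu> * c + j + \<lfloor>R1\<rfloor>))
             * I_integral (int k) c d R1 \<rho> \<gamma> j \<mu> v z s) =
       (\<Sum>\<mu><k. \<Sum>\<nu><k. h (- (\<lfloor>R2 + of_int d * (of_int j - frac R1) / of_int c\<rfloor> - (int k - 1 - int \<nu>) + d * int \<mu>)) * g (- (int \<mu> * c + j + \<lfloor>R1\<rfloor>))
             * I_integral (int k) c d R1 \<rho> \<gamma> j (int \<mu>) (int k - 1 - int \<nu>) z s)"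
      by (subst sum_int_interval(1)[OF refl]) (simp only: sum_int_interval(2)[OF refl])
    also have "\<dots> = (\<Sum>\<mu><k. \<Sum>\<nu><k. wt j (\<mu>, \<nu>) * - hankel (P j (\<mu>, \<nu>)) s)"
    proof (intro sum.cong refl)
      fix \<mu> \<nu> assume \<mu>\<nu>: "\<mu> \<in> {..<k}" "\<nu> \<in> {..<k}"
      define q where "q = of_int j - frac R1"
      \<comment> \<open>With v = k - 1 - \<nu> the term -v is 1 + \<nu> - k, and k drops out by
        periodicity.\<close>
      have h1: "h (- (\<lfloor>R2 + of_int d * q / of_int c\<rfloor> - (int k - 1 - int \<nu>) + d * int \<mu>)) = h (- (\<lfloor>R2 + of_int d * q / of_int c\<rfloor> + d * int \<mu> + 1 + int \<nu>))"
        by (rule periodic_seq_cong[OF gh(2)]) (simp add: cong_iff_dvd_diff)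
      \<comment> \<open>This explains \<rho>: the two arguments differ by the integer floor R2, so
        their fractional parts coincide.\<close>
      have fr: "frac ((of_int (d * j) + \<rho>) / of_int c) = frac (R2 + of_int d * q / of_int c)"
      proof -
        have "R2 + of_int d * q / of_int c = (of_int (d * j) + \<rho>) / of_int c + of_int \<lfloor>R2\<rfloor>"
          using cr by (simp add: \<rho> q_def frac_def field_simps)
        then show ?thesis by (simp add: frac_def)
      qed
      have x: "(real_of_int (c * int \<mu> + j) - frac R1) / of_int c = q / of_int c + real \<mu>"
        using cr by (simp add: q_def field_simps)
      have "I_integral (int k) c d R1 \<rho> \<gamma> j (int \<mu>) (int k - 1 - int \<nu>) z s =
          - hankel (barnes_kernel (of_real ((of_int (c * int \<mu> + j) - frac R1) / of_int c) * \<tau> +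
        of_real (of_int (int k) - of_int (int k - 1 - int \<nu>) - frac ((of_int (d * j) + \<rho>) / of_int c))) (of_int (int k) * \<tau>) (of_int (int k))) s"
        unfolding \<tau>_def using k c j Re\<tau> \<mu>\<nu> loop by (intro I_integral_eq_hankel) (auto simp: \<tau>_def)
      also have "of_real ((of_int (c * int \<mu> + j) - frac R1) / of_int c) * \<tau> +
        of_real (of_int (int k) - of_int (int k - 1 - int \<nu>) - frac ((of_int (d * j) + \<rho>) / of_int c)) =
         cone_base c d z R1 R2 j + of_nat \<mu> * \<tau> + of_nat \<nu> * 1"
        unfolding x fr cone_base_def q_def[symmetric] \<tau>_def[symmetric] by (simp add: algebra_simps)
      finally show "h (- (\<lfloor>R2 + of_int d * (of_int j - frac R1) / of_int c\<rfloor> - (int k - 1 - int \<nu>) + d * int \<mu>)) * g (- (int \<mu> * c + j + \<lfloor>R1\<rfloor>))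
             * I_integral (int k) c d R1 \<rho> \<gamma> j (int \<mu>) (int k - 1 - int \<nu>) z s = wt j (\<mu>, \<nu>) * - hankel (P j (\<mu>, \<nu>)) s"
        unfolding q_def[symmetric] h1 wt_def cone_weight_def cone_floor_def P_def fst_conv snd_conv by (simp add: mult_ac add_ac)
    qed
    also have "\<dots> = (\<Sum>p\<in>J. wt j p * - hankel (P j p) s)" by (simp add: J_def sum.cartesian_product)
    finally show "(\<Sum>\<mu> = 0..int k - 1. \<Sum>v = 0..int k - 1.
             h (- (\<lfloor>R2 + of_int d * (of_int j - frac R1) / of_int c\<rfloor> - v + d * \<mu>)) * g (- (\<mu> * c + j + \<lfloor>R1\<rfloor>))
             * I_integral (int k) c d R1 \<rho> \<gamma> j \<mu> v z s) = (\<Sum>p\<in>J. wt j p * - hankel (P j p) s)" .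
  qed simp
  have Isum_holo: "Isum holomorphic_on A" for A
  proof -
    have "Isum holomorphic_on UNIV"
      unfolding Isum_def using holomorphic_hankel[OF ker] by (intro holomorphic_intros) auto
    then show ?thesis by (rule holomorphic_on_subset) simp
  qed
  define F where "F = (\<lambda>s. cpow_low \<tau> (- s) * Gamma s * meromorphic_continuation 2 G1 s)"
  define H where "H = (\<lambda>s. Gamma s * meromorphic_continuation 2 G2 s
      - 2 * \<i> * Gamma s * sin (of_real pi * s) * meromorphic_continuation 1 L s * K0 + exp (2 * of_real pi * \<i> * (- s / 2)) * Isum s)"
  have ent: "f meromorphic_on UNIV" if "f holomorphic_on UNIV" for f :: "complex \<Rightarrow> complex"
    using that by (intro analytic_on_imp_meromorphic_on) (simp add: analytic_on_open)
  have c\<tau>: "(\<lambda>s. cpow_low \<tau> (- s)) holomorphic_on A" for A unfolding cpow_low_def by (intro holomorphic_intros)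
  have Gm: "Gamma meromorphic_on (UNIV :: complex set)"
  proof -
    have "(\<lambda>s :: complex. inverse (rGamma s)) meromorphic_on UNIV"
      by (intro meromorphic_on_inverse ent holomorphic_rGamma)
    then show ?thesis by (simp add: rGamma_inverse_Gamma)
  qed
  have cm: "meromorphic_continuation 2 G1 meromorphic_on UNIV" "meromorphic_continuation 2 G2 meromorphic_on UNIV"
    "meromorphic_continuation 1 L meromorphic_on UNIV"
    using cont1(1) cont2(1) cont3(1) by (auto simp: nicely_meromorphic_on_def)
  have "meromorphic_identity F H"
  proof (rule meromorphic_identityI[where \<sigma> = 2])
    show "F meromorphic_on UNIV" unfolding F_def by (intro meromorphic_on_mult Gm cm ent c\<tau>)
    show "H meromorphic_on UNIV"
      unfolding H_def
      by (intro meromorphic_on_mult meromorphic_on_add meromorphic_on_diff Gm cm ent Isum_holo) (intro holomorphic_intros; simp)+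
    have Gh: "Gamma holomorphic_on (- insert 1 \<int>\<^sub>\<le>\<^sub>0)" by (intro holomorphic_Gamma) auto
    show "F holomorphic_on (- insert 1 \<int>\<^sub>\<le>\<^sub>0)"
      unfolding F_def using cont1(3) by (intro holomorphic_intros c\<tau> Gh) auto
    show "H holomorphic_on (- insert 1 \<int>\<^sub>\<le>\<^sub>0)"
      unfolding H_def using cont2(3) cont3(3) by (intro holomorphic_intros Isum_holo Gh) auto
    fix s :: complex assume s: "Re s > 2"
    define S where "S = exp (\<i> * of_real pi * s) * (K0 * L s + (\<Sum>j = 1..c. (\<Sum>p\<in>J. wt j p * mellin (P j p) s) / Gamma s))"
    have "(G_term z g h R1 R2 s has_sum S) (branch_cone c d R1 R2)"
      using branch_cone_has_sum[OF k gh(1,2) c Imz _ s, of d R1 R2] Re\<tau>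
      unfolding S_def K0_def L_def J_def wt_def P_def \<tau>_def by (simp add: case_prod_unfold)
    from G_series_transform[OF k f gh det c Imz R1 R2 s this]
    have tr: "cpow_low \<tau> (- s) * G1 s = G2 s + (exp (- (2 * of_real pi * \<i> * s)) - 1) * S"
      by (simp only: \<tau>_def G1_def G2_def)
    have G0: "Gamma s \<noteq> 0" using Gamma_mult_rGamma[of s] s by auto
    have Is: "Isum s = - ((exp (2 * of_real pi * \<i> * s) - 1) * (\<Sum>j = 1..c. \<Sum>p\<in>J. wt j p * mellin (P j p) s))"
    proof -
      have "Isum s = (\<Sum>j = 1..c. \<Sum>p\<in>J. - ((exp (2 * of_real pi * \<i> * s) - 1) * (wt j p * mellin (P j p) s)))"
        unfolding Isum_def using hankel_eq_mellin[OF ker, of _ s] s by (intro sum.cong refl) simp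
      then show ?thesis by (simp only: sum_negf sum_distrib_left)
    qed
    \<comment> \<open>In terms of E the factor (1/E^2 - 1) E equals both -(E - 1/E), which is the
      sine in front of the L-series, and -(E^2 - 1) / E, which is the prefactor times the Hankel
      factor of the Barnes part.\<close>
    define E where "E = exp (\<i> * of_real pi * s)"
    have E0: "E \<noteq> 0" by (simp add: E_def)
    have E1: "exp (- (2 * of_real pi * \<i> * s)) = 1 / (E * E)" "exp (2 * of_real pi * \<i> * s) = E * E" "exp (2 * of_real pi * \<i> * (- s / 2)) = 1 / E"
      "sin (of_real pi * s) = (E - 1 / E) / (2 * \<i>)"
      by (simp_all add: E_def exp_add [symmetric] exp_minus sin_exp_eq field_simps)
    define M where "M = (\<Sum>j = 1..c. \<Sum>p\<in>J. wt j p * mellin (P j p) s)"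
    have S: "S = E * (K0 * L s + M / Gamma s)"
      by (simp only: S_def E_def M_def sum_divide_distrib)
    have "Gamma s * (cpow_low \<tau> (- s) * G1 s) = Gamma s * G2 s
       - 2 * \<i> * Gamma s * ((E - 1 / E) / (2 * \<i>)) * L s * K0 + 1 / E * (- ((E * E - 1) * M))"
      unfolding tr S E1 using G0 E0 by (simp add: field_simps)
    then show "F s = H s"
      unfolding F_def H_def Is M_def[symmetric] E1 using cont1(2)[of s] cont2(2)[of s] cont3(2)[of s] s by (simp add: mult_ac)
  qed simp
  then show ?thesis unfolding F_def H_def K0_def Gf1 Gf2 Lf Isum \<tau>_def .
qed

section \<open>The two congruence cases\<close>

theorem theorem1:
  fixes k a b c d :: int
    and f fs :: "int \<Rightarrow> complex"
    and r1 r2 R1 R2 \<rho> :: real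
    and z :: complex
    and \<gamma> :: "real \<Rightarrow> complex"
  assumes k_pos: "k > 0"
    and f_periodic: "periodic_seq k f"
    and fs_periodic: "periodic_seq k fs"
    and det: "a * d - b * c = 1"
    and c_pos: "c > 0"
    and R1: "R1 = of_int a * r1 + of_int c * r2"
    and R2: "R2 = of_int b * r1 + of_int d * r2"
    and rho: "\<rho> = frac R2 * of_int c - frac R1 * of_int d"
    and z: "z \<in> K_region c d"
    and loop: "hankel_loop (denom_zeros k c d z) \<gamma>"
  shows
    "([a = 0] (mod k) \<and> [d = 0] (mod k) \<longrightarrow>
     meromorphic_identity
       (\<lambda>s. cpow_low (of_int c * z + of_int d) (- s) * Gamma s
              * G_fun (mobius a b c d z) s f fs r1 r2)
       (\<lambda>s. Gamma s * G_fun z s (\<lambda>n. fs (- b * n)) (\<lambda>n. f (- c * n)) R1 R2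
            - 2 * \<i> * Gamma s * sin (of_real pi * s) * L_fun s (\<lambda>n. f (c * n)) (- R2)
                * (if R1 \<in> \<int> then fs (b * \<lfloor>R1\<rfloor>) else 0)
            + exp (2 * of_real pi * \<i> * (- s / 2))
                * (\<Sum>j = 1..c. \<Sum>\<mu> = 0..k - 1. \<Sum>v = 0..k - 1.
                     f (c * (\<lfloor>R2 + of_int d * (of_int j - frac R1) / of_int c\<rfloor> - v))
                     * fs (b * (\<mu> * c + j + \<lfloor>R1\<rfloor>))
                     * I_integral k c d R1 \<rho> \<gamma> j \<mu> v z s))) \<and>
     ([b = 0] (mod k) \<and> [c = 0] (mod k) \<longrightarrow>
     meromorphic_identity
       (\<lambda>s. cpow_low (of_int c * z + of_int d) (- s) * Gamma s
              * G_fun (mobius a b c d z) s f fs r1 r2)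
       (\<lambda>s. Gamma s * G_fun z s (\<lambda>n. f (d * n)) (\<lambda>n. fs (a * n)) R1 R2
            - 2 * \<i> * Gamma s * sin (of_real pi * s) * L_fun s (\<lambda>n. fs (- a * n)) (- R2)
                * (if R1 \<in> \<int> then f (- d * \<lfloor>R1\<rfloor>) else 0)
            + exp (2 * of_real pi * \<i> * (- s / 2))
                * (\<Sum>j = 1..c. \<Sum>\<mu> = 0..k - 1. \<Sum>v = 0..k - 1.
                     fs (- a * (\<lfloor>R2 + of_int d * (of_int j - frac R1) / of_int c\<rfloor> - v + d * \<mu>))
                     * f (- d * (j + \<lfloor>R1\<rfloor>))
                     * I_integral k c d R1 \<rho> \<gamma> j \<mu> v z s)))"
proof -
  define n where "n = nat k"
  have k: "k = int n" "n > 0" using k_pos by (auto simp: n_def)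
  note f' = f_periodic[unfolded k(1)] and fs' = fs_periodic[unfolded k(1)]
  note loop' = loop[unfolded k(1)]
  show ?thesis
  proof (intro conjI impI, goal_cases)
    case 1
    then have ad: "k dvd a" "k dvd d" by (auto simp: cong_0_iff)
    \<comment> \<open>Modulo k the multiples of a and d vanish, so f depends on N and fs on M alone:
      the roles of the two sequences are exchanged. The shift d \<mu> disappears from the weights as
      well.\<close>
    have f_d: "f (c * (x + d * \<mu>)) = f (c * x)" "f (d * x - c * y) = f (- c * y)" for x y \<mu>
      using ad by (auto intro!: periodic_seq_cong[OF f'] simp: k(1)[symmetric] cong_iff_dvd_diff algebra_simps)
    have fs_a: "fs (- b * x + a * y) = fs (- b * x)" for x y
      using ad by (auto intro!: periodic_seq_cong[OF fs'] simp: k(1)[symmetric] cong_iff_dvd_diff)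
    have "f (d * M - c * N) * fs (- b * M + a * N) = fs (- b * M) * f (- c * N)" for M N
      unfolding f_d fs_a by (rule mult.commute)
    from G_transformation[OF k(2) f' fs' periodic_seq_mult[OF fs'] periodic_seq_mult[OF f'] this det c_pos R1 R2 rho z loop']
    show ?case
      by (simp only: minus_mult_minus f_d k(1)[symmetric])
  next
    case 2
    then have bc: "k dvd b" "k dvd c" by (auto simp: cong_0_iff)
    \<comment> \<open>Here the multiples of b and c vanish and the sequences keep their roles. Now c
      \<mu> disappears from the argument of f, whereas d \<mu> remains in that of fs.\<close>
    have f_c: "f (- (d * (\<mu> * c + x + y))) = f (- (d * (x + y)))" "f (d * x - c * y') = f (d * x)" for x y y' \<mu>
      using bc by (auto intro!: periodic_seq_cong[OF f'] simp: k(1)[symmetric] cong_iff_dvd_diff algebra_simps)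
    have fs_b: "fs (- b * x + a * y) = fs (a * y)" for x y
      using bc by (auto intro!: periodic_seq_cong[OF fs'] simp: k(1)[symmetric] cong_iff_dvd_diff)
    have "f (d * M - c * N) * fs (- b * M + a * N) = f (d * M) * fs (a * N)" for M N
      by (simp only: f_c fs_b)
    from G_transformation[OF k(2) f' fs' periodic_seq_mult[OF f'] periodic_seq_mult[OF fs'] this det c_pos R1 R2 rho z loop']
    show ?case
      by (simp only: mult_minus_left mult_minus_right f_c k(1)[symmetric])
  qed
qed

end
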